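(* Let $n\ge2$ be an integer. A map $Z\colon\mathcal S_0^n\to M(S^{n-1})_+$ is a weak$^*$ continuous and rotation equivariant valuation satisfying $Z(\{0\})=0$ if and only if there exists a weak$^*$ continuous function $\tau\colon\mathbb R_+\to M([-1,1])_+$, $\lambda\mapsto\tau_\lambda$, such that $\tau_0=0$ and $$\langle Z(L),g\rangle=\int_{S^{n-1}}\int_{[-1,1]}\overline{\mathrm R}g(s,\alpha)\,\mathrm d\tau_{\rho_L(s)}(\alpha)\,\mathrm d\mathcal H^{n-1}(s)$$ for every $L\in\mathcal S_0^n$ and every $g\in C(S^{n-1})$.
   Context: $\mathbb R_+=[0,\infty)$; $S^{n-1}$ is the unit sphere of $\mathbb R^n$; $C(S^{n-1})$ is the space of real continuous functions on $S^{n-1}$ with the supremum norm $\|\cdot\|_\infty$. For a compact metric space $T$, $M(T)_+$ is the set of (finite) non-negative Radon measures on $T$, and $\langle\mu,g\rangle=\int_T g\,\mathrm d\mu$ for $g\in C(T)$. $\mathcal H^k$ is $k$-dimensional Hausdorff measure. Star bodies: a (non-empty) set $L\subset\mathbb R^n$ is a star set if $\{\lambda x:0\le\lambda\le1\}\subset L$ for every $x\in L$. Its radial function is $\rho_L(s)=\sup\{\lambda\ge0:\lambda s\in L\}$, $s\in S^{n-1}$. $L$ is a star body if $\rho_L$ is a (finite) continuous function on $S^{n-1}$. $\mathcal S_0^n$ is the set of star bodies in $\mathbb R^n$. Star bodies are identified with their radial functions, so that $L\mapsto\rho_L$ is a bijection from $\mathcal S_0^n$ onto the set of non-negative functions in $C(S^{n-1})$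 (e.g. each star body is taken to be $\{\lambda s: s\in S^{n-1}, 0\le\lambda\le \rho_L(s)\}$). Then $\rho_{K\cup L}=\max\{\rho_K,\rho_L\}$ and $\rho_{K\cap L}=\min\{\rho_K,\rho_L\}$. $\mathcal S_0^n$ carries the radial metric $\delta(K,L)=\|\rho_K-\rho_L\|_\infty$. $Z$ is a valuation if $Z(K\cup L)+Z(K\cap L)=Z(K)+Z(L)$ for all $K,L\in\mathcal S_0^n$. $Z$ is weak$^*$ continuous if $L\mapsto\langle Z(L),g\rangle$ is continuous on $\mathcal S_0^n$ for every $g\in C(S^{n-1})$. $Z$ is rotation equivariant if $\langle Z(\phi L),\phi g\rangle=\langle Z(L),g\rangle$ for all $L\in\mathcal S_0^n$, $g\in C(S^{n-1})$ and $\phi\in\mathrm O(n)$ (the orthogonal group), where $\phi L=\{\phi x:x\in L\}$ and $\phi g=g\circ\phi^{-1}$. $\tau$ is weak$^*$ continuous if $\lambda\mapsto\langle\tau_\lambda,\xi\rangle$ is continuous on $\mathbb R_+$ for every $\xi\in C([-1,1])$. For $g\in C(S^{n-1})$, $s\in S^{n-1}$ and $\alpha\in[-1,1]$, $\overline{\mathrm R}g(s,\alpha)$ is the average of $g$ over $\{r\in S^{n-1}:\langle r,s\rangle=\alpha\}$: $\overline{\mathrm R}g(s,1)=g(s)$, $\overline{\mathrm R}g(s,-1)=g(-s)$, and for $\alpha\in(-1,1)$ it is the average of $g$ over the $(n-2)$-sphere $\{r\in S^{n-1}:\langle r,s\rangle=\alpha\}$ with respect to normalized $\mathcal H^{n-2}$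 (for $n=2$: normalized counting measure on two points). *)

theory Defs
  imports "HOL-Analysis.Analysis"
begin

section \<open>Hausdorff measure\<close>

text \<open>
  The measure \<open>\<H>\<^sup>k\<close> with the normalization for which it agrees with Lebesgue measure on
  \<open>\<real>\<^sup>k\<close>. The case distinction in \<open>hausdorff_gauge\<close> matters for \<open>k = 0\<close>: nonempty
  sets have gauge 1 there, so \<open>\<H>\<^sup>0\<close> is counting measure. Boundedness of the covering sets is
  required because \<^const>\<open>diameter\<close> is unspecified on unbounded sets.
\<close>

definition hausdorff_gauge :: "nat \<Rightarrow> 'a::metric_space set \<Rightarrow> ennreal" where
  "hausdorff_gauge k C =
     (if C = {} then 0 else ennreal (unit_ball_vol (real k) * (diameter C / 2) ^ k))"

definition hausdorff_premeasure :: "nat \<Rightarrow> real \<Rightarrow> 'a::metric_space set \<Rightarrow> ennreal" where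
  "hausdorff_premeasure k d A =
     (INF C \<in> {C :: nat \<Rightarrow> 'a set. A \<subseteq> (\<Union>i. C i) \<and> (\<forall>i. bounded (C i) \<and> diameter (C i) \<le> d)}.
        (\<Sum>i. hausdorff_gauge k (C i)))"

definition hausdorff_outer :: "nat \<Rightarrow> 'a::metric_space set \<Rightarrow> ennreal" where
  "hausdorff_outer k A = (SUP d \<in> {0<..}. hausdorff_premeasure k d A)"

text \<open>
  \<open>hausdorff_outer k\<close> is a metric outer measure, so by Caratheodory its restriction to the Borel
  sets is a measure.
\<close>

definition hausdorff :: "nat \<Rightarrow> 'a::metric_space measure" where
  "hausdorff k = measure_of UNIV (sets borel) (hausdorff_outer k)"


section \<open>Finite Radon measures\<close>

definition radon_measures :: "'a::metric_space set \<Rightarrow> 'a measure set" where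
  "radon_measures T =
     {M. sets M = sets (restrict_space borel T) \<and> finite_measure M \<and>
         (\<forall>A\<in>sets M. emeasure M A = (SUP K \<in> {K. K \<subseteq> A \<and> compact K}. emeasure M K))}"

abbreviation zero_measure :: "'a::metric_space set \<Rightarrow> 'a measure" where
  "zero_measure T \<equiv> null_measure (restrict_space borel T)"


section \<open>Star bodies\<close>

abbreviation usphere :: "'a::euclidean_space set" where
  "usphere \<equiv> sphere 0 1"

definition star_set :: "'a::euclidean_space set \<Rightarrow> bool" where
  "star_set L \<longleftrightarrow> L \<noteq> {} \<and> (\<forall>x\<in>L. \<forall>t\<in>{0..1}. t *\<^sub>R x \<in> L)"

definition radial :: "'a::euclidean_space set \<Rightarrow> 'a \<Rightarrow> real" where
  "radial L s = Sup {t. 0 \<le> t \<and> t *\<^sub>R s \<in> L}"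

text \<open>
  Star bodies are identified when their radial functions agree; the last conjunct selects the
  representative \<open>{\<lambda>s | 0 \<le> \<lambda> \<le> \<rho>\<^sub>L(s)}\<close>. The condition \<^const>\<open>bdd_above\<close> says that the radial
  function is finite.
\<close>

definition star_bodies :: "'a::euclidean_space set set" where
  "star_bodies =
     {L. star_set L \<and>
         (\<forall>s\<in>usphere. bdd_above {t. 0 \<le> t \<and> t *\<^sub>R s \<in> L}) \<and>
         continuous_on usphere (radial L) \<and>
         L = {t *\<^sub>R s | t s. s \<in> usphere \<and> 0 \<le> t \<and> t \<le> radial L s}}"

definition radial_dist :: "'a::euclidean_space set \<Rightarrow> 'a set \<Rightarrow> real" where
  "radial_dist K L = (SUP s\<in>usphere. \<bar>radial K s - radial L s\<bar>)"


section \<open>Valuations with values in the finite Radon measures on the sphere\<close>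

definition valuation :: "('a::euclidean_space set \<Rightarrow> 'a measure) \<Rightarrow> bool" where
  "valuation Z \<longleftrightarrow>
     (\<forall>K\<in>star_bodies. \<forall>L\<in>star_bodies. \<forall>A\<in>sets (restrict_space borel usphere).
        emeasure (Z (K \<union> L)) A + emeasure (Z (K \<inter> L)) A = emeasure (Z K) A + emeasure (Z L) A)"

definition weak_star_continuous :: "('a::euclidean_space set \<Rightarrow> 'a measure) \<Rightarrow> bool" where
  "weak_star_continuous Z \<longleftrightarrow>
     (\<forall>g :: 'a \<Rightarrow> real. continuous_on usphere g \<longrightarrow>
        (\<forall>L\<in>star_bodies. \<forall>e>0. \<exists>d>0. \<forall>K\<in>star_bodies.
           radial_dist K L < d \<longrightarrow> \<bar>(\<integral>x. g x \<partial>Z K) - (\<integral>x. g x \<partial>Z L)\<bar> < e))"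

definition rotation_equivariant :: "('a::euclidean_space set \<Rightarrow> 'a measure) \<Rightarrow> bool" where
  "rotation_equivariant Z \<longleftrightarrow>
     (\<forall>L\<in>star_bodies. \<forall>g :: 'a \<Rightarrow> real. \<forall>\<phi>.
        continuous_on usphere g \<longrightarrow> orthogonal_transformation \<phi> \<longrightarrow>
        (\<integral>x. (g \<circ> inv \<phi>) x \<partial>Z (\<phi> ` L)) = (\<integral>x. g x \<partial>Z L))"

definition weak_star_continuous_param :: "(real \<Rightarrow> real measure) \<Rightarrow> bool" where
  "weak_star_continuous_param \<tau> \<longleftrightarrow>
     (\<forall>\<xi> :: real \<Rightarrow> real. continuous_on {-1..1} \<xi> \<longrightarrow>
        continuous_on {0..} (\<lambda>t. \<integral>a. \<xi> a \<partial>\<tau> t))"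


section \<open>Averages over subspheres\<close>

text \<open>
  The parameter \<open>g\<close> is only assumed continuous on the sphere, so it need not be Borel on the whole
  space; hence the set integral rather than an integral against a \<^const>\<open>uniform_measure\<close>, which
  would be 0 for nonmeasurable \<open>g\<close>.
\<close>

definition Rbar :: "('a::euclidean_space \<Rightarrow> real) \<Rightarrow> 'a \<Rightarrow> real \<Rightarrow> real" where
  "Rbar g s \<alpha> =
     (if \<alpha> = 1 then g s
      else if \<alpha> = -1 then g (- s)
      else (LINT r : {r \<in> usphere. r \<bullet> s = \<alpha>} | hausdorff (DIM('a) - 2). g r)
             / measure (hausdorff (DIM('a) - 2)) {r \<in> usphere. r \<bullet> s = \<alpha>})"

end

(*
  Z is bounded on radial functions with values in [0, l], so by pigeonhole the sphere can be cut
  into small pieces along seams on which all functions with values in [0, l] have small Z-mass. By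
  the valuation property and positivity, changing a function on the seams hardly changes Z. Hence
  Riemann sums: with cut-offs k_i of the pieces and points x_i in them, the sums over i of
  <Z(l * k_i), F(x_i, .)> converge to a positive functional M_l(F) on C(S x S), which is invariant
  under O(n) by equivariance. Averaging over orthonormal pairs identifies M_l(h(s) g(r)) with the
  integral over s of h(s) times the integral of Rbar g(s, .) against tau_l, where tau_l is (up to
  normalization) the image of M_l under (s, r) |-> <s, r>. Approximating f by functions that are
  constant on the pieces and sorting the pieces by the value of f (with hat functions) recovers
  <Z(f), g> from the functionals M_l. Conversely, the integral of Rbar g(s, .) against tau_l is
  jointly continuous in (s, l), and the valuation property holds pointwise in s.
*)
theory Submission
  imports Defs "HOL-Probability.Probability"
begin

section \<open>Metric outer measures\<close>

text \<open>\<open>Z\<close> is nonlinear in the body, and a continuous cut-off spoils the values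
  near the rim of a piece. The proof therefore rests on estimates for families of cut-offs with
  disjoint supports, summed over all pieces, whose bounds do not see the number of pieces. Such sums
  reduce to one function: on disjoint supports the valuation property is plain additivity, and total
  masses are nonnegative. Continuity of \<open>Z\<close> at a function bounds a single signed number
  only; it becomes a bound for a sum of absolute values by taking, piece by piece, the worse of two
  competitors. Freezing the height is what makes the limit functional linear in the test function.
  Its invariance is exploited through orbits: O(n) is transitive on the pairs of unit vectors with a
  given inner product. Of the Hausdorff measures, besides their being Borel measures, only
  finiteness, positivity and scaling under similarities enter; all averages are taken over
  normalized measures, and the area of the sphere reappears as one factor.\<close>

lemma metric_outer_measure_space:
  fixes \<mu> :: "'a::metric_space set \<Rightarrow> ennreal"
  assumes empty: "\<mu> {} = 0" and mono: "\<And>A B. A \<subseteq> B \<Longrightarrow> \<mu> A \<le> \<mu> B"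
    and csub: "\<And>A::nat \<Rightarrow> 'a set. \<mu> (\<Union>i. A i) \<le> (\<Sum>i. \<mu> (A i))"
    and metric: "\<And>A B d. 0 < d \<Longrightarrow> (\<And>x y. x \<in> A \<Longrightarrow> y \<in> B \<Longrightarrow> d \<le> dist x y) \<Longrightarrow> \<mu> A + \<mu> B \<le> \<mu> (A \<union> B)"
  shows "measure_space UNIV (sets borel) \<mu>"
proof -
  interpret sigma_algebra UNIV "UNIV :: 'a set set"
    using sigma_algebra_Pow[of UNIV] by simp
  have sub2: "\<mu> (A \<union> B) \<le> \<mu> A + \<mu> B" for A B
  proof -
    have "\<mu> (A \<union> B) = \<mu> (\<Union>i. if i = (0::nat) then A else if i = 1 then B else {})"
      by (rule arg_cong[where f=\<mu>]) (auto split: if_splits)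
    also have "\<dots> \<le> (\<Sum>i. \<mu> (if i = (0::nat) then A else if i = 1 then B else {}))"
      by (rule csub)
    also have "\<dots> = (\<Sum>i\<in>{0,1::nat}. \<mu> (if i = (0::nat) then A else if i = 1 then B else {}))"
      by (intro suminf_finite) (auto simp: empty)
    finally show ?thesis by simp
  qed
  have "outer_measure_space (UNIV :: 'a set set) \<mu>"
    unfolding outer_measure_space_def positive_def increasing_def countably_subadditive_def
    using empty mono csub by auto
  then have ms: "measure_space UNIV (lambda_system UNIV UNIV \<mu>) \<mu>"
    by (rule caratheodory_lemma)
  have "C \<in> lambda_system UNIV UNIV \<mu>" if C: "closed C" for C
  proof (cases "C = {}")
    case True
    then show ?thesis by (auto simp: lambda_system_eq empty)
  next
    case ne: False
    have "\<mu> (X \<inter> C) + \<mu> (X - C) \<le> \<mu> X" for X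
    proof (cases "\<mu> X = \<infinity>")
      case False
      \<comment> \<open>Caratheodory's criterion for the closed set \<open>C\<close>:
        \<open>A n\<close> keeps a distance of at least 1/(n+1) from \<open>C\<close>, and
        \<open>R n\<close> is the shell gained on passing to \<open>A (Suc n)\<close>. Shells whose
        indices differ by at least two are a positive distance apart, so that \<open>metric\<close>
        applies to them; neighbouring shells may touch.\<close>
      define A where "A n = {x \<in> X. infdist x C \<ge> 1 / real (Suc n)}" for n
      define R where "R n = A (Suc n) - A n" for n
      have incA: "A m \<subseteq> A n" if "m \<le> n" for m n
        using that unfolding A_def
        by (auto intro: order_trans[rotated] simp: frac_le)
      \<comment> \<open>\<open>c\<close> selects the parity of the shells; within one parity the
        hypothesis \<open>metric\<close> can be iterated.\<close>
      have half: "(\<Sum>i<N. \<mu> (R (2 * i + c))) \<le> \<mu> X" for N c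
      proof -
        have "(\<Sum>i<N. \<mu> (R (2 * i + c))) \<le> \<mu> (\<Union>i<N. R (2 * i + c))"
        proof (induction N)
          case (Suc N)
          \<comment> \<open>For \<open>N = 0\<close> and \<open>c = 0\<close> the truncated
            difference \<open>2 * N + c - 1\<close> is 0 and \<open>?d\<close> vanishes, so the case
            \<open>N = 0\<close>, where the earlier union is empty, is taken separately.\<close>
          let ?d = "1 / real (Suc (2 * N + c - 1)) - 1 / real (Suc (2 * N + c))"
          show ?case
          proof (cases "N = 0")
            case False
            have sep: "?d \<le> dist x y" if x: "x \<in> (\<Union>i<N. R (2 * i + c))" and y: "y \<in> R (2 * N + c)" for x y
            proof -
              obtain i where i: "i < N" "x \<in> R (2 * i + c)" using x by blast
              have "Suc (2 * i + c) \<le> 2 * N + c - 1" using i by linarith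
              then have "x \<in> A (2 * N + c - 1)"
                using incA[of "Suc (2 * i + c)" "2 * N + c - 1"] i by (auto simp: R_def subset_iff)
              then have "infdist x C \<ge> 1 / real (Suc (2 * N + c - 1))" by (simp add: A_def)
              moreover have "infdist y C < 1 / real (Suc (2 * N + c))"
                using y by (auto simp: R_def A_def)
              moreover have "infdist x C \<le> infdist y C + dist x y" by (rule infdist_triangle)
              ultimately show ?thesis by linarith
            qed
            have "1 / real (Suc (2 * N + c)) < 1 / real (Suc (2 * N + c - 1))"
              using False by (intro divide_strict_left_mono) auto
            then have "0 < ?d" by simp
            then have "\<mu> (\<Union>i<N. R (2 * i + c)) + \<mu> (R (2 * N + c)) \<le> \<mu> ((\<Union>i<N. R (2 * i + c)) \<union> R (2 * N + c))"
              using sep by (rule metric)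
            moreover have "(\<Sum>i<Suc N. \<mu> (R (2 * i + c))) \<le> \<mu> (\<Union>i<N. R (2 * i + c)) + \<mu> (R (2 * N + c))"
              using Suc.IH by (simp add: add_right_mono)
            ultimately have "(\<Sum>i<Suc N. \<mu> (R (2 * i + c))) \<le> \<mu> ((\<Union>i<N. R (2 * i + c)) \<union> R (2 * N + c))"
              by (rule order_trans[rotated])
            also have "(\<Union>i<N. R (2 * i + c)) \<union> R (2 * N + c) = (\<Union>i<Suc N. R (2 * i + c))"
              by (auto simp: less_Suc_eq)
            finally show ?thesis .
          qed auto
        qed (simp add: empty)
        also have "\<dots> \<le> \<mu> X" by (rule mono) (auto simp: R_def A_def)
        finally show ?thesis .
      qed
      have "(\<Sum>i<n. \<mu> (R i)) \<le> 2 * \<mu> X" for n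
      proof -
        have "(\<Sum>i<n. \<mu> (R i)) \<le> (\<Sum>i<2 * n. \<mu> (R i))" by (intro sum_mono2) auto
        also have "(\<Sum>i<2 * n. \<mu> (R i)) = (\<Sum>i<n. \<mu> (R (2 * i + 0))) + (\<Sum>i<n. \<mu> (R (2 * i + 1)))"
          by (induction n) (auto simp: algebra_simps)
        also have "\<dots> \<le> \<mu> X + \<mu> X" by (intro add_mono half)
        finally show ?thesis by (simp add: mult_2)
      qed
      then have "(\<Sum>i. \<mu> (R i)) \<le> 2 * \<mu> X" by (intro suminf_le_const) auto
      also have "\<dots> < \<infinity>" using False by (simp add: ennreal_mult_less_top less_top)
      finally have fin: "(\<Sum>i. \<mu> (R i)) \<noteq> \<infinity>" by simp
      then have fini: "\<mu> (R i) \<noteq> \<infinity>" for i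
        by (metis infinity_ennreal_def ennreal_suminf_lessD top.not_eq_extremum order.irrefl)
      have summ: "summable (\<lambda>i. enn2real (\<mu> (R i)))"
        by (rule summable_suminf_not_top) (use fin fini in \<open>auto simp: less_top\<close>)
      \<comment> \<open>The shells have finite total measure, so those from some index
        \<open>n\<close> on contribute at most \<open>e\<close>. Outside \<open>A n\<close>, the set
        \<open>X - C\<close> consists of such shells only, while \<open>A n\<close> itself has
        positive distance from \<open>C\<close>.\<close>
      have "\<mu> (X \<inter> C) + \<mu> (X - C) \<le> \<mu> X + ennreal e" if "0 < e" for e
      proof -
        obtain n where n: "norm (\<Sum>i. enn2real (\<mu> (R (i + n)))) < e"
          using suminf_exist_split[OF \<open>0 < e\<close> summ] by auto
        have tail: "(\<Sum>i. \<mu> (R (i + n))) \<le> ennreal e"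
        proof -
          have s: "summable (\<lambda>i. enn2real (\<mu> (R (i + n))))"
            using summ by (subst summable_iff_shift)
          have "(\<Sum>i. \<mu> (R (i + n))) = (\<Sum>i. ennreal (enn2real (\<mu> (R (i + n)))))"
            using fini by (intro suminf_cong) (simp add: less_top)
          also have "\<dots> = ennreal (\<Sum>i. enn2real (\<mu> (R (i + n))))"
            by (intro suminf_ennreal2 s) auto
          also have "\<dots> \<le> ennreal e" using n by (intro ennreal_leI) auto
          finally show ?thesis .
        qed
        have cov: "X - C \<subseteq> A n \<union> (\<Union>i. R (i + n))"
        proof
          fix x assume x: "x \<in> X - C"
          have "infdist x C > 0"
            using x C ne by (simp add: infdist_pos_not_in_closed)
          then obtain m where "1 / real (Suc m) < infdist x C"
            using reals_Archimedean by (metis inverse_eq_divide)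
          then have "x \<in> A m" using x by (auto simp: A_def)
          then have ex: "\<exists>m. x \<in> A m" ..
          define l where "l = (LEAST m. x \<in> A m)"
          have l: "x \<in> A l" unfolding l_def by (rule LeastI_ex[OF ex])
          show "x \<in> A n \<union> (\<Union>i. R (i + n))"
          proof (cases "l \<le> n")
            case True
            then show ?thesis using incA l by auto
          next
            case F: False
            then have "x \<notin> A (l - 1)"
              unfolding l_def using not_less_Least[of "l - 1" "\<lambda>m. x \<in> A m"] by (auto simp: l_def)
            then have "x \<in> R ((l - 1 - n) + n)" using F l by (auto simp: R_def)
            then show ?thesis by blast
          qed
        qed
        have "\<mu> (X - C) \<le> \<mu> (A n) + \<mu> (\<Union>i. R (i + n))"
          by (rule order_trans[OF mono[OF cov] sub2])
        also have "\<mu> (\<Union>i. R (i + n)) \<le> ennreal e"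
          by (rule order_trans[OF csub tail])
        finally have "\<mu> (X - C) \<le> \<mu> (A n) + ennreal e" by (simp add: add_left_mono)
        then have "\<mu> (X \<inter> C) + \<mu> (X - C) \<le> \<mu> (X \<inter> C) + \<mu> (A n) + ennreal e"
          by (metis add.assoc add_left_mono)
        also have "\<mu> (X \<inter> C) + \<mu> (A n) \<le> \<mu> (X \<inter> C \<union> A n)"
        proof (rule metric)
          show "0 < 1 / real (Suc n)" by simp
          fix x y assume "x \<in> X \<inter> C" "y \<in> A n"
          then have "1 / real (Suc n) \<le> infdist y C" "infdist y C \<le> dist y x"
            by (auto simp: A_def intro: infdist_le)
          then show "1 / real (Suc n) \<le> dist x y" by (simp add: dist_commute)
        qed
        also have "\<mu> (X \<inter> C \<union> A n) \<le> \<mu> X" by (rule mono) (auto simp: A_def)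
        finally show ?thesis by (simp add: add_right_mono)
      qed
      then show ?thesis by (rule ennreal_le_epsilon)
    qed simp
    moreover have "\<mu> X \<le> \<mu> (X \<inter> C) + \<mu> (X - C)" for X
      using sub2[of "X \<inter> C" "X - C"] by (metis Int_Diff_Un)
    ultimately show ?thesis by (auto simp: lambda_system_eq intro: antisym)
  qed
  then have "{C::'a set. closed C} \<subseteq> lambda_system UNIV UNIV \<mu>" by auto
  moreover have "sigma_algebra UNIV (lambda_system UNIV UNIV \<mu>)"
    using ms by (simp add: measure_space_def)
  ultimately have sub: "sets borel \<subseteq> lambda_system UNIV UNIV \<mu>"
    by (simp add: borel_eq_closed sigma_algebra.sigma_sets_subset)
  have sb: "sigma_algebra UNIV (sets (borel :: 'a measure))"
    using sets.sigma_algebra_axioms[of "borel :: 'a measure"] by simp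
  show ?thesis
    unfolding measure_space_def
  proof (intro conjI sb)
    show "positive (sets borel) \<mu>" by (simp add: positive_def empty)
    show "countably_additive (sets borel) \<mu>"
      unfolding countably_additive_def
    proof safe
      fix A :: "nat \<Rightarrow> 'a set" assume A: "range A \<subseteq> sets borel" "disjoint_family A" "\<Union> (range A) \<in> sets borel"
      have "countably_additive (lambda_system UNIV UNIV \<mu>) \<mu>"
        using ms by (simp add: measure_space_def)
      then show "(\<Sum>i. \<mu> (A i)) = \<mu> (\<Union> (range A))"
        unfolding countably_additive_def using A sub by blast
    qed
  qed
qed

section \<open>Hausdorff measures\<close>

lemma diameter_le_dist:
  fixes S :: "'a::metric_space set"
  assumes "0 \<le> d" "\<And>x y. x \<in> S \<Longrightarrow> y \<in> S \<Longrightarrow> dist x y \<le> d"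
  shows "diameter S \<le> d"
  using assms by (auto simp: diameter_def intro!: cSUP_least)

lemma bounded_if_dist_le:
  fixes S :: "'a::metric_space set"
  assumes "\<And>x y. x \<in> S \<Longrightarrow> y \<in> S \<Longrightarrow> dist x y \<le> d"
  shows "bounded S"
  using assms bounded_two_points by metis

lemma hausdorff_gauge_empty [simp]: "hausdorff_gauge k {} = 0"
  by (simp add: hausdorff_gauge_def)

lemma hausdorff_gauge_le:
  assumes "0 \<le> r" "\<And>x y. x \<in> C \<Longrightarrow> y \<in> C \<Longrightarrow> dist x y \<le> r"
  shows "hausdorff_gauge k C \<le> ennreal (unit_ball_vol (real k) * (r / 2) ^ k)"
proof -
  have "bounded C" by (rule bounded_if_dist_le) (rule assms(2))
  then have "0 \<le> diameter C" by (rule diameter_ge_0)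
  moreover have "diameter C \<le> r" by (rule diameter_le_dist) (use assms in auto)
  ultimately show ?thesis
    unfolding hausdorff_gauge_def
    by (auto intro!: ennreal_leI mult_left_mono power_mono)
qed

lemma hausdorff_premeasure_le_suminf:
  assumes "A \<subseteq> (\<Union>i. C i)" "\<And>i. bounded (C i)" "\<And>i. diameter (C i) \<le> d"
  shows "hausdorff_premeasure k d A \<le> (\<Sum>i. hausdorff_gauge k (C i))"
  unfolding hausdorff_premeasure_def by (rule INF_lower) (use assms in auto)

lemma hausdorff_premeasure_greatest:
  assumes "\<And>C. A \<subseteq> (\<Union>i. C i) \<Longrightarrow> (\<And>i. bounded (C i)) \<Longrightarrow> (\<And>i. diameter (C i) \<le> d) \<Longrightarrow>
    r \<le> (\<Sum>i. hausdorff_gauge k (C i))"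
  shows "r \<le> hausdorff_premeasure k d A"
  unfolding hausdorff_premeasure_def by (rule INF_greatest) (use assms in auto)

lemma hausdorff_premeasure_mono: "A \<subseteq> B \<Longrightarrow> hausdorff_premeasure k d A \<le> hausdorff_premeasure k d B"
  by (rule hausdorff_premeasure_greatest, rule hausdorff_premeasure_le_suminf) auto

lemma hausdorff_premeasure_antimono: "d \<le> d' \<Longrightarrow> hausdorff_premeasure k d' A \<le> hausdorff_premeasure k d A"
  by (rule hausdorff_premeasure_greatest, rule hausdorff_premeasure_le_suminf) (auto intro: order_trans)

lemma hausdorff_premeasure_le_gauge:
  assumes "bounded C" "diameter C \<le> d" "0 \<le> d"
  shows "hausdorff_premeasure k d C \<le> hausdorff_gauge k C"
proof -
  have "hausdorff_premeasure k d C \<le> (\<Sum>i. hausdorff_gauge k (if i = (0::nat) then C else {}))"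
    by (rule hausdorff_premeasure_le_suminf) (use assms in auto)
  also have "\<dots> = (\<Sum>i\<in>{0::nat}. hausdorff_gauge k (if i = 0 then C else {}))"
    by (rule suminf_finite) auto
  finally show ?thesis by simp
qed

lemma hausdorff_premeasure_empty: "0 \<le> d \<Longrightarrow> hausdorff_premeasure k d {} = 0"
  using hausdorff_premeasure_le_gauge[of "{}" d k] by simp

lemma hausdorff_premeasure_countably_subadditive:
  fixes A :: "nat \<Rightarrow> 'a::metric_space set"
  shows "hausdorff_premeasure k d (\<Union>i. A i) \<le> (\<Sum>i. hausdorff_premeasure k d (A i))"
proof (cases "(\<Sum>i. hausdorff_premeasure k d (A i)) = \<infinity>")
  case False
  then have fini: "hausdorff_premeasure k d (A i) \<noteq> \<infinity>" for i
    by (metis infinity_ennreal_def ennreal_suminf_lessD top.not_eq_extremum order.irrefl)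
  show ?thesis
  proof (rule ennreal_le_epsilon)
    fix e :: real assume e: "0 < e"
    have "\<exists>C. A i \<subseteq> (\<Union>j. C j) \<and> (\<forall>j. bounded (C j) \<and> diameter (C j) \<le> d) \<and>
        (\<Sum>j. hausdorff_gauge k (C j)) \<le> hausdorff_premeasure k d (A i) + ennreal (e * (1/2) ^ Suc i)" for i :: nat
    proof -
      have "hausdorff_premeasure k d (A i) < hausdorff_premeasure k d (A i) + ennreal (e * (1/2) ^ Suc i)"
        using fini[of i] e by (auto simp: less_top ennreal_zero_less_mult_iff intro!: ennreal_add_left_cancel_less[THEN iffD2, of _ 0, simplified])
      from this[THEN hausdorff_premeasure_def[of k d "A i", THEN arg_cong[where f="\<lambda>x. x < _"], THEN iffD1]]
      show ?thesis unfolding INF_less_iff by (auto intro: less_imp_le)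
    qed
    then obtain C where C: "\<And>i. A i \<subseteq> (\<Union>j. C i j)" "\<And>i j. bounded (C i j)" "\<And>i j. diameter (C i j) \<le> d"
      "\<And>i. (\<Sum>j. hausdorff_gauge k (C i j)) \<le> hausdorff_premeasure k d (A i) + ennreal (e * (1/2) ^ Suc i)"
      by metis
    have "hausdorff_premeasure k d (\<Union>i. A i) \<le> (\<Sum>p. hausdorff_gauge k (case_prod C (prod_decode p)))"
    proof (rule hausdorff_premeasure_le_suminf)
      show "(\<Union>i. A i) \<subseteq> (\<Union>p. case_prod C (prod_decode p))"
      proof
        fix x assume "x \<in> (\<Union>i. A i)"
        then obtain i j where "x \<in> C i j" using C(1) by blast
        then have "x \<in> case_prod C (prod_decode (prod_encode (i, j)))" by simp
        then show "x \<in> (\<Union>p. case_prod C (prod_decode p))" by (rule UN_I[OF UNIV_I])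
      qed
    qed (auto simp: C split: prod.split)
    also have "\<dots> = (\<Sum>i. \<Sum>j. hausdorff_gauge k (C i j))"
      by (rule suminf_ennreal_2dimen[where f="\<lambda>q. hausdorff_gauge k (case_prod C q)"]) simp
    also have "\<dots> \<le> (\<Sum>i. hausdorff_premeasure k d (A i) + ennreal (e * (1/2) ^ Suc i))"
      by (intro suminf_le C) auto
    also have "\<dots> = (\<Sum>i. hausdorff_premeasure k d (A i)) + (\<Sum>i. ennreal (e * (1/2) ^ Suc i))"
      by (rule suminf_add[symmetric]) auto
    also have "(\<Sum>i. ennreal (e * (1/2) ^ Suc i)) = ennreal e"
    proof -
      have "(\<lambda>i. e * (1/2) ^ Suc i) sums (e * 1)" by (intro sums_mult power_half_series)
      then show ?thesis using e by (intro suminf_ennreal_eq) auto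
    qed
    finally show "hausdorff_premeasure k d (\<Union>i. A i) \<le> (\<Sum>i. hausdorff_premeasure k d (A i)) + ennreal e" .
  qed
qed simp

lemma hausdorff_premeasure_le_outer: "0 < d \<Longrightarrow> hausdorff_premeasure k d A \<le> hausdorff_outer k A"
  unfolding hausdorff_outer_def by (rule SUP_upper) auto

lemma hausdorff_outer_least:
  "(\<And>d. 0 < d \<Longrightarrow> d \<le> d0 \<Longrightarrow> hausdorff_premeasure k d A \<le> r) \<Longrightarrow> 0 < d0 \<Longrightarrow> hausdorff_outer k A \<le> r"
  unfolding hausdorff_outer_def
proof (rule SUP_least)
  fix d :: real assume *: "\<And>d. 0 < d \<Longrightarrow> d \<le> d0 \<Longrightarrow> hausdorff_premeasure k d A \<le> r" "0 < d0" "d \<in> {0<..}"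
  have "hausdorff_premeasure k d A \<le> hausdorff_premeasure k (min d d0) A"
    by (rule hausdorff_premeasure_antimono) simp
  also have "\<dots> \<le> r" using * by auto
  finally show "hausdorff_premeasure k d A \<le> r" .
qed

lemma hausdorff_outer_mono: "A \<subseteq> B \<Longrightarrow> hausdorff_outer k A \<le> hausdorff_outer k B"
  unfolding hausdorff_outer_def by (intro SUP_mono) (auto intro: hausdorff_premeasure_mono)

text \<open>A covering set of diameter below \<open>r\<close> cannot meet both sets, so a fine cover
  of the union splits into covers of \<open>A\<close> and of \<open>B\<close> that share no nonempty
  member.\<close>

lemma hausdorff_outer_metric:
  assumes "0 < r" "\<And>x y. x \<in> A \<Longrightarrow> y \<in> B \<Longrightarrow> r \<le> dist x y"
  shows "hausdorff_outer k A + hausdorff_outer k B \<le> hausdorff_outer k (A \<union> B)"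
proof -
  have *: "hausdorff_premeasure k d A + hausdorff_premeasure k d B \<le> hausdorff_outer k (A \<union> B)"
    if "0 < d" "d < r" for d
  proof -
    have "hausdorff_premeasure k d A + hausdorff_premeasure k d B \<le> hausdorff_premeasure k d (A \<union> B)"
    proof (rule hausdorff_premeasure_greatest)
      fix C :: "nat \<Rightarrow> 'a set"
      assume C: "A \<union> B \<subseteq> (\<Union>i. C i)" "\<And>i. bounded (C i)" "\<And>i. diameter (C i) \<le> d"
      define CA where "CA i = (if C i \<inter> A \<noteq> {} then C i else {})" for i
      define CB where "CB i = (if C i \<inter> B \<noteq> {} then C i else {})" for i
      have 1: "hausdorff_premeasure k d A \<le> (\<Sum>i. hausdorff_gauge k (CA i))"
        using C \<open>0 < d\<close> by (intro hausdorff_premeasure_le_suminf) (auto simp: CA_def subset_iff, blast+)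
      have 2: "hausdorff_premeasure k d B \<le> (\<Sum>i. hausdorff_gauge k (CB i))"
        using C \<open>0 < d\<close> by (intro hausdorff_premeasure_le_suminf) (auto simp: CB_def subset_iff, blast+)
      have ex: "C i \<inter> A = {} \<or> C i \<inter> B = {}" for i
      proof (rule ccontr)
        assume "\<not> ?thesis"
        then obtain x y where xy: "x \<in> C i" "x \<in> A" "y \<in> C i" "y \<in> B" by blast
        then have "r \<le> dist x y" using assms by auto
        also have "dist x y \<le> diameter (C i)"
          by (rule diameter_bounded_bound) (use xy C in auto)
        finally show False using C(3)[of i] that by simp
      qed
      have "hausdorff_premeasure k d A + hausdorff_premeasure k d B
          \<le> (\<Sum>i. hausdorff_gauge k (CA i)) + (\<Sum>i. hausdorff_gauge k (CB i))"
        by (intro add_mono 1 2)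
      also have "\<dots> = (\<Sum>i. hausdorff_gauge k (CA i) + hausdorff_gauge k (CB i))"
        by (rule suminf_add) auto
      also have "\<dots> \<le> (\<Sum>i. hausdorff_gauge k (C i))"
        using ex by (intro suminf_le) (auto simp: CA_def CB_def)
      finally show "hausdorff_premeasure k d A + hausdorff_premeasure k d B \<le> (\<Sum>i. hausdorff_gauge k (C i))" .
    qed
    also have "\<dots> \<le> hausdorff_outer k (A \<union> B)" by (rule hausdorff_premeasure_le_outer) fact
    finally show ?thesis .
  qed
  have "hausdorff_outer k A + hausdorff_outer k B
      = (SUP d\<in>{0<..}. hausdorff_premeasure k d A) + (SUP d\<in>{0<..}. hausdorff_premeasure k d B)"
    by (simp add: hausdorff_outer_def)
  also have "\<dots> = (SUP d\<in>{0<..}. hausdorff_premeasure k d A + hausdorff_premeasure k d B)"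
  proof (rule SUP_add_directed_ennreal[symmetric])
    fix i j :: real assume "i \<in> {0<..}" "j \<in> {0<..}"
    then show "\<exists>l\<in>{0<..}. hausdorff_premeasure k i A + hausdorff_premeasure k j B
        \<le> hausdorff_premeasure k l A + hausdorff_premeasure k l B"
      by (intro bexI[of _ "min i j"] add_mono hausdorff_premeasure_antimono) auto
  qed
  also have "\<dots> \<le> hausdorff_outer k (A \<union> B)"
  proof (rule SUP_least)
    fix d :: real assume "d \<in> {0<..}"
    have "hausdorff_premeasure k d A + hausdorff_premeasure k d B
        \<le> hausdorff_premeasure k (min d (r/2)) A + hausdorff_premeasure k (min d (r/2)) B"
      by (intro add_mono hausdorff_premeasure_antimono) auto
    also have "\<dots> \<le> hausdorff_outer k (A \<union> B)"
      using \<open>d \<in> _\<close> \<open>0 < r\<close> by (intro *) (auto simp: min_def)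
    finally show "hausdorff_premeasure k d A + hausdorff_premeasure k d B \<le> hausdorff_outer k (A \<union> B)" .
  qed
  finally show ?thesis .
qed

lemma hausdorff_outer_empty: "hausdorff_outer k {} = 0"
  using hausdorff_outer_least[of 1 k "{}" 0] by (simp add: hausdorff_premeasure_empty)

lemma hausdorff_outer_countably_subadditive:
  "hausdorff_outer k (\<Union>i::nat. A i) \<le> (\<Sum>i. hausdorff_outer k (A i))"
  unfolding hausdorff_outer_def[of k "\<Union>i. A i"]
proof (rule SUP_least)
  fix d :: real assume "d \<in> {0<..}"
  have "hausdorff_premeasure k d (\<Union>i. A i) \<le> (\<Sum>i. hausdorff_premeasure k d (A i))"
    by (rule hausdorff_premeasure_countably_subadditive)
  also have "\<dots> \<le> (\<Sum>i. hausdorff_outer k (A i))"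
    using \<open>d \<in> _\<close> by (intro suminf_le hausdorff_premeasure_le_outer) auto
  finally show "hausdorff_premeasure k d (\<Union>i. A i) \<le> (\<Sum>i. hausdorff_outer k (A i))" .
qed

lemma sets_hausdorff [simp, measurable_cong]: "sets (hausdorff k) = sets borel"
  unfolding hausdorff_def using sets.sigma_sets_eq[of borel] by simp

lemma space_hausdorff [simp]: "space (hausdorff k) = UNIV"
  unfolding hausdorff_def by (simp add: space_measure_of_conv)

lemma emeasure_hausdorff:
  assumes "A \<in> sets borel"
  shows "emeasure (hausdorff k) A = hausdorff_outer k A"
proof -
  have "measure_space UNIV (sets borel) (hausdorff_outer k :: 'a set \<Rightarrow> ennreal)"
    by (rule metric_outer_measure_space[OF hausdorff_outer_empty hausdorff_outer_mono
          hausdorff_outer_countably_subadditive hausdorff_outer_metric])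
  then show ?thesis
    unfolding hausdorff_def measure_space_def using assms
    by (intro emeasure_measure_of_sigma) auto
qed

section \<open>Hausdorff measure of Lipschitz images and of images of products with an
  interval\<close>

lemma hausdorff_gauge_mono:
  assumes "A \<subseteq> B" "bounded B"
  shows "hausdorff_gauge k A \<le> hausdorff_gauge k B"
proof (cases "A = {}")
  case False
  then show ?thesis
    using assms bounded_subset[OF assms(2,1)]
    by (auto simp: hausdorff_gauge_def intro!: ennreal_leI mult_left_mono power_mono diameter_subset diameter_ge_0)
qed simp

lemma hausdorff_premeasure_greatest_cmult:
  assumes "0 < c"
    and "\<And>C. A \<subseteq> (\<Union>i. C i) \<Longrightarrow> (\<And>i. bounded (C i)) \<Longrightarrow> (\<And>i. diameter (C i) \<le> d) \<Longrightarrow>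
      r \<le> ennreal c * (\<Sum>i. hausdorff_gauge k (C i))"
  shows "r \<le> ennreal c * hausdorff_premeasure k d A"
proof -
  have inv: "ennreal (1 / c) * (ennreal c * x) = x" "ennreal c * (ennreal (1 / c) * x) = x" for x
    using assms(1) by (simp_all add: mult.assoc[symmetric] ennreal_mult[symmetric])
  have "ennreal (1 / c) * r \<le> hausdorff_premeasure k d A"
  proof (rule hausdorff_premeasure_greatest)
    fix C :: "nat \<Rightarrow> 'a set"
    assume C: "A \<subseteq> (\<Union>i. C i)" "\<And>i. bounded (C i)" "\<And>i. diameter (C i) \<le> d"
    have "ennreal (1 / c) * r \<le> ennreal (1 / c) * (ennreal c * (\<Sum>i. hausdorff_gauge k (C i)))"
      by (intro mult_left_mono assms(2) C) auto
    then show "ennreal (1 / c) * r \<le> (\<Sum>i. hausdorff_gauge k (C i))" by (simp add: inv)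
  qed
  then have "ennreal c * (ennreal (1 / c) * r) \<le> ennreal c * hausdorff_premeasure k d A"
    by (intro mult_left_mono) auto
  then show ?thesis by (simp add: inv)
qed

lemma hausdorff_outer_lipschitz_le:
  fixes f :: "'a::metric_space \<Rightarrow> 'b::metric_space"
  assumes L: "0 < L" and lip: "\<And>x y. x \<in> A \<Longrightarrow> y \<in> A \<Longrightarrow> dist (f x) (f y) \<le> L * dist x y"
  shows "hausdorff_outer k (f ` A) \<le> ennreal (L ^ k) * hausdorff_outer k A"
proof (rule hausdorff_outer_least[of 1])
  fix d :: real assume d: "0 < d" "d \<le> 1"
  have "hausdorff_premeasure k d (f ` A) \<le> ennreal (L ^ k) * hausdorff_premeasure k (d / L) A"
  proof (rule hausdorff_premeasure_greatest_cmult)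
    fix C :: "nat \<Rightarrow> 'a set"
    assume C: "A \<subseteq> (\<Union>i. C i)" "\<And>i. bounded (C i)" "\<And>i. diameter (C i) \<le> d / L"
    have dist: "dist (f x) (f y) \<le> L * diameter (C i)" if "x \<in> C i \<inter> A" "y \<in> C i \<inter> A" for i x y
    proof -
      have "dist (f x) (f y) \<le> L * dist x y" using lip that by auto
      also have "\<dots> \<le> L * diameter (C i)"
        using L C(2)[of i] that by (intro mult_left_mono diameter_bounded_bound) auto
      finally show ?thesis .
    qed
    have diam0: "0 \<le> diameter (C i)" for i using C(2) by (rule diameter_ge_0)
    have "hausdorff_premeasure k d (f ` A) \<le> (\<Sum>i. hausdorff_gauge k (f ` (C i \<inter> A)))"
    proof (rule hausdorff_premeasure_le_suminf)
      show "f ` A \<subseteq> (\<Union>i. f ` (C i \<inter> A))" using C(1) by blast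
      show "bounded (f ` (C i \<inter> A))" for i
        by (rule bounded_if_dist_le[where d="L * diameter (C i)"]) (use dist in auto)
      have "diameter (f ` (C i \<inter> A)) \<le> L * diameter (C i)" for i
        by (rule diameter_le_dist) (use dist L diam0 in auto)
      also have "L * diameter (C i) \<le> d" for i using C(3)[of i] L by (simp add: field_simps)
      finally show "diameter (f ` (C i \<inter> A)) \<le> d" for i .
    qed
    also have "\<dots> \<le> (\<Sum>i. ennreal (L ^ k) * hausdorff_gauge k (C i))"
    proof (intro suminf_le)
      fix i
      show "hausdorff_gauge k (f ` (C i \<inter> A)) \<le> ennreal (L ^ k) * hausdorff_gauge k (C i)"
      proof (cases "C i = {}")
        case False
        have "hausdorff_gauge k (f ` (C i \<inter> A)) \<le> ennreal (unit_ball_vol (real k) * (L * diameter (C i) / 2) ^ k)"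
          by (rule hausdorff_gauge_le) (use L diam0 dist in auto)
        also have "\<dots> = ennreal (L ^ k) * hausdorff_gauge k (C i)"
          using False L diam0 by (simp add: hausdorff_gauge_def ennreal_mult[symmetric] power_mult_distrib power_divide field_simps)
        finally show ?thesis .
      qed simp
    qed auto
    also have "\<dots> = ennreal (L ^ k) * (\<Sum>i. hausdorff_gauge k (C i))" by simp
    finally show "hausdorff_premeasure k d (f ` A) \<le> ennreal (L ^ k) * (\<Sum>i. hausdorff_gauge k (C i))" .
  qed (use L in auto)
  also have "\<dots> \<le> ennreal (L ^ k) * hausdorff_outer k A"
    using d L by (intro mult_left_mono hausdorff_premeasure_le_outer) auto
  finally show "hausdorff_premeasure k d (f ` A) \<le> ennreal (L ^ k) * hausdorff_outer k A" .
qed simp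

text \<open>If \<open>C\<close> has diameter r > 0, the interval is cut into about M/r pieces of
  length r. Each image piece has diameter at most 2 L r, so the total cost is of order (M/r) *
  r^(k+1), which is of order r^k. The quotient \<open>2 ^ k / unit_ball_vol (real k)\<close> in the
  constant turns the normalized gauge of \<open>C\<close> back into a plain power of its
  diameter.\<close>

lemma hausdorff_premeasure_interval_times_le:
  fixes F :: "real \<Rightarrow> 'a::metric_space \<Rightarrow> 'b::metric_space"
  assumes L: "0 < L" and M: "0 \<le> M"
    and lip: "\<And>s t x y. s \<in> {0..M} \<Longrightarrow> t \<in> {0..M} \<Longrightarrow> x \<in> C \<Longrightarrow> y \<in> C \<Longrightarrow>
      dist (F s x) (F t y) \<le> L * (\<bar>s - t\<bar> + dist x y)"
    and C: "bounded C" "diameter C \<le> d" and d: "0 < d" "d \<le> 1"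
  shows "hausdorff_premeasure (Suc k) (2 * L * d) (case_prod F ` ({0..M} \<times> C))
    \<le> ennreal ((M + 1) * unit_ball_vol (real (Suc k)) * L ^ Suc k * 2 ^ k / unit_ball_vol (real k)) * hausdorff_gauge k C"
    (is "?P \<le> ennreal ?c * _")
proof (cases "C = {}")
  case True
  then show ?thesis using d L by (simp add: hausdorff_premeasure_empty)
next
  case ne: False
  define K where "K = (M + 1) * unit_ball_vol (real (Suc k)) * L ^ Suc k"
  have K: "0 \<le> K" unfolding K_def using M L by (intro mult_nonneg_nonneg) auto
  have ubv: "0 < unit_ball_vol (real k)" by simp
  \<comment> \<open>The length \<open>r\<close> of the pieces is kept apart from the diameter of
    \<open>C\<close>, which may be 0.\<close>
  have main: "?P \<le> ennreal (K * r ^ k)" if r: "0 < r" "diameter C \<le> r" "r \<le> d" for r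
  proof -
    define N where "N = nat \<lfloor>M / r\<rfloor>"
    define D where "D j = (if j \<le> N then case_prod F ` (({real j * r .. real (Suc j) * r} \<inter> {0..M}) \<times> C) else {})" for j
    have dist: "dist p q \<le> 2 * L * r" if pq: "p \<in> D j" "q \<in> D j" for p q j
    proof -
      obtain s t x y where st: "s \<in> {real j * r .. real (Suc j) * r} \<inter> {0..M}" "t \<in> {real j * r .. real (Suc j) * r} \<inter> {0..M}"
        "x \<in> C" "y \<in> C" "p = F s x" "q = F t y"
        using pq unfolding D_def by (auto simp del: of_nat_Suc split: if_splits)
      have "dist p q \<le> L * (\<bar>s - t\<bar> + dist x y)" using lip st by auto
      also have "\<bar>s - t\<bar> \<le> r"
      proof -
        have "real (Suc j) * r = real j * r + r" by (simp add: algebra_simps)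
        then show ?thesis using st(1,2) by (auto simp: abs_if)
      qed
      also have "dist x y \<le> r" using diameter_bounded_bound[OF C(1) st(3,4)] r by linarith
      finally show ?thesis using L by (simp add: algebra_simps)
    qed
    have "?P \<le> (\<Sum>j. hausdorff_gauge (Suc k) (D j))"
    proof (rule hausdorff_premeasure_le_suminf)
      show "case_prod F ` ({0..M} \<times> C) \<subseteq> (\<Union>j. D j)"
      proof
        fix p assume "p \<in> case_prod F ` ({0..M} \<times> C)"
        then obtain t x where t: "t \<in> {0..M}" "x \<in> C" and p: "p = F t x" by auto
        define j where "j = nat \<lfloor>t / r\<rfloor>"
        have t0: "0 \<le> t / r" using t r by simp
        have 1: "real j \<le> t / r" "t / r \<le> real (Suc j)" unfolding j_def using t0 by linarith+
        have "j \<le> N" unfolding j_def N_def using t r by (intro nat_mono floor_mono divide_right_mono) auto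
        moreover have "t \<in> {real j * r .. real (Suc j) * r}" using 1 r by (simp add: field_simps)
        ultimately have "F t x \<in> D j" using t by (auto simp: D_def intro!: image_eqI[of _ _ "(t, x)"])
        then show "p \<in> (\<Union>j. D j)" using p by auto
      qed
      show "bounded (D j)" for j by (rule bounded_if_dist_le[where d="2 * L * r"]) (rule dist)
      have "diameter (D j) \<le> 2 * L * r" for j by (rule diameter_le_dist) (use dist L r in auto)
      also have "2 * L * r \<le> 2 * L * d" using r L by simp
      finally show "diameter (D j) \<le> 2 * L * d" for j .
    qed
    also have "\<dots> = (\<Sum>j\<in>{..N}. hausdorff_gauge (Suc k) (D j))"
      by (rule suminf_finite) (auto simp: D_def)
    also have "\<dots> \<le> (\<Sum>j\<in>{..N}. ennreal (unit_ball_vol (real (Suc k)) * (2 * L * r / 2) ^ Suc k))"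
      by (intro sum_mono hausdorff_gauge_le) (use dist L r in auto)
    also have "\<dots> = ennreal (real (Suc N) * (unit_ball_vol (real (Suc k)) * (L * r) ^ Suc k))"
      using L r by (simp add: ennreal_mult[symmetric] ennreal_of_nat_eq_real_of_nat del: of_nat_Suc power_Suc)
    also have "\<dots> \<le> ennreal (K * r ^ k)"
    proof (rule ennreal_leI)
      \<comment> \<open>Since \<open>r\<close> is at most 1, the extra piece at the end is absorbed:
        M/r + 1 is at most (M+1)/r.\<close>
      have "real (Suc N) \<le> M / r + 1" unfolding N_def using M r by simp
      also have "\<dots> \<le> (M + 1) / r" using r d by (simp add: field_simps)
      finally have "real (Suc N) * (unit_ball_vol (real (Suc k)) * (L * r) ^ Suc k)
          \<le> (M + 1) / r * (unit_ball_vol (real (Suc k)) * (L * r) ^ Suc k)"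
        using L r by (intro mult_right_mono) auto
      also have "\<dots> = K * r ^ k" using r by (simp add: K_def power_mult_distrib field_simps)
      finally show "real (Suc N) * (unit_ball_vol (real (Suc k)) * (L * r) ^ Suc k) \<le> K * r ^ k" .
    qed
    finally show ?thesis .
  qed
  have eq: "ennreal ?c * hausdorff_gauge k C = ennreal (K * diameter C ^ k)"
    using ne ubv K diameter_ge_0[OF C(1)] L M
    by (simp add: hausdorff_gauge_def K_def ennreal_mult[symmetric] power_divide del: unit_ball_vol_pos)
  show ?thesis
  proof (cases "diameter C = 0")
    case False
    then show ?thesis unfolding eq using main[of "diameter C"] diameter_ge_0[OF C(1)] C by simp
  next
    case True
    \<comment> \<open>A nonempty set of diameter 0 has gauge 1 for k = 0, and one choice of
      \<open>r\<close> suffices; for k > 0 its gauge is 0 and \<open>r\<close> has to tend to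
      0.\<close>
    show ?thesis
    proof (cases "k = 0")
      case True
      then show ?thesis unfolding eq using main[of d] C d by simp
    next
      case k: False
      show ?thesis
      proof (rule ennreal_le_epsilon)
        fix e :: real assume e: "0 < e"
        define r where "r = min d (e / (K + 1))"
        have r: "0 < r" "r \<le> d" "r \<le> 1" "r \<le> e / (K + 1)" using d e K by (auto simp: r_def)
        have "?P \<le> ennreal (K * r ^ k)" using r True by (intro main) auto
        also have "K * r ^ k \<le> K * r ^ 1" using r k K by (intro mult_left_mono power_decreasing) auto
        also have "K * r ^ 1 \<le> (K + 1) * r" using r by (simp add: algebra_simps)
        also have "\<dots> \<le> e" using r(4) K by (simp add: field_simps)
        finally have "?P \<le> ennreal e" by (simp add: ennreal_leI)
        then show "?P \<le> ennreal ?c * hausdorff_gauge k C + ennreal e"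
          by (rule order_trans) (simp add: add_increasing)
      qed
    qed
  qed
qed

text \<open>Serves two opposite aims: finite measure of \<open>A\<close> passes to the image, and
  positive measure of the image forces positive measure of \<open>A\<close>.\<close>

lemma hausdorff_outer_interval_times_le:
  fixes F :: "real \<Rightarrow> 'a::metric_space \<Rightarrow> 'b::metric_space"
  assumes L: "0 < L" and M: "0 \<le> M"
    and lip: "\<And>s t x y. s \<in> {0..M} \<Longrightarrow> t \<in> {0..M} \<Longrightarrow> x \<in> A \<Longrightarrow> y \<in> A \<Longrightarrow>
      dist (F s x) (F t y) \<le> L * (\<bar>s - t\<bar> + dist x y)"
  shows "\<exists>c>0. hausdorff_outer (Suc k) (case_prod F ` ({0..M} \<times> A)) \<le> ennreal c * hausdorff_outer k A"
proof (intro exI conjI)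
  let ?c = "(M + 1) * unit_ball_vol (real (Suc k)) * L ^ Suc k * 2 ^ k / unit_ball_vol (real k)"
  show c: "0 < ?c" using L M by (intro divide_pos_pos mult_pos_pos) auto
  show "hausdorff_outer (Suc k) (case_prod F ` ({0..M} \<times> A)) \<le> ennreal ?c * hausdorff_outer k A"
  proof (rule hausdorff_outer_least[of "2 * L"])
    fix d' :: real assume d': "0 < d'" "d' \<le> 2 * L"
    define d where "d = d' / (2 * L)"
    have d: "0 < d" "d \<le> 1" "d' = 2 * L * d" using d' L by (auto simp: d_def)
    have "hausdorff_premeasure (Suc k) d' (case_prod F ` ({0..M} \<times> A)) \<le> ennreal ?c * hausdorff_premeasure k d A"
    proof (rule hausdorff_premeasure_greatest_cmult[OF c])
      fix C :: "nat \<Rightarrow> 'a set"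
      assume C: "A \<subseteq> (\<Union>i. C i)" "\<And>i. bounded (C i)" "\<And>i. diameter (C i) \<le> d"
      have "hausdorff_premeasure (Suc k) d' (case_prod F ` ({0..M} \<times> A))
          \<le> hausdorff_premeasure (Suc k) d' (\<Union>i. case_prod F ` ({0..M} \<times> (C i \<inter> A)))"
        using C(1) by (intro hausdorff_premeasure_mono) blast
      also have "\<dots> \<le> (\<Sum>i. hausdorff_premeasure (Suc k) d' (case_prod F ` ({0..M} \<times> (C i \<inter> A))))"
        by (rule hausdorff_premeasure_countably_subadditive)
      also have "\<dots> \<le> (\<Sum>i. ennreal ?c * hausdorff_gauge k (C i))"
      proof (intro suminf_le)
        fix i
        have "hausdorff_premeasure (Suc k) d' (case_prod F ` ({0..M} \<times> (C i \<inter> A)))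
            \<le> ennreal ?c * hausdorff_gauge k (C i \<inter> A)"
          unfolding d(3)
        proof (rule hausdorff_premeasure_interval_times_le[OF L M lip])
          show "bounded (C i \<inter> A)" using C(2)[of i] by (rule bounded_subset) auto
          show "diameter (C i \<inter> A) \<le> d"
            using diameter_subset[OF _ C(2)[of i], of "C i \<inter> A"] C(3)[of i] by auto
        qed (use d in auto)
        also have "\<dots> \<le> ennreal ?c * hausdorff_gauge k (C i)"
          using C(2) by (intro mult_left_mono hausdorff_gauge_mono) auto
        finally show "hausdorff_premeasure (Suc k) d' (case_prod F ` ({0..M} \<times> (C i \<inter> A)))
            \<le> ennreal ?c * hausdorff_gauge k (C i)" .
      qed auto
      also have "\<dots> = ennreal ?c * (\<Sum>i. hausdorff_gauge k (C i))" by simp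
      finally show "hausdorff_premeasure (Suc k) d' (case_prod F ` ({0..M} \<times> A))
          \<le> ennreal ?c * (\<Sum>i. hausdorff_gauge k (C i))" .
    qed
    also have "\<dots> \<le> ennreal ?c * hausdorff_outer k A"
      using d by (intro mult_left_mono hausdorff_premeasure_le_outer) auto
    finally show "hausdorff_premeasure (Suc k) d' (case_prod F ` ({0..M} \<times> A)) \<le> ennreal ?c * hausdorff_outer k A" .
  qed (use L in auto)
qed

section \<open>Hausdorff measures of spheres\<close>

text \<open>For \<open>B\<close> inside the basis this is the unit sphere of the span of
  \<open>B\<close>; adding one basis vector at a time gives an induction over the dimension.\<close>

definition coord_sphere :: "'a::euclidean_space set \<Rightarrow> 'a set" where
  "coord_sphere B = {x. norm x = 1 \<and> (\<forall>b\<in>Basis - B. x \<bullet> b = 0)}"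

lemma coord_sphere_insert_subset:
  fixes b :: "'a::euclidean_space"
  assumes b: "b \<in> Basis" "b \<notin> B" and B: "B \<subseteq> Basis" "B \<noteq> {}"
  shows "coord_sphere (insert b B) \<subseteq> (\<lambda>(t, u). cos t *\<^sub>R b + sin t *\<^sub>R u) ` ({0..pi} \<times> coord_sphere B)"
proof
  fix x assume "x \<in> coord_sphere (insert b B)"
  then have x: "norm x = 1" "\<And>c. c \<in> Basis \<Longrightarrow> c \<notin> insert b B \<Longrightarrow> x \<bullet> c = 0" by (auto simp: coord_sphere_def)
  define t where "t = arccos (x \<bullet> b)"
  define y where "y = x - (x \<bullet> b) *\<^sub>R b"
  have bb: "b \<bullet> b = 1" using b by simp
  have "\<bar>x \<bullet> b\<bar> \<le> 1" using Basis_le_norm[OF b(1), of x] x by simp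
  then have xb: "-1 \<le> x \<bullet> b" "x \<bullet> b \<le> 1" by auto
  have t: "t \<in> {0..pi}" "cos t = x \<bullet> b" using xb by (auto simp: t_def arccos_lbound arccos_ubound cos_arccos)
  have xx: "x \<bullet> x = 1" using x(1) by (simp add: norm_eq_1)
  have "(norm y)\<^sup>2 = 1 - (x \<bullet> b)\<^sup>2"
    unfolding power2_norm_eq_inner y_def
    by (simp add: inner_diff_left inner_diff_right bb xx inner_commute[of b x] power2_eq_square)
  also have "\<dots> = (sin t)\<^sup>2" using t by (simp add: sin_squared_eq)
  finally have ny: "norm y = sin t"
    using t sin_ge_zero[of t] by (simp add: power2_eq_iff_nonneg)
  have yc: "y \<bullet> c = 0" if "c \<in> Basis" "c \<notin> B" for c
    using x(2)[of c] b that bb by (cases "c = b") (auto simp: y_def inner_diff_left inner_Basis)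
  \<comment> \<open>At a pole the tangential part \<open>y\<close> vanishes and its direction is
    arbitrary; \<open>c\<close> is the direction chosen there.\<close>
  obtain c where "c \<in> B" using B by auto
  then have c: "c \<in> coord_sphere B" using B by (auto simp: coord_sphere_def inner_Basis)
  define u where "u = (if y = 0 then c else y /\<^sub>R norm y)"
  have "u \<in> coord_sphere B"
    using c yc by (auto simp: u_def coord_sphere_def)
  moreover have "sin t *\<^sub>R u = y" by (simp add: u_def ny[symmetric])
  then have "x = cos t *\<^sub>R b + sin t *\<^sub>R u" by (simp add: t(2) y_def)
  ultimately show "x \<in> (\<lambda>(t, u). cos t *\<^sub>R b + sin t *\<^sub>R u) ` ({0..pi} \<times> coord_sphere B)"
    using t by (auto intro!: image_eqI[of _ _ "(t, u)"])
qed

lemma cos_sin_combination_lipschitz: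
  fixes b u v :: "'a::real_normed_vector"
  assumes "norm b = 1" "norm u = 1"
  shows "dist (cos s *\<^sub>R b + sin s *\<^sub>R u) (cos t *\<^sub>R b + sin t *\<^sub>R v) \<le> 2 * (\<bar>s - t\<bar> + dist u v)"
proof -
  have c: "\<bar>cos s - cos t\<bar> \<le> \<bar>s - t\<bar>"
  proof -
    have "\<bar>cos s - cos t\<bar> = 2 * \<bar>sin ((s + t) / 2)\<bar> * \<bar>sin ((t - s) / 2)\<bar>"
      by (simp add: cos_diff_cos abs_mult)
    also have "\<dots> \<le> 2 * 1 * \<bar>(t - s) / 2\<bar>" by (intro mult_mono abs_sin_x_le_abs_x) auto
    finally show ?thesis by simp
  qed
  have s: "\<bar>sin s - sin t\<bar> \<le> \<bar>s - t\<bar>"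
  proof -
    have "\<bar>sin s - sin t\<bar> = 2 * \<bar>sin ((s - t) / 2)\<bar> * \<bar>cos ((s + t) / 2)\<bar>"
      by (simp add: sin_diff_sin abs_mult)
    also have "\<dots> \<le> 2 * \<bar>(s - t) / 2\<bar> * 1" by (intro mult_mono abs_sin_x_le_abs_x) auto
    finally show ?thesis by simp
  qed
  have "dist (cos s *\<^sub>R b + sin s *\<^sub>R u) (cos t *\<^sub>R b + sin t *\<^sub>R v)
      = norm ((cos s - cos t) *\<^sub>R b + (sin s - sin t) *\<^sub>R u + sin t *\<^sub>R (u - v))"
    by (simp add: dist_norm algebra_simps)
  also have "\<dots> \<le> \<bar>cos s - cos t\<bar> * norm b + \<bar>sin s - sin t\<bar> * norm u + \<bar>sin t\<bar> * norm (u - v)"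
    by (metis (no_types) norm_scaleR norm_triangle_le order.refl add_mono norm_triangle_ineq)
  also have "\<dots> \<le> \<bar>s - t\<bar> + \<bar>s - t\<bar> + 1 * norm (u - v)"
    using c s assms by (intro add_mono mult_right_mono) auto
  also have "\<dots> \<le> 2 * (\<bar>s - t\<bar> + dist u v)" by (simp add: dist_norm)
  finally show ?thesis .
qed

lemma hausdorff_coord_sphere_insert_le:
  fixes b :: "'a::euclidean_space"
  assumes b: "b \<in> Basis" "b \<notin> B" and B: "B \<subseteq> Basis" "B \<noteq> {}"
  obtains c where "0 < c" "hausdorff_outer (Suc k) (coord_sphere (insert b B)) \<le> ennreal c * hausdorff_outer k (coord_sphere B)"
proof -
  have "\<exists>c>0. hausdorff_outer (Suc k) ((\<lambda>(t, u). cos t *\<^sub>R b + sin t *\<^sub>R u) ` ({0..pi} \<times> coord_sphere B)) \<le> ennreal c * hausdorff_outer k (coord_sphere B)"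
  proof (rule hausdorff_outer_interval_times_le[of 2 pi "coord_sphere B" "\<lambda>t u. cos t *\<^sub>R b + sin t *\<^sub>R u" k])
    show "dist (cos s *\<^sub>R b + sin s *\<^sub>R x) (cos t *\<^sub>R b + sin t *\<^sub>R y) \<le> 2 * (\<bar>s - t\<bar> + dist x y)"
      if "x \<in> coord_sphere B" for s t x y
      using that b by (intro cos_sin_combination_lipschitz) (auto simp: coord_sphere_def)
  qed auto
  then show thesis
    using hausdorff_outer_mono[OF coord_sphere_insert_subset[OF b B], of "Suc k"] order_trans that by blast
qed

lemma hausdorff_coord_sphere_finite:
  fixes B :: "'a::euclidean_space set"
  assumes "finite B" "B \<noteq> {}" "B \<subseteq> Basis"
  shows "hausdorff_outer (card B - 1) (coord_sphere B) < \<infinity>"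
  using assms
proof (induction B rule: finite_ne_induct)
  case (singleton b)
  have "coord_sphere {b} \<subseteq> {b, -b}"
  proof
    fix x assume x: "x \<in> coord_sphere {b}"
    have "x = (\<Sum>c\<in>Basis. (x \<bullet> c) *\<^sub>R c)" by (simp add: euclidean_representation)
    also have "\<dots> = (\<Sum>c\<in>{b}. (x \<bullet> c) *\<^sub>R c)"
      using x singleton by (intro sum.mono_neutral_right) (auto simp: coord_sphere_def)
    finally have *: "x = (x \<bullet> b) *\<^sub>R b" by simp
    have "norm x = \<bar>x \<bullet> b\<bar>" using singleton by (subst *) simp
    then have "x \<bullet> b = 1 \<or> x \<bullet> b = -1" using x by (auto simp: coord_sphere_def)
    then show "x \<in> {b, -b}" using * by (metis insertCI scaleR_minus1_left scaleR_one)
  qed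
  then have "hausdorff_outer 0 (coord_sphere {b}) \<le> hausdorff_outer 0 {b, -b}" by (rule hausdorff_outer_mono)
  also have "\<dots> \<le> 2"
  proof (rule hausdorff_outer_least[of 1])
    fix d :: real assume d: "0 < d" "d \<le> 1"
    have "hausdorff_premeasure 0 d {b, -b} \<le> (\<Sum>i. hausdorff_gauge 0 (if i = (0::nat) then {b} else if i = 1 then {-b} else {}))"
      by (rule hausdorff_premeasure_le_suminf) (use d in \<open>auto split: if_splits\<close>)
    also have "\<dots> = (\<Sum>i\<in>{0,1::nat}. hausdorff_gauge 0 (if i = (0::nat) then {b} else if i = 1 then {-b} else {}))"
      by (rule suminf_finite) auto
    also have "\<dots> = 2" by (simp add: hausdorff_gauge_def)
    finally show "hausdorff_premeasure 0 d {b, -b} \<le> 2" .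
  qed simp
  also have "(2::ennreal) < \<infinity>" by simp
  finally show ?case by simp
next
  case (insert b B)
  obtain c where "0 < c" and c: "hausdorff_outer (Suc (card B - 1)) (coord_sphere (insert b B)) \<le> ennreal c * hausdorff_outer (card B - 1) (coord_sphere B)"
    using hausdorff_coord_sphere_insert_le[of b B] insert by auto
  note c
  also have "ennreal c * hausdorff_outer (card B - 1) (coord_sphere B) < \<infinity>"
    using insert by (simp add: ennreal_mult_less_top)
  finally have "hausdorff_outer (Suc (card B - 1)) (coord_sphere (insert b B)) < \<infinity>" .
  moreover have "Suc (card B - 1) = card (insert b B) - 1"
    using insert by (simp add: card_gt_0_iff)
  ultimately show ?case by simp
qed

text \<open>Comparison with Lebesgue measure. Each covering set lies in the ball about one of its
  points whose radius is its diameter; this crude ball replaces the isodiametric inequality and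
  costs only the factor 2^n.\<close>

lemma hausdorff_cball_pos: "0 < hausdorff_outer DIM('a) (cball (0::'a::euclidean_space) 1)"
proof -
  let ?n = "DIM('a)" let ?V = "unit_ball_vol (real DIM('a))"
  have "ennreal ?V \<le> ennreal (2 ^ ?n) * hausdorff_premeasure ?n 1 (cball (0::'a) 1)"
  proof (rule hausdorff_premeasure_greatest_cmult)
    fix C :: "nat \<Rightarrow> 'a set"
    assume C: "cball (0::'a) 1 \<subseteq> (\<Union>i. C i)" "\<And>i. bounded (C i)" "\<And>i. diameter (C i) \<le> 1"
    define x where "x i = (SOME x. x \<in> C i)" for i
    define D where "D i = (if C i = {} then {} else cball (x i) (diameter (C i)))" for i
    have sub: "C i \<subseteq> D i" for i
      using diameter_bounded_bound[OF C(2)[of i]] some_in_eq[of "C i"] by (auto simp: D_def x_def)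
    have "ennreal ?V = emeasure lborel (cball (0::'a) 1)" by (subst emeasure_cball) auto
    also have "\<dots> \<le> emeasure lborel (\<Union>i. D i)"
    proof (rule emeasure_mono)
      show "cball 0 1 \<subseteq> (\<Union>i. D i)" using C(1) sub by blast
      have "D i \<in> sets lborel" for i by (simp add: D_def)
      then show "(\<Union>i. D i) \<in> sets lborel" by blast
    qed
    also have "\<dots> \<le> (\<Sum>i. emeasure lborel (D i))"
      by (intro emeasure_subadditive_countably) (auto simp: D_def)
    also have "\<dots> \<le> (\<Sum>i. ennreal (2 ^ ?n) * hausdorff_gauge ?n (C i))"
    proof (intro suminf_le)
      fix i
      show "emeasure lborel (D i) \<le> ennreal (2 ^ ?n) * hausdorff_gauge ?n (C i)"
      proof (cases "C i = {}")
        case False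
        then show ?thesis
          using diameter_ge_0[OF C(2)[of i]]
          by (simp add: D_def emeasure_cball hausdorff_gauge_def ennreal_mult[symmetric] power_divide)
      qed (simp add: D_def)
    qed auto
    also have "\<dots> = ennreal (2 ^ ?n) * (\<Sum>i. hausdorff_gauge ?n (C i))" by simp
    finally show "ennreal ?V \<le> ennreal (2 ^ ?n) * (\<Sum>i. hausdorff_gauge ?n (C i))" .
  qed simp
  also have "\<dots> \<le> ennreal (2 ^ ?n) * hausdorff_outer ?n (cball (0::'a) 1)"
    by (intro mult_left_mono hausdorff_premeasure_le_outer) auto
  finally have le: "ennreal ?V \<le> ennreal (2 ^ ?n) * hausdorff_outer ?n (cball (0::'a) 1)" .
  show ?thesis
  proof (rule ccontr)
    assume "\<not> ?thesis"
    then have "hausdorff_outer ?n (cball (0::'a) 1) = 0" by simp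
    with le have "ennreal ?V \<le> 0" by simp
    moreover have "0 < ?V" by simp
    ultimately show False by (simp add: ennreal_eq_0_iff)
  qed
qed

lemma cmult_pos_imp_pos:
  fixes x y :: ennreal
  assumes "0 < x" "x \<le> ennreal c * y"
  shows "0 < y"
  using assms by (metis gr_zeroI mult_zero_right not_less)

lemma hausdorff_usphere_finite: "hausdorff_outer (DIM('a) - 1) (usphere :: 'a::euclidean_space set) < \<infinity>"
  using hausdorff_coord_sphere_finite[of "Basis :: 'a set"]
  by (simp add: coord_sphere_def sphere_def dist_norm)

text \<open>The unit ball is covered by the image of \<open>{0..1} \<times> usphere\<close> under
  scaling, a Lipschitz map there, so a null sphere would give a null ball.\<close>

lemma hausdorff_usphere_pos: "0 < hausdorff_outer (DIM('a) - 1) (usphere :: 'a::euclidean_space set)"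
proof -
  have "\<exists>c>0. hausdorff_outer (Suc (DIM('a) - 1)) ((\<lambda>(t, u). t *\<^sub>R u) ` ({0..1} \<times> (usphere :: 'a set)))
     \<le> ennreal c * hausdorff_outer (DIM('a) - 1) (usphere :: 'a set)"
  proof (rule hausdorff_outer_interval_times_le[of 1 1 "usphere :: 'a set" "\<lambda>t u::'a. t *\<^sub>R u" "DIM('a) - 1"])
    fix s t :: real and x y :: 'a assume st: "s \<in> {0..1}" "t \<in> {0..1}" "x \<in> usphere" "y \<in> usphere"
    have "dist (s *\<^sub>R x) (t *\<^sub>R y) = norm ((s - t) *\<^sub>R x + t *\<^sub>R (x - y))" by (simp add: dist_norm algebra_simps)
    also have "\<dots> \<le> \<bar>s - t\<bar> * norm x + \<bar>t\<bar> * norm (x - y)" by (metis norm_scaleR norm_triangle_ineq)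
    also have "\<dots> \<le> \<bar>s - t\<bar> * 1 + 1 * norm (x - y)" using st by (intro add_mono mult_mono) auto
    finally show "dist (s *\<^sub>R x) (t *\<^sub>R y) \<le> 1 * (\<bar>s - t\<bar> + dist x y)" by (simp add: dist_norm)
  qed auto
  then obtain c where c: "0 < c" "hausdorff_outer (Suc (DIM('a) - 1)) ((\<lambda>(t, u). t *\<^sub>R u) ` ({0..1} \<times> (usphere :: 'a set)))
     \<le> ennreal c * hausdorff_outer (DIM('a) - 1) (usphere :: 'a set)" by blast
  have "cball (0::'a) 1 \<subseteq> (\<lambda>(t, u). t *\<^sub>R u) ` ({0..1} \<times> usphere)"
  proof
    fix x :: 'a assume x: "x \<in> cball 0 1"
    obtain b :: 'a where b: "b \<in> Basis" using SOME_Basis by blast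
    have "x = norm x *\<^sub>R (if x = 0 then b else x /\<^sub>R norm x)" by auto
    moreover have "(if x = 0 then b else x /\<^sub>R norm x) \<in> usphere" using b by auto
    ultimately show "x \<in> (\<lambda>(t, u). t *\<^sub>R u) ` ({0..1} \<times> usphere)"
      using x by (intro image_eqI[of _ _ "(norm x, if x = 0 then b else x /\<^sub>R norm x)"]) auto
  qed
  then have "hausdorff_outer (Suc (DIM('a) - 1)) (cball (0::'a) 1)
      \<le> hausdorff_outer (Suc (DIM('a) - 1)) ((\<lambda>(t, u). t *\<^sub>R u) ` ({0..1} \<times> (usphere :: 'a set)))"
    by (rule hausdorff_outer_mono)
  also note c(2)
  finally have "hausdorff_outer DIM('a) (cball (0::'a) 1) \<le> ennreal c * hausdorff_outer (DIM('a) - 1) (usphere :: 'a set)"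
    by (simp only: Suc_diff_1[OF DIM_positive])
  then show ?thesis by (rule cmult_pos_imp_pos[OF hausdorff_cball_pos])
qed

definition equator :: "'a::euclidean_space \<Rightarrow> 'a set" where
  "equator s = {x \<in> usphere. x \<bullet> s = 0}"

lemma equator_Basis: "b \<in> Basis \<Longrightarrow> equator b = coord_sphere (Basis - {b})"
  by (auto simp: equator_def coord_sphere_def)

text \<open>The sphere is swept out by the arcs from \<open>b\<close> to \<open>- b\<close> through
  the points of the equator, so positivity descends from the sphere to the equator; finiteness comes
  from the induction over coordinates.\<close>

lemma hausdorff_equator_Basis:
  assumes "2 \<le> DIM('a)" "b \<in> Basis"
  shows "0 < hausdorff_outer (DIM('a) - 2) (equator (b::'a::euclidean_space))"
    "hausdorff_outer (DIM('a) - 2) (equator (b::'a::euclidean_space)) < \<infinity>"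
proof -
  have card: "card (Basis - {b}) = DIM('a) - 1" using assms by simp
  with assms have ne: "Basis - {b} \<noteq> {}" by (metis card.empty diff_is_0_eq not_less_eq_eq numeral_2_eq_2 One_nat_def)
  show "hausdorff_outer (DIM('a) - 2) (equator b) < \<infinity>"
    using hausdorff_coord_sphere_finite[of "Basis - {b}"] ne card assms by (simp add: equator_Basis numeral_2_eq_2)
  obtain c where c: "0 < c" "hausdorff_outer (Suc (DIM('a) - 2)) (coord_sphere (insert b (Basis - {b}))) \<le> ennreal c * hausdorff_outer (DIM('a) - 2) (coord_sphere (Basis - {b}))"
    using hausdorff_coord_sphere_insert_le[of b "Basis - {b}" "DIM('a) - 2"] ne assms by auto
  moreover have "coord_sphere (insert b (Basis - {b})) = usphere"
    using assms by (auto simp: coord_sphere_def)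
  moreover have "Suc (DIM('a) - 2) = DIM('a) - 1" using assms by simp
  ultimately show "0 < hausdorff_outer (DIM('a) - 2) (equator b)"
    using hausdorff_usphere_pos[where 'a='a] cmult_pos_imp_pos by (metis equator_Basis[OF assms(2)])
qed

section \<open>Averages over subspheres\<close>

text \<open>Reflection in the line spanned by \<open>b + s\<close> (the point reflection if \<open>s = - b\<close>).\<close>

definition carry :: "'a::euclidean_space \<Rightarrow> 'a \<Rightarrow> 'a \<Rightarrow> 'a" where
  "carry b s x = (2 * ((s + b) \<bullet> x) / ((s + b) \<bullet> (s + b))) *\<^sub>R (s + b) - x"

lemma inner_carry: "carry b s x \<bullet> carry b s y = x \<bullet> y"
proof (cases "s + b = 0")
  case False
  define w where "w = s + b"
  define a where "a = w \<bullet> x" define c where "c = w \<bullet> y" define W where "W = w \<bullet> w"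
  have W: "W \<noteq> 0" using False by (simp add: W_def w_def)
  have comm: "x \<bullet> w = a" "y \<bullet> w = c" "w \<bullet> x = a" "w \<bullet> y = c" "w \<bullet> w = W"
    by (simp_all add: a_def c_def W_def inner_commute)
  have "carry b s x \<bullet> carry b s y = (2 * a / W) * (2 * c / W) * W - 2 * a / W * c - (2 * c / W * a) + x \<bullet> y"
    unfolding carry_def w_def[symmetric] comm
    by (simp only: inner_diff_left inner_diff_right inner_scaleR_left inner_scaleR_right comm) (simp add: algebra_simps)
  also have "\<dots> = x \<bullet> y" using W by (simp add: field_simps)
  finally show ?thesis .
qed (simp add: carry_def)

lemma norm_carry [simp]: "norm (carry b s x) = norm x"
  by (simp add: norm_eq_sqrt_inner inner_carry)

lemma linear_carry: "linear (carry b s)"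
  unfolding carry_def
  by (intro linearI) (simp_all add: inner_add_right algebra_simps add_divide_distrib)

lemma carry_self:
  assumes "norm b = 1" "norm s = 1"
  shows "carry b s b = s"
proof (cases "s + b = 0")
  case True
  then show ?thesis by (simp add: carry_def add_eq_0_iff)
next
  case False
  have "b \<bullet> b = 1" "s \<bullet> s = 1" using assms by (simp_all add: norm_eq_1)
  then have "(s + b) \<bullet> (s + b) = 2 * ((s + b) \<bullet> b)"
    by (simp add: inner_add_left inner_add_right inner_commute)
  moreover have "(s + b) \<bullet> (s + b) \<noteq> 0" using False by simp
  ultimately have eq: "2 * ((s + b) \<bullet> b) / ((s + b) \<bullet> (s + b)) = 1" by simp
  show ?thesis unfolding carry_def eq by simp
qed

lemma carry_carry [simp]: "carry b s (carry b s x) = x"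
proof (cases "s + b = 0")
  case False
  define w where "w = s + b"
  have w: "w \<bullet> w \<noteq> 0" using False by (simp add: w_def)
  have *: "w \<bullet> carry b s x = w \<bullet> x"
    unfolding carry_def w_def[symmetric] using w by (simp add: inner_diff_right)
  show ?thesis
    unfolding carry_def[of b s "carry b s x"] w_def[symmetric] * by (simp add: carry_def w_def)
qed (simp add: carry_def)

lemma continuous_on_carry_right: "continuous_on A (carry b s)"
  by (rule linear_continuous_on[OF linear_linear[THEN iffD2, OF linear_carry]])

lemma measurable_carry [measurable (raw)]:
  assumes [measurable]: "f \<in> borel_measurable M" "h \<in> borel_measurable M"
  shows "(\<lambda>x. carry b (f x) (h x)) \<in> borel_measurable M"
  unfolding carry_def by measurable

section \<open>Similarities and uniform laws on latitudes\<close>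

lemma hausdorff_outer_similarity:
  fixes T :: "'a::metric_space \<Rightarrow> 'b::metric_space"
  assumes r: "0 < r" and T: "\<And>x y. dist (T x) (T y) = r * dist x y"
  shows "hausdorff_outer k (T ` A) = ennreal (r ^ k) * hausdorff_outer k A"
proof (rule antisym)
  show "hausdorff_outer k (T ` A) \<le> ennreal (r ^ k) * hausdorff_outer k A"
    by (rule hausdorff_outer_lipschitz_le) (use r T in auto)
  have inj: "inj T" using T r by (metis (mono_tags) injI dist_eq_0_iff mult_eq_0_iff order_less_irrefl)
  have "hausdorff_outer k (inv T ` T ` A) \<le> ennreal ((1 / r) ^ k) * hausdorff_outer k (T ` A)"
    by (rule hausdorff_outer_lipschitz_le) (use r T inj in auto)
  then have "ennreal (r ^ k) * hausdorff_outer k A \<le> ennreal (r ^ k) * (ennreal ((1 / r) ^ k) * hausdorff_outer k (T ` A))"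
    using inj by (intro mult_left_mono) (auto simp: image_image)
  also have "\<dots> = hausdorff_outer k (T ` A)"
    using r by (simp add: mult.assoc[symmetric] ennreal_mult[symmetric] power_mult_distrib[symmetric])
  finally show "ennreal (r ^ k) * hausdorff_outer k A \<le> hausdorff_outer k (T ` A)" .
qed

text \<open>The scaling factor \<open>r ^ k\<close> cancels in the quotient that normalizes the
  measure. This serves the latitudes, with factor sqrt(1 - \<alpha>^2), and the rotations, with
  factor 1.\<close>

lemma uniform_measure_hausdorff_similarity:
  fixes T :: "'a::euclidean_space \<Rightarrow> 'b::euclidean_space"
  assumes r: "0 < r" and T: "\<And>x y. dist (T x) (T y) = r * dist x y"
    and A: "compact A"
  shows "uniform_measure (hausdorff k) (T ` A) = distr (uniform_measure (hausdorff k) A) borel T"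
proof (rule measure_eqI)
  have "r-lipschitz_on UNIV T" using r T by (auto intro!: lipschitz_onI)
  then have cont: "continuous_on UNIV T" by (rule lipschitz_on_continuous_on)
  then have meas[measurable]: "T \<in> borel_measurable borel" by (rule borel_measurable_continuous_onI)
  have TA: "T ` A \<in> sets borel"
    using A cont by (meson borel_compact compact_continuous_image continuous_on_subset subset_UNIV)
  have A': "A \<in> sets borel" using A by (rule borel_compact)
  fix B assume "B \<in> sets (uniform_measure (hausdorff k) (T ` A))"
  then have B: "B \<in> sets borel" by simp
  have TB: "T -` B \<in> sets borel" using measurable_sets[OF meas B] by simp
  have *: "T ` A \<inter> B = T ` (A \<inter> T -` B)" by auto
  have "emeasure (uniform_measure (hausdorff k) (T ` A)) B = hausdorff_outer k (T ` A \<inter> B) / hausdorff_outer k (T ` A)"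
    using TA B by (subst emeasure_uniform_measure) (auto simp: emeasure_hausdorff)
  also have "\<dots> = (ennreal (r ^ k) * hausdorff_outer k (A \<inter> T -` B)) / (ennreal (r ^ k) * hausdorff_outer k A)"
    unfolding * by (simp add: hausdorff_outer_similarity[OF r T])
  also have "\<dots> = hausdorff_outer k (A \<inter> T -` B) / hausdorff_outer k A"
    using r by (simp add: mult.commute[of "ennreal _"] divide_mult_eq)
  also have "\<dots> = emeasure (uniform_measure (hausdorff k) A) (T -` B)"
    using A' TB by (subst emeasure_uniform_measure) (auto simp: emeasure_hausdorff)
  also have "\<dots> = emeasure (distr (uniform_measure (hausdorff k) A) borel T) B"
    using B by (subst emeasure_distr) auto
  finally show "emeasure (uniform_measure (hausdorff k) (T ` A)) B = emeasure (distr (uniform_measure (hausdorff k) A) borel T) B" .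
qed simp

lemma integral_uniform_measure:
  fixes f :: "'a \<Rightarrow> real"
  assumes X: "emeasure M X \<noteq> 0" "emeasure M X \<noteq> \<infinity>" and f[measurable]: "f \<in> borel_measurable M"
  shows "(\<integral>x. f x \<partial>uniform_measure M X) = (LINT x:X|M. f x) / measure M X"
proof -
  have [measurable]: "X \<in> sets M" using X(1) by (rule emeasure_neq_0_sets)
  have m: "0 < measure M X" using X by (simp add: measure_def enn2real_positive_iff less_top zero_less_iff_neq_zero)
  have "uniform_measure M X = density M (\<lambda>x. ennreal (indicator X x / measure M X))"
    unfolding uniform_measure_def using X m
    by (intro arg_cong[where f="density M"] ext)
      (use divide_ennreal[of 1 "measure M X"] in \<open>auto simp: indicator_def emeasure_eq_ennreal_measure\<close>)
  then have "(\<integral>x. f x \<partial>uniform_measure M X) = (\<integral>x. (indicator X x / measure M X) *\<^sub>R f x \<partial>M)"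
    using m by (simp add: integral_density)
  also have "\<dots> = (\<integral>x. (indicator X x *\<^sub>R f x) / measure M X \<partial>M)"
    by simp
  also have "\<dots> = (LINT x:X|M. f x) / measure M X"
    unfolding set_lebesgue_integral_def by (rule integral_divide_zero)
  finally show ?thesis .
qed

definition latitude :: "'a::euclidean_space \<Rightarrow> real \<Rightarrow> 'a set" where
  "latitude s \<alpha> = {r \<in> usphere. r \<bullet> s = \<alpha>}"

text \<open>Parametrizes every latitude from the equator of one fixed \<open>b\<close>. Thus
  \<open>Rbar g s \<alpha>\<close> becomes an integral over a fixed probability space in which s and
  \<alpha> are mere parameters.\<close>

definition latitude_point :: "'a::euclidean_space \<Rightarrow> 'a \<Rightarrow> real \<Rightarrow> 'a \<Rightarrow> 'a" where
  "latitude_point b s \<alpha> u = \<alpha> *\<^sub>R s + sqrt (1 - \<alpha>\<^sup>2) *\<^sub>R carry b s u"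

lemma compact_latitude: "compact (latitude s \<alpha>)"
proof -
  have "latitude s \<alpha> = usphere \<inter> {r. r \<bullet> s = \<alpha>}" by (auto simp: latitude_def)
  moreover have "closed {r. r \<bullet> s = \<alpha>}" by (intro closed_Collect_eq continuous_intros)
  ultimately show ?thesis by (simp add: compact_Int_closed)
qed

lemma equator_eq_latitude: "equator s = latitude s 0"
  by (simp add: equator_def latitude_def)

lemma compact_equator: "compact (equator s)"
  by (simp add: equator_eq_latitude compact_latitude)

lemma carry_inner_pole:
  assumes "b \<in> usphere" "s \<in> usphere"
  shows "carry b s u \<bullet> s = u \<bullet> b"
  using inner_carry[of b s u b] carry_self[of b s] assms by simp

lemma sqrt_one_minus_square:
  fixes \<alpha> :: real
  assumes "\<alpha> \<in> {-1..1}"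
  shows "sqrt (1 - \<alpha>\<^sup>2) * sqrt (1 - \<alpha>\<^sup>2) = 1 - \<alpha>\<^sup>2"
proof -
  have "\<alpha>\<^sup>2 \<le> 1" using assms by (simp add: abs_square_le_1 abs_le_iff)
  then show ?thesis by simp
qed

lemma latitude_combination:
  assumes "s \<in> usphere" "v \<in> equator s" "\<alpha> \<in> {-1..1}"
  shows "\<alpha> *\<^sub>R s + sqrt (1 - \<alpha>\<^sup>2) *\<^sub>R v \<in> latitude s \<alpha>"
proof -
  have 1: "s \<bullet> s = 1" "v \<bullet> v = 1" "v \<bullet> s = 0" "s \<bullet> v = 0"
    using assms by (auto simp: equator_def norm_eq_1 inner_commute)
  have "(\<alpha> *\<^sub>R s + sqrt (1 - \<alpha>\<^sup>2) *\<^sub>R v) \<bullet> (\<alpha> *\<^sub>R s + sqrt (1 - \<alpha>\<^sup>2) *\<^sub>R v) = 1"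
    using sqrt_one_minus_square[OF assms(3)]
    by (simp add: inner_add_left inner_add_right 1 power2_eq_square)
  then show ?thesis by (auto simp: latitude_def norm_eq_1 inner_add_left 1)
qed

lemma carry_equator:
  assumes "b \<in> usphere" "s \<in> usphere"
  shows "carry b s ` equator b = equator s"
proof
  show "carry b s ` equator b \<subseteq> equator s"
    using carry_inner_pole[OF assms] by (auto simp: equator_def)
  show "equator s \<subseteq> carry b s ` equator b"
  proof
    fix v assume v: "v \<in> equator s"
    have "carry b s v \<in> equator b"
      using carry_inner_pole[OF assms, of "carry b s v"] v by (auto simp: equator_def)
    then show "v \<in> carry b s ` equator b" by (metis carry_carry imageI)
  qed
qed

lemma latitude_point_image:
  assumes bs: "b \<in> usphere" "s \<in> usphere" and \<alpha>: "\<bar>\<alpha>\<bar> < 1"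
  shows "latitude_point b s \<alpha> ` equator b = latitude s \<alpha>"
proof
  have \<alpha>': "\<alpha> \<in> {-1..1}" using \<alpha> by auto
  show "latitude_point b s \<alpha> ` equator b \<subseteq> latitude s \<alpha>"
    using latitude_combination[OF bs(2) _ \<alpha>'] carry_equator[OF bs] by (auto simp: latitude_point_def)
  show "latitude s \<alpha> \<subseteq> latitude_point b s \<alpha> ` equator b"
  proof
    fix r assume r: "r \<in> latitude s \<alpha>"
    have pos: "0 < sqrt (1 - \<alpha>\<^sup>2)" using \<alpha> by (simp add: abs_square_less_1)
    define v where "v = (r - \<alpha> *\<^sub>R s) /\<^sub>R sqrt (1 - \<alpha>\<^sup>2)"
    have 1: "s \<bullet> s = 1" "r \<bullet> r = 1" "r \<bullet> s = \<alpha>" "s \<bullet> r = \<alpha>"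
      using r bs by (auto simp: latitude_def norm_eq_1 inner_commute)
    have "(r - \<alpha> *\<^sub>R s) \<bullet> (r - \<alpha> *\<^sub>R s) = 1 - \<alpha>\<^sup>2"
      by (simp add: inner_diff_left inner_diff_right 1 power2_eq_square)
    then have "v \<bullet> v = 1"
      using pos sqrt_one_minus_square[OF \<alpha>'] unfolding v_def
      by (simp only: inner_scaleR_left inner_scaleR_right) (simp add: field_simps)
    moreover have "v \<bullet> s = 0" by (simp add: v_def inner_diff_left 1)
    ultimately have "v \<in> equator s" by (simp add: equator_def norm_eq_1)
    then obtain u where u: "u \<in> equator b" "v = carry b s u" using carry_equator[OF bs] by blast
    have "r = latitude_point b s \<alpha> u"
      unfolding latitude_point_def u(2)[symmetric] using pos by (simp add: v_def)
    then show "r \<in> latitude_point b s \<alpha> ` equator b" using u by blast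
  qed
qed

lemma dist_latitude_point:
  assumes "\<bar>\<alpha>\<bar> < 1"
  shows "dist (latitude_point b s \<alpha> u) (latitude_point b s \<alpha> v) = sqrt (1 - \<alpha>\<^sup>2) * dist u v"
proof -
  have "latitude_point b s \<alpha> u - latitude_point b s \<alpha> v = sqrt (1 - \<alpha>\<^sup>2) *\<^sub>R carry b s (u - v)"
    by (simp add: latitude_point_def linear_diff[OF linear_carry] scaleR_diff_right)
  moreover have "0 \<le> sqrt (1 - \<alpha>\<^sup>2)" using assms by (simp add: abs_square_less_1 less_imp_le)
  ultimately show ?thesis by (simp add: dist_norm)
qed

lemma hausdorff_latitude:
  assumes dim: "2 \<le> DIM('a)" and s: "s \<in> usphere" and \<alpha>: "\<bar>\<alpha>\<bar> < 1"
  shows "emeasure (hausdorff (DIM('a) - 2)) (latitude (s::'a::euclidean_space) \<alpha>) \<noteq> 0"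
    "emeasure (hausdorff (DIM('a) - 2)) (latitude (s::'a::euclidean_space) \<alpha>) \<noteq> \<infinity>"
proof -
  obtain b :: 'a where b: "b \<in> Basis" using SOME_Basis by blast
  then have b': "b \<in> usphere" by simp
  have pos: "0 < sqrt (1 - \<alpha>\<^sup>2)" using \<alpha> by (simp add: abs_square_less_1)
  have "emeasure (hausdorff (DIM('a) - 2)) (latitude s \<alpha>) = ennreal (sqrt (1 - \<alpha>\<^sup>2) ^ (DIM('a) - 2)) * hausdorff_outer (DIM('a) - 2) (equator b)"
    using hausdorff_outer_similarity[OF pos dist_latitude_point[OF \<alpha>, of b s], of "DIM('a) - 2" "equator b"]
    by (simp add: latitude_point_image[OF b' s \<alpha>] emeasure_hausdorff borel_compact compact_latitude)
  then show "emeasure (hausdorff (DIM('a) - 2)) (latitude s \<alpha>) \<noteq> 0"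
    "emeasure (hausdorff (DIM('a) - 2)) (latitude s \<alpha>) \<noteq> \<infinity>"
    using hausdorff_equator_Basis[OF dim b] zero_less_power[OF pos, of "DIM('a) - 2"]
    by (auto simp: ennreal_mult_eq_top_iff ennreal_eq_0_iff simp del: zero_less_power_eq)
qed

section \<open>Uniform laws on the sphere and on equators\<close>

definition equator_prob :: "'a::euclidean_space \<Rightarrow> 'a measure" where
  "equator_prob b = uniform_measure (hausdorff (DIM('a) - 2)) (equator b)"

definition sphere_prob :: "'a::euclidean_space measure" where
  "sphere_prob = uniform_measure (hausdorff (DIM('a) - 1)) usphere"

lemma sets_equator_prob [simp, measurable_cong]: "sets (equator_prob b) = sets borel"
  by (simp add: equator_prob_def)

lemma sets_sphere_prob [simp, measurable_cong]: "sets sphere_prob = sets borel"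
  by (simp add: sphere_prob_def)

lemma space_equator_prob [simp]: "space (equator_prob b) = UNIV"
  by (simp add: equator_prob_def)

lemma space_sphere_prob [simp]: "space sphere_prob = UNIV"
  by (simp add: sphere_prob_def)

lemma emeasure_hausdorff_usphere:
  "emeasure (hausdorff (DIM('a) - 1)) (usphere :: 'a::euclidean_space set) \<noteq> 0"
  "emeasure (hausdorff (DIM('a) - 1)) (usphere :: 'a::euclidean_space set) \<noteq> \<infinity>"
  using hausdorff_usphere_pos[where 'a='a] hausdorff_usphere_finite[where 'a='a]
  by (simp_all add: emeasure_hausdorff)

lemma prob_space_sphere_prob: "prob_space (sphere_prob :: 'a::euclidean_space measure)"
  unfolding sphere_prob_def by (rule prob_space_uniform_measure) (rule emeasure_hausdorff_usphere)+

lemma AE_sphere_prob: "AE x in sphere_prob. x \<in> usphere"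
  unfolding sphere_prob_def by (rule AE_uniform_measureI) auto

lemma prob_space_equator_prob:
  assumes "2 \<le> DIM('a)" "b \<in> usphere"
  shows "prob_space (equator_prob (b::'a::euclidean_space))"
  unfolding equator_prob_def equator_eq_latitude
  by (rule prob_space_uniform_measure) (use hausdorff_latitude[OF assms, of 0] in auto)

lemma AE_equator_prob: "AE x in equator_prob b. x \<in> equator b"
  unfolding equator_prob_def
  by (rule AE_uniform_measureI) (auto simp: borel_compact compact_equator)

lemma Rbar_cong:
  assumes "\<And>x. x \<in> usphere \<Longrightarrow> g x = h x" "s \<in> usphere"
  shows "Rbar g s \<alpha> = Rbar h s \<alpha>"
proof -
  have "(\<lambda>x. indicator {r \<in> usphere. r \<bullet> s = \<alpha>} x *\<^sub>R g x) = (\<lambda>x. indicator {r \<in> usphere. r \<bullet> s = \<alpha>} x *\<^sub>R h x)"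
    using assms(1) by (auto simp: indicator_def)
  then show ?thesis using assms by (simp add: Rbar_def set_lebesgue_integral_def)
qed

lemma Rbar_latitude:
  fixes g :: "'a::euclidean_space \<Rightarrow> real"
  assumes "2 \<le> DIM('a)" "s \<in> usphere" "\<bar>\<alpha>\<bar> < 1" and [measurable]: "g \<in> borel_measurable borel"
  shows "Rbar g s \<alpha> = (\<integral>x. g x \<partial>uniform_measure (hausdorff (DIM('a) - 2)) (latitude s \<alpha>))"
  using assms(3) hausdorff_latitude[OF assms(1-3)]
  by (subst integral_uniform_measure) (auto simp: Rbar_def latitude_def)

lemma continuous_on_latitude_point: "continuous_on A (latitude_point b s \<alpha>)"
  unfolding latitude_point_def by (intro continuous_intros continuous_on_carry_right)

text \<open>For \<alpha> = 1 and \<alpha> = -1 the square root vanishes and the map is constantly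
  \<open>s\<close> or \<open>- s\<close>, so the same formula also yields the special values in the
  definition of \<open>Rbar\<close>. Continuity up to the poles then needs no separate
  argument.\<close>

lemma Rbar_equator:
  fixes g :: "'a::euclidean_space \<Rightarrow> real"
  assumes dim: "2 \<le> DIM('a)" and b: "b \<in> usphere" and s: "s \<in> usphere" and \<alpha>: "\<alpha> \<in> {-1..1}"
    and g[measurable]: "g \<in> borel_measurable borel"
  shows "Rbar g s \<alpha> = (\<integral>u. g (latitude_point b s \<alpha> u) \<partial>equator_prob b)"
proof (cases "\<bar>\<alpha>\<bar> < 1")
  case True
  have pos: "0 < sqrt (1 - \<alpha>\<^sup>2)" using True by (simp add: abs_square_less_1)
  have [measurable]: "latitude_point b s \<alpha> \<in> borel_measurable borel"
    by (rule borel_measurable_continuous_onI) (rule continuous_on_latitude_point)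
  have "uniform_measure (hausdorff (DIM('a) - 2)) (latitude s \<alpha>) = distr (equator_prob b) borel (latitude_point b s \<alpha>)"
    unfolding latitude_point_image[OF b s True, symmetric] equator_prob_def
    by (rule uniform_measure_hausdorff_similarity[OF pos dist_latitude_point[OF True] compact_equator])
  then show ?thesis
    unfolding Rbar_latitude[OF dim s True g] by (simp add: integral_distr)
next
  case False
  interpret prob_space "equator_prob b" by (rule prob_space_equator_prob[OF dim b])
  have "\<alpha> = 1 \<or> \<alpha> = -1" using False \<alpha> by auto
  then show ?thesis by (auto simp: Rbar_def latitude_point_def prob_space[simplified])
qed

lemma Rbar_rotate:
  fixes g :: "'a::euclidean_space \<Rightarrow> real" and \<phi> :: "'a \<Rightarrow> 'a"
  assumes dim: "2 \<le> DIM('a)" and \<phi>: "orthogonal_transformation \<phi>" and s: "s \<in> usphere" and \<alpha>: "\<alpha> \<in> {-1..1}"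
    and g[measurable]: "g \<in> borel_measurable borel"
  shows "Rbar (\<lambda>x. g (\<phi> x)) s \<alpha> = Rbar g (\<phi> s) \<alpha>"
proof (cases "\<bar>\<alpha>\<bar> < 1")
  case True
  have lin: "linear \<phi>" and n: "\<And>x. norm (\<phi> x) = norm x" and i: "\<And>x y. \<phi> x \<bullet> \<phi> y = x \<bullet> y"
    using \<phi> by (auto simp: orthogonal_transformation_def orthogonal_transformation_norm[OF \<phi>])
  have [measurable]: "\<phi> \<in> borel_measurable borel"
    using lin by (simp add: borel_measurable_continuous_onI linear_continuous_on linear_linear)
  have im: "\<phi> ` latitude s \<alpha> = latitude (\<phi> s) \<alpha>"
  proof
    show "\<phi> ` latitude s \<alpha> \<subseteq> latitude (\<phi> s) \<alpha>" by (auto simp: latitude_def n i)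
    show "latitude (\<phi> s) \<alpha> \<subseteq> \<phi> ` latitude s \<alpha>"
    proof
      fix r assume r: "r \<in> latitude (\<phi> s) \<alpha>"
      obtain x where "r = \<phi> x" using orthogonal_transformation_surj[OF \<phi>] by (metis surjD)
      then show "r \<in> \<phi> ` latitude s \<alpha>" using r by (auto simp: latitude_def n i)
    qed
  qed
  have "uniform_measure (hausdorff (DIM('a) - 2)) (latitude (\<phi> s) \<alpha>)
     = distr (uniform_measure (hausdorff (DIM('a) - 2)) (latitude s \<alpha>)) borel \<phi>"
    unfolding im[symmetric]
    by (rule uniform_measure_hausdorff_similarity[OF zero_less_one _ compact_latitude])
      (simp add: dist_norm linear_diff[OF lin, symmetric] n)
  moreover have "\<phi> s \<in> usphere" using s n by simp
  ultimately show ?thesis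
    by (subst (1 2) Rbar_latitude[OF dim _ True]) (use s in \<open>auto simp: integral_distr\<close>)
next
  case False
  then have "\<alpha> = 1 \<or> \<alpha> = -1" using \<alpha> by auto
  moreover have "\<phi> (- s) = - \<phi> s" using \<phi> by (simp add: orthogonal_transformation_def linear_neg)
  ultimately show ?thesis by (auto simp: Rbar_def)
qed

lemma latitude_point_usphere:
  assumes "b \<in> usphere" "s \<in> usphere" "\<alpha> \<in> {-1..1}" "u \<in> equator b"
  shows "latitude_point b s \<alpha> u \<in> usphere"
  using latitude_combination[OF assms(2) _ assms(3), of "carry b s u"] carry_equator[OF assms(1,2)] assms(4)
  by (auto simp: latitude_point_def latitude_def)

text \<open>The parametrization in \<open>Rbar_equator\<close> depends continuously on the pole away
  from the antipode of the base point. The base point is therefore chosen to be the limit point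
  \<open>s\<close> itself, and dominated convergence along the sequence applies.\<close>

lemma continuous_on_Rbar:
  fixes g :: "'a::euclidean_space \<Rightarrow> real"
  assumes dim: "2 \<le> DIM('a)" and g: "continuous_on UNIV g"
  shows "continuous_on (usphere \<times> {-1..1}) (\<lambda>(s, \<alpha>). Rbar g s \<alpha>)"
  unfolding continuous_on_sequentially
proof (intro allI ballI impI)
  fix x :: "nat \<Rightarrow> 'a \<times> real" and p :: "'a \<times> real"
  assume p: "p \<in> usphere \<times> {-1..1}" and "(\<forall>n. x n \<in> usphere \<times> {-1..1}) \<and> x \<longlonglongrightarrow> p"
  then have x: "\<And>n. x n \<in> usphere \<times> {-1..1}" and lim: "x \<longlonglongrightarrow> p" by auto
  have gm[measurable]: "g \<in> borel_measurable borel" using g by (rule borel_measurable_continuous_onI)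
  define s where "s = fst p" define \<alpha> where "\<alpha> = snd p"
  have s: "s \<in> usphere" and \<alpha>: "\<alpha> \<in> {-1..1}" using p by (auto simp: s_def \<alpha>_def mem_Times_iff)
  have xs: "fst (x n) \<in> usphere" "snd (x n) \<in> {-1..1}" for n using x[of n] by (auto simp: mem_Times_iff)
  have ls: "(\<lambda>n. fst (x n)) \<longlonglongrightarrow> s" and la: "(\<lambda>n. snd (x n)) \<longlonglongrightarrow> \<alpha>"
    unfolding s_def \<alpha>_def by (intro tendsto_fst tendsto_snd lim)+
  interpret prob_space "equator_prob s" by (rule prob_space_equator_prob[OF dim s])
  have [measurable]: "latitude_point b c a \<in> borel_measurable borel" for b c :: 'a and a
    by (rule borel_measurable_continuous_onI) (rule continuous_on_latitude_point)
  have "compact (g ` usphere)" by (intro compact_continuous_image continuous_on_subset[OF g]) auto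
  then obtain B where B: "\<And>y. y \<in> usphere \<Longrightarrow> \<bar>g y\<bar> \<le> B"
    using compact_imp_bounded bounded_iff by (metis imageI real_norm_def)
  have nz: "s + s \<noteq> 0" using s by (auto simp flip: scaleR_2)
  have "(\<lambda>n. \<integral>u. g (latitude_point s (fst (x n)) (snd (x n)) u) \<partial>equator_prob s) \<longlonglongrightarrow> (\<integral>u. g (latitude_point s s \<alpha> u) \<partial>equator_prob s)"
  proof (rule integral_dominated_convergence[where w="\<lambda>_. B"])
    have "(\<lambda>n. g (latitude_point s (fst (x n)) (snd (x n)) u)) \<longlonglongrightarrow> g (latitude_point s s \<alpha> u)" for u
    proof (rule isCont_tendsto_compose[of _ g])
      show "isCont g (latitude_point s s \<alpha> u)" using g by (simp add: continuous_on_eq_continuous_at)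
      show "(\<lambda>n. latitude_point s (fst (x n)) (snd (x n)) u) \<longlonglongrightarrow> latitude_point s s \<alpha> u"
        unfolding latitude_point_def carry_def using nz
        by (intro tendsto_intros ls la) auto
    qed
    then show "AE u in equator_prob s. (\<lambda>n. g (latitude_point s (fst (x n)) (snd (x n)) u)) \<longlonglongrightarrow> g (latitude_point s s \<alpha> u)"
      by auto
    show "AE u in equator_prob s. norm (g (latitude_point s (fst (x n)) (snd (x n)) u)) \<le> B" for n
      using AE_equator_prob by eventually_elim (use B[OF latitude_point_usphere[OF s xs]] in auto)
  qed auto
  then show "((\<lambda>(s, \<alpha>). Rbar g s \<alpha>) \<circ> x) \<longlonglongrightarrow> (\<lambda>(s, \<alpha>). Rbar g s \<alpha>) p"
    using Rbar_equator[OF dim s xs gm] Rbar_equator[OF dim s s \<alpha> gm]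
    by (simp add: case_prod_beta o_def s_def \<alpha>_def)
qed

section \<open>Averaging over orthonormal pairs\<close>

lemma continuous_on_integral_parameter:
  fixes G :: "'a::heine_borel \<Rightarrow> 'b::metric_space \<Rightarrow> real"
  assumes G: "continuous_on UNIV (\<lambda>(x, y). G x y)" and T: "prob_space T" "sets T = sets borel"
    and K: "compact K" "AE y in T. y \<in> K"
  shows "continuous_on UNIV (\<lambda>x. \<integral>y. G x y \<partial>T)"
  unfolding continuous_on_sequentially
proof (intro allI ballI impI)
  fix X :: "nat \<Rightarrow> 'a" and x assume "(\<forall>n. X n \<in> UNIV) \<and> X \<longlonglongrightarrow> x"
  then have X: "X \<longlonglongrightarrow> x" by simp
  note [measurable_cong] = T(2)
  interpret prob_space T by fact
  have Gc: "continuous_on A (\<lambda>z. G (fst z) (snd z))" for A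
    using continuous_on_subset[OF G, of A] by (simp add: case_prod_beta)
  have meas: "G z \<in> borel_measurable borel" for z
    by (rule borel_measurable_continuous_onI)
      (rule continuous_on_compose2[OF Gc[of UNIV], of _ "\<lambda>y. (z, y)", simplified], intro continuous_intros)
  have meas': "G z \<in> borel_measurable T" for z using meas[of z] T(2) by (simp cong: measurable_cong_sets)
  have "compact (insert x (range X) \<times> K)" by (intro compact_Times compact_sequence_with_limit X K)
  then have "compact ((\<lambda>z. G (fst z) (snd z)) ` (insert x (range X) \<times> K))"
    by (intro compact_continuous_image Gc)
  then obtain B where B0: "\<And>w. w \<in> (\<lambda>z. G (fst z) (snd z)) ` (insert x (range X) \<times> K) \<Longrightarrow> norm w \<le> B"
    using compact_imp_bounded bounded_iff by metis
  have B: "\<bar>G z y\<bar> \<le> B" if "z \<in> insert x (range X)" "y \<in> K" for z y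
    using B0[OF imageI, of "(z, y)"] that by simp
  have "(\<lambda>n. \<integral>y. G (X n) y \<partial>T) \<longlonglongrightarrow> (\<integral>y. G x y \<partial>T)"
  proof (rule integral_dominated_convergence[where w="\<lambda>_. B"])
    have "(\<lambda>n. G (X n) y) \<longlonglongrightarrow> G x y" for y
    proof -
      have "(\<lambda>n. (\<lambda>z. G (fst z) (snd z)) (X n, y)) \<longlonglongrightarrow> (\<lambda>z. G (fst z) (snd z)) (x, y)"
        by (rule continuous_on_tendsto_compose[OF Gc[of UNIV]]) (auto intro!: tendsto_intros X)
      then show ?thesis by simp
    qed
    then show "AE y in T. (\<lambda>n. G (X n) y) \<longlonglongrightarrow> G x y" by auto
    show "AE y in T. norm (G (X n) y) \<le> B" for n
      using K(2) by eventually_elim (use B in auto)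
  qed (use meas' in auto)
  then show "((\<lambda>x. \<integral>y. G x y \<partial>T) \<circ> X) \<longlonglongrightarrow> (\<integral>y. G x y \<partial>T)" by (simp add: o_def)
qed

section \<open>Rotations and the law of a random orthonormal pair\<close>

lemma orthogonal_transformation_usphere_image:
  fixes \<phi> :: "'a::euclidean_space \<Rightarrow> 'a"
  assumes "orthogonal_transformation \<phi>"
  shows "\<phi> ` usphere = usphere"
proof
  show "\<phi> ` usphere \<subseteq> usphere" using orthogonal_transformation_norm[OF assms] by auto
  show "usphere \<subseteq> \<phi> ` usphere"
  proof
    fix y :: 'a assume y: "y \<in> usphere"
    obtain x where "y = \<phi> x" using orthogonal_transformation_surj[OF assms] by (metis surjD)
    then show "y \<in> \<phi> ` usphere" using y orthogonal_transformation_norm[OF assms] by auto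
  qed
qed

lemma orthogonal_transformation_borel_measurable:
  fixes \<phi> :: "'a::euclidean_space \<Rightarrow> 'a"
  assumes "orthogonal_transformation \<phi>"
  shows "\<phi> \<in> borel_measurable borel"
  using assms by (simp add: orthogonal_transformation_def borel_measurable_continuous_onI linear_continuous_on linear_linear)

lemma orthogonal_transformation_dist:
  "orthogonal_transformation \<phi> \<Longrightarrow> dist (\<phi> x) (\<phi> y) = dist x y"
  by (metis dist_norm linear_diff orthogonal_transformation_def orthogonal_transformation_norm)

lemma sphere_prob_rotate:
  fixes \<phi> :: "'a::euclidean_space \<Rightarrow> 'a"
  assumes \<phi>: "orthogonal_transformation \<phi>"
  shows "distr sphere_prob borel \<phi> = sphere_prob"
  unfolding sphere_prob_def
  by (subst uniform_measure_hausdorff_similarity[OF zero_less_one, symmetric])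
    (use orthogonal_transformation_dist[OF \<phi>] orthogonal_transformation_usphere_image[OF \<phi>] in auto)

text \<open>For a unit vector \<open>b\<close> this is the law of a random orthonormal pair: s is
  uniform on the sphere and, given s, the second vector is uniform on the equator of s. The equator
  of \<open>b\<close> is only the fixed model that \<open>carry\<close> moves to the equator of
  s.\<close>

definition frame_law :: "'a::euclidean_space \<Rightarrow> ('a \<times> 'a) measure" where
  "frame_law b = distr (sphere_prob \<Otimes>\<^sub>M equator_prob b) borel (\<lambda>(s, u). (s, carry b s u))"

definition frames :: "('a::euclidean_space \<times> 'a) set" where
  "frames = {(s, v). s \<in> usphere \<and> v \<in> equator s}"

text \<open>For \<alpha> in [-1,1] it maps \<open>frames\<close> onto the pairs of unit vectors with
  inner product \<alpha>, which form one orbit of the diagonal action of O(n).\<close>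

definition frame_point :: "real \<Rightarrow> 'a::euclidean_space \<times> 'a \<Rightarrow> 'a \<times> 'a" where
  "frame_point \<alpha> y = (fst y, \<alpha> *\<^sub>R fst y + sqrt (1 - \<alpha>\<^sup>2) *\<^sub>R snd y)"

definition frame_average :: "'a::euclidean_space \<Rightarrow> ('a \<times> 'a \<Rightarrow> real) \<Rightarrow> real \<Rightarrow> real" where
  "frame_average b F \<alpha> = (\<integral>y. F (frame_point \<alpha> y) \<partial>frame_law b)"

lemma sets_frame_law [simp, measurable_cong]: "sets (frame_law b) = sets borel"
  by (simp add: frame_law_def)

lemma frames_subset: "frames \<subseteq> usphere \<times> usphere"
  by (auto simp: frames_def equator_def)

lemma continuous_on_frame_point [continuous_intros]:
  assumes "continuous_on A f" "continuous_on A g"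
  shows "continuous_on A (\<lambda>x. frame_point (f x) (g x))"
  unfolding frame_point_def by (intro continuous_intros assms)

lemma frame_point_mem:
  assumes "y \<in> frames" "\<alpha> \<in> {-1..1}"
  shows "frame_point \<alpha> y \<in> usphere \<times> usphere" "fst (frame_point \<alpha> y) \<bullet> snd (frame_point \<alpha> y) = \<alpha>"
proof -
  have "snd (frame_point \<alpha> y) \<in> latitude (fst y) \<alpha>" "fst y \<in> usphere"
    using assms latitude_combination[of "fst y" "snd y" \<alpha>] by (auto simp: frames_def frame_point_def)
  then show "frame_point \<alpha> y \<in> usphere \<times> usphere" "fst (frame_point \<alpha> y) \<bullet> snd (frame_point \<alpha> y) = \<alpha>"
    by (auto simp: latitude_def frame_point_def inner_commute)
qed

lemma frame_point_orthogonal: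
  assumes "orthogonal_transformation \<phi>"
  shows "map_prod \<phi> \<phi> (frame_point \<alpha> y) = frame_point \<alpha> (map_prod \<phi> \<phi> y)"
proof -
  have "linear \<phi>" using assms by (simp add: orthogonal_transformation_def)
  then show ?thesis by (simp add: frame_point_def map_prod_def case_prod_beta linear_add linear_scale)
qed

lemma frame_law_AE_measurable:
  fixes b :: "'a::euclidean_space"
  assumes dim: "2 \<le> DIM('a)" and b: "b \<in> usphere"
  shows "AE y in (sphere_prob :: 'a measure) \<Otimes>\<^sub>M equator_prob b. fst y \<in> usphere \<and> snd y \<in> equator b"
    and "pair_sigma_finite (sphere_prob :: 'a measure) (equator_prob b)"
    and "prob_space ((sphere_prob :: 'a measure) \<Otimes>\<^sub>M equator_prob b)"
    and "(\<lambda>(s, u). (s, carry b s u)) \<in> measurable ((sphere_prob :: 'a measure) \<Otimes>\<^sub>M equator_prob b) borel"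
proof -
  interpret S: prob_space "sphere_prob :: 'a measure" by (rule prob_space_sphere_prob)
  interpret E: prob_space "equator_prob b" by (rule prob_space_equator_prob[OF assms])
  interpret P: pair_prob_space "sphere_prob :: 'a measure" "equator_prob b" ..
  show "pair_sigma_finite (sphere_prob :: 'a measure) (equator_prob b)" ..
  show "prob_space ((sphere_prob :: 'a measure) \<Otimes>\<^sub>M equator_prob b)" by (rule P.prob_space_axioms)
  have [measurable]: "equator b \<in> sets borel" by (rule borel_compact) (rule compact_equator)
  show "AE y in (sphere_prob :: 'a measure) \<Otimes>\<^sub>M equator_prob b. fst y \<in> usphere \<and> snd y \<in> equator b"
  proof (rule P.AE_pair_measure)
    show "AE s in (sphere_prob :: 'a measure). AE u in equator_prob b. fst (s, u) \<in> usphere \<and> snd (s, u) \<in> equator b"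
      using AE_sphere_prob
    proof eventually_elim
      case (elim s)
      show ?case using AE_equator_prob by eventually_elim (use elim in auto)
    qed
    have "usphere \<times> equator b \<in> sets ((sphere_prob :: 'a measure) \<Otimes>\<^sub>M equator_prob b)"
      by (intro pair_measureI) auto
    also have "usphere \<times> equator b = {y \<in> space ((sphere_prob :: 'a measure) \<Otimes>\<^sub>M equator_prob b). fst y \<in> usphere \<and> snd y \<in> equator b}"
      by (auto simp: space_pair_measure)
    finally show "{y \<in> space ((sphere_prob :: 'a measure) \<Otimes>\<^sub>M equator_prob b). fst y \<in> usphere \<and> snd y \<in> equator b}
        \<in> sets ((sphere_prob :: 'a measure) \<Otimes>\<^sub>M equator_prob b)" .
  qed
  show "(\<lambda>(s, u). (s, carry b s u)) \<in> measurable ((sphere_prob :: 'a measure) \<Otimes>\<^sub>M equator_prob b) borel"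
    unfolding borel_prod[symmetric] by measurable
qed

lemma prob_space_frame_law:
  fixes b :: "'a::euclidean_space"
  assumes dim: "2 \<le> DIM('a)" and b: "b \<in> usphere"
  shows "prob_space (frame_law b)"
  unfolding frame_law_def
  by (rule prob_space.prob_space_distr[OF frame_law_AE_measurable(3,4)[OF assms]])

lemma compact_frames: "compact (frames :: ('a::euclidean_space \<times> 'a) set)"
proof -
  have eq: "(frames :: ('a \<times> 'a) set) = (usphere \<times> usphere) \<inter> {y. snd y \<bullet> fst y = 0}"
    by (auto simp: frames_def equator_def)
  show ?thesis unfolding eq
    by (intro compact_Int_closed compact_Times compact_sphere closed_Collect_eq continuous_intros)
qed

lemma AE_frame_law:
  fixes b :: "'a::euclidean_space"
  assumes dim: "2 \<le> DIM('a)" and b: "b \<in> usphere"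
  shows "AE y in frame_law b. y \<in> frames"
proof -
  have m: "(frames :: ('a \<times> 'a) set) \<in> sets (borel :: ('a \<times> 'a) measure)" by (rule borel_compact) (rule compact_frames)
  show ?thesis
    unfolding frame_law_def
  proof (subst AE_distr_iff[OF frame_law_AE_measurable(4)[OF assms]])
    show "{x \<in> space borel. x \<in> (frames :: ('a \<times> 'a) set)} \<in> sets borel" using m by simp
    show "AE x in sphere_prob \<Otimes>\<^sub>M equator_prob b. (case x of (s, u) \<Rightarrow> (s, carry b s u)) \<in> frames"
      using frame_law_AE_measurable(1)[OF assms]
    proof eventually_elim
      case (elim x)
      then show ?case using carry_equator[OF b, of "fst x"] by (auto simp: frames_def case_prod_beta)
    qed
  qed
qed

lemma continuous_usphere_bounded:
  fixes H :: "'a::euclidean_space \<times> 'a \<Rightarrow> real"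
  assumes "continuous_on UNIV H"
  obtains B where "0 \<le> B" "\<And>x. x \<in> usphere \<times> usphere \<Longrightarrow> \<bar>H x\<bar> \<le> B"
proof -
  have "compact (H ` (usphere \<times> usphere))"
    by (intro compact_continuous_image continuous_on_subset[OF assms] compact_Times) auto
  then obtain B where "\<And>x. x \<in> usphere \<times> usphere \<Longrightarrow> \<bar>H x\<bar> \<le> B"
    unfolding compact_eq_bounded_closed bounded_iff by auto
  then show thesis using that[of "max B 0"] by (meson max.cobounded2 max.coboundedI1)
qed

text \<open>Integrating the second vector of the pair first produces \<open>Rbar\<close>, by Fubini.
  The indicator of the sphere is there for measurability, since \<open>Rbar\<close> is controlled
  for unit vectors only.\<close>

lemma frame_average_eq:
  fixes H :: "'a::euclidean_space \<times> 'a \<Rightarrow> real"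
  assumes dim: "2 \<le> DIM('a)" and b: "b \<in> usphere" and \<alpha>: "\<alpha> \<in> {-1..1}" and H: "continuous_on UNIV H"
  shows "frame_average b H \<alpha> = (\<integral>s. indicator usphere s * Rbar (\<lambda>r. H (s, r)) s \<alpha> \<partial>sphere_prob)"
    and "(\<lambda>s. indicator usphere s * Rbar (\<lambda>r. H (s, r)) s \<alpha>) \<in> borel_measurable borel"
proof -
  interpret S: prob_space "sphere_prob :: 'a measure" by (rule prob_space_sphere_prob)
  interpret E: prob_space "equator_prob b" by (rule prob_space_equator_prob[OF dim b])
  interpret P: pair_prob_space "sphere_prob :: 'a measure" "equator_prob b" ..
  have Hm[measurable]: "H \<in> borel_measurable (borel \<Otimes>\<^sub>M borel)"
    unfolding borel_prod using H by (rule borel_measurable_continuous_onI)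
  define h where "h = (\<lambda>(s, u). H (s, latitude_point b s \<alpha> u))"
  have hm[measurable]: "h \<in> borel_measurable (sphere_prob \<Otimes>\<^sub>M equator_prob b)"
    unfolding h_def latitude_point_def by measurable
  obtain B where B: "\<And>x. x \<in> usphere \<times> usphere \<Longrightarrow> \<bar>H x\<bar> \<le> B" using continuous_usphere_bounded[OF H] by metis
  have hB: "AE y in sphere_prob \<Otimes>\<^sub>M equator_prob b. norm (h y) \<le> B"
    using frame_law_AE_measurable(1)[OF dim b]
  proof eventually_elim
    case (elim y)
    then show ?case
      using latitude_point_usphere[OF b _ \<alpha>, of "fst y" "snd y"] by (auto simp: h_def case_prod_beta intro!: B)
  qed
  have int: "integrable (sphere_prob \<Otimes>\<^sub>M equator_prob b) h"
    by (rule P.integrable_const_bound[OF hB hm])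
  have gm: "(\<lambda>r. H (s, r)) \<in> borel_measurable borel" for s by measurable
  have Rb: "Rbar (\<lambda>r. H (s, r)) s \<alpha> = (\<integral>u. h (s, u) \<partial>equator_prob b)" if "s \<in> usphere" for s
    using Rbar_equator[OF dim b that \<alpha> gm] by (simp add: h_def)
  have eq: "(\<lambda>s. indicator usphere s * Rbar (\<lambda>r. H (s, r)) s \<alpha>) = (\<lambda>s. indicator usphere s * (\<integral>u. h (s, u) \<partial>equator_prob b))"
    using Rb by (auto simp: indicator_def)
  have hm': "(\<lambda>s. \<integral>u. h (s, u) \<partial>equator_prob b) \<in> borel_measurable borel"
  proof -
    have "(\<lambda>s. \<integral>u. h (s, u) \<partial>equator_prob b) \<in> borel_measurable sphere_prob"
      using E.borel_measurable_lebesgue_integral[of "\<lambda>s u. h (s, u)" "sphere_prob"] hm by (simp add: case_prod_beta')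
    then show ?thesis by (simp cong: measurable_cong_sets)
  qed
  show "(\<lambda>s. indicator usphere s * Rbar (\<lambda>r. H (s, r)) s \<alpha>) \<in> borel_measurable borel"
    unfolding eq by (intro borel_measurable_times borel_measurable_indicator hm') auto
  have "frame_average b H \<alpha> = (\<integral>y. h y \<partial>(sphere_prob \<Otimes>\<^sub>M equator_prob b))"
    unfolding frame_average_def frame_law_def
  proof (subst integral_distr[OF frame_law_AE_measurable(4)[OF dim b]])
    have "continuous_on UNIV (\<lambda>y. H (frame_point \<alpha> y))"
      by (rule continuous_on_compose2[OF H]) (auto intro!: continuous_intros)
    then show "(\<lambda>y. H (frame_point \<alpha> y)) \<in> borel_measurable borel" by (rule borel_measurable_continuous_onI)
  qed (simp add: h_def case_prod_unfold frame_point_def latitude_point_def)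
  also have "\<dots> = (\<integral>s. \<integral>u. h (s, u) \<partial>equator_prob b \<partial>sphere_prob)"
    by (rule P.integral_fst'[OF int, symmetric])
  also have "\<dots> = (\<integral>s. indicator usphere s * (\<integral>u. h (s, u) \<partial>equator_prob b) \<partial>sphere_prob)"
  proof (rule integral_cong_AE)
    show "AE s in sphere_prob. (\<integral>u. h (s, u) \<partial>equator_prob b) = indicator usphere s * (\<integral>u. h (s, u) \<partial>equator_prob b)"
      using AE_sphere_prob by eventually_elim auto
    have "(\<lambda>s. indicator usphere s * (\<integral>u. h (s, u) \<partial>equator_prob b)) \<in> borel_measurable borel"
      by (intro borel_measurable_times borel_measurable_indicator hm') auto
    then show "(\<lambda>s. indicator usphere s * (\<integral>u. h (s, u) \<partial>equator_prob b)) \<in> borel_measurable sphere_prob"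
      by (simp cong: measurable_cong_sets)
  qed (use hm' in \<open>simp cong: measurable_cong_sets\<close>)
  finally show "frame_average b H \<alpha> = (\<integral>s. indicator usphere s * Rbar (\<lambda>r. H (s, r)) s \<alpha> \<partial>sphere_prob)"
    unfolding eq .
qed

text \<open>Invariance is read off the formula with \<open>Rbar\<close>: the uniform law on the
  sphere is invariant and \<open>Rbar\<close> commutes with rotations. The frame law itself need not
  be shown to be invariant.\<close>

lemma frame_average_rotate:
  fixes H :: "'a::euclidean_space \<times> 'a \<Rightarrow> real"
  assumes dim: "2 \<le> DIM('a)" and b: "b \<in> usphere" and \<alpha>: "\<alpha> \<in> {-1..1}" and H: "continuous_on UNIV H"
    and \<phi>: "orthogonal_transformation \<phi>"
  shows "frame_average b (\<lambda>x. H (map_prod \<phi> \<phi> x)) \<alpha> = frame_average b H \<alpha>"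
proof -
  have lin: "linear \<phi>" using \<phi> by (simp add: orthogonal_transformation_def)
  have \<phi>c: "continuous_on A \<phi>" for A using lin by (simp add: linear_continuous_on linear_linear)
  note [measurable] = orthogonal_transformation_borel_measurable[OF \<phi>]
  have H\<phi>: "continuous_on UNIV (\<lambda>x. H (map_prod \<phi> \<phi> x))"
    unfolding map_prod_def case_prod_beta
    by (rule continuous_on_compose2[OF H]) (auto intro!: continuous_intros continuous_on_compose2[OF \<phi>c[of UNIV]])
  have gm: "(\<lambda>r. H (s, r)) \<in> borel_measurable borel" for s
    by (rule borel_measurable_continuous_onI) (rule continuous_on_compose2[OF H], auto intro!: continuous_intros)
  let ?k = "\<lambda>s. indicator usphere s * Rbar (\<lambda>r. H (s, r)) s \<alpha>"
  have "frame_average b (\<lambda>x. H (map_prod \<phi> \<phi> x)) \<alpha>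
      = (\<integral>s. indicator usphere s * Rbar (\<lambda>r. H (\<phi> s, \<phi> r)) s \<alpha> \<partial>sphere_prob)"
    by (subst frame_average_eq[OF dim b \<alpha> H\<phi>]) simp
  also have "\<dots> = (\<integral>s. ?k (\<phi> s) \<partial>sphere_prob)"
  proof (intro Bochner_Integration.integral_cong refl)
    fix s :: 'a
    show "indicator usphere s * Rbar (\<lambda>r. H (\<phi> s, \<phi> r)) s \<alpha> = ?k (\<phi> s)"
      using Rbar_rotate[OF dim \<phi> _ \<alpha> gm[of "\<phi> s"], of s] orthogonal_transformation_norm[OF \<phi>]
      by (auto simp: indicator_def)
  qed
  also have "\<dots> = (\<integral>s. ?k s \<partial>distr sphere_prob borel \<phi>)"
    using frame_average_eq(2)[OF dim b \<alpha> H] by (subst integral_distr) auto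
  also have "\<dots> = frame_average b H \<alpha>"
    by (simp add: sphere_prob_rotate[OF \<phi>] frame_average_eq(1)[OF dim b \<alpha> H])
  finally show ?thesis .
qed

text \<open>\<open>- carry (- v1) v\<close> is the reflection in the hyperplane orthogonal to \<open>v - v1\<close>; unlike
  \<open>carry v1 v\<close> it fixes the first vector of the frame.\<close>

lemma frames_transitive:
  assumes y: "y \<in> frames" and z: "z \<in> frames"
  obtains \<phi> :: "'a::euclidean_space \<Rightarrow> 'a" where "orthogonal_transformation \<phi>" "map_prod \<phi> \<phi> y = z"
proof -
  define s where "s = fst z" define v where "v = snd z"
  define c where "c = carry (fst y) s"
  define w where "w = c (snd y)"
  define \<phi> where "\<phi> x = - carry (- w) v (c x)" for x
  have n: "norm (fst y) = 1" "norm (snd y) = 1" "norm s = 1" "norm v = 1" "v \<bullet> s = 0" "snd y \<bullet> fst y = 0"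
    using y z by (auto simp: frames_def equator_def s_def v_def)
  have cs: "c (fst y) = s" unfolding c_def by (rule carry_self) (use n in auto)
  have w: "norm w = 1" "w \<bullet> s = 0"
    using n inner_carry[of "fst y" s "snd y" "fst y"] cs by (auto simp: w_def c_def)
  have "\<phi> (fst y) = s"
  proof -
    have "(v + - w) \<bullet> s = 0" using w n by (simp add: inner_diff_left)
    then show ?thesis by (simp add: \<phi>_def cs carry_def)
  qed
  moreover have "\<phi> (snd y) = v"
  proof -
    have "\<phi> (snd y) = carry (- w) v (- w)"
      using linear_neg[OF linear_carry, of "- w" v w] by (simp add: \<phi>_def w_def)
    also have "\<dots> = v" by (rule carry_self) (use n w in auto)
    finally show ?thesis .
  qed
  moreover have "orthogonal_transformation \<phi>"
    unfolding orthogonal_transformation_def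
  proof
    show "linear \<phi>" unfolding \<phi>_def c_def
      by (intro linearI) (simp_all add: linear_add[OF linear_carry] linear_scale[OF linear_carry])
    show "\<forall>a b. \<phi> a \<bullet> \<phi> b = a \<bullet> b" by (simp add: \<phi>_def c_def inner_carry)
  qed
  ultimately show thesis using that by (simp add: map_prod_def case_prod_beta s_def v_def)
qed

lemma frame_point_surj:
  assumes dim: "2 \<le> DIM('a)" and x: "x \<in> usphere \<times> (usphere :: 'a::euclidean_space set)"
  obtains y where "y \<in> frames" "x = frame_point (fst x \<bullet> snd x) y"
proof -
  define s where "s = fst x" define r where "r = snd x" define \<alpha> where "\<alpha> = s \<bullet> r"
  have sr: "s \<in> usphere" "r \<in> usphere" using x by (auto simp: s_def r_def mem_Times_iff)
  have abs: "\<bar>\<alpha>\<bar> \<le> 1" using Cauchy_Schwarz_ineq2[of s r] sr by (simp add: \<alpha>_def)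
  have "\<exists>v\<in>equator s. r = \<alpha> *\<^sub>R s + sqrt (1 - \<alpha>\<^sup>2) *\<^sub>R v"
  proof (cases "\<bar>\<alpha>\<bar> < 1")
    case True
    have "r \<in> latitude s \<alpha>" using sr by (simp add: latitude_def \<alpha>_def inner_commute)
    then obtain u where "u \<in> equator s" "r = latitude_point s s \<alpha> u"
      using latitude_point_image[OF sr(1,1) True] by blast
    then show ?thesis using carry_equator[OF sr(1,1)] by (intro bexI[of _ "carry s s u"]) (auto simp: latitude_point_def)
  next
    case False
    then have \<alpha>1: "\<alpha> * \<alpha> = 1" using abs by (auto simp: abs_if split: if_splits)
    have "(r - \<alpha> *\<^sub>R s) \<bullet> (r - \<alpha> *\<^sub>R s) = r \<bullet> r - 2 * \<alpha> * (s \<bullet> r) + \<alpha> * \<alpha> * (s \<bullet> s)"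
      by (simp add: inner_diff_left inner_diff_right inner_commute algebra_simps)
    also have "\<dots> = 0" using sr \<alpha>1 by (simp add: \<alpha>_def[symmetric] norm_eq_1)
    finally have "r = \<alpha> *\<^sub>R s" by simp
    \<comment> \<open>Here \<open>r\<close> is s or -s and any vector of the equator completes the
      pair; one exists because the equator has positive Hausdorff measure.\<close>
    moreover have "equator s \<noteq> {}"
      using hausdorff_latitude(1)[OF dim sr(1), of 0] by (auto simp: equator_eq_latitude)
    ultimately show ?thesis using \<alpha>1 by (auto simp: power2_eq_square)
  qed
  then obtain v where v: "v \<in> equator s" "r = \<alpha> *\<^sub>R s + sqrt (1 - \<alpha>\<^sup>2) *\<^sub>R v" by blast
  show thesis
  proof
    show "(s, v) \<in> frames" using v sr by (simp add: frames_def)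
    have "frame_point \<alpha> (s, v) = (s, r)" using v(2) by (simp add: frame_point_def)
    then show "x = frame_point (fst x \<bullet> snd x) (s, v)" by (simp add: s_def r_def \<alpha>_def)
qed
qed

text \<open>Replaces a statement about the support of the frame law. If the average vanished at
  \<open>x\<close>, invariance would make it vanish at every point of the orbit of \<open>x\<close>.
  Finitely many of the open sets where some \<open>K z\<close> is positive cover the compact orbit,
  so a function positive on the whole orbit would have integral 0.\<close>

lemma frame_average_pos:
  fixes K :: "'a::euclidean_space \<times> 'a \<Rightarrow> 'a \<times> 'a \<Rightarrow> real"
  assumes dim: "2 \<le> DIM('a)" and b: "b \<in> usphere"
    and K: "continuous_on UNIV (\<lambda>(x, y). K x y)" and nonneg: "\<And>x y. 0 \<le> K x y" and pos: "\<And>x. 0 < K x x"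
    and inv: "\<And>\<phi> x y. orthogonal_transformation \<phi> \<Longrightarrow> K (map_prod \<phi> \<phi> x) (map_prod \<phi> \<phi> y) = K x y"
    and x: "x \<in> usphere \<times> usphere"
  shows "0 < frame_average b (K x) (fst x \<bullet> snd x)"
proof (rule ccontr)
  assume neg: "\<not> ?thesis"
  interpret prob_space "frame_law b" by (rule prob_space_frame_law[OF dim b])
  define \<alpha> where "\<alpha> = fst x \<bullet> snd x"
  have "\<bar>\<alpha>\<bar> \<le> 1" using Cauchy_Schwarz_ineq2[of "fst x" "snd x"] x by (auto simp: \<alpha>_def mem_Times_iff)
  then have \<alpha>: "\<alpha> \<in> {-1..1}" by auto
  have Kc: "continuous_on A (\<lambda>z. K (f z) (g z))" if "continuous_on A f" "continuous_on A g"
    for A :: "'b::topological_space set" and f g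
    using continuous_on_compose2[OF K continuous_on_Pair[OF that]] by simp
  have Kz: "continuous_on A (K z)" for z A by (rule Kc) (auto intro: continuous_intros)
  define O' where "O' = frame_point \<alpha> ` (frames :: ('a \<times> 'a) set)"
  have comp: "compact O'" unfolding O'_def
    by (intro compact_continuous_image compact_frames continuous_intros)
  obtain y0 where y0: "y0 \<in> frames" "x = frame_point \<alpha> y0" using frame_point_surj[OF dim x] by (auto simp: \<alpha>_def)
  have zero: "frame_average b (K z) \<alpha> = 0" if z: "z \<in> O'" for z
  proof -
    obtain y where y: "y \<in> frames" "z = frame_point \<alpha> y" using z by (auto simp: O'_def)
    obtain \<phi> where \<phi>: "orthogonal_transformation \<phi>" "map_prod \<phi> \<phi> y0 = y" using frames_transitive[OF y0(1) y(1)] .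
    have zx: "z = map_prod \<phi> \<phi> x" by (simp add: y y0 frame_point_orthogonal[OF \<phi>(1)] \<phi>(2))
    have "frame_average b (K z) \<alpha> = frame_average b (\<lambda>w. K z (map_prod \<phi> \<phi> w)) \<alpha>"
      by (rule frame_average_rotate[OF dim b \<alpha> Kz \<phi>(1), symmetric])
    also have "\<dots> = frame_average b (K x) \<alpha>" by (simp add: zx inv[OF \<phi>(1)])
    also have "\<dots> \<le> 0" using neg by (simp add: \<alpha>_def)
    moreover have "0 \<le> frame_average b (K z) \<alpha>" unfolding frame_average_def by (intro Bochner_Integration.integral_nonneg) (rule nonneg)
    ultimately show ?thesis by linarith
  qed
  have "\<exists>Z\<subseteq>O'. finite Z \<and> O' \<subseteq> (\<Union>z\<in>Z. {w. 0 < K z w})"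
  proof (rule compactE_image[OF comp, of O' "\<lambda>z. {w. 0 < K z w}"])
    show "open {w. 0 < K z w}" for z by (intro open_Collect_less continuous_intros Kz)
    show "O' \<subseteq> (\<Union>z\<in>O'. {w. 0 < K z w})" using pos by auto
  qed blast
  then obtain Z where Z: "Z \<subseteq> O'" "finite Z" "O' \<subseteq> (\<Union>z\<in>Z. {w. 0 < K z w})" by blast
  have fc: "continuous_on UNIV (\<lambda>y. K z (frame_point \<alpha> y))" for z by (intro Kc continuous_intros)
  have fm: "(\<lambda>y. K z (frame_point \<alpha> y)) \<in> borel_measurable (frame_law b)" for z
    using borel_measurable_continuous_onI[OF fc] by (simp cong: measurable_cong_sets)
  have fint: "integrable (frame_law b) (\<lambda>y. K z (frame_point \<alpha> y))" for z
  proof -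
    obtain B where B: "\<And>x. x \<in> usphere \<times> usphere \<Longrightarrow> \<bar>K z x\<bar> \<le> B" using continuous_usphere_bounded[OF Kz] by metis
    show ?thesis
    proof (rule integrable_const_bound[OF _ fm])
      show "AE y in frame_law b. norm (K z (frame_point \<alpha> y)) \<le> B"
        using AE_frame_law[OF dim b] by eventually_elim (use B[OF frame_point_mem(1)[OF _ \<alpha>]] in auto)
    qed
  qed
  have "(\<integral>y. (\<Sum>z\<in>Z. K z (frame_point \<alpha> y)) \<partial>frame_law b) = (\<Sum>z\<in>Z. frame_average b (K z) \<alpha>)"
    unfolding frame_average_def by (rule Bochner_Integration.integral_sum) (rule fint)
  also have "\<dots> = 0" using zero Z by (intro sum.neutral) auto
  finally have "(\<integral>y. (\<Sum>z\<in>Z. K z (frame_point \<alpha> y)) \<partial>frame_law b) = 0" .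
  then have "AE y in frame_law b. (\<Sum>z\<in>Z. K z (frame_point \<alpha> y)) = 0"
    by (subst (asm) integral_nonneg_eq_0_iff_AE) (auto intro!: sum_nonneg nonneg Bochner_Integration.integrable_sum fint)
  moreover have "AE y in frame_law b. (\<Sum>z\<in>Z. K z (frame_point \<alpha> y)) \<noteq> 0"
    using AE_frame_law[OF dim b]
  proof eventually_elim
    case (elim y)
    then have "frame_point \<alpha> y \<in> O'" by (auto simp: O'_def)
    then obtain z where "z \<in> Z" "0 < K z (frame_point \<alpha> y)" using Z(3) by blast
    then have "0 < (\<Sum>z\<in>Z. K z (frame_point \<alpha> y))" by (intro sum_pos2[OF Z(2)] nonneg)
    then show ?case by simp
  qed
  ultimately have "AE y in frame_law b. False" by eventually_elim simp
  then show False by simp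
qed

text \<open>Kernel argument replacing the Haar measure of the orthogonal group. By invariance of \<open>M\<close>,
  the frame \<open>y\<close> in \<open>K x (frame_point \<alpha> y)\<close> may be exchanged for an independent one, and the
  normalization of the kernel then integrates to 1.\<close>

lemma invariant_functional_average:
  fixes M :: "('a::euclidean_space \<times> 'a \<Rightarrow> real) \<Rightarrow> real"
  assumes dim: "2 \<le> DIM('a)" and b: "b \<in> usphere"
    and lip: "\<And>F G e. continuous_on UNIV F \<Longrightarrow> continuous_on UNIV G \<Longrightarrow>
      (\<And>x. x \<in> usphere \<times> usphere \<Longrightarrow> \<bar>F x - G x\<bar> \<le> e) \<Longrightarrow> \<bar>M F - M G\<bar> \<le> C * e"
    and inv: "\<And>F \<phi>. continuous_on UNIV F \<Longrightarrow> orthogonal_transformation \<phi> \<Longrightarrow> M (\<lambda>x. F (map_prod \<phi> \<phi> x)) = M F"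
    and swap: "\<And>G. continuous_on UNIV (\<lambda>(x, y). G x y) \<Longrightarrow>
      M (\<lambda>x. \<integral>y. G x y \<partial>frame_law b) = (\<integral>y. M (\<lambda>x. G x y) \<partial>frame_law b)"
    and F: "continuous_on UNIV F"
  shows "M F = M (\<lambda>x. frame_average b F (fst x \<bullet> snd x))"
proof -
  interpret prob_space "frame_law b" by (rule prob_space_frame_law[OF dim b])
  let ?S = "usphere \<times> usphere :: ('a \<times> 'a) set"
  let ?a = "\<lambda>x :: 'a \<times> 'a. fst x \<bullet> snd x"
  note fl = prob_space_frame_law[OF dim b] sets_frame_law compact_frames AE_frame_law[OF dim b]
  have compS: "compact ?S" by (intro compact_Times) auto
  have \<alpha>: "?a x \<in> {-1..1}" if "x \<in> ?S" for x
    using Cauchy_Schwarz_ineq2[of "fst x" "snd x"] that by (auto simp: mem_Times_iff abs_le_iff)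
  have cong: "M F = M G" if "continuous_on UNIV F" "continuous_on UNIV G" "\<And>x. x \<in> ?S \<Longrightarrow> F x = G x" for F G
    using lip[OF that(1,2), of 0] that(3) by simp
  have Fc: "continuous_on A (\<lambda>z. F (f z))" if "continuous_on A f" for A :: "'b::topological_space set" and f
    using continuous_on_compose2[OF F that] by simp
  have avg: "continuous_on UNIV (\<lambda>x. frame_average b F (?a x))"
    unfolding frame_average_def
    by (rule continuous_on_integral_parameter[OF _ fl]) (unfold case_prod_beta, intro Fc continuous_intros)
  have main: "\<bar>M F - M (\<lambda>x. frame_average b F (?a x))\<bar> \<le> C * e" if e: "0 < e" for e
  proof -
    have "uniformly_continuous_on ?S F"
      by (intro compact_uniformly_continuous compS continuous_on_subset[OF F]) auto
    then obtain d where d: "0 < d" and Fd: "\<And>x z. x \<in> ?S \<Longrightarrow> z \<in> ?S \<Longrightarrow> dist z x < d \<Longrightarrow> dist (F z) (F x) < e"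
      using e unfolding uniformly_continuous_on_def by metis
    \<comment> \<open>A tent of radius \<open>d\<close>, within which \<open>F\<close> varies by
      less than \<open>e\<close>. Being built from distances of components, it is unchanged when a
      rotation acts on all four vectors.\<close>
    define K where "K x z = max 0 (d - (dist (fst x) (fst z) + dist (snd x) (snd z)))" for x z :: "'a \<times> 'a"
    have K0: "0 \<le> K x z" for x z by (simp add: K_def)
    have Kc: "continuous_on A (\<lambda>z. K (f z) (g z))" if "continuous_on A f" "continuous_on A g"
      for A :: "'b::topological_space set" and f g
      unfolding K_def by (intro continuous_intros that)
    have Kinv: "K (map_prod \<phi> \<phi> x) (map_prod \<phi> \<phi> z) = K x z" if "orthogonal_transformation \<phi>" for \<phi> x z
      by (simp add: K_def orthogonal_transformation_dist[OF that])
    have Kd: "dist z x < d" if "K x z \<noteq> 0" for x z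
    proof -
      have "dist z x \<le> dist (fst x) (fst z) + dist (snd x) (snd z)"
        unfolding dist_prod_def dist_commute[of "fst z"] dist_commute[of "snd z"]
        by (rule sqrt_sum_squares_le_sum) auto
      then show ?thesis using that by (auto simp: K_def max_def split: if_splits)
    qed
    define N where "N x = frame_average b (K x) (?a x)" for x
    have Nc: "continuous_on A N" for A
    proof -
      have "continuous_on UNIV N"
        unfolding N_def frame_average_def
        by (rule continuous_on_integral_parameter[OF _ fl]) (unfold case_prod_beta, intro Kc continuous_intros)
      then show ?thesis by (rule continuous_on_subset) auto
    qed
    have Npos: "0 < N x" if "x \<in> ?S" for x
      unfolding N_def
    proof (rule frame_average_pos[OF dim b])
      show "continuous_on UNIV (\<lambda>(x, y). K x y)" unfolding case_prod_beta by (intro Kc continuous_intros)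
      show "0 < K x x" for x using d by (simp add: K_def)
    qed (use K0 Kinv that in auto)
    have Ninv: "N (map_prod \<phi> \<phi> x) = N x" if x: "x \<in> ?S" and \<phi>: "orthogonal_transformation \<phi>" for \<phi> x
    proof -
      have a: "?a (map_prod \<phi> \<phi> x) = ?a x"
        using \<phi> by (cases x) (simp add: orthogonal_transformation_def)
      have "N (map_prod \<phi> \<phi> x) = frame_average b (K (map_prod \<phi> \<phi> x)) (?a x)" unfolding N_def a ..
      also have "\<dots> = frame_average b (\<lambda>z. K (map_prod \<phi> \<phi> x) (map_prod \<phi> \<phi> z)) (?a x)"
        by (rule frame_average_rotate[OF dim b \<alpha>[OF x] _ \<phi>, symmetric]) (intro Kc continuous_intros)
      also have "\<dots> = N x" by (simp add: Kinv[OF \<phi>] N_def)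
      finally show ?thesis .
    qed
    obtain m where m: "0 < m" "\<And>x. x \<in> ?S \<Longrightarrow> m \<le> N x"
    proof -
      have "?S \<noteq> {}" using b by auto
      from continuous_attains_inf[OF compS this Nc] obtain x0 where "x0 \<in> ?S" "\<And>x. x \<in> ?S \<Longrightarrow> N x0 \<le> N x" by blast
      then show thesis using that[of "N x0"] Npos by blast
    qed
    \<comment> \<open>On pairs of unit vectors this is 1/N; the maximum with the lower bound
      \<open>m\<close> keeps it continuous on the whole space.\<close>
    define \<Phi> where "\<Phi> x = 1 / max (N x) m" for x
    have \<Phi>c: "continuous_on A (\<lambda>z. \<Phi> (f z))" if "continuous_on A f" for A :: "'b::topological_space set" and f
      unfolding \<Phi>_def using m(1)
      by (intro continuous_intros continuous_on_compose2[OF Nc that]) (auto simp: max_def)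
    have N\<Phi>: "N x * \<Phi> x = 1" if "x \<in> ?S" for x
      using m(2)[OF that] Npos[OF that] by (simp add: \<Phi>_def max_def)
    have \<Phi>inv: "\<Phi> (map_prod \<phi> \<phi> x) = \<Phi> x" if "x \<in> ?S" "orthogonal_transformation \<phi>" for \<phi> x
      using Ninv[OF that] by (simp add: \<Phi>_def)
    have \<Phi>0: "0 \<le> \<Phi> x" for x using m(1) by (simp add: \<Phi>_def le_max_iff_disj)
    \<comment> \<open>Two frames enter: \<open>y\<close> gives the point at which \<open>F\<close>
      is evaluated, \<open>y0\<close> the point at which the kernel is. With \<open>y0 = y\<close>
      and integrated over \<open>y\<close>, this is \<open>F\<close> smoothed along orbits;
      integrated over \<open>y0\<close> alone, the kernel disappears by normalization
      (\<open>Gint\<close>).\<close>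
    define G where "G y0 x y = F (frame_point (?a x) y) * K x (frame_point (?a x) y0) * \<Phi> x" for y0 y x
    have Gc: "continuous_on A (\<lambda>z. G (f z) (g z) (h z))"
      if "continuous_on A f" "continuous_on A g" "continuous_on A h" for A :: "'b::topological_space set" and f g h
      unfolding G_def by (intro continuous_intros Fc Kc \<Phi>c that)
    have Gint: "(\<integral>y0. G y0 x y \<partial>frame_law b) = F (frame_point (?a x) y)" if "x \<in> ?S" for x y
    proof -
      have "(\<integral>y0. G y0 x y \<partial>frame_law b) = (\<integral>y0. (F (frame_point (?a x) y) * \<Phi> x) * K x (frame_point (?a x) y0) \<partial>frame_law b)"
        by (simp add: G_def ac_simps)
      also have "\<dots> = F (frame_point (?a x) y) * \<Phi> x * N x"
        unfolding N_def frame_average_def by (rule integral_mult_right_zero)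
      finally show ?thesis using N\<Phi>[OF that] by (simp add: ac_simps)
    qed
    \<comment> \<open>Since \<open>F\<close> is evaluated at a point depending on \<open>x\<close>
      only through the inner product, rotating \<open>x\<close> leaves that factor alone and moves
      the frame in the kernel from \<open>y\<close> to \<open>y0\<close>.\<close>
    have swap_frames: "M (\<lambda>x. G y x y) = M (\<lambda>x. G y0 x y)" if y: "y \<in> frames" "y0 \<in> frames" for y y0
    proof -
      obtain \<phi> where \<phi>: "orthogonal_transformation \<phi>" "map_prod \<phi> \<phi> y0 = y" using frames_transitive[OF y(2,1)] .
      have \<phi>c: "continuous_on UNIV \<phi>"
        using \<phi>(1) by (simp add: orthogonal_transformation_def linear_continuous_on linear_linear)
      have mc: "continuous_on UNIV (map_prod \<phi> \<phi>)"
        unfolding map_prod_def case_prod_beta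
        by (intro continuous_on_Pair continuous_on_compose2[OF \<phi>c] continuous_intros) auto
      have "M (\<lambda>x. G y x y) = M (\<lambda>x. G y (map_prod \<phi> \<phi> x) y)"
        by (rule inv[OF _ \<phi>(1), symmetric]) (intro Gc continuous_intros)
      also have "\<dots> = M (\<lambda>x. G y0 x y)"
      proof (rule cong)
        fix x assume x: "x \<in> ?S"
        have a: "?a (map_prod \<phi> \<phi> x) = ?a x"
          using \<phi> by (cases x) (simp add: orthogonal_transformation_def)
        show "G y (map_prod \<phi> \<phi> x) y = G y0 x y"
          unfolding G_def a \<Phi>inv[OF x \<phi>(1)]
          using frame_point_orthogonal[OF \<phi>(1), of "?a x" y0] Kinv[OF \<phi>(1)] \<phi>(2) by metis
      qed (intro Gc continuous_intros mc)+
      finally show ?thesis .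
    qed
    have "M (\<lambda>x. \<integral>y. G y x y \<partial>frame_law b) = (\<integral>y. M (\<lambda>x. G y x y) \<partial>frame_law b)"
      by (rule swap) (unfold case_prod_beta, intro Gc continuous_intros)
    also have "\<dots> = (\<integral>y. M (\<lambda>x. F (frame_point (?a x) y)) \<partial>frame_law b)"
    proof (rule integral_cong_AE)
      \<comment> \<open>Measurability comes from continuity in \<open>y\<close>: on a compact
        neighbourhood \<open>H\<close> is uniformly continuous, and \<open>lip\<close> carries this
        over to \<open>M\<close>.\<close>
      have Mm: "(\<lambda>y. M (\<lambda>x. H x y)) \<in> borel_measurable (frame_law b)"
        if H: "continuous_on UNIV (\<lambda>(x, y). H x y)" for H :: "'a \<times> 'a \<Rightarrow> 'a \<times> 'a \<Rightarrow> real"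
      proof -
        have Hc: "continuous_on A (\<lambda>z. H (f z) (g z))" if "continuous_on A f" "continuous_on A g"
          for A :: "'b::topological_space set" and f g
          using continuous_on_compose2[OF H continuous_on_Pair[OF that]] by simp
        have "continuous_on UNIV (\<lambda>y. M (\<lambda>x. H x y))"
          unfolding continuous_on_iff
        proof safe
          fix y :: "'a \<times> 'a" and e :: real assume e: "0 < e"
          define e' where "e' = e / (\<bar>C\<bar> + 1)"
          have e': "0 < e'" using e by (simp add: e'_def)
          have "uniformly_continuous_on (?S \<times> cball y 1) (\<lambda>z. H (fst z) (snd z))"
            by (intro compact_uniformly_continuous compact_Times Hc continuous_intros) auto
          then obtain r where r: "0 < r" and Hr: "\<And>z w. z \<in> ?S \<times> cball y 1 \<Longrightarrow> w \<in> ?S \<times> cball y 1 \<Longrightarrow> dist w z < r \<Longrightarrow>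
             dist (H (fst w) (snd w)) (H (fst z) (snd z)) < e'"
            using e' unfolding uniformly_continuous_on_def by metis
          show "\<exists>d>0. \<forall>y'\<in>UNIV. dist y' y < d \<longrightarrow> dist (M (\<lambda>x. H x y')) (M (\<lambda>x. H x y)) < e"
          proof (intro exI[of _ "min r 1"] conjI ballI impI)
            fix y' assume y': "dist y' y < min r 1"
            have "\<bar>M (\<lambda>x. H x y') - M (\<lambda>x. H x y)\<bar> \<le> C * e'"
            proof (rule lip)
              show "\<bar>H x y' - H x y\<bar> \<le> e'" if "x \<in> ?S" for x
                using Hr[of "(x, y)" "(x, y')"] y' that by (auto simp: dist_real_def dist_commute dist_Pair_Pair)
            qed (intro Hc continuous_intros)+
            also have "\<dots> \<le> \<bar>C\<bar> * e'" using e' by (intro mult_right_mono) auto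
            also have "\<dots> < e" using e by (simp add: e'_def field_simps)
            finally show "dist (M (\<lambda>x. H x y')) (M (\<lambda>x. H x y)) < e" by (simp add: dist_real_def)
          qed (use r in auto)
        qed
        from borel_measurable_continuous_onI[OF this] show ?thesis by (simp cong: measurable_cong_sets)
      qed
      show "(\<lambda>y. M (\<lambda>x. G y x y)) \<in> borel_measurable (frame_law b)"
        by (rule Mm) (unfold case_prod_beta, intro Gc continuous_intros)
      show "(\<lambda>y. M (\<lambda>x. F (frame_point (?a x) y))) \<in> borel_measurable (frame_law b)"
        by (rule Mm) (unfold case_prod_beta, intro Fc continuous_intros)
      show "AE y in frame_law b. M (\<lambda>x. G y x y) = M (\<lambda>x. F (frame_point (?a x) y))"
        using AE_frame_law[OF dim b]
      proof eventually_elim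
        case (elim y)
        have "M (\<lambda>x. F (frame_point (?a x) y)) = M (\<lambda>x. \<integral>y0. G y0 x y \<partial>frame_law b)"
          by (rule cong)
            (auto simp: Gint case_prod_beta intro!: Fc continuous_intros Gc continuous_on_integral_parameter[OF _ fl])
        also have "\<dots> = (\<integral>y0. M (\<lambda>x. G y0 x y) \<partial>frame_law b)"
          by (rule swap) (unfold case_prod_beta, intro Gc continuous_intros)
        also have "\<dots> = (\<integral>y0. M (\<lambda>x. G y x y) \<partial>frame_law b)"
        proof (rule integral_cong_AE)
          show "AE y0 in frame_law b. M (\<lambda>x. G y0 x y) = M (\<lambda>x. G y x y)"
            using AE_frame_law[OF dim b] by eventually_elim (rule swap_frames[OF elim, symmetric])
          show "(\<lambda>y0. M (\<lambda>x. G y0 x y)) \<in> borel_measurable (frame_law b)"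
            by (rule Mm) (unfold case_prod_beta, intro Gc continuous_intros)
        qed simp
        also have "\<dots> = M (\<lambda>x. G y x y)" by (simp add: prob_space)
        finally show ?case ..
      qed
    qed
    also have "\<dots> = M (\<lambda>x. \<integral>y. F (frame_point (?a x) y) \<partial>frame_law b)"
      by (rule swap[symmetric]) (unfold case_prod_beta, intro Fc continuous_intros)
    finally have eq: "M (\<lambda>x. \<integral>y. G y x y \<partial>frame_law b) = M (\<lambda>x. frame_average b F (?a x))"
      by (simp add: frame_average_def)
    have "\<bar>M F - M (\<lambda>x. \<integral>y. G y x y \<partial>frame_law b)\<bar> \<le> C * e"
    proof (rule lip[OF F])
      show "continuous_on UNIV (\<lambda>x. \<integral>y. G y x y \<partial>frame_law b)"
        by (rule continuous_on_integral_parameter[OF _ fl]) (unfold case_prod_beta, intro Gc continuous_intros)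
      fix x assume x: "x \<in> ?S"
      have meas: "(\<lambda>y. h y) \<in> borel_measurable (frame_law b)" if "continuous_on UNIV h" for h :: "'a \<times> 'a \<Rightarrow> real"
        using borel_measurable_continuous_onI[OF that] by (simp cong: measurable_cong_sets)
      have intg: "integrable (frame_law b) h" if h: "continuous_on UNIV h" for h :: "'a \<times> 'a \<Rightarrow> real"
      proof -
        obtain B where B: "\<And>x. x \<in> ?S \<Longrightarrow> \<bar>h x\<bar> \<le> B" using continuous_usphere_bounded[OF h] by metis
        show ?thesis
          by (rule integrable_const_bound[OF _ meas[OF h], where B=B])
            (use AE_frame_law[OF dim b] in eventually_elim, use B frames_subset in auto)
      qed
      have i1: "integrable (frame_law b) (\<lambda>y. G y x y)" by (intro intg Gc continuous_intros)
      have i2: "integrable (frame_law b) (\<lambda>y. K x (frame_point (?a x) y))" by (intro intg Kc continuous_intros)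
      have N1: "(\<integral>y. F x * \<Phi> x * K x (frame_point (?a x) y) \<partial>frame_law b) = F x"
      proof -
        have "(\<integral>y. F x * \<Phi> x * K x (frame_point (?a x) y) \<partial>frame_law b) = F x * \<Phi> x * N x"
          unfolding N_def frame_average_def by (rule integral_mult_right_zero)
        then show ?thesis using N\<Phi>[OF x] by (simp add: ac_simps)
      qed
      have N2: "(\<integral>y. e * \<Phi> x * K x (frame_point (?a x) y) \<partial>frame_law b) = e"
      proof -
        have "(\<integral>y. e * \<Phi> x * K x (frame_point (?a x) y) \<partial>frame_law b) = e * \<Phi> x * N x"
          unfolding N_def frame_average_def by (rule integral_mult_right_zero)
        then show ?thesis using N\<Phi>[OF x] by (simp add: ac_simps)
      qed
      have "\<bar>F x - (\<integral>y. G y x y \<partial>frame_law b)\<bar> = \<bar>\<integral>y. F x * \<Phi> x * K x (frame_point (?a x) y) - G y x y \<partial>frame_law b\<bar>"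
        unfolding Bochner_Integration.integral_diff[OF integrable_mult_right[OF i2] i1] N1 ..
      also have "\<dots> \<le> (\<integral>y. \<bar>F x * \<Phi> x * K x (frame_point (?a x) y) - G y x y\<bar> \<partial>frame_law b)"
        by (rule integral_abs_bound)
      also have "\<dots> \<le> (\<integral>y. e * \<Phi> x * K x (frame_point (?a x) y) \<partial>frame_law b)"
      proof (rule integral_mono_AE)
        show "AE y in frame_law b. \<bar>F x * \<Phi> x * K x (frame_point (?a x) y) - G y x y\<bar> \<le> e * \<Phi> x * K x (frame_point (?a x) y)"
          using AE_frame_law[OF dim b]
        proof eventually_elim
          case (elim y)
          let ?p = "frame_point (?a x) y"
          have p: "?p \<in> ?S" by (rule frame_point_mem(1)[OF elim \<alpha>[OF x]])
          have "F x * \<Phi> x * K x ?p - G y x y = (F x - F ?p) * (\<Phi> x * K x ?p)"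
            by (simp add: G_def algebra_simps)
          then have "\<bar>F x * \<Phi> x * K x ?p - G y x y\<bar> = \<bar>F x - F ?p\<bar> * (\<Phi> x * K x ?p)"
            using \<Phi>0[of x] K0[of x ?p] by (simp add: abs_mult)
          also have "\<dots> \<le> e * (\<Phi> x * K x ?p)"
          proof (cases "K x ?p = 0")
            case False
            then have "\<bar>F x - F ?p\<bar> \<le> e" using Fd[OF x p Kd] by (simp add: dist_real_def abs_minus_commute)
            then show ?thesis using \<Phi>0 K0 by (intro mult_right_mono) auto
          qed simp
          finally show ?case by (simp add: ac_simps)
        qed
      qed (use i1 i2 in \<open>auto intro!: integrable_mult_right\<close>)
      finally show "\<bar>F x - (\<integral>y. G y x y \<partial>frame_law b)\<bar> \<le> e" unfolding N2 .
    qed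
    then show ?thesis unfolding eq .
  qed
  have "\<bar>M F - M (\<lambda>x. frame_average b F (?a x))\<bar> \<le> 0 + e" if "0 < e" for e
  proof -
    have "\<bar>M F - M (\<lambda>x. frame_average b F (?a x))\<bar> \<le> C * (e / (\<bar>C\<bar> + 1))" using \<open>0 < e\<close>
      by (intro main) auto
    also have "\<dots> \<le> \<bar>C\<bar> * (e / (\<bar>C\<bar> + 1))" using \<open>0 < e\<close> by (intro mult_right_mono) auto
    also have "\<dots> \<le> e" using \<open>0 < e\<close> by (simp add: field_simps)
    finally show ?thesis by simp
  qed
  then have "\<bar>M F - M (\<lambda>x. frame_average b F (?a x))\<bar> \<le> 0" by (rule field_le_epsilon)
  then show ?thesis by simp
qed

section \<open>Star bodies as continuous functions on the sphere\<close>

definition body :: "('a::euclidean_space \<Rightarrow> real) \<Rightarrow> 'a set" where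
  "body f = {t *\<^sub>R s | t s. s \<in> usphere \<and> 0 \<le> t \<and> t \<le> f s}"

definition radial_fun :: "('a::euclidean_space \<Rightarrow> real) \<Rightarrow> bool" where
  "radial_fun f \<longleftrightarrow> continuous_on usphere f \<and> (\<forall>s\<in>usphere. 0 \<le> f s)"

lemma radial_fun_nonneg: "radial_fun f \<Longrightarrow> s \<in> usphere \<Longrightarrow> 0 \<le> f s"
  by (simp add: radial_fun_def)

lemma radial_fun_continuous: "radial_fun f \<Longrightarrow> continuous_on usphere f"
  by (simp add: radial_fun_def)

lemma unit_scaleR_eq:
  fixes s s' :: "'a::euclidean_space"
  assumes "t *\<^sub>R s = t' *\<^sub>R s'" "norm s = 1" "norm s' = 1" "0 \<le> t" "0 \<le> t'"
  shows "t = t'" "0 < t \<Longrightarrow> s = s'"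
proof -
  have "\<bar>t\<bar> * norm s = \<bar>t'\<bar> * norm s'" using arg_cong[OF assms(1), of norm] by (simp only: norm_scaleR)
  then show "t = t'" using assms(2-) by simp
  with assms show "0 < t \<Longrightarrow> s = s'" by simp
qed

lemma scaleR_mem_body:
  assumes "radial_fun f" "s \<in> usphere" "0 \<le> t"
  shows "t *\<^sub>R s \<in> body f \<longleftrightarrow> t \<le> f s"
proof
  assume "t *\<^sub>R s \<in> body f"
  then obtain t' s' where *: "t *\<^sub>R s = t' *\<^sub>R s'" "s' \<in> usphere" "0 \<le> t'" "t' \<le> f s'"
    by (auto simp: body_def)
  show "t \<le> f s"
    using unit_scaleR_eq[OF *(1)] * assms radial_fun_nonneg[OF assms(1,2)] by (cases "t = 0") auto
next
  assume "t \<le> f s"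
  then show "t *\<^sub>R s \<in> body f" using assms unfolding body_def by blast
qed

lemma body_cong: "(\<And>s. s \<in> usphere \<Longrightarrow> f s = g s) \<Longrightarrow> body f = body g"
  unfolding body_def by (intro Collect_cong ex_cong1) auto

lemma radial_body: "radial (body f) s = f s" if "radial_fun f" "s \<in> usphere"
proof -
  have "{t. 0 \<le> t \<and> t *\<^sub>R s \<in> body f} = {0..f s}" using scaleR_mem_body[OF that] by auto
  then show ?thesis using radial_fun_nonneg[OF that] by (simp add: radial_def)
qed

lemma body_in_star_bodies: "body f \<in> star_bodies" if f: "radial_fun f"
proof -
  have "star_set (body f)"
    unfolding star_set_def
  proof (intro conjI ballI)
    obtain b :: 'a where "b \<in> Basis" using SOME_Basis by blast
    then have "0 *\<^sub>R b \<in> body f" using scaleR_mem_body[OF f, of b 0] radial_fun_nonneg[OF f, of b] by simp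
    then show "body f \<noteq> {}" by auto
    fix x and t :: real assume x: "x \<in> body f" and t: "t \<in> {0..1}"
    then obtain u s where u: "x = u *\<^sub>R s" "s \<in> usphere" "0 \<le> u" "u \<le> f s" by (auto simp: body_def)
    have "t * u \<le> 1 * u" using t u by (intro mult_right_mono) auto
    then have "(t * u) *\<^sub>R s \<in> body f" using t u by (subst scaleR_mem_body[OF f]) auto
    then show "t *\<^sub>R x \<in> body f" by (simp add: u)
  qed
  moreover have "bdd_above {t. 0 \<le> t \<and> t *\<^sub>R s \<in> body f}" if "s \<in> usphere" for s
    using scaleR_mem_body[OF f that] by (auto simp: bdd_above_def)
  moreover have "continuous_on usphere (radial (body f))"
    using radial_fun_continuous[OF f] by (rule continuous_on_eq) (simp add: radial_body[OF f])
  moreover have "body f = {t *\<^sub>R s |t s. s \<in> usphere \<and> 0 \<le> t \<and> t \<le> radial (body f) s}"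
    using body_cong[of f "radial (body f)"] radial_body[OF f] unfolding body_def[of "radial _"] by simp
  ultimately show ?thesis by (simp add: star_bodies_def)
qed

lemma star_bodies_radial_fun: "radial_fun (radial L)" if "L \<in> star_bodies"
proof -
  have L: "star_set L" "continuous_on usphere (radial L)"
    "\<And>s. s \<in> usphere \<Longrightarrow> bdd_above {t. 0 \<le> t \<and> t *\<^sub>R s \<in> L}"
    using that by (auto simp: star_bodies_def)
  obtain x where x: "x \<in> L" using L(1) by (auto simp: star_set_def)
  then have "0 *\<^sub>R x \<in> L" using L(1) unfolding star_set_def by (meson atLeastAtMost_iff order.refl zero_le_one)
  then have "0 \<in> L" by simp
  then have "0 \<le> radial L s" if "s \<in> usphere" for s
    unfolding radial_def by (intro cSup_upper L(3) that) simp
  then show ?thesis using L by (simp add: radial_fun_def)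
qed

lemma body_radial: "L = body (radial L)" if "L \<in> star_bodies"
  using that by (simp add: star_bodies_def body_def)

lemma radial_fun_max: "radial_fun f \<Longrightarrow> radial_fun g \<Longrightarrow> radial_fun (\<lambda>s. max (f s) (g s))"
  by (auto simp: radial_fun_def intro!: continuous_intros)

lemma radial_fun_min: "radial_fun f \<Longrightarrow> radial_fun g \<Longrightarrow> radial_fun (\<lambda>s. min (f s) (g s))"
  by (auto simp: radial_fun_def intro!: continuous_intros)

lemma body_Un: "body f \<union> body g = body (\<lambda>s. max (f s) (g s))"
  by (auto simp: body_def le_max_iff_disj)

lemma body_Int:
  assumes "radial_fun f" "radial_fun g"
  shows "body f \<inter> body g = body (\<lambda>s. min (f s) (g s))"
proof
  show "body (\<lambda>s. min (f s) (g s)) \<subseteq> body f \<inter> body g" by (auto simp: body_def)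
  show "body f \<inter> body g \<subseteq> body (\<lambda>s. min (f s) (g s))"
  proof
    fix x assume x: "x \<in> body f \<inter> body g"
    then obtain t s where t: "x = t *\<^sub>R s" "s \<in> usphere" "0 \<le> t" "t \<le> f s" by (auto simp: body_def)
    then have "t \<le> g s" using x scaleR_mem_body[OF assms(2)] by auto
    then show "x \<in> body (\<lambda>s. min (f s) (g s))" using t unfolding body_def by auto
  qed
qed

lemma body_zero: "body (\<lambda>_. 0) = {0 :: 'a::euclidean_space}"
proof -
  obtain b :: 'a where "b \<in> Basis" using SOME_Basis by blast
  then show ?thesis by (auto simp: body_def intro!: exI[of _ b])
qed

lemma body_rotate:
  fixes \<phi> :: "'a::euclidean_space \<Rightarrow> 'a"
  assumes \<phi>: "orthogonal_transformation \<phi>"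
  shows "\<phi> ` body f = body (f \<circ> inv \<phi>)"
proof -
  have bij: "bij \<phi>" by (rule orthogonal_transformation_bij[OF \<phi>])
  have lin: "linear \<phi>" using \<phi> by (simp add: orthogonal_transformation_def)
  have inv\<phi>: "orthogonal_transformation (inv \<phi>)" by (rule orthogonal_transformation_inv[OF \<phi>])
  show ?thesis
  proof safe
    fix x assume "x \<in> body f"
    then obtain t s where t: "x = t *\<^sub>R s" "s \<in> usphere" "0 \<le> t" "t \<le> f s" by (auto simp: body_def)
    have "\<phi> x = t *\<^sub>R \<phi> s" "\<phi> s \<in> usphere" "inv \<phi> (\<phi> s) = s"
      using t lin bij orthogonal_transformation_norm[OF \<phi>] by (auto simp: linear_scale bij_is_inj)
    then show "\<phi> x \<in> body (f \<circ> inv \<phi>)"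
      using t unfolding body_def by (intro CollectI exI[of _ t] exI[of _ "\<phi> s"]) auto
  next
    fix x assume "x \<in> body (f \<circ> inv \<phi>)"
    then obtain t s where t: "x = t *\<^sub>R s" "s \<in> usphere" "0 \<le> t" "t \<le> f (inv \<phi> s)" by (auto simp: body_def)
    have "x = \<phi> (t *\<^sub>R inv \<phi> s)"
      using t lin bij by (simp add: linear_scale bij_is_surj surj_f_inv_f)
    moreover have "t *\<^sub>R inv \<phi> s \<in> body f"
      using t orthogonal_transformation_norm[OF inv\<phi>] unfolding body_def
      by (intro CollectI exI[of _ t] exI[of _ "inv \<phi> s"]) auto
    ultimately show "x \<in> \<phi> ` body f" by blast
  qed
qed

lemma radial_fun_rotate:
  fixes \<phi> :: "'a::euclidean_space \<Rightarrow> 'a"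
  assumes "orthogonal_transformation \<phi>" "radial_fun f"
  shows "radial_fun (f \<circ> \<phi>)"
proof -
  have "continuous_on usphere \<phi>"
    using assms(1) by (simp add: orthogonal_transformation_def linear_continuous_on linear_linear)
  then show ?thesis
    using assms orthogonal_transformation_norm[OF assms(1)] orthogonal_transformation_usphere_image[OF assms(1)]
    by (auto simp: radial_fun_def o_def intro!: continuous_on_compose2[of usphere f])
qed

lemma radial_dist_le:
  assumes "radial_fun f" "radial_fun g" "\<And>s. s \<in> usphere \<Longrightarrow> \<bar>f s - g s\<bar> \<le> d"
  shows "radial_dist (body f) (body g) \<le> (d :: real)"
proof -
  have "(usphere :: 'a set) \<noteq> {}" by simp
  then show ?thesis
    unfolding radial_dist_def by (rule cSUP_least) (use assms(3) radial_body[OF assms(1)] radial_body[OF assms(2)] in auto)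
qed

lemma abs_radial_diff_le:
  assumes "K \<in> star_bodies" "L \<in> star_bodies" "s \<in> usphere"
  shows "\<bar>radial K s - radial L s\<bar> \<le> radial_dist K L"
  unfolding radial_dist_def
proof (rule cSUP_upper[OF assms(3)])
  have "continuous_on usphere (\<lambda>s. \<bar>radial K s - radial L s\<bar>)"
    by (intro continuous_intros radial_fun_continuous star_bodies_radial_fun assms)
  then have "compact ((\<lambda>s. \<bar>radial K s - radial L s\<bar>) ` usphere)"
    by (rule compact_continuous_image) simp
  then show "bdd_above ((\<lambda>s. \<bar>radial K s - radial L s\<bar>) ` usphere)"
    by (intro bounded_imp_bdd_above compact_imp_bounded)
qed

section \<open>Finite measures on compact sets\<close>

lemma radon_measuresD:
  assumes "M \<in> radon_measures T"
  shows "sets M = sets (restrict_space borel T)" "finite_measure M" "space M = T"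
  using assms sets_eq_imp_space_eq[of M "restrict_space borel T"]
  by (auto simp: radon_measures_def space_restrict_space)

lemma borel_measurable_radon:
  assumes M: "sets M = sets (restrict_space borel T)" and g: "continuous_on T (g :: 'a::metric_space \<Rightarrow> real)"
  shows "g \<in> borel_measurable M"
  using borel_measurable_continuous_on_restrict[OF g] by (simp cong: measurable_cong_sets add: M)

lemma integrable_radon:
  assumes M: "sets M = sets (restrict_space borel T)" "finite_measure M" and T: "compact T"
    and g: "continuous_on T (g :: 'a::metric_space \<Rightarrow> real)"
  shows "integrable M g"
proof -
  interpret finite_measure M by fact
  have sp: "space M = T" using sets_eq_imp_space_eq[OF M(1)] by (simp add: space_restrict_space)
  have "compact (g ` T)" by (rule compact_continuous_image[OF g T])
  then obtain B where "\<And>x. x \<in> T \<Longrightarrow> \<bar>g x\<bar> \<le> B"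
    unfolding compact_eq_bounded_closed bounded_iff by auto
  then show ?thesis
    by (intro integrable_const_bound[where B=B] borel_measurable_radon[OF M(1) g] AE_I2) (simp add: sp)
qed

lemma measure_closed_limit:
  assumes M: "sets M = sets (restrict_space borel T)" "finite_measure M" "closed T" and C: "closed C" "C \<noteq> {}"
  shows "(\<lambda>n. \<integral>x. max 0 (1 - real n * infdist x C) \<partial>M) \<longlonglongrightarrow> measure M (C \<inter> T)"
proof -
  interpret finite_measure M by fact
  have sp: "space M = T" using sets_eq_imp_space_eq[OF M(1)] by (simp add: space_restrict_space)
  have CT: "C \<inter> T \<in> sets M" using C by (auto simp: M(1) sets_restrict_space)
  have "(\<lambda>n. \<integral>x. max 0 (1 - real n * infdist x C) \<partial>M) \<longlonglongrightarrow> (\<integral>x. indicator (C \<inter> T) x \<partial>M)"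
  proof (rule integral_dominated_convergence[where w="\<lambda>_. 1"])
    show "AE x in M. (\<lambda>n. max 0 (1 - real n * infdist x C)) \<longlonglongrightarrow> indicator (C \<inter> T) x"
    proof (rule AE_I2)
      fix x assume x: "x \<in> space M"
      show "(\<lambda>n. max 0 (1 - real n * infdist x C)) \<longlonglongrightarrow> indicator (C \<inter> T) x"
      proof (cases "x \<in> C")
        case True
        then show ?thesis using x by (simp add: sp)
      next
        case False
        then have pos: "0 < infdist x C" using C by (simp add: infdist_pos_not_in_closed)
        obtain N :: nat where N: "1 / infdist x C < real N" using reals_Archimedean2 by blast
        have "max 0 (1 - real n * infdist x C) = 0" if "N \<le> n" for n
        proof -
          have "1 / infdist x C \<le> real n" using N that by linarith
          then show ?thesis using pos by (simp add: field_simps)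
        qed
        then have "eventually (\<lambda>n. max 0 (1 - real n * infdist x C) = 0) sequentially"
          by (auto simp: eventually_sequentially)
        then show ?thesis using False by (simp add: tendsto_eventually)
      qed
    qed
    show "(\<lambda>x. max 0 (1 - real n * infdist x C)) \<in> borel_measurable M" for n
      by (rule borel_measurable_radon[OF M(1)]) (intro continuous_intros)
    show "AE x in M. norm (max 0 (1 - real n * infdist x C)) \<le> 1" for n
      by (intro AE_I2) (simp add: infdist_nonneg)
  qed (use CT in auto)
  then show ?thesis using CT by simp
qed

text \<open>Passes from integrals to sets: closed sets are reached by decreasing tents, all Borel
  sets by a Dynkin argument. An identity between two sums of measures is kept as a relation among
  four indexed measures, which is the form of the valuation property.\<close>

lemma measure_add_eqI:
  fixes T :: "'a::metric_space set"
  assumes T: "compact T" and M: "\<And>i. i \<in> {1..4} \<Longrightarrow> sets (M i) = sets (restrict_space borel T)"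
    "\<And>i::nat. i \<in> {1..4} \<Longrightarrow> finite_measure (M i)"
    and eq: "\<And>g::'a \<Rightarrow> real. continuous_on T g \<Longrightarrow> (\<integral>x. g x \<partial>M 1) + (\<integral>x. g x \<partial>M 2) = (\<integral>x. g x \<partial>M 3) + (\<integral>x. g x \<partial>M 4)"
    and A: "A \<in> sets (restrict_space borel T)"
  shows "emeasure (M 1) A + emeasure (M 2) A = emeasure (M 3) A + emeasure (M 4) A"
proof -
  have cl: "closed T" using T by (rule compact_imp_closed)
  have sp: "space (M i) = T" if "i \<in> {1..4}" for i
    using sets_eq_imp_space_eq[OF M(1)[OF that]] by (simp add: space_restrict_space)
  have in_sets: "B \<inter> T \<in> sets (M i)" if "B \<in> sets borel" "i \<in> {1..4}" for B i
    using that by (auto simp: M(1) sets_restrict_space)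
  define P where "P B \<longleftrightarrow> measure (M 1) (B \<inter> T) + measure (M 2) (B \<inter> T) = measure (M 3) (B \<inter> T) + measure (M 4) (B \<inter> T)" for B
  have Pcl: "P C" if "closed C" for C
  proof (cases "C = {}")
    case False
    note lim = measure_closed_limit[OF M cl that False]
    let ?g = "\<lambda>n x. max 0 (1 - real n * infdist x C)"
    have "(\<lambda>n. (\<integral>x. ?g n x \<partial>M 1) + (\<integral>x. ?g n x \<partial>M 2)) \<longlonglongrightarrow> measure (M 1) (C \<inter> T) + measure (M 2) (C \<inter> T)"
      by (intro tendsto_add lim) auto
    moreover have "(\<lambda>n. (\<integral>x. ?g n x \<partial>M 3) + (\<integral>x. ?g n x \<partial>M 4)) \<longlonglongrightarrow> measure (M 3) (C \<inter> T) + measure (M 4) (C \<inter> T)"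
      by (intro tendsto_add lim) auto
    moreover have "(\<integral>x. ?g n x \<partial>M 1) + (\<integral>x. ?g n x \<partial>M 2) = (\<integral>x. ?g n x \<partial>M 3) + (\<integral>x. ?g n x \<partial>M 4)" for n
      by (intro eq continuous_intros)
    ultimately show ?thesis unfolding P_def by (simp add: LIMSEQ_unique)
  qed (simp add: P_def)
  have P: "P B" if "B \<in> sets borel" for B
  proof -
    have mem: "B \<in> sigma_sets UNIV (Collect closed)" using that by (simp add: borel_eq_closed)
    have int: "Int_stable (Collect (closed :: 'a set \<Rightarrow> bool))" by (auto simp: Int_stable_def)
    have pow: "Collect (closed :: 'a set \<Rightarrow> bool) \<subseteq> Pow UNIV" by simp
    from int pow mem show ?thesis
    proof (induction rule: sigma_sets_induct_disjoint)
      case (basic B) then show ?case by (auto intro: Pcl)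
    next
      case empty then show ?case by (simp add: P_def)
    next
      case (compl B)
      have B: "B \<in> sets borel" using compl by (simp add: borel_eq_closed)
      have "measure (M i) ((UNIV - B) \<inter> T) = measure (M i) (UNIV \<inter> T) - measure (M i) (B \<inter> T)" if "i \<in> {1..4}" for i
      proof -
        interpret finite_measure "M i" by (rule M(2)[OF that])
        have "(UNIV - B) \<inter> T = space (M i) - B \<inter> T" by (auto simp: sp[OF that])
        then show ?thesis using finite_measure_compl[OF in_sets[OF B that]] by (simp add: sp[OF that])
      qed
      then show ?case using compl.IH Pcl[of UNIV] unfolding P_def by auto
    next
      case (union B)
      have B: "B n \<in> sets borel" for n using union.hyps by (auto simp: borel_eq_closed)
      have s: "(\<lambda>n. measure (M i) (B n \<inter> T)) sums measure (M i) ((\<Union>n. B n) \<inter> T)" if "i \<in> {1..4}" for i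
      proof -
        interpret finite_measure "M i" by (rule M(2)[OF that])
        have "(\<lambda>n. measure (M i) (B n \<inter> T)) sums measure (M i) (\<Union>n. B n \<inter> T)"
          by (rule finite_measure_UNION) (use in_sets[OF B that] union.hyps in \<open>auto simp: disjoint_family_on_def\<close>)
        then show ?thesis by simp
      qed
      have "(\<lambda>n. measure (M 1) (B n \<inter> T) + measure (M 2) (B n \<inter> T)) sums (measure (M 1) ((\<Union>n. B n) \<inter> T) + measure (M 2) ((\<Union>n. B n) \<inter> T))"
        by (intro sums_add s) auto
      moreover have "(\<lambda>n. measure (M 3) (B n \<inter> T) + measure (M 4) (B n \<inter> T)) sums (measure (M 3) ((\<Union>n. B n) \<inter> T) + measure (M 4) ((\<Union>n. B n) \<inter> T))"
        by (intro sums_add s) auto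
      moreover have "measure (M 1) (B n \<inter> T) + measure (M 2) (B n \<inter> T) = measure (M 3) (B n \<inter> T) + measure (M 4) (B n \<inter> T)" for n
        using union.IH unfolding P_def by blast
      ultimately show ?case unfolding P_def by (simp add: sums_unique2)
    qed
  qed
  obtain B where B: "B \<in> sets borel" "A = B \<inter> T" using A by (auto simp: sets_restrict_space)
  have em: "emeasure (M i) A = ennreal (measure (M i) A)" if "i \<in> {1..4}" for i
  proof -
    interpret finite_measure "M i" by (rule M(2)[OF that])
    show ?thesis by (rule emeasure_eq_measure)
  qed
  show ?thesis
    using P[OF B(1)] unfolding P_def B(2)[symmetric] by (simp add: em ennreal_plus[symmetric] del: ennreal_plus)
qed

text \<open>The passage back from sets to integrals, by induction over nonnegative measurable
  functions; signed test functions are treated later by adding a constant.\<close>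

lemma integral_add_eq:
  fixes T :: "'a::metric_space set" and g :: "'a \<Rightarrow> real"
  assumes T: "compact T" and M: "\<And>i. i \<in> {1..4} \<Longrightarrow> sets (M i) = sets (restrict_space borel T)"
    "\<And>i::nat. i \<in> {1..4} \<Longrightarrow> finite_measure (M i)"
    and eq: "\<And>A. A \<in> sets (restrict_space borel T) \<Longrightarrow> emeasure (M 1) A + emeasure (M 2) A = emeasure (M 3) A + emeasure (M 4) A"
    and g: "continuous_on T g" "\<And>x. x \<in> T \<Longrightarrow> 0 \<le> g x"
  shows "(\<integral>x. g x \<partial>M 1) + (\<integral>x. g x \<partial>M 2) = (\<integral>x. g x \<partial>M 3) + (\<integral>x. g x \<partial>M 4)"
proof -
  have sp: "space (M i) = T" if "i \<in> {1..4}" for i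
    using sets_eq_imp_space_eq[OF M(1)[OF that]] by (simp add: space_restrict_space)
  have meas: "f \<in> borel_measurable (M i)" if "f \<in> borel_measurable (restrict_space borel T)" "i \<in> {1..4}"
    for f :: "'a \<Rightarrow> ennreal" and i
    using that by (simp cong: measurable_cong_sets add: M(1))
  have main: "(\<integral>\<^sup>+x. f x \<partial>M 1) + (\<integral>\<^sup>+x. f x \<partial>M 2) = (\<integral>\<^sup>+x. f x \<partial>M 3) + (\<integral>\<^sup>+x. f x \<partial>M 4)"
    if "f \<in> borel_measurable (restrict_space borel T)" for f :: "'a \<Rightarrow> ennreal"
    using that
  proof (induction f rule: borel_measurable_induct)
    case (cong f g)
    have "(\<integral>\<^sup>+x. f x \<partial>M i) = (\<integral>\<^sup>+x. g x \<partial>M i)" if "i \<in> {1..4}" for i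
      by (rule nn_integral_cong) (use cong that in \<open>auto simp: sp space_restrict_space\<close>)
    then show ?case using cong by simp
  next
    case (set A)
    then show ?case using eq by (simp add: M(1))
  next
    case (mult u c)
    then show ?case by (simp add: nn_integral_cmult meas distrib_left[symmetric])
  next
    case (add u v)
    have "(\<integral>\<^sup>+x. v x + u x \<partial>M i) = (\<integral>\<^sup>+x. v x \<partial>M i) + (\<integral>\<^sup>+x. u x \<partial>M i)" if i: "i \<in> {1..4}" for i
      by (rule nn_integral_add) (rule meas[OF add.hyps(3) i], rule meas[OF add.hyps(1) i])
    note nn = this
    have "(\<integral>\<^sup>+x. v x + u x \<partial>M 1) + (\<integral>\<^sup>+x. v x + u x \<partial>M 2)
        = ((\<integral>\<^sup>+x. v x \<partial>M 1) + (\<integral>\<^sup>+x. v x \<partial>M 2)) + ((\<integral>\<^sup>+x. u x \<partial>M 1) + (\<integral>\<^sup>+x. u x \<partial>M 2))"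
      by (subst (1 2) nn) (simp_all add: ac_simps)
    also have "\<dots> = ((\<integral>\<^sup>+x. v x \<partial>M 3) + (\<integral>\<^sup>+x. v x \<partial>M 4)) + ((\<integral>\<^sup>+x. u x \<partial>M 3) + (\<integral>\<^sup>+x. u x \<partial>M 4))"
      by (simp only: add.IH)
    also have "\<dots> = (\<integral>\<^sup>+x. v x + u x \<partial>M 3) + (\<integral>\<^sup>+x. v x + u x \<partial>M 4)"
      by (subst (1 2) nn) (simp_all add: ac_simps)
    finally show ?case .
  next
    case (seq U)
    have *: "(\<integral>\<^sup>+x. (SUP i. U i) x \<partial>M j) = (SUP i. \<integral>\<^sup>+x. U i x \<partial>M j)" if j: "j \<in> {1..4}" for j
    proof -
      have "(\<integral>\<^sup>+x. (SUP i. U i) x \<partial>M j) = (\<integral>\<^sup>+x. (SUP i. U i x) \<partial>M j)" by (simp add: image_comp)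
      also have "\<dots> = (SUP i. \<integral>\<^sup>+x. U i x \<partial>M j)"
        by (rule nn_integral_monotone_convergence_SUP[OF \<open>incseq U\<close>]) (rule meas[OF seq.hyps(1) j])
      finally show ?thesis .
    qed
    have inc: "incseq (\<lambda>i. \<integral>\<^sup>+x. U i x \<partial>M j)" for j
      using \<open>incseq U\<close> by (auto simp: incseq_def le_fun_def intro!: nn_integral_mono)
    have "(SUP i. \<integral>\<^sup>+x. U i x \<partial>M 1) + (SUP i. \<integral>\<^sup>+x. U i x \<partial>M 2) = (SUP i. (\<integral>\<^sup>+x. U i x \<partial>M 1) + (\<integral>\<^sup>+x. U i x \<partial>M 2))"
      by (rule ennreal_SUP_add[OF inc inc, symmetric])
    also have "\<dots> = (SUP i. (\<integral>\<^sup>+x. U i x \<partial>M 3) + (\<integral>\<^sup>+x. U i x \<partial>M 4))"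
      by (simp only: seq.IH)
    also have "\<dots> = (SUP i. \<integral>\<^sup>+x. U i x \<partial>M 3) + (SUP i. \<integral>\<^sup>+x. U i x \<partial>M 4)"
      by (rule ennreal_SUP_add[OF inc inc])
    finally show ?case by (subst (1 2 3 4) *) auto
  qed
  have int: "(\<integral>\<^sup>+x. ennreal (g x) \<partial>M i) = ennreal (\<integral>x. g x \<partial>M i)" "0 \<le> (\<integral>x. g x \<partial>M i)" if i: "i \<in> {1..4}" for i
    by (auto intro!: nn_integral_eq_integral integrable_radon[OF M(1,2)[OF i] T g(1)] AE_I2 Bochner_Integration.integral_nonneg_AE
        simp: sp[OF i] g(2))
  have "(\<lambda>x. ennreal (g x)) \<in> borel_measurable (restrict_space borel T)"
    using borel_measurable_continuous_on_restrict[OF g(1)] by measurable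
  from main[OF this] show ?thesis
    by (simp add: int ennreal_plus[symmetric] del: ennreal_plus)
qed

section \<open>Measures given by an integral kernel\<close>

lemma continuous_on_compact_abs_bound:
  fixes u :: "'a::topological_space \<Rightarrow> real"
  assumes "compact S" "continuous_on S u"
  obtains B where "0 \<le> B" "\<And>x. x \<in> S \<Longrightarrow> \<bar>u x\<bar> \<le> B"
proof -
  have "bounded (u ` S)" by (intro compact_imp_bounded compact_continuous_image assms)
  then obtain B where B: "0 < B" "\<And>w. w \<in> u ` S \<Longrightarrow> norm w \<le> B" unfolding bounded_pos by blast
  show thesis
  proof
    show "0 \<le> B" using B(1) by simp
    show "\<bar>u x\<bar> \<le> B" if "x \<in> S" for x using B(2)[OF imageI[OF that]] by simp
  qed
qed

text \<open>The integrand carries the indicator because \<open>u\<close> will only be continuous on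
  the sphere and need not be Borel on the whole space.\<close>

definition sphere_average :: "('a::euclidean_space \<Rightarrow> real) \<Rightarrow> real" where
  "sphere_average u = (\<integral>s. indicator usphere s * u s \<partial>sphere_prob)"

lemma sphere_indicator_measurable:
  assumes "continuous_on usphere (u :: 'a::euclidean_space \<Rightarrow> real)"
  shows "(\<lambda>s. indicator usphere s * u s) \<in> borel_measurable borel"
proof -
  have "(\<lambda>s. indicator usphere s *\<^sub>R u s) \<in> borel_measurable borel"
    using borel_measurable_continuous_on_indicator[OF _ assms] by simp
  then show ?thesis by simp
qed

lemma sphere_average_integrable:
  assumes u: "continuous_on usphere (u :: 'a::euclidean_space \<Rightarrow> real)"
  shows "integrable sphere_prob (\<lambda>s. indicator usphere s * u s)"
proof -
  interpret prob_space "sphere_prob :: 'a measure" by (rule prob_space_sphere_prob)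
  obtain B where B: "0 \<le> B" "\<And>x. x \<in> usphere \<Longrightarrow> \<bar>u x\<bar> \<le> B"
    using continuous_on_compact_abs_bound[OF compact_sphere u] by metis
  show ?thesis
    by (rule integrable_const_bound[where B=B])
      (use B sphere_indicator_measurable[OF u] in \<open>auto simp: indicator_def cong: measurable_cong_sets\<close>)
qed

lemma sphere_average_cong:
  "(\<And>s. s \<in> usphere \<Longrightarrow> u s = v s) \<Longrightarrow> sphere_average u = sphere_average v"
  unfolding sphere_average_def by (intro Bochner_Integration.integral_cong) (auto simp: indicator_def)

lemma sphere_average_diff:
  assumes "continuous_on usphere u" "continuous_on usphere v"
  shows "sphere_average (\<lambda>s. u s - v s) = sphere_average u - sphere_average v"
  unfolding sphere_average_def
  by (subst Bochner_Integration.integral_diff[symmetric])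
    (auto intro!: sphere_average_integrable assms simp: right_diff_distrib)

lemma sphere_average_add:
  assumes "continuous_on usphere u" "continuous_on usphere v"
  shows "sphere_average (\<lambda>s. u s + v s) = sphere_average u + sphere_average v"
  unfolding sphere_average_def
  by (subst Bochner_Integration.integral_add[symmetric])
    (auto intro!: sphere_average_integrable assms simp: distrib_left)

lemma sphere_average_sum:
  assumes "\<And>k. k \<in> I \<Longrightarrow> continuous_on usphere (u k)"
  shows "sphere_average (\<lambda>s. \<Sum>k\<in>I. u k s) = (\<Sum>k\<in>I. sphere_average (u k))"
  unfolding sphere_average_def
  by (subst Bochner_Integration.integral_sum[symmetric])
    (auto intro!: sphere_average_integrable assms simp: sum_distrib_left)

lemma abs_sphere_average_le:
  fixes u :: "'a::euclidean_space \<Rightarrow> real"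
  assumes u: "continuous_on usphere u" and e: "\<And>s. s \<in> usphere \<Longrightarrow> \<bar>u s\<bar> \<le> e" "0 \<le> e"
  shows "\<bar>sphere_average u\<bar> \<le> e"
proof -
  interpret prob_space "sphere_prob :: 'a measure" by (rule prob_space_sphere_prob)
  have "\<bar>sphere_average u\<bar> \<le> (\<integral>s. \<bar>indicator usphere s * u s\<bar> \<partial>sphere_prob)"
    unfolding sphere_average_def by (rule integral_abs_bound)
  also have "\<dots> \<le> (\<integral>s. e \<partial>(sphere_prob :: 'a measure))"
    using e sphere_average_integrable[OF u] by (intro Bochner_Integration.integral_mono) (auto simp: indicator_def)
  finally show ?thesis by (simp add: prob_space[simplified])
qed

lemma sphere_average_rotate:
  fixes u :: "'a::euclidean_space \<Rightarrow> real" and \<phi> :: "'a \<Rightarrow> 'a"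
  assumes \<phi>: "orthogonal_transformation \<phi>" and u: "continuous_on usphere u"
  shows "sphere_average (\<lambda>s. u (\<phi> s)) = sphere_average u"
proof -
  let ?k = "\<lambda>s. indicator usphere s * u s"
  have [measurable]: "\<phi> \<in> borel_measurable borel" by (rule orthogonal_transformation_borel_measurable[OF \<phi>])
  have "sphere_average (\<lambda>s. u (\<phi> s)) = (\<integral>s. ?k (\<phi> s) \<partial>sphere_prob)"
    unfolding sphere_average_def
    by (intro Bochner_Integration.integral_cong) (auto simp: indicator_def orthogonal_transformation_norm[OF \<phi>])
  also have "\<dots> = (\<integral>s. ?k s \<partial>distr sphere_prob borel \<phi>)"
    using sphere_indicator_measurable[OF u] by (subst integral_distr) auto
  finally show ?thesis by (simp add: sphere_prob_rotate[OF \<phi>] sphere_average_def)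
qed

definition sphere_area :: "'a::euclidean_space itself \<Rightarrow> real" where
  "sphere_area _ = measure (hausdorff (DIM('a) - 1)) (usphere :: 'a set)"

lemma sphere_area_pos: "0 < sphere_area TYPE('a::euclidean_space)"
  using emeasure_hausdorff_usphere[where 'a='a] unfolding sphere_area_def
  by (simp add: measure_def enn2real_positive_iff less_top zero_less_iff_neq_zero)

lemma set_integral_usphere:
  fixes u :: "'a::euclidean_space \<Rightarrow> real"
  assumes u: "continuous_on usphere u"
  shows "(LINT s:usphere|hausdorff (DIM('a) - 1). u s) = sphere_area TYPE('a) * sphere_average u"
proof -
  have "(\<lambda>s. indicator usphere s * u s) \<in> borel_measurable (hausdorff (DIM('a) - 1))"
    using sphere_indicator_measurable[OF u] by (simp cong: measurable_cong_sets)
  from integral_uniform_measure[OF emeasure_hausdorff_usphere this]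
  have "sphere_average u = (LINT s:usphere|hausdorff (DIM('a) - 1). indicator usphere s * u s) / sphere_area TYPE('a)"
    unfolding sphere_average_def sphere_prob_def sphere_area_def .
  moreover have "(LINT s:usphere|hausdorff (DIM('a) - 1). indicator usphere s * u s) = (LINT s:usphere|hausdorff (DIM('a) - 1). u s)"
    unfolding set_lebesgue_integral_def by (intro Bochner_Integration.integral_cong) (auto simp: indicator_def)
  ultimately show ?thesis using sphere_area_pos[where 'a='a] by simp
qed

text \<open>For fixed s, weak* continuity handles the dependence on l. The dependence on s is
  uniform in l near the given point: \<open>R\<close> is uniformly continuous, and the test function
  1 shows that the masses of \<tau> are locally bounded.\<close>

lemma continuous_on_kernel:
  fixes R :: "'a::heine_borel \<Rightarrow> real \<Rightarrow> real"
  assumes R: "continuous_on (S \<times> {-1..1}) (\<lambda>(s, \<alpha>). R s \<alpha>)" and S: "compact S"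
    and \<tau>: "\<tau> \<in> {0..} \<rightarrow> radon_measures {-1..1}" and w: "weak_star_continuous_param \<tau>"
  shows "continuous_on (S \<times> {0..}) (\<lambda>(s, l). \<integral>\<alpha>. R s \<alpha> \<partial>\<tau> l)"
  unfolding continuous_on_iff
proof (intro ballI allI impI)
  fix p :: "'a \<times> real" and e :: real assume p: "p \<in> S \<times> {0..}" and e: "0 < e"
  define s l where "s = fst p" and "l = snd p"
  have sl: "s \<in> S" "0 \<le> l" using p by (auto simp: s_def l_def mem_Times_iff)
  have rad: "sets (\<tau> t) = sets (restrict_space borel {-1..1})" "finite_measure (\<tau> t)" "space (\<tau> t) = {-1..1}" if "0 \<le> t" for t
    using radon_measuresD \<tau> that by (metis Pi_mem atLeast_iff)+
  have Rs: "continuous_on {-1..1} (R s)" if "s \<in> S" for s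
  proof -
    have "continuous_on {-1..1} (\<lambda>\<alpha>. (\<lambda>(s, \<alpha>). R s \<alpha>) (s, \<alpha>))"
      by (rule continuous_on_compose2[OF R]) (use that in \<open>auto intro!: continuous_on_Pair continuous_on_id continuous_on_const\<close>)
    then show ?thesis by simp
  qed
  have int: "integrable (\<tau> t) (R s)" if "s \<in> S" "0 \<le> t" for s t
    by (rule integrable_radon[OF rad(1,2)[OF that(2)] compact_Icc Rs[OF that(1)]])
  have mass: "continuous_on {0..} (\<lambda>t. \<integral>\<alpha>. (1::real) \<partial>\<tau> t)"
    using w[unfolded weak_star_continuous_param_def, rule_format, of "\<lambda>_. 1"] by simp
  obtain d0 where d0: "0 < d0" "\<And>t. 0 \<le> t \<Longrightarrow> \<bar>t - l\<bar> < d0 \<Longrightarrow> \<bar>(\<integral>\<alpha>. (1::real) \<partial>\<tau> t) - (\<integral>\<alpha>. 1 \<partial>\<tau> l)\<bar> < 1"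
    using mass sl unfolding continuous_on_iff dist_real_def by (metis atLeast_iff zero_less_one)
  define B where "B = \<bar>\<integral>\<alpha>. (1::real) \<partial>\<tau> l\<bar> + 1"
  have B: "0 < B" by (simp add: B_def add_nonneg_pos)
  have "uniformly_continuous_on (S \<times> {-1..1}) (\<lambda>(s, \<alpha>). R s \<alpha>)"
    by (intro compact_uniformly_continuous R compact_Times S) auto
  then obtain d1 where d1: "0 < d1" "\<And>x y. x \<in> S \<times> {-1..1} \<Longrightarrow> y \<in> S \<times> {-1..1} \<Longrightarrow> dist y x < d1 \<Longrightarrow>
     dist ((\<lambda>(s, \<alpha>). R s \<alpha>) y) ((\<lambda>(s, \<alpha>). R s \<alpha>) x) < e / (2 * B)"
    using e B unfolding uniformly_continuous_on_def by (metis divide_pos_pos mult_pos_pos zero_less_numeral)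
  have "continuous_on {0..} (\<lambda>t. \<integral>\<alpha>. R s \<alpha> \<partial>\<tau> t)"
    using w Rs[OF sl(1)] unfolding weak_star_continuous_param_def by blast
  then obtain d2 where d2: "0 < d2" "\<And>t. 0 \<le> t \<Longrightarrow> \<bar>t - l\<bar> < d2 \<Longrightarrow> \<bar>(\<integral>\<alpha>. R s \<alpha> \<partial>\<tau> t) - (\<integral>\<alpha>. R s \<alpha> \<partial>\<tau> l)\<bar> < e / 2"
    using sl e unfolding continuous_on_iff dist_real_def by (metis atLeast_iff half_gt_zero)
  show "\<exists>d>0. \<forall>q\<in>S \<times> {0..}. dist q p < d \<longrightarrow>
      dist (case q of (s, l) \<Rightarrow> \<integral>\<alpha>. R s \<alpha> \<partial>\<tau> l) (case p of (s, l) \<Rightarrow> \<integral>\<alpha>. R s \<alpha> \<partial>\<tau> l) < e"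
  proof (intro exI[of _ "min d0 (min d1 d2)"] conjI ballI impI)
    fix q assume q: "q \<in> S \<times> {0..}" and dq: "dist q p < min d0 (min d1 d2)"
    define s' t where "s' = fst q" and "t = snd q"
    have st: "s' \<in> S" "0 \<le> t" using q by (auto simp: s'_def t_def mem_Times_iff)
    interpret finite_measure "\<tau> t" by (rule rad(2)[OF st(2)])
    have ds: "dist s' s < d1" "\<bar>t - l\<bar> < d0" "\<bar>t - l\<bar> < d2"
      using dist_fst_le[of q p] dist_snd_le[of q p] dq by (auto simp: s_def s'_def l_def t_def dist_real_def)
    have mB: "measure (\<tau> t) (space (\<tau> t)) \<le> B"
      using d0(2)[OF st(2) ds(2)] by (simp add: B_def)
    have "\<bar>(\<integral>\<alpha>. R s' \<alpha> \<partial>\<tau> t) - (\<integral>\<alpha>. R s \<alpha> \<partial>\<tau> t)\<bar> = \<bar>\<integral>\<alpha>. R s' \<alpha> - R s \<alpha> \<partial>\<tau> t\<bar>"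
      by (simp add: Bochner_Integration.integral_diff int st sl)
    also have "\<dots> \<le> (\<integral>\<alpha>. \<bar>R s' \<alpha> - R s \<alpha>\<bar> \<partial>\<tau> t)" by (rule integral_abs_bound)
    also have "\<dots> \<le> (\<integral>\<alpha>. e / (2 * B) \<partial>\<tau> t)"
    proof (rule Bochner_Integration.integral_mono)
      fix \<alpha> assume "\<alpha> \<in> space (\<tau> t)"
      then have "\<alpha> \<in> {-1..1}" using rad(3)[OF st(2)] by simp
      then show "\<bar>R s' \<alpha> - R s \<alpha>\<bar> \<le> e / (2 * B)"
        using d1(2)[of "(s, \<alpha>)" "(s', \<alpha>)"] st sl ds(1) by (auto simp: dist_Pair_Pair dist_real_def)
    qed (auto intro!: integrable_abs Bochner_Integration.integrable_diff int st sl)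
    also have "\<dots> = measure (\<tau> t) (space (\<tau> t)) * (e / (2 * B))" by simp
    also have "\<dots> \<le> B * (e / (2 * B))" using mB e B by (intro mult_right_mono) auto
    also have "\<dots> = e / 2" using B by simp
    finally have "\<bar>(\<integral>\<alpha>. R s' \<alpha> \<partial>\<tau> t) - (\<integral>\<alpha>. R s \<alpha> \<partial>\<tau> t)\<bar> \<le> e / 2" .
    with d2(2)[OF st(2) ds(3)] have "\<bar>(\<integral>\<alpha>. R s' \<alpha> \<partial>\<tau> t) - (\<integral>\<alpha>. R s \<alpha> \<partial>\<tau> l)\<bar> < e" by linarith
    then show "dist (case q of (s, l) \<Rightarrow> \<integral>\<alpha>. R s \<alpha> \<partial>\<tau> l) (case p of (s, l) \<Rightarrow> \<integral>\<alpha>. R s \<alpha> \<partial>\<tau> l) < e"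
      by (simp add: case_prod_beta s_def l_def s'_def t_def dist_real_def)
  qed (use d0 d1 d2 in auto)
qed

text \<open>Links test functions that are continuous on the sphere only with the results on
  \<open>Rbar\<close> that ask for functions on the whole space.\<close>

lemma continuous_on_usphere_extension:
  fixes g :: "'a::euclidean_space \<Rightarrow> real"
  assumes "continuous_on usphere g"
  obtains h :: "'a \<Rightarrow> real" where "continuous_on UNIV h" "\<And>x. x \<in> usphere \<Longrightarrow> h x = g x"
  using Tietze_unbounded[OF assms, of UNIV] by auto

lemma continuous_on_Rbar':
  fixes g :: "'a::euclidean_space \<Rightarrow> real"
  assumes dim: "2 \<le> DIM('a)" and g: "continuous_on usphere g"
  shows "continuous_on (usphere \<times> {-1..1}) (\<lambda>(s, \<alpha>). Rbar g s \<alpha>)"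
proof -
  obtain h where h: "continuous_on UNIV h" "\<And>x. x \<in> usphere \<Longrightarrow> h x = g x"
    using continuous_on_usphere_extension[OF g] by metis
  have "continuous_on (usphere \<times> {-1..1}) (\<lambda>(s, \<alpha>). Rbar h s \<alpha>)" by (rule continuous_on_Rbar[OF dim h(1)])
  then show ?thesis
    by (rule continuous_on_eq) (use Rbar_cong[OF h(2)] in auto)
qed

lemma Rbar_rotate':
  fixes g :: "'a::euclidean_space \<Rightarrow> real" and \<phi> :: "'a \<Rightarrow> 'a"
  assumes dim: "2 \<le> DIM('a)" and g: "continuous_on usphere g" and \<phi>: "orthogonal_transformation \<phi>"
    and s: "s \<in> usphere" and \<alpha>: "\<alpha> \<in> {-1..1}"
  shows "Rbar (g \<circ> \<phi>) s \<alpha> = Rbar g (\<phi> s) \<alpha>"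
proof -
  obtain h where h: "continuous_on UNIV h" "\<And>x. x \<in> usphere \<Longrightarrow> h x = g x"
    using continuous_on_usphere_extension[OF g] by metis
  have \<phi>s: "\<phi> x \<in> usphere" if "x \<in> usphere" for x using that orthogonal_transformation_norm[OF \<phi>] by simp
  have "Rbar (g \<circ> \<phi>) s \<alpha> = Rbar (\<lambda>x. h (\<phi> x)) s \<alpha>"
  proof (rule Rbar_cong[OF _ s])
    show "(g \<circ> \<phi>) x = h (\<phi> x)" if "x \<in> usphere" for x using h(2)[OF \<phi>s[OF that]] by simp
  qed
  also have "\<dots> = Rbar h (\<phi> s) \<alpha>"
    by (rule Rbar_rotate[OF dim \<phi> s \<alpha>]) (rule borel_measurable_continuous_onI[OF h(1)])
  also have "\<dots> = Rbar g (\<phi> s) \<alpha>" by (rule Rbar_cong[OF h(2) \<phi>s[OF s]])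
  finally show ?thesis .
qed

theorem kernel_imp_valuation:
  fixes Z :: "'a::euclidean_space set \<Rightarrow> 'a measure"
  assumes dim: "2 \<le> DIM('a)" and Z: "Z \<in> star_bodies \<rightarrow> radon_measures usphere"
    and \<tau>: "\<tau> \<in> {0..} \<rightarrow> radon_measures {-1..1}" and w: "weak_star_continuous_param \<tau>"
    and \<tau>0: "\<tau> 0 = zero_measure {-1..1}"
    and rep: "\<And>L g. L \<in> star_bodies \<Longrightarrow> continuous_on usphere g \<Longrightarrow> (\<integral>x. g x \<partial>Z L) =
      (LINT s:usphere|hausdorff (DIM('a) - 1). (\<integral>\<alpha>. Rbar g s \<alpha> \<partial>\<tau> (radial L s)))"
  shows "weak_star_continuous Z" "rotation_equivariant Z" "valuation Z" "Z {0} = zero_measure usphere"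
proof -
  define G where "G g s l = (\<integral>\<alpha>. Rbar g s \<alpha> \<partial>\<tau> l)" for g and s :: 'a and l
  let ?A = "sphere_area TYPE('a)"
  have Gc: "continuous_on (usphere \<times> {0..}) (\<lambda>(s, l). G g s l)" if "continuous_on usphere g" for g
    unfolding G_def by (rule continuous_on_kernel[OF continuous_on_Rbar'[OF dim that] _ \<tau> w]) simp
  have Gf: "continuous_on usphere (\<lambda>s. G g s (f s))" if "continuous_on usphere g" "radial_fun f" for g f
  proof -
    have "continuous_on usphere (\<lambda>s. (\<lambda>(s, l). G g s l) (s, f s))"
      by (rule continuous_on_compose2[OF Gc[OF that(1)]])
        (use that(2) in \<open>auto simp: radial_fun_def intro!: continuous_on_Pair continuous_on_id\<close>)
    then show ?thesis by simp
  qed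
  have rf: "radial_fun (radial L)" if "L \<in> star_bodies" for L :: "'a set" by (rule star_bodies_radial_fun[OF that])
  have rep': "(\<integral>x. g x \<partial>Z L) = ?A * sphere_average (\<lambda>s. G g s (radial L s))"
    if "L \<in> star_bodies" "continuous_on usphere g" for L g
    unfolding rep[OF that] G_def[symmetric] by (rule set_integral_usphere[OF Gf[OF that(2) rf[OF that(1)]]])
  have ZD: "sets (Z L) = sets (restrict_space borel usphere)" "finite_measure (Z L)" "space (Z L) = usphere"
    if "L \<in> star_bodies" for L
    using radon_measuresD[of "Z L" usphere] Z that by auto
  show "weak_star_continuous Z"
    unfolding weak_star_continuous_def
  proof (intro allI impI ballI)
    fix g :: "'a \<Rightarrow> real" and L :: "'a set" and e :: real
    assume g: "continuous_on usphere g" and L: "L \<in> star_bodies" and e: "0 < e"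
    obtain B where B: "\<And>s. s \<in> usphere \<Longrightarrow> \<bar>radial L s\<bar> \<le> B"
      using continuous_on_compact_abs_bound[OF compact_sphere radial_fun_continuous[OF rf[OF L]]] by metis
    \<comment> \<open>Radial functions within distance 1 of that of \<open>L\<close> stay below
      \<open>B + 1\<close>, so joint uniform continuity on this compact set serves all nearby
      bodies.\<close>
    let ?K = "usphere \<times> {0..B + 1} :: ('a \<times> real) set"
    define e' where "e' = e / (2 * ?A)"
    have e': "0 < e'" using e sphere_area_pos[where 'a='a] by (simp add: e'_def)
    have "uniformly_continuous_on ?K (\<lambda>(s, l). G g s l)"
      by (intro compact_uniformly_continuous continuous_on_subset[OF Gc[OF g]] compact_Times) auto
    then obtain d where d: "0 < d" "\<And>x y. x \<in> ?K \<Longrightarrow> y \<in> ?K \<Longrightarrow> dist y x < d \<Longrightarrow>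
        dist ((\<lambda>(s, l). G g s l) y) ((\<lambda>(s, l). G g s l) x) < e'"
      using e' unfolding uniformly_continuous_on_def by metis
    show "\<exists>d>0. \<forall>K\<in>star_bodies. radial_dist K L < d \<longrightarrow> \<bar>(\<integral>x. g x \<partial>Z K) - (\<integral>x. g x \<partial>Z L)\<bar> < e"
    proof (intro exI[of _ "min d 1"] conjI ballI impI)
      fix K assume K: "K \<in> star_bodies" and dist: "radial_dist K L < min d 1"
      have close: "\<bar>G g s (radial K s) - G g s (radial L s)\<bar> \<le> e'" if s: "s \<in> usphere" for s
      proof -
        have "\<bar>radial K s - radial L s\<bar> < min d 1" using abs_radial_diff_le[OF K L s] dist by linarith
        moreover have "0 \<le> radial K s" "0 \<le> radial L s" using radial_fun_nonneg[OF rf s] K L by auto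
        moreover have "radial K s \<le> B + 1" "radial L s \<le> B + 1" using calculation B[OF s] by linarith+
        ultimately show ?thesis
          using d(2)[of "(s, radial L s)" "(s, radial K s)"] s by (auto simp: dist_Pair_Pair dist_real_def)
      qed
      have "(\<integral>x. g x \<partial>Z K) - (\<integral>x. g x \<partial>Z L) = ?A * sphere_average (\<lambda>s. G g s (radial K s) - G g s (radial L s))"
        by (simp add: rep' K L g sphere_average_diff Gf rf right_diff_distrib)
      then have "\<bar>(\<integral>x. g x \<partial>Z K) - (\<integral>x. g x \<partial>Z L)\<bar> = ?A * \<bar>sphere_average (\<lambda>s. G g s (radial K s) - G g s (radial L s))\<bar>"
        using sphere_area_pos[where 'a='a] by (simp add: abs_mult)
      also have "\<dots> \<le> ?A * e'"
        using sphere_area_pos[where 'a='a] e' close K L g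
        by (intro mult_left_mono abs_sphere_average_le continuous_intros Gf rf) auto
      also have "\<dots> < e" using e sphere_area_pos[where 'a='a] by (simp add: e'_def)
      finally show "\<bar>(\<integral>x. g x \<partial>Z K) - (\<integral>x. g x \<partial>Z L)\<bar> < e" .
    qed (use d in auto)
  qed
  show "rotation_equivariant Z"
    unfolding rotation_equivariant_def
  proof (intro allI impI ballI)
    fix g :: "'a \<Rightarrow> real" and L :: "'a set" and \<phi> :: "'a \<Rightarrow> 'a"
    assume L: "L \<in> star_bodies" and g: "continuous_on usphere g" and \<phi>: "orthogonal_transformation \<phi>"
    have i\<phi>: "orthogonal_transformation (inv \<phi>)" by (rule orthogonal_transformation_inv[OF \<phi>])
    have rL: "radial_fun (radial L \<circ> inv \<phi>)" by (rule radial_fun_rotate[OF i\<phi> rf[OF L]])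
    have \<phi>L: "\<phi> ` L = body (radial L \<circ> inv \<phi>)" using body_radial[OF L] body_rotate[OF \<phi>] by metis
    have \<phi>Ls: "\<phi> ` L \<in> star_bodies" unfolding \<phi>L by (rule body_in_star_bodies[OF rL])
    have isp: "inv \<phi> s \<in> usphere" if "s \<in> usphere" for s using that orthogonal_transformation_norm[OF i\<phi>] by simp
    have g\<phi>: "continuous_on usphere (g \<circ> inv \<phi>)"
    proof -
      have "continuous_on usphere (inv \<phi>)"
        using i\<phi> by (simp add: orthogonal_transformation_def linear_continuous_on linear_linear)
      then show ?thesis unfolding o_def by (rule continuous_on_compose2[OF g]) (use isp in auto)
    qed
    have "(\<integral>x. (g \<circ> inv \<phi>) x \<partial>Z (\<phi> ` L)) = ?A * sphere_average (\<lambda>s. G (g \<circ> inv \<phi>) s (radial (\<phi> ` L) s))"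
      by (rule rep'[OF \<phi>Ls g\<phi>])
    also have "sphere_average (\<lambda>s. G (g \<circ> inv \<phi>) s (radial (\<phi> ` L) s)) = sphere_average (\<lambda>s. (\<lambda>s. G g s (radial L s)) (inv \<phi> s))"
    proof (rule sphere_average_cong)
      fix s :: 'a assume s: "s \<in> usphere"
      have l: "radial (\<phi> ` L) s = radial L (inv \<phi> s)" unfolding \<phi>L using radial_body[OF rL s] by simp
      have "space (\<tau> (radial L (inv \<phi> s))) = {-1..1}"
        using radon_measuresD(3)[of "\<tau> (radial L (inv \<phi> s))"] \<tau> radial_fun_nonneg[OF rf[OF L] isp[OF s]] by auto
      then show "G (g \<circ> inv \<phi>) s (radial (\<phi> ` L) s) = G g (inv \<phi> s) (radial L (inv \<phi> s))"
        unfolding l G_def by (intro Bochner_Integration.integral_cong refl) (use Rbar_rotate'[OF dim g i\<phi> s] in auto)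
    qed
    also have "\<dots> = sphere_average (\<lambda>s. G g s (radial L s))"
      by (rule sphere_average_rotate[OF i\<phi> Gf[OF g rf[OF L]]])
    finally show "(\<integral>x. (g \<circ> inv \<phi>) x \<partial>Z (\<phi> ` L)) = (\<integral>x. g x \<partial>Z L)" by (simp add: rep'[OF L g])
  qed
  show "valuation Z"
    unfolding valuation_def
  proof (intro ballI)
    fix K L A :: "'a set" assume K: "K \<in> star_bodies" and L: "L \<in> star_bodies"
      and A: "A \<in> sets (restrict_space borel usphere)"
    let ?f = "radial K" let ?g = "radial L"
    have Kf: "K = body ?f" and Lf: "L = body ?g" by (rule body_radial[OF K], rule body_radial[OF L])
    have max: "radial_fun (\<lambda>s. max (?f s) (?g s))" and min: "radial_fun (\<lambda>s. min (?f s) (?g s))"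
      by (intro radial_fun_max radial_fun_min rf K L)+
    have U: "K \<union> L = body (\<lambda>s. max (?f s) (?g s))" using body_Un[of ?f ?g] Kf Lf by simp
    have I: "K \<inter> L = body (\<lambda>s. min (?f s) (?g s))" using body_Int[OF rf[OF K] rf[OF L]] Kf Lf by simp
    have UI: "K \<union> L \<in> star_bodies" "K \<inter> L \<in> star_bodies"
      unfolding U I by (intro body_in_star_bodies max min)+
    define M where "M i = (if i = 1 then Z (K \<union> L) else if i = 2 then Z (K \<inter> L) else if i = 3 then Z K else Z L)" for i :: nat
    have "emeasure (M 1) A + emeasure (M 2) A = emeasure (M 3) A + emeasure (M 4) A"
    proof (rule measure_add_eqI[OF _ _ _ _ A])
      fix g :: "'a \<Rightarrow> real" assume g: "continuous_on usphere g"
      have "sphere_average (\<lambda>s. G g s (radial (K \<union> L) s)) + sphere_average (\<lambda>s. G g s (radial (K \<inter> L) s))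
          = sphere_average (\<lambda>s. G g s (radial (K \<union> L) s) + G g s (radial (K \<inter> L) s))"
        by (simp add: sphere_average_add Gf g rf UI)
      \<comment> \<open>At each point the maximum and the minimum are the two values in some order,
        so a functional that depends on the body pointwise through its radial function is a
        valuation.\<close>
      also have "\<dots> = sphere_average (\<lambda>s. G g s (?f s) + G g s (?g s))"
      proof (rule sphere_average_cong)
        fix s :: 'a assume s: "s \<in> usphere"
        have "radial (K \<union> L) s = max (?f s) (?g s)" "radial (K \<inter> L) s = min (?f s) (?g s)"
          unfolding U I using radial_body[OF max s] radial_body[OF min s] by auto
        then show "G g s (radial (K \<union> L) s) + G g s (radial (K \<inter> L) s) = G g s (?f s) + G g s (?g s)"
          by (simp add: max_def min_def)
      qed
      also have "\<dots> = sphere_average (\<lambda>s. G g s (?f s)) + sphere_average (\<lambda>s. G g s (?g s))"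
        by (simp add: sphere_average_add Gf g rf K L)
      finally show "(\<integral>x. g x \<partial>M 1) + (\<integral>x. g x \<partial>M 2) = (\<integral>x. g x \<partial>M 3) + (\<integral>x. g x \<partial>M 4)"
        by (simp add: M_def rep' K L UI g distrib_left[symmetric])
    qed (auto simp: M_def ZD K L UI)
    then show "emeasure (Z (K \<union> L)) A + emeasure (Z (K \<inter> L)) A = emeasure (Z K) A + emeasure (Z L) A"
      by (simp add: M_def)
  qed
  have zero: "radial_fun (\<lambda>_ :: 'a. 0)" by (simp add: radial_fun_def)
  have Z0: "{0} \<in> (star_bodies :: 'a set set)" using body_in_star_bodies[OF zero] by (simp add: body_zero)
  have r0: "radial {0} s = 0" if "s \<in> usphere" for s :: 'a using radial_body[OF zero that] by (simp add: body_zero)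
  interpret Z0: finite_measure "Z {0}" by (rule ZD(2)[OF Z0])
  \<comment> \<open>The constant test function measures the total mass; a nonnegative measure of
    mass 0 is the zero measure.\<close>
  have "sphere_average (\<lambda>s. G (\<lambda>_. 1) s (radial {0} s)) = sphere_average (\<lambda>_ :: 'a. 0)"
    by (rule sphere_average_cong) (simp add: r0 G_def \<tau>0 integral_null_measure)
  then have "(\<integral>x. 1 \<partial>Z {0}) = (0::real)" by (subst rep'[OF Z0]) (auto simp: sphere_average_def)
  then have em: "emeasure (Z {0}) (space (Z {0})) = 0" by (simp add: Z0.emeasure_eq_measure)
  show "Z {0} = zero_measure usphere"
  proof (rule measure_eqI)
    fix A assume "A \<in> sets (Z {0})"
    then have "emeasure (Z {0}) A \<le> emeasure (Z {0}) (space (Z {0}))" by (intro emeasure_mono sets.sets_into_space) auto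
    then show "emeasure (Z {0}) A = emeasure (zero_measure usphere) A" using em by simp
  qed (simp add: ZD(1)[OF Z0])
qed

section \<open>Equivariant valuations\<close>

lemma radial_fun_const: "0 \<le> c \<Longrightarrow> radial_fun (\<lambda>_. c)"
  by (simp add: radial_fun_def)

lemma radial_fun_add: "radial_fun f \<Longrightarrow> radial_fun h \<Longrightarrow> radial_fun (\<lambda>s. f s + h s)"
  by (auto simp: radial_fun_def intro!: continuous_intros)

lemma radial_fun_mult: "radial_fun f \<Longrightarrow> radial_fun h \<Longrightarrow> radial_fun (\<lambda>s. f s * h s)"
  by (auto simp: radial_fun_def intro!: continuous_intros)

lemma radial_fun_sum: "(\<And>i. i \<in> I \<Longrightarrow> radial_fun (f i)) \<Longrightarrow> radial_fun (\<lambda>s. \<Sum>i\<in>I. f i s)"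
  by (auto simp: radial_fun_def intro!: continuous_intros sum_nonneg)

lemma radial_fun_prod: "(\<And>i. i \<in> I \<Longrightarrow> radial_fun (f i)) \<Longrightarrow> radial_fun (\<lambda>s. \<Prod>i\<in>I. f i s)"
  by (auto simp: radial_fun_def intro!: continuous_intros prod_nonneg)

lemmas radial_fun_intros = radial_fun_const radial_fun_add radial_fun_mult radial_fun_sum radial_fun_prod
  radial_fun_max radial_fun_min

section \<open>The valuation as a functional of a test function and a radial function\<close>

locale equivariant_valuation =
  fixes Z :: "'a::euclidean_space set \<Rightarrow> 'a measure"
  assumes dim: "2 \<le> DIM('a)"
    and radon: "Z \<in> star_bodies \<rightarrow> radon_measures usphere"
    and continuous: "weak_star_continuous Z"
    and equivariant: "rotation_equivariant Z"
    and valuation: "valuation Z"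
    and zero: "Z {0} = zero_measure usphere"
begin

definition V :: "('a \<Rightarrow> real) \<Rightarrow> ('a \<Rightarrow> real) \<Rightarrow> real" where
  "V g f = (\<integral>x. g x \<partial>Z (body f))"

text \<open>The total mass. As the values of \<open>Z\<close> are nonnegative measures, it dominates
  \<open>V g\<close> for every test function (\<open>abs_V_le\<close>), so all smallness statements
  are made for it alone.\<close>

abbreviation V1 :: "('a \<Rightarrow> real) \<Rightarrow> real" where
  "V1 \<equiv> V (\<lambda>_. 1)"

lemma Z_body:
  assumes "radial_fun f"
  shows "sets (Z (body f)) = sets (restrict_space borel usphere)" "finite_measure (Z (body f))" "space (Z (body f)) = usphere"
  using radon_measuresD[of "Z (body f)" usphere] radon body_in_star_bodies[OF assms] by auto

lemma integrable_Z:
  "radial_fun f \<Longrightarrow> continuous_on usphere g \<Longrightarrow> integrable (Z (body f)) (g :: 'a \<Rightarrow> real)"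
  by (rule integrable_radon[OF Z_body(1,2) compact_sphere])

lemma V_cong: "(\<And>s. s \<in> usphere \<Longrightarrow> f s = h s) \<Longrightarrow> V g f = V g h"
  unfolding V_def using body_cong[of f h] by simp

lemma V_cong_test: "radial_fun f \<Longrightarrow> (\<And>s. s \<in> usphere \<Longrightarrow> g s = h s) \<Longrightarrow> V g f = V h f"
  unfolding V_def by (intro Bochner_Integration.integral_cong) (auto simp: Z_body)

lemma V_zero [simp]: "V g (\<lambda>_. 0) = 0"
  unfolding V_def body_zero zero by (simp add: integral_null_measure)

lemma V_eq_zero: "(\<And>s. s \<in> usphere \<Longrightarrow> f s = 0) \<Longrightarrow> V g f = 0"
  using V_cong[of f "\<lambda>_. 0" g] by simp

lemma V_add: "radial_fun f \<Longrightarrow> continuous_on usphere g \<Longrightarrow> continuous_on usphere h \<Longrightarrow>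
  V (\<lambda>s. g s + h s) f = V g f + V h f"
  unfolding V_def by (intro Bochner_Integration.integral_add integrable_Z)

lemma V_diff: "radial_fun f \<Longrightarrow> continuous_on usphere g \<Longrightarrow> continuous_on usphere h \<Longrightarrow>
  V (\<lambda>s. g s - h s) f = V g f - V h f"
  unfolding V_def by (intro Bochner_Integration.integral_diff integrable_Z)

lemma V_cmult: "V (\<lambda>s. c * g s) f = c * V g f"
  unfolding V_def by simp

lemma V_mono: "radial_fun f \<Longrightarrow> continuous_on usphere g \<Longrightarrow> continuous_on usphere h \<Longrightarrow>
  (\<And>s. s \<in> usphere \<Longrightarrow> g s \<le> h s) \<Longrightarrow> V g f \<le> V h f"
  unfolding V_def by (intro Bochner_Integration.integral_mono integrable_Z) (auto simp: Z_body)

lemma V1_nonneg: "0 \<le> V1 f"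
  unfolding V_def by (intro Bochner_Integration.integral_nonneg) simp

lemma abs_V_le:
  assumes "radial_fun f" "continuous_on usphere g" "\<And>s. s \<in> usphere \<Longrightarrow> \<bar>g s\<bar> \<le> B"
  shows "\<bar>V g f\<bar> \<le> B * V1 f"
proof -
  have "V g f \<le> V (\<lambda>s. B * 1) f" "V (\<lambda>s. (- B) * 1) f \<le> V g f"
    by (intro V_mono assms continuous_intros; use assms(3) in \<open>auto simp: abs_le_iff\<close>; fastforce)+
  then show ?thesis unfolding V_cmult by (simp add: abs_le_iff)
qed

lemma V_valuation:
  assumes f: "radial_fun f" and h: "radial_fun h" and g: "continuous_on usphere g"
  shows "V g (\<lambda>s. max (f s) (h s)) + V g (\<lambda>s. min (f s) (h s)) = V g f + V g h"
proof -
  have pos: "V k (\<lambda>s. max (f s) (h s)) + V k (\<lambda>s. min (f s) (h s)) = V k f + V k h"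
    if k: "continuous_on usphere k" "\<And>s. s \<in> usphere \<Longrightarrow> 0 \<le> k s" for k
  proof -
    define M where "M i = (if i = 1 then Z (body (\<lambda>s. max (f s) (h s))) else if i = 2 then Z (body (\<lambda>s. min (f s) (h s)))
      else if i = 3 then Z (body f) else Z (body h))" for i :: nat
    have "(\<integral>x. k x \<partial>M 1) + (\<integral>x. k x \<partial>M 2) = (\<integral>x. k x \<partial>M 3) + (\<integral>x. k x \<partial>M 4)"
    proof (rule integral_add_eq[OF compact_sphere _ _ _ k])
      fix A :: "'a set" assume A: "A \<in> sets (restrict_space borel (sphere 0 1))"
      show "emeasure (M 1) A + emeasure (M 2) A = emeasure (M 3) A + emeasure (M 4) A"
        using valuation[unfolded valuation_def, rule_format, OF body_in_star_bodies[OF f] body_in_star_bodies[OF h] A]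
        by (simp add: M_def body_Un body_Int[OF f h])
    qed (auto simp: M_def Z_body f h radial_fun_max radial_fun_min)
    then show ?thesis by (simp add: M_def V_def)
  qed
  \<comment> \<open>A signed test function is the difference of \<open>g + B\<close> and the
    constant \<open>B\<close>, both nonnegative on the sphere.\<close>
  obtain B where B: "\<And>s. s \<in> usphere \<Longrightarrow> \<bar>g s\<bar> \<le> B"
    using continuous_on_compact_abs_bound[OF compact_sphere g] by metis
  have "V (\<lambda>s. g s + B) k = V g k + V (\<lambda>_. B) k" if "radial_fun k" for k
    using that by (intro V_add g continuous_intros)
  moreover have "0 \<le> g s + B" "0 \<le> B" if "s \<in> usphere" for s using B[OF that] by auto
  moreover have "0 \<le> B"
  proof -
    obtain b :: 'a where "b \<in> Basis" using SOME_Basis by blast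
    then show ?thesis using B[of b] by simp
  qed
  ultimately show ?thesis
    using pos[of "\<lambda>s. g s + B"] pos[of "\<lambda>_. B"] g f h by (simp add: continuous_intros radial_fun_max radial_fun_min)
qed

lemma V_continuous:
  assumes f: "radial_fun f" and g: "continuous_on usphere g" and e: "0 < e"
  obtains d where "0 < d" "\<And>h. radial_fun h \<Longrightarrow> (\<And>s. s \<in> usphere \<Longrightarrow> \<bar>h s - f s\<bar> \<le> d) \<Longrightarrow> \<bar>V g h - V g f\<bar> < e"
proof -
  obtain d where d: "0 < d" "\<And>K. K \<in> star_bodies \<Longrightarrow> radial_dist K (body f) < d \<Longrightarrow> \<bar>(\<integral>x. g x \<partial>Z K) - (\<integral>x. g x \<partial>Z (body f))\<bar> < e"
    using continuous[unfolded weak_star_continuous_def, rule_format, OF g body_in_star_bodies[OF f] e] by blast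
  show thesis
  proof
    show "0 < d / 2" using d by simp
    fix h assume h: "radial_fun h" "\<And>s. s \<in> usphere \<Longrightarrow> \<bar>h s - f s\<bar> \<le> d / 2"
    have "radial_dist (body h) (body f) \<le> d / 2" by (rule radial_dist_le[OF h(1) f h(2)])
    also have "\<dots> < d" using d by simp
    finally show "\<bar>V g h - V g f\<bar> < e" unfolding V_def by (intro d body_in_star_bodies h)
  qed
qed

lemma V_rotate:
  fixes \<phi> :: "'a \<Rightarrow> 'a"
  assumes f: "radial_fun f" and g: "continuous_on usphere g" and \<phi>: "orthogonal_transformation \<phi>"
  shows "V (\<lambda>s. g (\<phi> s)) (\<lambda>s. f (\<phi> s)) = V g f"
proof -
  have i\<phi>: "orthogonal_transformation (inv \<phi>)" by (rule orthogonal_transformation_inv[OF \<phi>])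
  have ii: "inv (inv \<phi>) = \<phi>" by (rule inv_inv_eq[OF orthogonal_transformation_bij[OF \<phi>]])
  show ?thesis
    using equivariant[unfolded rotation_equivariant_def, rule_format, OF body_in_star_bodies[OF f] g i\<phi>]
    by (simp add: V_def body_rotate[OF i\<phi>] ii o_def)
qed

text \<open>For nonnegative functions with disjoint supports the maximum is the sum and the minimum
  is 0, where \<open>V\<close> vanishes; the valuation property then becomes additivity.\<close>

lemma V_disjoint_sum:
  assumes "finite I" "\<And>i. i \<in> I \<Longrightarrow> radial_fun (f i)" and g: "continuous_on usphere g"
    and "\<And>i k s. i \<in> I \<Longrightarrow> k \<in> I \<Longrightarrow> i \<noteq> k \<Longrightarrow> s \<in> usphere \<Longrightarrow> f i s = 0 \<or> f k s = 0"
  shows "V g (\<lambda>s. \<Sum>i\<in>I. f i s) = (\<Sum>i\<in>I. V g (f i))"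
  using assms(1,2,4)
proof (induction I rule: finite_induct)
  case (insert k I)
  let ?h = "\<lambda>s. \<Sum>i\<in>I. f i s"
  have h: "radial_fun ?h" using insert by (intro radial_fun_sum) auto
  have fk: "radial_fun (f k)" using insert by auto
  have disj: "f k s = 0 \<or> ?h s = 0" if "s \<in> usphere" for s
    using insert.prems(2)[of k _ s] insert.hyps that by (auto intro!: sum.neutral)
  have "V g (\<lambda>s. max (f k s) (?h s)) + V g (\<lambda>s. min (f k s) (?h s)) = V g (f k) + V g ?h"
    by (rule V_valuation[OF fk h g])
  moreover have "V g (\<lambda>s. min (f k s) (?h s)) = 0"
  proof (rule V_eq_zero)
    show "min (f k s) (?h s) = 0" if "s \<in> usphere" for s
      using disj[OF that] radial_fun_nonneg[OF fk that] radial_fun_nonneg[OF h that] by (auto simp: min_def)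
  qed
  moreover have "V g (\<lambda>s. max (f k s) (?h s)) = V g (\<lambda>s. \<Sum>i\<in>insert k I. f i s)"
  proof (rule V_cong)
    show "max (f k s) (?h s) = (\<Sum>i\<in>insert k I. f i s)" if "s \<in> usphere" for s
      using disj[OF that] radial_fun_nonneg[OF fk that] radial_fun_nonneg[OF h that] insert.hyps by (auto simp: max_def)
  qed
  ultimately show ?case using insert by simp
qed simp

text \<open>Bisection of the range of values: \<open>V1\<close> is bounded near constant functions by continuity, and
  cutting a function at a height \<open>c\<close> reduces it to its parts below and above \<open>c\<close>.\<close>

lemma V1_bounded:
  assumes "0 \<le> \<Lambda>"
  obtains C where "0 \<le> C" "\<And>f. radial_fun f \<Longrightarrow> (\<And>s. s \<in> usphere \<Longrightarrow> f s \<le> \<Lambda>) \<Longrightarrow> V1 f \<le> C"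
proof -
  have one: "continuous_on usphere (\<lambda>_ :: 'a. 1 :: real)" by (intro continuous_intros)
  define P where "P a b \<longleftrightarrow> (0 \<le> a \<longrightarrow> (\<exists>C. \<forall>f. radial_fun f \<longrightarrow> (\<forall>s\<in>usphere. a \<le> f s \<and> f s \<le> b) \<longrightarrow> V1 f \<le> C))" for a b :: real
  have "P 0 \<Lambda>"
    using assms
  proof (induction rule: Bolzano)
    case (trans a b c)
    show ?case
      unfolding P_def
    proof
      assume "0 \<le> a"
      then have "0 \<le> b" using trans by simp
      from \<open>0 \<le> a\<close> obtain C where C: "\<And>f. radial_fun f \<Longrightarrow> (\<forall>s\<in>usphere. a \<le> f s \<and> f s \<le> b) \<Longrightarrow> V1 f \<le> C"
        using \<open>P a b\<close> unfolding P_def by blast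
      from \<open>0 \<le> b\<close> obtain D where D: "\<And>f. radial_fun f \<Longrightarrow> (\<forall>s\<in>usphere. b \<le> f s \<and> f s \<le> c) \<Longrightarrow> V1 f \<le> D"
        using \<open>P b c\<close> unfolding P_def by blast
      have b: "radial_fun (\<lambda>_ :: 'a. b)" using \<open>0 \<le> a\<close> trans by (intro radial_fun_const) auto
      have "V1 f \<le> C + D" if f: "radial_fun f" "\<forall>s\<in>usphere. a \<le> f s \<and> f s \<le> c" for f
      proof -
        have "V1 (\<lambda>s. max (f s) b) + V1 (\<lambda>s. min (f s) b) = V1 f + V1 (\<lambda>_. b)"
          by (rule V_valuation[OF f(1) b one])
        moreover have "V1 (\<lambda>s. max (f s) b) \<le> D" using f b trans by (intro D radial_fun_max) auto
        moreover have "V1 (\<lambda>s. min (f s) b) \<le> C" using f b trans by (intro C radial_fun_min) auto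
        moreover have "0 \<le> V1 (\<lambda>_. b)" by (rule V1_nonneg)
        ultimately show ?thesis by linarith
      qed
      then show "\<exists>C. \<forall>f. radial_fun f \<longrightarrow> (\<forall>s\<in>usphere. a \<le> f s \<and> f s \<le> c) \<longrightarrow> V1 f \<le> C" by blast
    qed
  next
    case (local x)
    then obtain d where d: "0 < d" "\<And>h. radial_fun h \<Longrightarrow> (\<And>s. s \<in> usphere \<Longrightarrow> \<bar>h s - x\<bar> \<le> d) \<Longrightarrow> \<bar>V1 h - V1 (\<lambda>_. x)\<bar> < 1"
      using V_continuous[OF radial_fun_const one zero_less_one, of x] by auto
    show ?case
    proof (intro exI[of _ d] conjI allI impI d(1))
      fix a b assume ab: "a \<le> x \<and> x \<le> b \<and> b - a < d"
      have "V1 f \<le> V1 (\<lambda>_. x) + 1" if "radial_fun f" "\<forall>s\<in>usphere. a \<le> f s \<and> f s \<le> b" for f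
      proof -
        have "\<bar>V1 f - V1 (\<lambda>_. x)\<bar> < 1"
        proof (rule d(2)[OF that(1)])
          fix s :: 'a assume "s \<in> usphere"
          then have "a \<le> f s" "f s \<le> b" using that(2) by auto
          then show "\<bar>f s - x\<bar> \<le> d" using ab by (auto simp: abs_le_iff)
        qed
        then show ?thesis by simp
      qed
      then show "P a b" unfolding P_def by blast
    qed
  qed
  then obtain C where C: "\<And>f. radial_fun f \<Longrightarrow> (\<forall>s\<in>usphere. 0 \<le> f s \<and> f s \<le> \<Lambda>) \<Longrightarrow> V1 f \<le> C"
    unfolding P_def by auto
  show thesis
  proof
    show "0 \<le> max C 0" by simp
    fix f :: "'a \<Rightarrow> real" assume "radial_fun f" "\<And>s. s \<in> usphere \<Longrightarrow> f s \<le> \<Lambda>"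
    then show "V1 f \<le> max C 0" using C[of f] radial_fun_nonneg[of f] by (simp add: le_max_iff_disj del: mem_sphere)
  qed
qed

text \<open>All functions below \<Lambda>\<psi> are quantified over because \<open>V1\<close> need
  not be monotone: a small mass of \<Lambda>\<psi> itself would say nothing about the functions
  under it.\<close>

definition thin :: "real \<Rightarrow> real \<Rightarrow> ('a \<Rightarrow> real) \<Rightarrow> bool" where
  "thin \<Lambda> e \<psi> \<longleftrightarrow> (\<forall>q. radial_fun q \<longrightarrow> (\<forall>s\<in>usphere. q s \<le> \<Lambda> * \<psi> s) \<longrightarrow> V1 q \<le> e)"

lemma thinD: "thin \<Lambda> e \<psi> \<Longrightarrow> radial_fun q \<Longrightarrow> (\<And>s. s \<in> usphere \<Longrightarrow> q s \<le> \<Lambda> * \<psi> s) \<Longrightarrow> V1 q \<le> e"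
  unfolding thin_def by blast

lemma thin_mono:
  assumes "thin \<Lambda> e \<psi>" "\<Lambda>' \<le> \<Lambda>" "e \<le> e'" "radial_fun \<psi>"
  shows "thin \<Lambda>' e' \<psi>"
  unfolding thin_def
proof (intro allI impI)
  fix q :: "'a \<Rightarrow> real" assume q: "radial_fun q" "\<forall>s\<in>usphere. q s \<le> \<Lambda>' * \<psi> s"
  have "V1 q \<le> e"
  proof (rule thinD[OF assms(1) q(1)])
    fix s :: 'a assume s: "s \<in> usphere"
    have "q s \<le> \<Lambda>' * \<psi> s" using q s by blast
    also have "\<dots> \<le> \<Lambda> * \<psi> s" using assms radial_fun_nonneg[OF assms(4) s] by (intro mult_right_mono)
    finally show "q s \<le> \<Lambda> * \<psi> s" .
  qed
  then show "V1 q \<le> e'" using assms by simp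
qed

text \<open>A function under the maximum is itself the maximum of its truncations at the two bounds.
  The valuation property gives subadditivity, since the mass of the minimum is nonnegative.\<close>

lemma thin_max:
  assumes "0 \<le> \<Lambda>" "radial_fun \<psi>\<^sub>1" "radial_fun \<psi>\<^sub>2" "thin \<Lambda> e\<^sub>1 \<psi>\<^sub>1" "thin \<Lambda> e\<^sub>2 \<psi>\<^sub>2"
  shows "thin \<Lambda> (e\<^sub>1 + e\<^sub>2) (\<lambda>s. max (\<psi>\<^sub>1 s) (\<psi>\<^sub>2 s))"
  unfolding thin_def
proof (intro allI impI)
  fix q :: "'a \<Rightarrow> real" assume q: "radial_fun q" "\<forall>s\<in>usphere. q s \<le> \<Lambda> * max (\<psi>\<^sub>1 s) (\<psi>\<^sub>2 s)"
  let ?a = "\<lambda>s. min (q s) (\<Lambda> * \<psi>\<^sub>1 s)" let ?b = "\<lambda>s. min (q s) (\<Lambda> * \<psi>\<^sub>2 s)"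
  have a: "radial_fun ?a" and b: "radial_fun ?b" using assms q by (intro radial_fun_intros; simp)+
  have "V1 q = V1 (\<lambda>s. max (?a s) (?b s))"
  proof (rule V_cong)
    fix s :: 'a assume "s \<in> usphere"
    then have "q s \<le> max (\<Lambda> * \<psi>\<^sub>1 s) (\<Lambda> * \<psi>\<^sub>2 s)" using q(2) assms(1) by (simp add: max_mult_distrib_left)
    then show "q s = max (?a s) (?b s)" by (auto simp: max_def min_def split: if_splits)
  qed
  also have "\<dots> \<le> V1 ?a + V1 ?b"
    using V_valuation[OF a b, of "\<lambda>_. 1"] V1_nonneg[of "\<lambda>s. min (?a s) (?b s)"] by (simp add: continuous_intros)
  also have "\<dots> \<le> e\<^sub>1 + e\<^sub>2"
    by (intro add_mono thinD[OF assms(4) a] thinD[OF assms(5) b]) auto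
  finally show "V1 q \<le> e\<^sub>1 + e\<^sub>2" .
qed

lemma thin_finite:
  assumes "0 \<le> \<Lambda>" "finite J" "\<And>c. c \<in> J \<Longrightarrow> radial_fun (\<psi> c)" "\<And>c. c \<in> J \<Longrightarrow> thin \<Lambda> e (\<psi> c)"
  shows "\<exists>\<psi>'. radial_fun \<psi>' \<and> thin \<Lambda> (real (card J) * e) \<psi>' \<and> (\<forall>c\<in>J. \<forall>s. \<psi> c s \<le> \<psi>' s)"
  using assms(2-)
proof (induction J rule: finite_induct)
  case empty
  have "thin \<Lambda> 0 (\<lambda>_. 0)"
    unfolding thin_def
  proof (intro allI impI)
    fix q :: "'a \<Rightarrow> real" assume q: "radial_fun q" "\<forall>s\<in>usphere. q s \<le> \<Lambda> * 0"
    then have "V1 q = 0" using radial_fun_nonneg[OF q(1)] by (intro V_eq_zero) (simp add: order_antisym del: mem_sphere)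
    then show "V1 q \<le> 0" by simp
  qed
  then show ?case using radial_fun_const[of 0] by (intro exI[of _ "\<lambda>_. 0"]) auto
next
  case (insert c J)
  then obtain \<psi>' where \<psi>': "radial_fun \<psi>'" "thin \<Lambda> (real (card J) * e) \<psi>'" "\<forall>c\<in>J. \<forall>s. \<psi> c s \<le> \<psi>' s" by auto
  have "thin \<Lambda> (e + real (card J) * e) (\<lambda>s. max (\<psi> c s) (\<psi>' s))"
    using insert \<psi>' assms(1) by (intro thin_max) auto
  moreover have "e + real (card J) * e = real (card (insert c J)) * e" using insert by (simp add: algebra_simps)
  ultimately show ?case
    using \<psi>' insert by (intro exI[of _ "\<lambda>s. max (\<psi> c s) (\<psi>' s)"]) (auto intro!: radial_fun_max simp: le_max_iff_disj)
qed

text \<open>At each point at most one member is nonzero, which makes \<open>V\<close> additive over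
  the family. The price is that the members cannot sum to 1 across the seams between their
  supports.\<close>

definition disjoint_family_fun :: "'i set \<Rightarrow> ('i \<Rightarrow> 'a \<Rightarrow> real) \<Rightarrow> bool" where
  "disjoint_family_fun I \<kappa> \<longleftrightarrow> finite I \<and> (\<forall>i\<in>I. radial_fun (\<kappa> i) \<and> (\<forall>s\<in>usphere. \<kappa> i s \<le> 1)) \<and>
    (\<forall>i\<in>I. \<forall>k\<in>I. i \<noteq> k \<longrightarrow> (\<forall>s\<in>usphere. \<kappa> i s = 0 \<or> \<kappa> k s = 0))"

lemma disjoint_family_funD:
  assumes "disjoint_family_fun I \<kappa>"
  shows "finite I" "\<And>i. i \<in> I \<Longrightarrow> radial_fun (\<kappa> i)" "\<And>i s. i \<in> I \<Longrightarrow> s \<in> usphere \<Longrightarrow> \<kappa> i s \<le> 1"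
    "\<And>i k s. i \<in> I \<Longrightarrow> k \<in> I \<Longrightarrow> i \<noteq> k \<Longrightarrow> s \<in> usphere \<Longrightarrow> \<kappa> i s = 0 \<or> \<kappa> k s = 0"
    "\<And>i s. i \<in> I \<Longrightarrow> s \<in> usphere \<Longrightarrow> 0 \<le> \<kappa> i s"
  using assms radial_fun_nonneg unfolding disjoint_family_fun_def by blast+

lemma disjoint_family_cases:
  assumes "disjoint_family_fun I \<kappa>" "s \<in> usphere"
  obtains "\<And>i. i \<in> I \<Longrightarrow> \<kappa> i s = 0"
  | i where "i \<in> I" "\<kappa> i s \<noteq> 0" "\<And>k. k \<in> I \<Longrightarrow> k \<noteq> i \<Longrightarrow> \<kappa> k s = 0"
  using disjoint_family_funD(4)[OF assms(1) _ _ _ assms(2)] by metis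

lemma disjoint_family_sum_single:
  assumes "disjoint_family_fun I \<kappa>" "i \<in> I" "\<And>k. k \<in> I \<Longrightarrow> k \<noteq> i \<Longrightarrow> \<kappa> k s = 0"
  shows "(\<Sum>k\<in>I. a k * \<kappa> k s) = a i * \<kappa> i s"
proof -
  have "(\<Sum>k\<in>I. a k * \<kappa> k s) = (\<Sum>k\<in>{i}. a k * \<kappa> k s)"
    using assms disjoint_family_funD(1)[OF assms(1)] by (intro sum.mono_neutral_right) auto
  then show ?thesis by simp
qed

lemma disjoint_family_sum_le:
  assumes "disjoint_family_fun I \<kappa>" "s \<in> usphere" "\<And>i. i \<in> I \<Longrightarrow> a i \<le> c" "0 \<le> c"
  shows "(\<Sum>i\<in>I. a i * \<kappa> i s) \<le> c"
  using assms(1,2)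
proof (cases rule: disjoint_family_cases)
  case (2 i)
  have "a i * \<kappa> i s \<le> c * 1"
    using assms 2 disjoint_family_funD(3,5)[OF assms(1) 2(1) assms(2)]
    by (intro mult_mono) auto
  then show ?thesis using disjoint_family_sum_single[OF assms(1) 2(1,3)] by simp
qed (use assms(4) in simp)

lemma V_disjoint_mult:
  assumes "disjoint_family_fun I \<kappa>" "\<And>i. i \<in> I \<Longrightarrow> radial_fun (h i)" "continuous_on usphere g"
  shows "V g (\<lambda>s. \<Sum>i\<in>I. h i s * \<kappa> i s) = (\<Sum>i\<in>I. V g (\<lambda>s. h i s * \<kappa> i s))"
  using disjoint_family_funD[OF assms(1)] assms(2,3)
  by (intro V_disjoint_sum radial_fun_mult) (auto, metis)

text \<open>With q = min(f1, \<Lambda>\<psi>) one has f1 = max(f2, q), so the valuation property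
  trades V(f1) - V(f2) for V(q) - V(min(f2, q)), where both functions lie under \<Lambda>\<psi>.
  This survives multiplication by a nonnegative cut-off, as maxima and minima do. The masses over
  the members then add up to the mass of one function under \<Lambda>\<psi>, so the bound is free of
  the number of members.\<close>

lemma localization_family:
  assumes I: "disjoint_family_fun I \<kappa>" and \<Lambda>: "0 \<le> \<Lambda>"
    and f: "radial_fun f\<^sub>1" "radial_fun f\<^sub>2" "\<And>s. s \<in> usphere \<Longrightarrow> f\<^sub>2 s \<le> f\<^sub>1 s" "\<And>s. s \<in> usphere \<Longrightarrow> f\<^sub>1 s \<le> \<Lambda>"
    and \<psi>: "radial_fun \<psi>" "thin \<Lambda> e \<psi>" "\<And>s. s \<in> usphere \<Longrightarrow> f\<^sub>1 s \<noteq> f\<^sub>2 s \<Longrightarrow> 1 \<le> \<psi> s"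
    and g: "\<And>i. i \<in> I \<Longrightarrow> continuous_on usphere (g i)" "\<And>i s. i \<in> I \<Longrightarrow> s \<in> usphere \<Longrightarrow> \<bar>g i s\<bar> \<le> B" "0 \<le> B"
  shows "(\<Sum>i\<in>I. \<bar>V (g i) (\<lambda>s. f\<^sub>1 s * \<kappa> i s) - V (g i) (\<lambda>s. f\<^sub>2 s * \<kappa> i s)\<bar>) \<le> 2 * B * e"
proof -
  note ID = disjoint_family_funD[OF I]
  let ?q = "\<lambda>s. min (f\<^sub>1 s) (\<Lambda> * \<psi> s)"
  let ?m = "\<lambda>s. min (f\<^sub>2 s) (?q s)"
  have q: "radial_fun ?q" and m: "radial_fun ?m" using f \<psi> \<Lambda> by (auto intro!: radial_fun_intros)
  have each: "\<bar>V (g i) (\<lambda>s. f\<^sub>1 s * \<kappa> i s) - V (g i) (\<lambda>s. f\<^sub>2 s * \<kappa> i s)\<bar> \<le> B * V1 (\<lambda>s. ?q s * \<kappa> i s) + B * V1 (\<lambda>s. ?m s * \<kappa> i s)"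
    if i: "i \<in> I" for i
  proof -
    have qi: "radial_fun (\<lambda>s. ?q s * \<kappa> i s)" and mi: "radial_fun (\<lambda>s. ?m s * \<kappa> i s)" and f2i: "radial_fun (\<lambda>s. f\<^sub>2 s * \<kappa> i s)"
      by (intro radial_fun_mult q m f ID(2) i)+
    have "V (g i) (\<lambda>s. max (f\<^sub>2 s * \<kappa> i s) (?q s * \<kappa> i s)) + V (g i) (\<lambda>s. min (f\<^sub>2 s * \<kappa> i s) (?q s * \<kappa> i s))
      = V (g i) (\<lambda>s. f\<^sub>2 s * \<kappa> i s) + V (g i) (\<lambda>s. ?q s * \<kappa> i s)"
      by (rule V_valuation[OF f2i qi g(1)[OF i]])
    moreover have "V (g i) (\<lambda>s. max (f\<^sub>2 s * \<kappa> i s) (?q s * \<kappa> i s)) = V (g i) (\<lambda>s. f\<^sub>1 s * \<kappa> i s)"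
    proof (rule V_cong)
      fix s :: 'a assume s: "s \<in> usphere"
      have "max (f\<^sub>2 s) (?q s) = f\<^sub>1 s"
      proof (cases "f\<^sub>1 s = f\<^sub>2 s")
        case False
        then have "\<Lambda> * 1 \<le> \<Lambda> * \<psi> s" using \<psi>(3)[OF s] \<Lambda> by (intro mult_left_mono) auto
        then show ?thesis using f(3,4)[OF s] by (auto simp: max_def min_def)
      qed (auto simp: max_def min_def)
      then show "max (f\<^sub>2 s * \<kappa> i s) (?q s * \<kappa> i s) = f\<^sub>1 s * \<kappa> i s"
        using ID(5)[OF i s] max_mult_distrib_right[of "f\<^sub>2 s" "?q s" "\<kappa> i s"] by simp
    qed
    moreover have "V (g i) (\<lambda>s. min (f\<^sub>2 s * \<kappa> i s) (?q s * \<kappa> i s)) = V (g i) (\<lambda>s. ?m s * \<kappa> i s)"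
    proof (rule V_cong)
      show "min (f\<^sub>2 s * \<kappa> i s) (?q s * \<kappa> i s) = ?m s * \<kappa> i s" if "s \<in> usphere" for s
        using ID(5)[OF i that] min_mult_distrib_right[of "f\<^sub>2 s" "?q s" "\<kappa> i s"] by simp
    qed
    ultimately have "V (g i) (\<lambda>s. f\<^sub>1 s * \<kappa> i s) - V (g i) (\<lambda>s. f\<^sub>2 s * \<kappa> i s) = V (g i) (\<lambda>s. ?q s * \<kappa> i s) - V (g i) (\<lambda>s. ?m s * \<kappa> i s)"
      by linarith
    then show ?thesis
      using abs_V_le[OF qi g(1)[OF i] g(2)[OF i]] abs_V_le[OF mi g(1)[OF i] g(2)[OF i]] by linarith
  qed
  have small: "(\<Sum>i\<in>I. V1 (\<lambda>s. h s * \<kappa> i s)) \<le> e" if h: "radial_fun h" "\<And>s. s \<in> usphere \<Longrightarrow> h s \<le> \<Lambda> * \<psi> s" for h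
  proof -
    have "(\<Sum>i\<in>I. V1 (\<lambda>s. h s * \<kappa> i s)) = V1 (\<lambda>s. \<Sum>i\<in>I. h s * \<kappa> i s)"
      by (rule V_disjoint_mult[OF I h(1), symmetric]) (auto intro: continuous_intros)
    also have "\<dots> \<le> e"
    proof (rule thinD[OF \<psi>(2)])
      show "radial_fun (\<lambda>s. \<Sum>i\<in>I. h s * \<kappa> i s)" by (intro radial_fun_sum radial_fun_mult h ID(2))
      fix s :: 'a assume s: "s \<in> usphere"
      have "(\<Sum>i\<in>I. h s * \<kappa> i s) \<le> h s"
        by (rule disjoint_family_sum_le[OF I s]) (use radial_fun_nonneg[OF h(1) s] in auto)
      also have "\<dots> \<le> \<Lambda> * \<psi> s" by (rule h(2)[OF s])
      finally show "(\<Sum>i\<in>I. h s * \<kappa> i s) \<le> \<Lambda> * \<psi> s" .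
    qed
    finally show ?thesis .
  qed
  have "(\<Sum>i\<in>I. \<bar>V (g i) (\<lambda>s. f\<^sub>1 s * \<kappa> i s) - V (g i) (\<lambda>s. f\<^sub>2 s * \<kappa> i s)\<bar>)
      \<le> (\<Sum>i\<in>I. B * V1 (\<lambda>s. ?q s * \<kappa> i s) + B * V1 (\<lambda>s. ?m s * \<kappa> i s))"
    by (rule sum_mono) (rule each)
  also have "\<dots> = B * (\<Sum>i\<in>I. V1 (\<lambda>s. ?q s * \<kappa> i s)) + B * (\<Sum>i\<in>I. V1 (\<lambda>s. ?m s * \<kappa> i s))"
    by (simp add: sum.distrib sum_distrib_left)
  also have "\<dots> \<le> B * e + B * e"
    by (intro add_mono mult_left_mono small q m g(3)) auto
  finally show ?thesis by simp
qed

lemma localization: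
  assumes \<Lambda>: "0 \<le> \<Lambda>"
    and f: "radial_fun f\<^sub>1" "radial_fun f\<^sub>2" "\<And>s. s \<in> usphere \<Longrightarrow> f\<^sub>2 s \<le> f\<^sub>1 s" "\<And>s. s \<in> usphere \<Longrightarrow> f\<^sub>1 s \<le> \<Lambda>"
    and \<psi>: "radial_fun \<psi>" "thin \<Lambda> e \<psi>" "\<And>s. s \<in> usphere \<Longrightarrow> f\<^sub>1 s \<noteq> f\<^sub>2 s \<Longrightarrow> 1 \<le> \<psi> s"
    and g: "continuous_on usphere g" "\<And>s. s \<in> usphere \<Longrightarrow> \<bar>g s\<bar> \<le> B" "0 \<le> B"
  shows "\<bar>V g f\<^sub>1 - V g f\<^sub>2\<bar> \<le> 2 * B * e"
proof -
  have "disjoint_family_fun {()} (\<lambda>_ _. 1)"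
    by (auto simp: disjoint_family_fun_def intro: radial_fun_const)
  from localization_family[OF this \<Lambda> f \<psi>, of "\<lambda>_. g" B] g show ?thesis by simp
qed

section \<open>Partitions of the sphere with thin seams\<close>

text \<open>\<Lambda> bounds the heights at which it is used, \<open>d\<close> is the mesh and
  \<open>e\<close> the mass allowed on the seams, where the cut-offs fail to sum to 1 and \<psi> is
  at least 1. The points \<open>x\<close> are the sample points of Riemann sums.\<close>

definition thin_partition ::
  "real \<Rightarrow> real \<Rightarrow> real \<Rightarrow> 'i set \<Rightarrow> ('i \<Rightarrow> 'a \<Rightarrow> real) \<Rightarrow> ('i \<Rightarrow> 'a) \<Rightarrow> ('a \<Rightarrow> real) \<Rightarrow> bool" where
  "thin_partition \<Lambda> d e I \<kappa> x \<psi> \<longleftrightarrow> disjoint_family_fun I \<kappa> \<and> radial_fun \<psi> \<and> thin \<Lambda> e \<psi> \<and>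
    (\<forall>s\<in>usphere. (\<Sum>i\<in>I. \<kappa> i s) \<noteq> 1 \<longrightarrow> 1 \<le> \<psi> s) \<and>
    (\<forall>i\<in>I. x i \<in> usphere \<and> (\<forall>s\<in>usphere. \<kappa> i s \<noteq> 0 \<longrightarrow> dist s (x i) < d))"

lemma thin_partitionD:
  assumes "thin_partition \<Lambda> d e I \<kappa> x \<psi>"
  shows "disjoint_family_fun I \<kappa>" "radial_fun \<psi>" "thin \<Lambda> e \<psi>"
    "\<And>s. s \<in> usphere \<Longrightarrow> (\<Sum>i\<in>I. \<kappa> i s) \<noteq> 1 \<Longrightarrow> 1 \<le> \<psi> s"
    "\<And>i. i \<in> I \<Longrightarrow> x i \<in> usphere"
    "\<And>i s. i \<in> I \<Longrightarrow> s \<in> usphere \<Longrightarrow> \<kappa> i s \<noteq> 0 \<Longrightarrow> dist s (x i) < d"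
  using assms unfolding thin_partition_def by blast+

lemma thin_partition_mono:
  assumes "thin_partition \<Lambda> d e I \<kappa> x \<psi>" "\<Lambda>' \<le> \<Lambda>" "d \<le> d'" "e \<le> e'"
  shows "thin_partition \<Lambda>' d' e' I \<kappa> x \<psi>"
proof -
  note D = thin_partitionD[OF assms(1)]
  have "thin \<Lambda>' e' \<psi>" by (rule thin_mono[OF D(3) assms(2,4) D(2)])
  moreover have "dist s (x i) < d'" if "i \<in> I" "s \<in> usphere" "\<kappa> i s \<noteq> 0" for i s
    using D(6)[OF that] assms(3) by simp
  ultimately show ?thesis using D(1,2,4,5) unfolding thin_partition_def by blast
qed

text \<open>Pigeonhole: if \<open>N\<close> slabs with disjoint interiors all failed, the sum of the
  offending functions would still be at most \<Lambda>, yet have mass at least N e, more than the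
  bound of \<open>V1_bounded\<close> allows.\<close>

lemma thin_slab:
  assumes \<Lambda>: "0 \<le> \<Lambda>" and e: "0 < e" and a: "a < a'"
  shows "\<exists>c \<eta>. 0 < \<eta> \<and> a < c \<and> c < a' \<and> thin \<Lambda> e (\<lambda>s. max 0 (min 1 (2 - \<bar>s \<bullet> b - c\<bar> / \<eta>)))"
proof (rule ccontr)
  assume neg: "\<not> ?thesis"
  obtain C where C: "0 \<le> C" "\<And>f. radial_fun f \<Longrightarrow> (\<And>s. s \<in> usphere \<Longrightarrow> f s \<le> \<Lambda>) \<Longrightarrow> V1 f \<le> C"
    using V1_bounded[OF \<Lambda>] by metis
  obtain N :: nat where N: "C / e < real N" using reals_Archimedean2 by blast
  then have N0: "0 < real N" using C e by (smt (verit) divide_nonneg_pos)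
  \<comment> \<open>The interval is cut into \<open>N\<close> equal parts with midpoints
    \<open>c j\<close>. With \<eta> a quarter of their length, the profile is 1 up to distance
    \<eta> from the midpoint and 0 from distance 2 \<eta> on, that is, outside its own part.\<close>
  define c where "c j = a + (a' - a) * (real j + 1/2) / real N" for j
  define \<eta> where "\<eta> = (a' - a) / (4 * real N)"
  have \<eta>: "0 < \<eta>" using a N0 by (simp add: \<eta>_def)
  define \<psi> where "\<psi> j s = max 0 (min 1 (2 - \<bar>s \<bullet> b - c j\<bar> / \<eta>))" for j s
  have "\<not> thin \<Lambda> e (\<psi> j)" if "j < N" for j
  proof -
    have "a < c j" using a N0 by (simp add: c_def)
    moreover have "c j < a'"
    proof -
      have "(real j + 1/2) / real N < 1" using that N0 by simp
      then have "(a' - a) * ((real j + 1/2) / real N) < (a' - a) * 1" using a by (intro mult_strict_left_mono) auto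
      then show ?thesis by (simp add: c_def)
    qed
    ultimately show ?thesis using neg \<eta> unfolding \<psi>_def by blast
  qed
  then have "\<exists>q. radial_fun q \<and> (\<forall>s\<in>usphere. q s \<le> \<Lambda> * \<psi> j s) \<and> e < V1 q" if "j < N" for j
    using that unfolding thin_def by (meson not_less)
  then obtain q where q: "\<And>j. j < N \<Longrightarrow> radial_fun (q j)" "\<And>j s. j < N \<Longrightarrow> s \<in> usphere \<Longrightarrow> q j s \<le> \<Lambda> * \<psi> j s"
    "\<And>j. j < N \<Longrightarrow> e < V1 (q j)" by metis
  have near: "\<bar>s \<bullet> b - c j\<bar> < 2 * \<eta>" if "j < N" "s \<in> usphere" "q j s \<noteq> 0" for j s
  proof (rule ccontr)
    assume "\<not> ?thesis"
    then have "\<psi> j s = 0" using \<eta> by (simp add: \<psi>_def field_simps)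
    then show False using q(2)[OF that(1,2)] radial_fun_nonneg[OF q(1)[OF that(1)] that(2)] that(3) by simp
  qed
  have disj: "q i s = 0 \<or> q k s = 0" if "i < N" "k < N" "i \<noteq> k" "s \<in> usphere" for i k s
  proof (rule ccontr)
    assume "\<not> ?thesis"
    then have "\<bar>c i - c k\<bar> < 4 * \<eta>" using near[of i s] near[of k s] that by auto
    moreover have "c i - c k = (real i - real k) * (4 * \<eta>)"
      using N0 by (simp add: c_def \<eta>_def field_simps)
    ultimately have "\<bar>real i - real k\<bar> * (4 * \<eta>) < 1 * (4 * \<eta>)" using \<eta> by (simp add: abs_mult)
    then have "\<bar>real i - real k\<bar> < 1" using \<eta> by simp
    then show False using that(3) by linarith
  qed
  have "real N * e \<le> (\<Sum>j<N. V1 (q j))"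
    using sum_bounded_below[of "{..<N}" e "\<lambda>j. V1 (q j)"] q(3) by (auto simp: less_imp_le)
  also have "\<dots> = V1 (\<lambda>s. \<Sum>j<N. q j s)"
    by (rule V_disjoint_sum[symmetric]) (use q(1) disj in \<open>auto intro: continuous_intros\<close>)
  also have "\<dots> \<le> C"
  proof (rule C(2))
    show "radial_fun (\<lambda>s. \<Sum>j<N. q j s)" using q(1) by (intro radial_fun_sum) auto
    fix s :: 'a assume s: "s \<in> usphere"
    have q\<Lambda>: "q j s \<le> \<Lambda>" if "j < N" for j
    proof -
      have "\<Lambda> * \<psi> j s \<le> \<Lambda> * 1" using \<Lambda> by (intro mult_left_mono) (auto simp: \<psi>_def)
      then show ?thesis using q(2)[OF that s] by simp
    qed
    show "(\<Sum>j<N. q j s) \<le> \<Lambda>"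
    proof (cases "\<exists>j<N. q j s \<noteq> 0")
      case True
      then obtain j where j: "j < N" "q j s \<noteq> 0" by blast
      have "q i s = 0" if "i < N" "i \<noteq> j" for i
        using disj[OF that(1) j(1) that(2) s] j(2) by simp
      then have "(\<Sum>j<N. q j s) = (\<Sum>j\<in>{j}. q j s)"
        using j(1) by (intro sum.mono_neutral_right) auto
      then show ?thesis using q\<Lambda>[OF j(1)] by simp
    qed (use \<Lambda> in simp)
  qed
  finally show False using N e by (simp add: field_simps)
qed

text \<open>The sphere is cut by hyperplanes orthogonal to the basis vectors, each placed by
  \<open>thin_slab\<close> inside a prescribed short interval. A cell is indexed by the set of
  hyperplanes on whose positive side it lies.\<close>

lemma thin_partition_exists:
  assumes \<Lambda>: "0 \<le> \<Lambda>" and d: "0 < d" and e: "0 < e"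
  shows "\<exists>(I :: ('a \<times> int) set set) \<kappa> x \<psi>. thin_partition \<Lambda> d e I \<kappa> x \<psi>"
proof -
  \<comment> \<open>Points of one cell will differ by at most 2h in each coordinate, so the sum norm
    bounds their distance by 2hn = d/2.\<close>
  define h where "h = d / (4 * real DIM('a))"
  have h: "0 < h" using d by (simp add: h_def)
  define K where "K = \<lceil>1 / h\<rceil>"
  \<comment> \<open>The pair (b, k) stands for one hyperplane orthogonal to \<open>b\<close>, with
    position strictly between kh and (k+1)h. The range of k suffices for all coordinates of unit
    vectors.\<close>
  define J :: "('a \<times> int) set" where "J = Basis \<times> {-K..K}"
  have fJ: "finite J" by (simp add: J_def)
  define e0 where "e0 = e / (real (card J) + 1)"
  have e0: "0 < e0" using e by (simp add: e0_def add_nonneg_pos)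
  define bump where "bump c \<eta> p s = max 0 (min 1 (2 - \<bar>s \<bullet> fst p - c\<bar> / \<eta>))" for c \<eta> :: real and p :: "'a \<times> int" and s :: 'a
  have "\<exists>c \<eta>. 0 < \<eta> \<and> real_of_int (snd p) * h < c \<and> c < (real_of_int (snd p) + 1) * h \<and> thin \<Lambda> e0 (bump c \<eta> p)" for p
    unfolding bump_def using h by (intro thin_slab[OF \<Lambda> e0]) simp
  then obtain c \<eta> where c: "\<And>p. 0 < \<eta> p" "\<And>p. real_of_int (snd p) * h < c p" "\<And>p. c p < (real_of_int (snd p) + 1) * h"
    "\<And>p. thin \<Lambda> e0 (bump (c p) (\<eta> p) p)" by metis
  have bump_rf: "radial_fun (bump (c p) (\<eta> p) p)" for p
    using c(1)[of p] by (auto simp: radial_fun_def bump_def intro!: continuous_intros)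
  obtain \<psi> where \<psi>: "radial_fun \<psi>" "thin \<Lambda> (real (card J) * e0) \<psi>" "\<And>p s. p \<in> J \<Longrightarrow> bump (c p) (\<eta> p) p s \<le> \<psi> s"
    using thin_finite[OF \<Lambda> fJ, of "\<lambda>p. bump (c p) (\<eta> p) p" e0] bump_rf c(4) by blast
  \<comment> \<open>Ramps on the two sides of a hyperplane, both zero on it. They are never nonzero
    together, and their sum is 1 at distance at least \<eta> from it.\<close>
  define wp where "wp p s = max 0 (min 1 ((s \<bullet> fst p - c p) / \<eta> p))" for p s
  define wm where "wm p s = max 0 (min 1 ((c p - s \<bullet> fst p) / \<eta> p))" for p s
  have w_rf: "radial_fun (wp p)" "radial_fun (wm p)" for p
    using c(1)[of p] by (auto simp: radial_fun_def wp_def wm_def intro!: continuous_intros)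
  have w01: "0 \<le> wp p s" "wp p s \<le> 1" "0 \<le> wm p s" "wm p s \<le> 1" for p s by (auto simp: wp_def wm_def)
  have wp_side: "c p < s \<bullet> fst p" if "wp p s \<noteq> 0" for p s
    using that c(1)[of p] by (auto simp: wp_def max_def min_def field_simps split: if_splits)
  have wm_side: "s \<bullet> fst p < c p" if "wm p s \<noteq> 0" for p s
    using that c(1)[of p] by (auto simp: wm_def max_def min_def field_simps split: if_splits)
  define \<kappa> where "\<kappa> T s = (\<Prod>p\<in>T. wp p s) * (\<Prod>p\<in>J - T. wm p s)" for T s
  have \<kappa>_side: "p \<in> T \<Longrightarrow> c p < s \<bullet> fst p" "p \<notin> T \<Longrightarrow> s \<bullet> fst p < c p"
    if "T \<subseteq> J" "\<kappa> T s \<noteq> 0" "p \<in> J" for T s p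
  proof -
    have fT: "finite T" "finite (J - T)" using fJ that(1) finite_subset by auto
    show "p \<in> T \<Longrightarrow> c p < s \<bullet> fst p"
      using that(2) fT unfolding \<kappa>_def by (intro wp_side) auto
    show "p \<notin> T \<Longrightarrow> s \<bullet> fst p < c p"
      using that(2,3) fT unfolding \<kappa>_def by (intro wm_side) auto
  qed
  have disj: "disjoint_family_fun (Pow J) \<kappa>"
    unfolding disjoint_family_fun_def
  proof (intro conjI ballI impI)
    show "finite (Pow J)" using fJ by simp
    show "radial_fun (\<kappa> T)" for T unfolding \<kappa>_def by (intro radial_fun_mult radial_fun_prod w_rf)
    show "\<kappa> T s \<le> 1" for T s
      unfolding \<kappa>_def by (intro mult_le_one prod_le_1 prod_nonneg) (auto simp: w01)
    fix T T' s assume T: "T \<in> Pow J" "T' \<in> Pow J" "T \<noteq> T'"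
    then obtain p where "p \<in> J" "p \<in> T \<longleftrightarrow> p \<notin> T'" by blast
    then show "\<kappa> T s = 0 \<or> \<kappa> T' s = 0"
      using \<kappa>_side[of T s p] \<kappa>_side[of T' s p] T by (metis PowD less_asym)
  qed
  \<comment> \<open>Expanding the product gives one term for each choice of side at every
    hyperplane, which is the sum over cells. The sum can thus differ from 1 only close to some
    hyperplane.\<close>
  have sum: "(\<Sum>T\<in>Pow J. \<kappa> T s) = (\<Prod>p\<in>J. wp p s + wm p s)" for s
    unfolding \<kappa>_def by (rule prod_add[OF fJ, symmetric])
  have seam: "1 \<le> \<psi> s" if "(\<Sum>T\<in>Pow J. \<kappa> T s) \<noteq> 1" for s
  proof -
    have "\<exists>p\<in>J. wp p s + wm p s \<noteq> 1"
    proof (rule ccontr)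
      assume "\<not> ?thesis"
      then have "(\<Prod>p\<in>J. wp p s + wm p s) = 1" by (intro prod.neutral) auto
      then show False using that unfolding sum by simp
    qed
    then obtain p where p: "p \<in> J" "wp p s + wm p s \<noteq> 1" by blast
    have "\<bar>s \<bullet> fst p - c p\<bar> / \<eta> p < 1"
    proof (rule ccontr)
      assume "\<not> ?thesis"
      then have "\<eta> p \<le> \<bar>s \<bullet> fst p - c p\<bar>" using c(1)[of p] by (simp add: field_simps)
      then have "wp p s + wm p s = 1"
        using c(1)[of p] by (cases "c p < s \<bullet> fst p") (auto simp: wp_def wm_def max_def min_def field_simps)
      then show False using p(2) by simp
    qed
    then have "bump (c p) (\<eta> p) p s = 1" by (simp add: bump_def)
    then show ?thesis using \<psi>(3)[OF p(1), of s] by simp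
  qed
  \<comment> \<open>If a coordinate grew by more than 2h, the hyperplane numbered by rounding up
    s.b/h would lie strictly between the two points, although they are on the same side of all
    hyperplanes.\<close>
  have close1: "s' \<bullet> b \<le> s \<bullet> b + 2 * h"
    if "T \<subseteq> J" "s \<in> usphere" "\<kappa> T s \<noteq> 0" "\<kappa> T s' \<noteq> 0" "b \<in> Basis" for T s s' b
  proof (rule ccontr)
    assume neg: "\<not> ?thesis"
    define k where "k = \<lceil>s \<bullet> b / h\<rceil>"
    have sb: "\<bar>s \<bullet> b\<bar> \<le> 1" using Basis_le_norm[OF that(5), of s] that(2) by simp
    have k1: "s \<bullet> b / h \<le> k" "k < s \<bullet> b / h + 1" unfolding k_def by linarith+
    have k2: "s \<bullet> b \<le> k * h" "k * h < s \<bullet> b + h" using k1 h by (auto simp: field_simps)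
    have "k \<le> K" unfolding k_def K_def using sb h by (intro ceiling_mono divide_right_mono) auto
    moreover have "- K \<le> k"
    proof -
      have "- (1 / h) \<le> s \<bullet> b / h" using sb h by (simp add: field_simps abs_le_iff)
      then show ?thesis unfolding k_def K_def by linarith
    qed
    ultimately have p: "(b, k) \<in> J" using that(5) by (simp add: J_def)
    have "s \<bullet> b < c (b, k)" using k2 c(2)[of "(b, k)"] by simp
    moreover have "c (b, k) < s' \<bullet> b" using k2 c(3)[of "(b, k)"] neg by (simp add: algebra_simps)
    ultimately show False
      using \<kappa>_side[OF that(1,3) p] \<kappa>_side[OF that(1,4) p] by (cases "(b, k) \<in> T") auto
  qed
  have mesh: "dist s s' < d"
    if "T \<subseteq> J" "s \<in> usphere" "s' \<in> usphere" "\<kappa> T s \<noteq> 0" "\<kappa> T s' \<noteq> 0" for T s s'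
  proof -
    have "dist s s' \<le> (\<Sum>b\<in>Basis. \<bar>(s - s') \<bullet> b\<bar>)" unfolding dist_norm by (rule norm_le_l1)
    also have "\<dots> \<le> (\<Sum>b\<in>(Basis :: 'a set). 2 * h)"
      using close1[OF that(1,2,4,5)] close1[OF that(1,3,5,4)]
      by (intro sum_mono) (auto simp: inner_diff_left abs_le_iff algebra_simps)
    also have "\<dots> = d / 2" by (simp add: h_def)
    finally show ?thesis using d by simp
  qed
  obtain b0 :: 'a where b0: "b0 \<in> Basis" using SOME_Basis by blast
  \<comment> \<open>A cell that does not meet the sphere gets an arbitrary unit vector as its sample
    point.\<close>
  define x where "x T = (if \<exists>s\<in>usphere. \<kappa> T s \<noteq> 0 then SOME s. s \<in> usphere \<and> \<kappa> T s \<noteq> 0 else b0)" for T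
  have x: "x T \<in> usphere \<and> ((\<exists>s\<in>usphere. \<kappa> T s \<noteq> 0) \<longrightarrow> \<kappa> T (x T) \<noteq> 0)" for T
  proof (cases "\<exists>s\<in>usphere. \<kappa> T s \<noteq> 0")
    case True
    then have "\<exists>s. s \<in> usphere \<and> \<kappa> T s \<noteq> 0" by blast
    from someI_ex[OF this] show ?thesis using True by (simp add: x_def)
  qed (use b0 in \<open>simp add: x_def\<close>)
  have "thin \<Lambda> e \<psi>"
  proof (rule thin_mono[OF \<psi>(2) order_refl _ \<psi>(1)])
    show "real (card J) * e0 \<le> e" using e by (simp add: e0_def field_simps)
  qed
  then have "thin_partition \<Lambda> d e (Pow J) \<kappa> x \<psi>"
    unfolding thin_partition_def using disj \<psi>(1) seam x mesh by blast
  then show ?thesis by blast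
qed

text \<open>Total masses are invariant under rotations, so thin seams remain thin. This gives
  partitions whose seams need not follow coordinate hyperplanes, as \<open>M_rotate\<close>
  requires.\<close>

lemma thin_partition_rotate:
  fixes \<phi> :: "'a \<Rightarrow> 'a"
  assumes P: "thin_partition \<Lambda> d e I \<kappa> x \<psi>" and \<phi>: "orthogonal_transformation \<phi>"
  shows "thin_partition \<Lambda> d e I (\<lambda>i s. \<kappa> i (inv \<phi> s)) (\<lambda>i. \<phi> (x i)) (\<lambda>s. \<psi> (inv \<phi> s))"
proof -
  note D = thin_partitionD[OF P] note I = disjoint_family_funD[OF D(1)]
  have i\<phi>: "orthogonal_transformation (inv \<phi>)" by (rule orthogonal_transformation_inv[OF \<phi>])
  have inv: "inv \<phi> (\<phi> s) = s" "\<phi> (inv \<phi> s) = s" for s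
    using orthogonal_transformation_bij[OF \<phi>] by (auto simp: bij_is_inj bij_is_surj surj_f_inv_f)
  have sph: "\<phi> s \<in> usphere" "inv \<phi> s \<in> usphere" if "s \<in> usphere" for s
    using that orthogonal_transformation_norm[OF \<phi>] orthogonal_transformation_norm[OF i\<phi>] by auto
  have "thin \<Lambda> e (\<lambda>s. \<psi> (inv \<phi> s))"
    unfolding thin_def
  proof (intro allI impI)
    fix q :: "'a \<Rightarrow> real" assume q: "radial_fun q" "\<forall>s\<in>usphere. q s \<le> \<Lambda> * \<psi> (inv \<phi> s)"
    have "V1 q = V1 (\<lambda>s. q (\<phi> s))"
      using V_rotate[OF q(1) _ \<phi>, of "\<lambda>_. 1"] by (simp add: continuous_intros)
    also have "\<dots> \<le> e"
    proof (rule thinD[OF D(3)])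
      show "radial_fun (\<lambda>s. q (\<phi> s))" using radial_fun_rotate[OF \<phi> q(1)] by (simp add: o_def)
      show "q (\<phi> s) \<le> \<Lambda> * \<psi> s" if "s \<in> usphere" for s using q(2) sph(1)[OF that] inv by metis
    qed
    finally show "V1 q \<le> e" .
  qed
  moreover have "disjoint_family_fun I (\<lambda>i s. \<kappa> i (inv \<phi> s))"
    unfolding disjoint_family_fun_def
    using I sph radial_fun_rotate[OF i\<phi>] by (auto simp: o_def simp del: mem_sphere)
  moreover have "radial_fun (\<lambda>s. \<psi> (inv \<phi> s))" using radial_fun_rotate[OF i\<phi> D(2)] by (simp add: o_def)
  moreover have "dist s (\<phi> (x i)) < d" if "i \<in> I" "s \<in> usphere" "\<kappa> i (inv \<phi> s) \<noteq> 0" for i s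
    using D(6)[OF that(1) sph(2)[OF that(2)] that(3)] orthogonal_transformation_dist[OF i\<phi>, of s "\<phi> (x i)"] by (simp add: inv)
  ultimately show ?thesis
    unfolding thin_partition_def using D(4,5) sph by blast
qed

section \<open>The limit functional\<close>

definition riemann_sum :: "real \<Rightarrow> 'i set \<Rightarrow> ('i \<Rightarrow> 'a \<Rightarrow> real) \<Rightarrow> ('i \<Rightarrow> 'a) \<Rightarrow> ('a \<times> 'a \<Rightarrow> real) \<Rightarrow> real" where
  "riemann_sum l I \<kappa> x F = (\<Sum>i\<in>I. V (\<lambda>r. F (x i, r)) (\<lambda>s. l * \<kappa> i s))"

lemma continuous_on_section:
  fixes F :: "'a \<times> 'a \<Rightarrow> real"
  shows "continuous_on UNIV F \<Longrightarrow> continuous_on A (\<lambda>r. F (y, r))"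
  by (rule continuous_on_compose2[of UNIV F]) (auto intro!: continuous_intros)

lemma sum_V1_le:
  assumes I: "disjoint_family_fun I \<kappa>" and l: "0 \<le> l" "l \<le> \<Lambda>"
    and C: "\<And>f. radial_fun f \<Longrightarrow> (\<And>s. s \<in> usphere \<Longrightarrow> f s \<le> \<Lambda>) \<Longrightarrow> V1 f \<le> C"
  shows "(\<Sum>i\<in>I. V1 (\<lambda>s. l * \<kappa> i s)) \<le> C"
proof -
  have "(\<Sum>i\<in>I. V1 (\<lambda>s. l * \<kappa> i s)) = V1 (\<lambda>s. \<Sum>i\<in>I. l * \<kappa> i s)"
    by (rule V_disjoint_mult[OF I, symmetric]) (auto intro: continuous_intros radial_fun_const l)
  also have "\<dots> \<le> C"
  proof (rule C)
    show "radial_fun (\<lambda>s. \<Sum>i\<in>I. l * \<kappa> i s)"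
      by (intro radial_fun_sum radial_fun_mult radial_fun_const l disjoint_family_funD(2)[OF I])
    show "(\<Sum>i\<in>I. l * \<kappa> i s) \<le> \<Lambda>" if "s \<in> usphere" for s
      using disjoint_family_sum_le[OF I that, of "\<lambda>_. l" l] l by simp
  qed
  finally show ?thesis .
qed

lemma disjoint_family_product:
  assumes I: "disjoint_family_fun I \<kappa>" and K: "disjoint_family_fun K \<theta>"
  shows "disjoint_family_fun (I \<times> K) (\<lambda>p s. \<kappa> (fst p) s * \<theta> (snd p) s)"
  unfolding disjoint_family_fun_def
proof (intro conjI ballI impI)
  note ID = disjoint_family_funD[OF I] note KD = disjoint_family_funD[OF K]
  show "finite (I \<times> K)" using ID(1) KD(1) by simp
  fix p assume p: "p \<in> I \<times> K"
  show "radial_fun (\<lambda>s. \<kappa> (fst p) s * \<theta> (snd p) s)" using p by (intro radial_fun_mult ID(2) KD(2)) auto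
  show "\<kappa> (fst p) s * \<theta> (snd p) s \<le> 1" if "s \<in> usphere" for s :: 'a
    using p ID(3,5) KD(3,5) that by (intro mult_le_one) auto
  fix q and s :: 'a assume q: "q \<in> I \<times> K" "p \<noteq> q" "s \<in> usphere"
  then have "fst p \<noteq> fst q \<or> snd p \<noteq> snd q" by (auto simp: prod_eq_iff)
  then show "\<kappa> (fst p) s * \<theta> (snd p) s = 0 \<or> \<kappa> (fst q) s * \<theta> (snd q) s = 0"
    using p q ID(4)[of "fst p" "fst q" s] KD(4)[of "snd p" "snd q" s] by (auto simp: mem_Times_iff)
qed

text \<open>Refining by a second partition multiplies each cut-off by a sum that is 1 off the seams
  of that partition. The change is therefore of the kind treated by
  \<open>localization_family\<close>, with an error depending on the second seam only.\<close>

lemma riemann_sum_refine: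
  assumes P: "thin_partition \<Lambda> d e I \<kappa> x \<psi>" and Q: "thin_partition \<Lambda> d' e' K \<theta> y \<psi>'"
    and l: "0 \<le> l" "l \<le> \<Lambda>" and F: "continuous_on UNIV F"
    and B: "\<And>z. z \<in> usphere \<times> usphere \<Longrightarrow> \<bar>F z\<bar> \<le> B" "0 \<le> B"
  shows "\<bar>riemann_sum l I \<kappa> x F - (\<Sum>i\<in>I. \<Sum>k\<in>K. V (\<lambda>r. F (x i, r)) (\<lambda>s. l * (\<kappa> i s * \<theta> k s)))\<bar> \<le> 2 * B * e'"
proof -
  note PD = thin_partitionD[OF P] note QD = thin_partitionD[OF Q]
  note ID = disjoint_family_funD[OF PD(1)] note KD = disjoint_family_funD[OF QD(1)]
  let ?W = "\<lambda>s. \<Sum>k\<in>K. l * \<theta> k s"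
  have W: "radial_fun ?W" by (intro radial_fun_sum radial_fun_mult radial_fun_const l KD(2))
  have Wl: "?W s \<le> l" if "s \<in> usphere" for s
    using disjoint_family_sum_le[OF QD(1) that, of "\<lambda>_. l" l] l by simp
  have eq: "(\<Sum>k\<in>K. V (\<lambda>r. F (x i, r)) (\<lambda>s. l * (\<kappa> i s * \<theta> k s))) = V (\<lambda>r. F (x i, r)) (\<lambda>s. ?W s * \<kappa> i s)" if i: "i \<in> I" for i
  proof -
    have "V (\<lambda>r. F (x i, r)) (\<lambda>s. ?W s * \<kappa> i s) = V (\<lambda>r. F (x i, r)) (\<lambda>s. \<Sum>k\<in>K. (l * \<kappa> i s) * \<theta> k s)"
      by (rule V_cong) (simp add: sum_distrib_left ac_simps)
    also have "\<dots> = (\<Sum>k\<in>K. V (\<lambda>r. F (x i, r)) (\<lambda>s. (l * \<kappa> i s) * \<theta> k s))"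
      by (rule V_disjoint_mult[OF QD(1)]) (intro radial_fun_mult radial_fun_const l ID(2) i continuous_on_section F)+
    finally show ?thesis by (simp add: ac_simps)
  qed
  have "\<bar>riemann_sum l I \<kappa> x F - (\<Sum>i\<in>I. \<Sum>k\<in>K. V (\<lambda>r. F (x i, r)) (\<lambda>s. l * (\<kappa> i s * \<theta> k s)))\<bar>
      = \<bar>\<Sum>i\<in>I. (V (\<lambda>r. F (x i, r)) (\<lambda>s. l * \<kappa> i s) - V (\<lambda>r. F (x i, r)) (\<lambda>s. ?W s * \<kappa> i s))\<bar>"
    unfolding riemann_sum_def by (simp add: eq sum_subtractf)
  also have "\<dots> \<le> (\<Sum>i\<in>I. \<bar>V (\<lambda>r. F (x i, r)) (\<lambda>s. l * \<kappa> i s) - V (\<lambda>r. F (x i, r)) (\<lambda>s. ?W s * \<kappa> i s)\<bar>)"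
    by (rule sum_abs)
  also have "\<dots> \<le> 2 * B * e'"
  proof (rule localization_family[OF PD(1) _ _ W Wl _ QD(2,3)])
    show "0 \<le> \<Lambda>" using l by simp
    show "radial_fun (\<lambda>_. l)" using l by (rule_tac radial_fun_const)
    show "1 \<le> \<psi>' s" if "s \<in> usphere" "l \<noteq> ?W s" for s
      using that by (intro QD(4)) (auto simp: sum_distrib_left[symmetric])
    show "\<bar>F (x i, s)\<bar> \<le> B" if "i \<in> I" "s \<in> usphere" for i s
      using that PD(5) by (intro B(1)) auto
  qed (use l B in \<open>auto intro: continuous_on_section F\<close>)
  finally show ?thesis .
qed

text \<open>Both sums pass to the common refinement by products of cut-offs, at the cost of the
  seams. A product cell that meets the sphere has its two sample points less than 2d apart, and the
  total mass of the product cells is at most \<open>C\<close>.\<close>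

lemma riemann_sum_compare:
  assumes P: "thin_partition \<Lambda> d e I \<kappa> x \<psi>" and Q: "thin_partition \<Lambda> d e K \<theta> y \<psi>'"
    and l: "0 \<le> l" "l \<le> \<Lambda>" and F: "continuous_on UNIV F"
    and B: "\<And>z. z \<in> usphere \<times> usphere \<Longrightarrow> \<bar>F z\<bar> \<le> B" "0 \<le> B"
    and C: "\<And>f. radial_fun f \<Longrightarrow> (\<And>s. s \<in> usphere \<Longrightarrow> f s \<le> \<Lambda>) \<Longrightarrow> V1 f \<le> C"
    and \<omega>: "\<And>a b r. a \<in> usphere \<Longrightarrow> b \<in> usphere \<Longrightarrow> r \<in> usphere \<Longrightarrow> dist a b < 2 * d \<Longrightarrow> \<bar>F (a, r) - F (b, r)\<bar> \<le> \<omega>" "0 \<le> \<omega>"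
  shows "\<bar>riemann_sum l I \<kappa> x F - riemann_sum l K \<theta> y F\<bar> \<le> 4 * B * e + \<omega> * C"
proof -
  note PD = thin_partitionD[OF P] note QD = thin_partitionD[OF Q]
  note ID = disjoint_family_funD[OF PD(1)] note KD = disjoint_family_funD[OF QD(1)]
  let ?A = "\<Sum>i\<in>I. \<Sum>k\<in>K. V (\<lambda>r. F (x i, r)) (\<lambda>s. l * (\<kappa> i s * \<theta> k s))"
  let ?B = "\<Sum>i\<in>I. \<Sum>k\<in>K. V (\<lambda>r. F (y k, r)) (\<lambda>s. l * (\<kappa> i s * \<theta> k s))"
  have B2: "?B = (\<Sum>k\<in>K. \<Sum>i\<in>I. V (\<lambda>r. F (y k, r)) (\<lambda>s. l * (\<theta> k s * \<kappa> i s)))"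
    by (subst sum.swap) (simp add: mult.commute)
  have 1: "\<bar>riemann_sum l I \<kappa> x F - ?A\<bar> \<le> 2 * B * e" by (rule riemann_sum_refine[OF P Q l F B])
  have 2: "\<bar>riemann_sum l K \<theta> y F - ?B\<bar> \<le> 2 * B * e" unfolding B2 by (rule riemann_sum_refine[OF Q P l F B])
  have each: "\<bar>V (\<lambda>r. F (x i, r)) (\<lambda>s. l * (\<kappa> i s * \<theta> k s)) - V (\<lambda>r. F (y k, r)) (\<lambda>s. l * (\<kappa> i s * \<theta> k s))\<bar>
      \<le> \<omega> * V1 (\<lambda>s. l * (\<kappa> i s * \<theta> k s))" if ik: "i \<in> I" "k \<in> K" for i k
  proof (cases "\<exists>s\<in>usphere. \<kappa> i s * \<theta> k s \<noteq> 0")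
    case True
    then obtain s where s: "s \<in> usphere" "\<kappa> i s \<noteq> 0" "\<theta> k s \<noteq> 0" by auto
    have "dist (x i) (y k) \<le> dist s (x i) + dist s (y k)" by (metis dist_commute dist_triangle2 dist_triangle)
    then have "dist (x i) (y k) < 2 * d" using PD(6)[OF ik(1) s(1,2)] QD(6)[OF ik(2) s(1,3)] by linarith
    then have \<omega>': "\<bar>F (x i, r) - F (y k, r)\<bar> \<le> \<omega>" if "r \<in> usphere" for r
      using PD(5)[OF ik(1)] QD(5)[OF ik(2)] that by (intro \<omega>)
    have rf: "radial_fun (\<lambda>s. l * (\<kappa> i s * \<theta> k s))" by (intro radial_fun_mult radial_fun_const l ID(2) KD(2) ik)
    have "V (\<lambda>r. F (x i, r)) (\<lambda>s. l * (\<kappa> i s * \<theta> k s)) - V (\<lambda>r. F (y k, r)) (\<lambda>s. l * (\<kappa> i s * \<theta> k s))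
        = V (\<lambda>r. F (x i, r) - F (y k, r)) (\<lambda>s. l * (\<kappa> i s * \<theta> k s))"
      by (rule V_diff[symmetric]) (intro rf continuous_on_section F)+
    also have "\<bar>\<dots>\<bar> \<le> \<omega> * V1 (\<lambda>s. l * (\<kappa> i s * \<theta> k s))"
      by (rule abs_V_le[OF rf _ \<omega>']) (intro continuous_intros continuous_on_section F)
    finally show ?thesis .
  next
    case False
    then have "V g (\<lambda>s. l * (\<kappa> i s * \<theta> k s)) = 0" for g by (intro V_eq_zero) (auto simp del: mem_sphere)
    then show ?thesis by simp
  qed
  have "\<bar>?A - ?B\<bar> = \<bar>\<Sum>i\<in>I. \<Sum>k\<in>K. (V (\<lambda>r. F (x i, r)) (\<lambda>s. l * (\<kappa> i s * \<theta> k s)) - V (\<lambda>r. F (y k, r)) (\<lambda>s. l * (\<kappa> i s * \<theta> k s)))\<bar>"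
    by (simp add: sum_subtractf)
  also have "\<dots> \<le> (\<Sum>i\<in>I. \<Sum>k\<in>K. \<omega> * V1 (\<lambda>s. l * (\<kappa> i s * \<theta> k s)))"
    by (rule order_trans[OF sum_abs], rule sum_mono, rule order_trans[OF sum_abs], rule sum_mono) (rule each)
  also have "\<dots> = \<omega> * (\<Sum>p\<in>I \<times> K. V1 (\<lambda>s. l * (\<kappa> (fst p) s * \<theta> (snd p) s)))"
    by (simp add: sum.cartesian_product case_prod_beta sum_distrib_left)
  also have "\<dots> \<le> \<omega> * C"
    by (intro mult_left_mono sum_V1_le[OF disjoint_family_product[OF PD(1) QD(1)] l C] \<omega>(2))
  finally have "\<bar>?A - ?B\<bar> \<le> \<omega> * C" .
  with 1 2 show ?thesis by linarith
qed

text \<open>The height bound tends to infinity while mesh and seam mass tend to 0, so one sequence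
  serves all heights, and Riemann sums at different heights can be compared cell by cell.\<close>

definition seq_partition ::
  "nat \<Rightarrow> ('a \<times> int) set set \<times> (('a \<times> int) set \<Rightarrow> 'a \<Rightarrow> real) \<times> (('a \<times> int) set \<Rightarrow> 'a) \<times> ('a \<Rightarrow> real)" where
  "seq_partition j = (SOME (I, \<kappa>, x, \<psi>). thin_partition (real j) (1 / real (Suc j)) (1 / real (Suc j)) I \<kappa> x \<psi>)"

definition "seq_cells j = fst (seq_partition j)"
definition "seq_bumps j = fst (snd (seq_partition j))"
definition "seq_points j = fst (snd (snd (seq_partition j)))"
definition "seq_seam j = snd (snd (snd (seq_partition j)))"

lemma seq_partition:
  "thin_partition (real j) (1 / real (Suc j)) (1 / real (Suc j)) (seq_cells j) (seq_bumps j) (seq_points j) (seq_seam j)"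
proof -
  obtain I :: "('a \<times> int) set set" and \<kappa> x \<psi> where
    P: "thin_partition (real j) (1 / real (Suc j)) (1 / real (Suc j)) I \<kappa> x \<psi>"
    using thin_partition_exists[of "real j" "1 / real (Suc j)" "1 / real (Suc j)"] by auto
  have "(case seq_partition j of (I, \<kappa>, x, \<psi>) \<Rightarrow> thin_partition (real j) (1 / real (Suc j)) (1 / real (Suc j)) I \<kappa> x \<psi>)"
    unfolding seq_partition_def by (rule someI[of _ "(I, \<kappa>, x, \<psi>)"]) (use P in simp)
  then show ?thesis
    by (simp add: case_prod_beta seq_cells_def seq_bumps_def seq_points_def seq_seam_def del: of_nat_Suc)
qed

lemma seq_disjoint: "disjoint_family_fun (seq_cells j) (seq_bumps j)"
  by (rule thin_partitionD(1)[OF seq_partition])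

lemma seq_points_usphere: "i \<in> seq_cells j \<Longrightarrow> seq_points j i \<in> usphere"
  by (rule thin_partitionD(5)[OF seq_partition])

lemma eventually_seq_partition:
  assumes "0 < d" "0 < e"
  shows "eventually (\<lambda>j. thin_partition \<Lambda> d e (seq_cells j) (seq_bumps j) (seq_points j) (seq_seam j)) sequentially"
proof -
  have "eventually (\<lambda>j. \<Lambda> \<le> real j) sequentially"
    using filterlim_real_sequentially by (simp add: filterlim_at_top)
  moreover have "eventually (\<lambda>j. 1 / real (Suc j) < min d e) sequentially"
    using LIMSEQ_inverse_real_of_nat assms by (intro order_tendstoD(2)[of _ 0]) (auto simp: inverse_eq_divide)
  ultimately show ?thesis
    by eventually_elim (rule thin_partition_mono[OF seq_partition], auto)
qed

definition riemann_seq :: "real \<Rightarrow> ('a \<times> 'a \<Rightarrow> real) \<Rightarrow> nat \<Rightarrow> real" where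
  "riemann_seq l F j = riemann_sum l (seq_cells j) (seq_bumps j) (seq_points j) F"

definition M :: "real \<Rightarrow> ('a \<times> 'a \<Rightarrow> real) \<Rightarrow> real" where
  "M l F = lim (riemann_seq l F)"

lemma riemann_sum_close:
  assumes l: "0 \<le> l" and F: "continuous_on UNIV F" and \<epsilon>: "0 < \<epsilon>"
  obtains d e where "0 < d" "0 < e"
    "\<And>(I :: ('a \<times> int) set set) \<kappa> x \<psi> (K :: ('a \<times> int) set set) \<theta> y \<psi>'. thin_partition l d e I \<kappa> x \<psi> \<Longrightarrow>
      thin_partition l d e K \<theta> y \<psi>' \<Longrightarrow> \<bar>riemann_sum l I \<kappa> x F - riemann_sum l K \<theta> y F\<bar> \<le> \<epsilon>"
proof -
  obtain C where C: "0 \<le> C" "\<And>f. radial_fun f \<Longrightarrow> (\<And>s. s \<in> usphere \<Longrightarrow> f s \<le> l) \<Longrightarrow> V1 f \<le> C"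
    using V1_bounded[OF l] by metis
  obtain B where B: "0 \<le> B" "\<And>z. z \<in> usphere \<times> usphere \<Longrightarrow> \<bar>F z\<bar> \<le> B" using continuous_usphere_bounded[OF F] by metis
  define \<omega> where "\<omega> = \<epsilon> / (2 * (C + 1))"
  have \<omega>: "0 < \<omega>" using \<epsilon> C by (simp add: \<omega>_def)
  have "uniformly_continuous_on (usphere \<times> usphere) F"
    by (intro compact_uniformly_continuous compact_Times continuous_on_subset[OF F]) auto
  then obtain d where d: "0 < d" "\<And>x z. x \<in> usphere \<times> usphere \<Longrightarrow> z \<in> usphere \<times> usphere \<Longrightarrow> dist z x < d \<Longrightarrow> dist (F z) (F x) < \<omega>"
    using \<omega> unfolding uniformly_continuous_on_def by metis
  define e where "e = \<epsilon> / (8 * (B + 1))"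
  have e: "0 < e" using \<epsilon> B by (simp add: e_def)
  show thesis
  proof
    show "0 < d / 2" "0 < e" using d e by auto
    fix I K :: "('a \<times> int) set set" and \<kappa> \<theta> x y \<psi> \<psi>'
    assume P: "thin_partition l (d / 2) e I \<kappa> x \<psi>" and Q: "thin_partition l (d / 2) e K \<theta> y \<psi>'"
    have "\<bar>riemann_sum l I \<kappa> x F - riemann_sum l K \<theta> y F\<bar> \<le> 4 * B * e + \<omega> * C"
    proof (rule riemann_sum_compare[OF P Q l order_refl F B(2,1) C(2)])
      show "\<bar>F (a, r) - F (b, r)\<bar> \<le> \<omega>" if "a \<in> usphere" "b \<in> usphere" "r \<in> usphere" "dist a b < 2 * (d / 2)" for a b r
        using d(2)[of "(b, r)" "(a, r)"] that by (auto simp: dist_Pair_Pair dist_real_def)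
    qed (use \<omega> in auto)
    also have "4 * B * e \<le> \<epsilon> / 2" using B \<epsilon> by (simp add: e_def field_simps)
    also have "\<omega> * C \<le> \<epsilon> / 2" using C \<epsilon> by (simp add: \<omega>_def field_simps)
    finally show "\<bar>riemann_sum l I \<kappa> x F - riemann_sum l K \<theta> y F\<bar> \<le> \<epsilon>" by simp
  qed
qed

lemma riemann_seq_tendsto:
  assumes l: "0 \<le> l" and F: "continuous_on UNIV F"
  shows "riemann_seq l F \<longlonglongrightarrow> M l F"
proof -
  have "Cauchy (riemann_seq l F)"
    unfolding Cauchy_def
  proof (intro allI impI)
    fix \<epsilon> :: real assume \<epsilon>: "0 < \<epsilon>"
    obtain d e where de: "0 < d" "0 < e"
      "\<And>(I :: ('a \<times> int) set set) \<kappa> x \<psi> (K :: ('a \<times> int) set set) \<theta> y \<psi>'. thin_partition l d e I \<kappa> x \<psi> \<Longrightarrow>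
      thin_partition l d e K \<theta> y \<psi>' \<Longrightarrow> \<bar>riemann_sum l I \<kappa> x F - riemann_sum l K \<theta> y F\<bar> \<le> \<epsilon> / 2"
      using riemann_sum_close[OF l F half_gt_zero[OF \<epsilon>]] by metis
    obtain J where J: "\<And>j. J \<le> j \<Longrightarrow> thin_partition l d e (seq_cells j) (seq_bumps j) (seq_points j) (seq_seam j)"
      using eventually_seq_partition[OF de(1,2)] unfolding eventually_sequentially by blast
    have "dist (riemann_seq l F m) (riemann_seq l F n) < \<epsilon>" if "J \<le> m" "J \<le> n" for m n
      using de(3)[OF J[OF that(1)] J[OF that(2)]] \<epsilon> by (simp add: riemann_seq_def dist_real_def)
    then show "\<exists>M. \<forall>m\<ge>M. \<forall>n\<ge>M. dist (riemann_seq l F m) (riemann_seq l F n) < \<epsilon>" by blast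
  qed
  then have "convergent (riemann_seq l F)" by (rule Cauchy_convergent)
  then show ?thesis unfolding M_def by (simp add: convergent_LIMSEQ_iff)
qed

text \<open>Shows that the limit is not tied to the chosen sequence: every fine enough thin
  partition approximates it, in particular a rotated one.\<close>

lemma M_approx:
  assumes l: "0 \<le> l" and F: "continuous_on UNIV F" and \<epsilon>: "0 < \<epsilon>"
  obtains d e where "0 < d" "0 < e"
    "\<And>(I :: ('a \<times> int) set set) \<kappa> x \<psi>. thin_partition l d e I \<kappa> x \<psi> \<Longrightarrow> \<bar>riemann_sum l I \<kappa> x F - M l F\<bar> \<le> \<epsilon>"
proof -
  obtain d e where de: "0 < d" "0 < e"
    "\<And>(I :: ('a \<times> int) set set) \<kappa> x \<psi> (K :: ('a \<times> int) set set) \<theta> y \<psi>'. thin_partition l d e I \<kappa> x \<psi> \<Longrightarrow>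
      thin_partition l d e K \<theta> y \<psi>' \<Longrightarrow> \<bar>riemann_sum l I \<kappa> x F - riemann_sum l K \<theta> y F\<bar> \<le> \<epsilon>"
    using riemann_sum_close[OF l F \<epsilon>] by metis
  show thesis
  proof
    fix I :: "('a \<times> int) set set" and \<kappa> x \<psi> assume P: "thin_partition l d e I \<kappa> x \<psi>"
    have "(\<lambda>j. \<bar>riemann_sum l I \<kappa> x F - riemann_seq l F j\<bar>) \<longlonglongrightarrow> \<bar>riemann_sum l I \<kappa> x F - M l F\<bar>"
      by (intro tendsto_intros riemann_seq_tendsto l F)
    moreover have "eventually (\<lambda>j. \<bar>riemann_sum l I \<kappa> x F - riemann_seq l F j\<bar> \<le> \<epsilon>) sequentially"
      using eventually_seq_partition[OF de(1,2)]
      by eventually_elim (use de(3)[OF P] in \<open>auto simp: riemann_seq_def\<close>)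
    ultimately show "\<bar>riemann_sum l I \<kappa> x F - M l F\<bar> \<le> \<epsilon>"
      by (rule tendsto_upperbound) simp
  qed (use de in auto)
qed

section \<open>Lipschitz bound, rotation invariance and Fubini for the limit functional\<close>

lemma riemann_sum_lip:
  assumes I: "disjoint_family_fun I \<kappa>" "\<And>i. i \<in> I \<Longrightarrow> x i \<in> usphere" and l: "0 \<le> l" "l \<le> \<Lambda>"
    and F: "continuous_on UNIV F" "continuous_on UNIV G"
    and C: "\<And>f. radial_fun f \<Longrightarrow> (\<And>s. s \<in> usphere \<Longrightarrow> f s \<le> \<Lambda>) \<Longrightarrow> V1 f \<le> C"
    and e: "\<And>z. z \<in> usphere \<times> usphere \<Longrightarrow> \<bar>F z - G z\<bar> \<le> e" "0 \<le> e"
  shows "\<bar>riemann_sum l I \<kappa> x F - riemann_sum l I \<kappa> x G\<bar> \<le> C * e"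
proof -
  have each: "\<bar>V (\<lambda>r. F (x i, r)) (\<lambda>s. l * \<kappa> i s) - V (\<lambda>r. G (x i, r)) (\<lambda>s. l * \<kappa> i s)\<bar> \<le> e * V1 (\<lambda>s. l * \<kappa> i s)"
    if i: "i \<in> I" for i
  proof -
    have rf: "radial_fun (\<lambda>s. l * \<kappa> i s)" by (intro radial_fun_mult radial_fun_const l disjoint_family_funD(2)[OF I(1)] i)
    have "V (\<lambda>r. F (x i, r)) (\<lambda>s. l * \<kappa> i s) - V (\<lambda>r. G (x i, r)) (\<lambda>s. l * \<kappa> i s) = V (\<lambda>r. F (x i, r) - G (x i, r)) (\<lambda>s. l * \<kappa> i s)"
      by (rule V_diff[symmetric]) (intro rf continuous_on_section F)+
    also have "\<bar>\<dots>\<bar> \<le> e * V1 (\<lambda>s. l * \<kappa> i s)"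
      by (rule abs_V_le[OF rf]) (use I(2)[OF i] in \<open>auto intro!: e continuous_intros continuous_on_section F\<close>)
    finally show ?thesis .
  qed
  have "\<bar>riemann_sum l I \<kappa> x F - riemann_sum l I \<kappa> x G\<bar> \<le> (\<Sum>i\<in>I. e * V1 (\<lambda>s. l * \<kappa> i s))"
    unfolding riemann_sum_def sum_subtractf[symmetric]
    by (rule order_trans[OF sum_abs], rule sum_mono) (rule each)
  also have "\<dots> = e * (\<Sum>i\<in>I. V1 (\<lambda>s. l * \<kappa> i s))" by (simp add: sum_distrib_left)
  also have "\<dots> \<le> e * C" by (intro mult_left_mono sum_V1_le[OF I(1) l C] e)
  finally show ?thesis by (simp add: mult.commute)
qed

lemma riemann_seq_lip:
  assumes l: "0 \<le> l" "l \<le> \<Lambda>"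
    and F: "continuous_on UNIV F" "continuous_on UNIV G"
    and C: "\<And>f. radial_fun f \<Longrightarrow> (\<And>s. s \<in> usphere \<Longrightarrow> f s \<le> \<Lambda>) \<Longrightarrow> V1 f \<le> C"
    and e: "\<And>z. z \<in> usphere \<times> usphere \<Longrightarrow> \<bar>F z - G z\<bar> \<le> e"
  shows "\<bar>riemann_seq l F j - riemann_seq l G j\<bar> \<le> C * e"
proof -
  obtain b :: 'a where "b \<in> Basis" using SOME_Basis by blast
  then have "0 \<le> e" using e[of "(b, b)"] by simp
  then show ?thesis
    unfolding riemann_seq_def by (intro riemann_sum_lip[OF seq_disjoint seq_points_usphere l F C e])
qed

lemma M_lip:
  assumes l: "0 \<le> l" "l \<le> \<Lambda>"
    and F: "continuous_on UNIV F" "continuous_on UNIV G"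
    and C: "\<And>f. radial_fun f \<Longrightarrow> (\<And>s. s \<in> usphere \<Longrightarrow> f s \<le> \<Lambda>) \<Longrightarrow> V1 f \<le> C"
    and e: "\<And>z. z \<in> usphere \<times> usphere \<Longrightarrow> \<bar>F z - G z\<bar> \<le> e"
  shows "\<bar>M l F - M l G\<bar> \<le> C * e"
proof (rule tendsto_upperbound)
  show "(\<lambda>j. \<bar>riemann_seq l F j - riemann_seq l G j\<bar>) \<longlonglongrightarrow> \<bar>M l F - M l G\<bar>"
    by (intro tendsto_intros riemann_seq_tendsto l F)
  show "eventually (\<lambda>j. \<bar>riemann_seq l F j - riemann_seq l G j\<bar> \<le> C * e) sequentially"
    by (intro always_eventually allI riemann_seq_lip[OF l F C e])
qed simp

text \<open>By equivariance, the Riemann sum of the rotated integrand on a partition equals the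
  Riemann sum of \<open>F\<close> on the rotated partition; both approximate their limits.\<close>

lemma M_rotate:
  fixes \<phi> :: "'a \<Rightarrow> 'a"
  assumes l: "0 \<le> l" and F: "continuous_on UNIV F" and \<phi>: "orthogonal_transformation \<phi>"
  shows "M l (\<lambda>x. F (map_prod \<phi> \<phi> x)) = M l F"
proof -
  have \<phi>c: "continuous_on UNIV \<phi>"
    using \<phi> by (simp add: orthogonal_transformation_def linear_continuous_on linear_linear)
  have F\<phi>: "continuous_on UNIV (\<lambda>x. F (map_prod \<phi> \<phi> x))"
    unfolding map_prod_def case_prod_beta
    by (rule continuous_on_compose2[OF F])
      (auto intro!: continuous_on_Pair continuous_on_compose2[OF \<phi>c] continuous_intros)
  have inv: "inv \<phi> (\<phi> s) = s" for s
    using orthogonal_transformation_bij[OF \<phi>] by (auto simp: bij_is_inj)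
  have i\<phi>: "orthogonal_transformation (inv \<phi>)" by (rule orthogonal_transformation_inv[OF \<phi>])
  have "\<bar>M l (\<lambda>x. F (map_prod \<phi> \<phi> x)) - M l F\<bar> \<le> 0 + \<epsilon>" if \<epsilon>: "0 < \<epsilon>" for \<epsilon>
  proof -
    obtain d e where de: "0 < d" "0 < e"
      "\<And>(I :: ('a \<times> int) set set) \<kappa> x \<psi>. thin_partition l d e I \<kappa> x \<psi> \<Longrightarrow> \<bar>riemann_sum l I \<kappa> x F - M l F\<bar> \<le> \<epsilon> / 2"
      using M_approx[OF l F half_gt_zero[OF \<epsilon>]] by metis
    obtain d' e' where de': "0 < d'" "0 < e'"
      "\<And>(I :: ('a \<times> int) set set) \<kappa> x \<psi>. thin_partition l d' e' I \<kappa> x \<psi> \<Longrightarrow>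
         \<bar>riemann_sum l I \<kappa> x (\<lambda>x. F (map_prod \<phi> \<phi> x)) - M l (\<lambda>x. F (map_prod \<phi> \<phi> x))\<bar> \<le> \<epsilon> / 2"
      using M_approx[OF l F\<phi> half_gt_zero[OF \<epsilon>]] by metis
    obtain I :: "('a \<times> int) set set" and \<kappa> x \<psi> where P: "thin_partition l (min d d') (min e e') I \<kappa> x \<psi>"
      using thin_partition_exists[OF l, of "min d d'" "min e e'"] de de' by auto
    have 1: "thin_partition l d' e' I \<kappa> x \<psi>" by (rule thin_partition_mono[OF P]) auto
    have 2: "thin_partition l d e I (\<lambda>i s. \<kappa> i (inv \<phi> s)) (\<lambda>i. \<phi> (x i)) (\<lambda>s. \<psi> (inv \<phi> s))"
      by (rule thin_partition_rotate[OF thin_partition_mono[OF P] \<phi>]) auto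
    have "V (\<lambda>r. F (\<phi> (x i), \<phi> r)) (\<lambda>s. l * \<kappa> i s) = V (\<lambda>r. F (\<phi> (x i), r)) (\<lambda>s. l * \<kappa> i (inv \<phi> s))" if i: "i \<in> I" for i
    proof -
      have "radial_fun (\<lambda>s. l * \<kappa> i (inv \<phi> s))"
        using radial_fun_rotate[OF i\<phi> disjoint_family_funD(2)[OF thin_partitionD(1)[OF P] i]] l
        by (intro radial_fun_mult radial_fun_const) (auto simp: o_def)
      from V_rotate[OF this continuous_on_section[OF F] \<phi>, of "\<phi> (x i)"] show ?thesis by (simp add: inv)
    qed
    then have "riemann_sum l I \<kappa> x (\<lambda>x. F (map_prod \<phi> \<phi> x)) = riemann_sum l I (\<lambda>i s. \<kappa> i (inv \<phi> s)) (\<lambda>i. \<phi> (x i)) F"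
      unfolding riemann_sum_def by simp
    then show ?thesis using de(3)[OF 2] de'(3)[OF 1] by linarith
  qed
  then have "\<bar>M l (\<lambda>x. F (map_prod \<phi> \<phi> x)) - M l F\<bar> \<le> 0" by (rule field_le_epsilon)
  then show ?thesis by simp
qed

lemma V_swap:
  fixes G :: "'a \<Rightarrow> 'b::second_countable_topology \<Rightarrow> real"
  assumes f: "radial_fun f" and T: "prob_space T" "sets T = sets borel" "AE y in T. y \<in> K" "compact K"
    and G: "continuous_on UNIV (\<lambda>(r, y). G r y)"
  shows "V (\<lambda>r. \<integral>y. G r y \<partial>T) f = (\<integral>y. V (\<lambda>r. G r y) f \<partial>T)"
    and "(\<lambda>y. V (\<lambda>r. G r y) f) \<in> borel_measurable T"
proof -
  note [measurable_cong] = T(2)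
  interpret T: prob_space T by fact
  interpret Z: finite_measure "Z (body f)" by (rule Z_body(2)[OF f])
  interpret P: pair_sigma_finite "Z (body f)" T ..
  have idm: "(\<lambda>x. x) \<in> measurable (Z (body f)) borel"
    using measurable_restrict_space1[of "\<lambda>x. x" borel borel usphere] by (simp cong: measurable_cong_sets add: Z_body(1)[OF f])
  have "(\<lambda>(r, y). G r y) \<in> borel_measurable (borel \<Otimes>\<^sub>M borel)"
    unfolding borel_prod using G by (rule borel_measurable_continuous_onI)
  moreover have "(\<lambda>p. (fst p, snd p)) \<in> measurable (Z (body f) \<Otimes>\<^sub>M T) (borel \<Otimes>\<^sub>M borel)"
    using measurable_compose[OF measurable_fst idm, of T] by (intro measurable_Pair) (auto cong: measurable_cong_sets)
  ultimately have Gm: "(\<lambda>(r, y). G r y) \<in> borel_measurable (Z (body f) \<Otimes>\<^sub>M T)"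
    using measurable_compose by fastforce
  obtain B where B: "0 \<le> B" "\<And>z. z \<in> usphere \<times> K \<Longrightarrow> \<bar>(\<lambda>(r, y). G r y) z\<bar> \<le> B"
    using continuous_on_compact_abs_bound[OF compact_Times[OF compact_sphere T(4)] continuous_on_subset[OF G]] by (metis subset_UNIV)
  have Gr: "G r \<in> borel_measurable T" for r
  proof -
    have "continuous_on UNIV (\<lambda>y. (\<lambda>(r, y). G r y) (r, y))"
      by (rule continuous_on_compose2[OF G]) (auto intro!: continuous_on_Pair continuous_on_const continuous_on_id)
    then have "G r \<in> borel_measurable borel" using borel_measurable_continuous_onI[of "G r"] by simp
    then show ?thesis by (simp cong: measurable_cong_sets)
  qed
  have int: "integrable (Z (body f) \<Otimes>\<^sub>M T) (\<lambda>(r, y). G r y)"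
  proof (rule P.Fubini_integrable[OF Gm])
    have "(\<integral>y. norm (G r y) \<partial>T) \<le> B" if "r \<in> usphere" for r
    proof -
      have "AE y in T. norm (G r y) \<le> B" using T(3) by eventually_elim (use B(2)[of "(r, _)"] that in auto)
      moreover note Gr[of r]
      ultimately have "(\<integral>y. norm (G r y) \<partial>T) \<le> (\<integral>y. B \<partial>T)"
        using B(1) by (intro integral_mono_AE T.integrable_const_bound[where B=B]) auto
      then show ?thesis by (simp add: T.prob_space)
    qed
    then show "integrable (Z (body f)) (\<lambda>r. \<integral>y. norm (case (r, y) of (r, y) \<Rightarrow> G r y) \<partial>T)"
      using Gm by (intro Z.integrable_const_bound[where B=B] AE_I2)
        (auto simp: Z_body[OF f] intro!: T.borel_measurable_lebesgue_integral measurable_compose[OF _ borel_measurable_norm])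
    show "AE r in Z (body f). integrable T (\<lambda>y. case (r, y) of (r, y) \<Rightarrow> G r y)"
    proof (rule AE_I2)
      fix r assume r: "r \<in> space (Z (body f))"
      have "AE y in T. norm (G r y) \<le> B" using T(3) by eventually_elim (use B(2)[of "(r, _)"] r in \<open>auto simp: Z_body[OF f]\<close>)
      moreover note Gr[of r]
      ultimately show "integrable T (\<lambda>y. case (r, y) of (r, y) \<Rightarrow> G r y)"
        by (simp, intro T.integrable_const_bound[where B=B]) auto
    qed
  qed
  show "V (\<lambda>r. \<integral>y. G r y \<partial>T) f = (\<integral>y. V (\<lambda>r. G r y) f \<partial>T)"
    unfolding V_def using P.Fubini_integral[OF int] by simp
  show "(\<lambda>y. V (\<lambda>r. G r y) f) \<in> borel_measurable T"
    unfolding V_def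
    by (rule Z.borel_measurable_lebesgue_integral) (use measurable_pair_swap[OF Gm] in simp)
qed

text \<open>Fubini holds for each Riemann sum, a finite sum of integrals. Dominated convergence with
  the bound \<open>C * B\<close>, uniform in the index, carries it to the limit.\<close>

lemma M_swap:
  fixes b :: 'a
  assumes l: "0 \<le> l" and G: "continuous_on UNIV (\<lambda>(x, y). G x y)" and b: "b \<in> usphere"
  shows "M l (\<lambda>x. \<integral>y. G x y \<partial>frame_law b) = (\<integral>y. M l (\<lambda>x. G x y) \<partial>frame_law b)"
proof -
  interpret T: prob_space "frame_law b" by (rule prob_space_frame_law[OF dim b])
  note fl = prob_space_frame_law[OF dim b] sets_frame_law AE_frame_law[OF dim b] compact_frames
  obtain C where C: "0 \<le> C" "\<And>f. radial_fun f \<Longrightarrow> (\<And>s. s \<in> usphere \<Longrightarrow> f s \<le> l) \<Longrightarrow> V1 f \<le> C"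
    using V1_bounded[OF l] by metis
  have Gc: "continuous_on A (\<lambda>z. G (f z) (h z))" if "continuous_on A f" "continuous_on A h"
    for A :: "'c::topological_space set" and f h
    using continuous_on_compose2[OF G continuous_on_Pair[OF that]] by simp
  have comp: "compact ((usphere \<times> usphere) \<times> (frames :: ('a \<times> 'a) set))"
    by (intro compact_Times compact_frames) auto
  obtain B where B: "0 \<le> B" "\<And>z. z \<in> (usphere \<times> usphere) \<times> frames \<Longrightarrow> \<bar>(\<lambda>(x, y). G x y) z\<bar> \<le> B"
    using continuous_on_compact_abs_bound[OF comp continuous_on_subset[OF G]] by (metis subset_UNIV)
  have Gi: "continuous_on UNIV (\<lambda>x. \<integral>y. G x y \<partial>frame_law b)"
    by (rule continuous_on_integral_parameter[OF G fl(1,2,4,3)])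
  have Gy: "continuous_on UNIV (\<lambda>x. G x y)" for y by (intro Gc continuous_intros)
  have rf: "radial_fun (\<lambda>s. l * seq_bumps j i s)" if "i \<in> seq_cells j" for i j
    by (intro radial_fun_mult radial_fun_const l disjoint_family_funD(2)[OF seq_disjoint] that)
  have Gsec: "continuous_on UNIV (\<lambda>(r, y). G (z, r) y)" for z
    unfolding case_prod_beta by (intro Gc continuous_intros)
  have meas: "(\<lambda>y. riemann_seq l (\<lambda>x. G x y) j) \<in> borel_measurable (frame_law b)" for j
    unfolding riemann_seq_def riemann_sum_def
    by (intro borel_measurable_sum V_swap(2)[OF rf fl Gsec])
  have bound: "\<bar>riemann_seq l (\<lambda>x. G x y) j\<bar> \<le> C * B" if "y \<in> frames" for y j
  proof -
    have "\<bar>riemann_seq l (\<lambda>x. G x y) j - riemann_seq l (\<lambda>x. 0) j\<bar> \<le> C * B"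
      by (rule riemann_seq_lip[OF l order_refl Gy _ C(2)]) (use B(2)[of "(_, y)"] that in auto)
    moreover have "V (\<lambda>r. 0) f = 0" for f by (simp add: V_def)
    ultimately show ?thesis by (simp add: riemann_seq_def riemann_sum_def)
  qed
  have int: "integrable (frame_law b) (\<lambda>y. V (\<lambda>r. G (seq_points j i, r) y) (\<lambda>s. l * seq_bumps j i s))"
    if i: "i \<in> seq_cells j" for i j
  proof (rule T.integrable_const_bound[OF _ V_swap(2)[OF rf[OF i] fl Gsec]])
    show "AE y in frame_law b. norm (V (\<lambda>r. G (seq_points j i, r) y) (\<lambda>s. l * seq_bumps j i s)) \<le> B * V1 (\<lambda>s. l * seq_bumps j i s)"
      using fl(3)
    proof eventually_elim
      case (elim y)
      then show ?case
        using seq_points_usphere[OF i] B(2)[of "((seq_points j i, _), y)"]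
        by (auto intro!: abs_V_le[OF rf[OF i]] Gc continuous_intros)
    qed
  qed
  have eq: "riemann_seq l (\<lambda>x. \<integral>y. G x y \<partial>frame_law b) j = (\<integral>y. riemann_seq l (\<lambda>x. G x y) j \<partial>frame_law b)" for j
    unfolding riemann_seq_def riemann_sum_def
    by (simp add: Bochner_Integration.integral_sum int V_swap(1)[OF rf fl Gsec])
  have "(\<lambda>j. \<integral>y. riemann_seq l (\<lambda>x. G x y) j \<partial>frame_law b) \<longlonglongrightarrow> (\<integral>y. M l (\<lambda>x. G x y) \<partial>frame_law b)"
  proof (rule integral_dominated_convergence[where w="\<lambda>_. C * B"])
    show "(\<lambda>y. M l (\<lambda>x. G x y)) \<in> borel_measurable (frame_law b)"
      by (rule borel_measurable_LIMSEQ_real[OF _ meas]) (rule riemann_seq_tendsto[OF l Gy])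
    show "AE y in frame_law b. (\<lambda>j. riemann_seq l (\<lambda>x. G x y) j) \<longlonglongrightarrow> M l (\<lambda>x. G x y)"
      by (intro AE_I2 riemann_seq_tendsto[OF l Gy])
    show "AE y in frame_law b. norm (riemann_seq l (\<lambda>x. G x y) j) \<le> C * B" for j
      using fl(3) by eventually_elim (use bound in auto)
  qed (use meas in auto)
  then have "riemann_seq l (\<lambda>x. \<integral>y. G x y \<partial>frame_law b) \<longlonglongrightarrow> (\<integral>y. M l (\<lambda>x. G x y) \<partial>frame_law b)"
    unfolding eq[symmetric] .
  then show ?thesis by (rule LIMSEQ_unique[OF riemann_seq_tendsto[OF l Gi]])
qed

lemma M_average:
  fixes b :: 'a
  assumes l: "0 \<le> l" and F: "continuous_on UNIV F" and b: "b \<in> usphere"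
  shows "M l F = M l (\<lambda>x. frame_average b F (fst x \<bullet> snd x))"
proof -
  obtain C where C: "\<And>f. radial_fun f \<Longrightarrow> (\<And>s. s \<in> usphere \<Longrightarrow> f s \<le> l) \<Longrightarrow> V1 f \<le> C"
    using V1_bounded[OF l] by metis
  show ?thesis
    by (rule invariant_functional_average[OF dim b M_lip[OF l order_refl _ _ C] M_rotate[OF l] M_swap[OF l _ b] F])
qed

text \<open>Near the seams the function made of the pieces may drop far below \<open>f\<close>.
  Filling the gap with the missing multiple of \<open>f\<close> gives a function uniformly within
  \<open>d\<close> of \<open>f\<close>, to which \<open>near\<close> applies; removing the filling
  changes values on the seams only.\<close>

lemma V_variation:
  fixes I :: "'i set"
  assumes f: "radial_fun f" and g: "continuous_on usphere g"
    and B: "\<And>s. s \<in> usphere \<Longrightarrow> \<bar>g s\<bar> \<le> B" "0 \<le> B"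
    and near: "\<And>k. radial_fun k \<Longrightarrow> (\<And>s. s \<in> usphere \<Longrightarrow> \<bar>k s - f s\<bar> \<le> d) \<Longrightarrow> \<bar>V g k - V g f\<bar> \<le> \<epsilon>"
    and \<Lambda>: "\<And>s. s \<in> usphere \<Longrightarrow> f s + d \<le> \<Lambda>" "0 \<le> \<Lambda>" and d: "0 \<le> d"
    and P: "thin_partition \<Lambda> d' e I \<kappa> x \<psi>" and h: "\<And>i. i \<in> I \<Longrightarrow> radial_fun (h i)"
    and close: "\<And>i s. i \<in> I \<Longrightarrow> s \<in> usphere \<Longrightarrow> \<kappa> i s \<noteq> 0 \<Longrightarrow> \<bar>h i s - f s\<bar> \<le> d"
  shows "\<bar>(\<Sum>i\<in>I. V g (\<lambda>s. h i s * \<kappa> i s)) - V g f\<bar> \<le> \<epsilon> + 2 * B * e"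
proof -
  note PD = thin_partitionD[OF P] note ID = disjoint_family_funD[OF PD(1)]
  define k where "k s = (\<Sum>i\<in>I. h i s * \<kappa> i s)" for s
  define k' where "k' s = k s + (1 - (\<Sum>i\<in>I. \<kappa> i s)) * f s" for s
  have krf: "radial_fun k" unfolding k_def by (intro radial_fun_sum radial_fun_mult h ID(2))
  have le1: "(\<Sum>i\<in>I. \<kappa> i s) \<le> 1" if "s \<in> usphere" for s
    using disjoint_family_sum_le[OF PD(1) that, of "\<lambda>_. 1" 1] by simp
  have k'rf: "radial_fun k'"
    unfolding radial_fun_def
  proof (intro conjI ballI)
    show "continuous_on usphere k'"
      unfolding k'_def by (intro continuous_intros radial_fun_continuous krf ID(2) f)
    show "0 \<le> k' s" if "s \<in> usphere" for s
      unfolding k'_def using radial_fun_nonneg[OF krf that] radial_fun_nonneg[OF f that] le1[OF that] by simp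
  qed
  have k'f: "\<bar>k' s - f s\<bar> \<le> d" if s: "s \<in> usphere" for s
    using PD(1) s
  proof (cases rule: disjoint_family_cases)
    case 1
    then show ?thesis using d by (simp add: k'_def k_def)
  next
    case (2 i)
    have "k s = h i s * \<kappa> i s"
      unfolding k_def by (rule disjoint_family_sum_single[OF PD(1) 2(1,3)])
    moreover have "(\<Sum>i\<in>I. \<kappa> i s) = \<kappa> i s"
      using disjoint_family_sum_single[OF PD(1) 2(1,3), of "\<lambda>_. 1"] by simp
    ultimately have "k' s - f s = (h i s - f s) * \<kappa> i s" by (simp add: k'_def algebra_simps)
    then have "\<bar>k' s - f s\<bar> = \<bar>h i s - f s\<bar> * \<kappa> i s" using ID(5)[OF 2(1) s] by (simp add: abs_mult)
    also have "\<dots> \<le> d * 1"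
      using close[OF 2(1) s 2(2)] ID(3,5)[OF 2(1) s] d by (intro mult_mono) auto
    finally show ?thesis by simp
  qed
  have "\<bar>V g k' - V g k\<bar> \<le> 2 * B * e"
  proof (rule localization[OF \<Lambda>(2) k'rf krf _ _ PD(2,3) _ g B])
    fix s :: 'a assume s: "s \<in> usphere"
    show "k s \<le> k' s" using le1[OF s] radial_fun_nonneg[OF f s] by (simp add: k'_def)
    show "k' s \<le> \<Lambda>" using k'f[OF s] \<Lambda>(1)[OF s] by auto
    show "1 \<le> \<psi> s" if "k' s \<noteq> k s" using that by (intro PD(4)[OF s]) (auto simp: k'_def)
  qed
  moreover have "\<bar>V g k' - V g f\<bar> \<le> \<epsilon>" by (rule near[OF k'rf k'f])
  moreover have "V g k = (\<Sum>i\<in>I. V g (\<lambda>s. h i s * \<kappa> i s))"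
    unfolding k_def by (rule V_disjoint_mult[OF PD(1) h g])
  ultimately show ?thesis by linarith
qed

text \<open>The hypothesis \<open>near\<close> controls a single signed quantity. Choosing in every
  cell whichever of \<open>h i\<close> and \<open>f\<close> gives the larger value, and in a second
  function the smaller one, makes the difference of the two totals equal to the sum of absolute
  values.\<close>

lemma V_total_variation:
  fixes I :: "'i set"
  assumes f: "radial_fun f" and g: "continuous_on usphere g"
    and B: "\<And>s. s \<in> usphere \<Longrightarrow> \<bar>g s\<bar> \<le> B" "0 \<le> B"
    and near: "\<And>k. radial_fun k \<Longrightarrow> (\<And>s. s \<in> usphere \<Longrightarrow> \<bar>k s - f s\<bar> \<le> d) \<Longrightarrow> \<bar>V g k - V g f\<bar> \<le> \<epsilon>"
    and \<Lambda>: "\<And>s. s \<in> usphere \<Longrightarrow> f s + d \<le> \<Lambda>" "0 \<le> \<Lambda>" and d: "0 \<le> d"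
    and P: "thin_partition \<Lambda> d' e I \<kappa> x \<psi>" and h: "\<And>i. i \<in> I \<Longrightarrow> radial_fun (h i)"
    and close: "\<And>i s. i \<in> I \<Longrightarrow> s \<in> usphere \<Longrightarrow> \<kappa> i s \<noteq> 0 \<Longrightarrow> \<bar>h i s - f s\<bar> \<le> d"
  shows "(\<Sum>i\<in>I. \<bar>V g (\<lambda>s. h i s * \<kappa> i s) - V g (\<lambda>s. f s * \<kappa> i s)\<bar>) \<le> 2 * \<epsilon> + 4 * B * e"
proof -
  define up where "up i \<longleftrightarrow> V g (\<lambda>s. f s * \<kappa> i s) \<le> V g (\<lambda>s. h i s * \<kappa> i s)" for i
  define hp where "hp i = (if up i then h i else f)" for i
  define hm where "hm i = (if up i then f else h i)" for i
  have "\<bar>(\<Sum>i\<in>I. V g (\<lambda>s. hp i s * \<kappa> i s)) - V g f\<bar> \<le> \<epsilon> + 2 * B * e"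
    by (rule V_variation[OF f g B near \<Lambda> d P]) (use h f close d in \<open>auto simp: hp_def\<close>)
  moreover have "\<bar>(\<Sum>i\<in>I. V g (\<lambda>s. hm i s * \<kappa> i s)) - V g f\<bar> \<le> \<epsilon> + 2 * B * e"
    by (rule V_variation[OF f g B near \<Lambda> d P]) (use h f close d in \<open>auto simp: hm_def\<close>)
  moreover have "(\<Sum>i\<in>I. \<bar>V g (\<lambda>s. h i s * \<kappa> i s) - V g (\<lambda>s. f s * \<kappa> i s)\<bar>)
      = (\<Sum>i\<in>I. V g (\<lambda>s. hp i s * \<kappa> i s) - V g (\<lambda>s. hm i s * \<kappa> i s))"
    by (rule sum.cong) (auto simp: hp_def hm_def up_def)
  ultimately show ?thesis by (simp add: sum_subtractf)
qed

text \<open>The test function in a Riemann sum changes with the cell through the sample point, while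
  \<open>V_total_variation\<close> treats one test function at a time. A finite net \<open>Y\<close>
  of first arguments reduces the sum to finitely many test functions, up to the oscillation of
  \<open>F\<close>.\<close>

lemma continuous_on_M:
  assumes F: "continuous_on UNIV F"
  shows "continuous_on {0..} (\<lambda>l. M l F)"
  unfolding continuous_on_iff
proof (intro ballI allI impI)
  fix l0 \<epsilon> :: real assume l0: "l0 \<in> {0..}" and \<epsilon>: "0 < \<epsilon>"
  define \<Lambda> where "\<Lambda> = l0 + 1"
  have \<Lambda>: "0 \<le> \<Lambda>" using l0 by (simp add: \<Lambda>_def)
  obtain C where C: "0 \<le> C" "\<And>f. radial_fun f \<Longrightarrow> (\<And>s. s \<in> usphere \<Longrightarrow> f s \<le> \<Lambda>) \<Longrightarrow> V1 f \<le> C"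
    using V1_bounded[OF \<Lambda>] by metis
  obtain B where B: "0 \<le> B" "\<And>z. z \<in> usphere \<times> usphere \<Longrightarrow> \<bar>F z\<bar> \<le> B" using continuous_usphere_bounded[OF F] by metis
  define \<omega> where "\<omega> = \<epsilon> / (8 * (C + 1))"
  have \<omega>: "0 < \<omega>" using \<epsilon> C by (simp add: \<omega>_def)
  have "uniformly_continuous_on (usphere \<times> usphere) F"
    by (intro compact_uniformly_continuous compact_Times continuous_on_subset[OF F]) auto
  then obtain \<delta> where \<delta>: "0 < \<delta>" "\<And>x z. x \<in> usphere \<times> usphere \<Longrightarrow> z \<in> usphere \<times> usphere \<Longrightarrow> dist z x < \<delta> \<Longrightarrow> dist (F z) (F x) < \<omega>"
    using \<omega> unfolding uniformly_continuous_on_def by metis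
  have "\<exists>Y\<subseteq>usphere. finite Y \<and> usphere \<subseteq> (\<Union>y\<in>Y. ball y \<delta> :: 'a set)"
    by (rule compactE_image[OF compact_sphere, of usphere "\<lambda>y. ball y \<delta>"]) (use \<delta> in auto)
  then obtain Y :: "'a set" where Y: "Y \<subseteq> usphere" "finite Y" "usphere \<subseteq> (\<Union>y\<in>Y. ball y \<delta>)" by blast
  define \<epsilon>1 where "\<epsilon>1 = \<epsilon> / (16 * (real (card Y) + 1))"
  have \<epsilon>1: "0 < \<epsilon>1" using \<epsilon> by (simp add: \<epsilon>1_def add_nonneg_pos)
  define e where "e = \<epsilon>1 / (2 * (B + 1))"
  have e: "0 < e" "4 * B * e \<le> 2 * \<epsilon>1" using \<epsilon>1 B by (auto simp: e_def field_simps)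
  \<comment> \<open>Uniform over all admissible partitions, so the resulting \<open>d\<close> does
    not depend on the index of the sequence.\<close>
  define Q where "Q y d \<longleftrightarrow> (\<forall>(I :: ('a \<times> int) set set) \<kappa> x \<psi> l. thin_partition \<Lambda> 1 e I \<kappa> x \<psi> \<longrightarrow> 0 \<le> l \<longrightarrow> \<bar>l - l0\<bar> \<le> d \<longrightarrow>
      (\<Sum>i\<in>I. \<bar>V (\<lambda>r. F (y, r)) (\<lambda>s. l * \<kappa> i s) - V (\<lambda>r. F (y, r)) (\<lambda>s. l0 * \<kappa> i s)\<bar>) \<le> 4 * \<epsilon>1)" for y d
  have "\<exists>d>0. Q y d" if y: "y \<in> Y" for y
  proof -
    have l0rf: "radial_fun (\<lambda>_ :: 'a. l0)" using l0 by (simp add: radial_fun_const)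
    have By: "\<bar>F (y, s)\<bar> \<le> B" if "s \<in> usphere" for s using B(2) y Y(1) that by blast
    obtain d0 where d0: "0 < d0" "\<And>h. radial_fun h \<Longrightarrow> (\<And>s. s \<in> usphere \<Longrightarrow> \<bar>h s - l0\<bar> \<le> d0) \<Longrightarrow>
        \<bar>V (\<lambda>r. F (y, r)) h - V (\<lambda>r. F (y, r)) (\<lambda>_. l0)\<bar> < \<epsilon>1"
      using V_continuous[OF l0rf continuous_on_section[OF F] \<epsilon>1] by metis
    show ?thesis
      unfolding Q_def
    proof (intro exI[of _ "min d0 1"] conjI allI impI)
      fix I :: "('a \<times> int) set set" and \<kappa> x \<psi> l
      assume P: "thin_partition \<Lambda> 1 e I \<kappa> x \<psi>" and l: "0 \<le> l" "\<bar>l - l0\<bar> \<le> min d0 1"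
      have "(\<Sum>i\<in>I. \<bar>V (\<lambda>r. F (y, r)) (\<lambda>s. l * \<kappa> i s) - V (\<lambda>r. F (y, r)) (\<lambda>s. l0 * \<kappa> i s)\<bar>) \<le> 2 * \<epsilon>1 + 4 * B * e"
      proof (rule V_total_variation[OF l0rf continuous_on_section[OF F] By B(1) _ _ \<Lambda> _ P])
        show "\<bar>V (\<lambda>r. F (y, r)) k - V (\<lambda>r. F (y, r)) (\<lambda>_. l0)\<bar> \<le> \<epsilon>1"
          if "radial_fun k" "\<And>s. s \<in> usphere \<Longrightarrow> \<bar>k s - l0\<bar> \<le> min d0 1" for k
          using d0(2)[OF that(1)] that(2) by (simp add: less_imp_le)
      qed (use l d0(1) in \<open>auto simp: \<Lambda>_def radial_fun_const\<close>)
      then show "(\<Sum>i\<in>I. \<bar>V (\<lambda>r. F (y, r)) (\<lambda>s. l * \<kappa> i s) - V (\<lambda>r. F (y, r)) (\<lambda>s. l0 * \<kappa> i s)\<bar>) \<le> 4 * \<epsilon>1"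
        using e by linarith
    qed (use d0(1) in auto)
  qed
  then obtain dy where dy: "\<And>y. y \<in> Y \<Longrightarrow> 0 < dy y" "\<And>y. y \<in> Y \<Longrightarrow> Q y (dy y)" by metis
  define d where "d = Min (insert 1 (dy ` Y))"
  have d: "0 < d" "d \<le> 1" "\<And>y. y \<in> Y \<Longrightarrow> d \<le> dy y"
    using dy(1) Y(2) by (auto simp: d_def)
  show "\<exists>d>0. \<forall>l\<in>{0..}. dist l l0 < d \<longrightarrow> dist (M l F) (M l0 F) < \<epsilon>"
  proof (intro exI[of _ d] conjI ballI impI d(1))
    fix l :: real assume l: "l \<in> {0..}" and dl: "dist l l0 < d"
    have ll: "0 \<le> l" "l \<le> \<Lambda>" "\<bar>l - l0\<bar> \<le> d" "0 \<le> l0" "l0 \<le> \<Lambda>"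
      using l dl d(2) l0 by (auto simp: dist_real_def \<Lambda>_def)
    have est: "\<bar>riemann_seq l F j - riemann_seq l0 F j\<bar> \<le> \<epsilon> / 2"
      if P: "thin_partition \<Lambda> 1 e (seq_cells j) (seq_bumps j) (seq_points j) (seq_seam j)" for j
    proof -
      let ?I = "seq_cells j" let ?\<kappa> = "seq_bumps j" let ?x = "seq_points j"
      note ID = disjoint_family_funD[OF seq_disjoint[of j]]
      let ?D = "\<lambda>y i. \<bar>V (\<lambda>r. F (y, r)) (\<lambda>s. l * ?\<kappa> i s) - V (\<lambda>r. F (y, r)) (\<lambda>s. l0 * ?\<kappa> i s)\<bar>"
      \<comment> \<open>The net point depends on the cell; to avoid grouping cells by net point, the
        difference at that point is bounded by the sum over the whole net.\<close>
      have each: "?D (?x i) i \<le> (\<Sum>y\<in>Y. ?D y i) + \<omega> * (V1 (\<lambda>s. l * ?\<kappa> i s) + V1 (\<lambda>s. l0 * ?\<kappa> i s))" if i: "i \<in> ?I" for i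
      proof -
        have xi: "?x i \<in> usphere" by (rule seq_points_usphere[OF i])
        then obtain y where y: "y \<in> Y" "dist y (?x i) < \<delta>" using Y(3) by (auto simp del: mem_sphere)
        have cl: "\<bar>F (?x i, r) - F (y, r)\<bar> \<le> \<omega>" if "r \<in> usphere" for r
          using \<delta>(2)[of "(?x i, r)" "(y, r)"] xi y Y(1) that
          by (auto simp: dist_Pair_Pair dist_real_def abs_minus_commute less_imp_le)
        have diff: "\<bar>V (\<lambda>r. F (?x i, r)) f - V (\<lambda>r. F (y, r)) f\<bar> \<le> \<omega> * V1 f" if f: "radial_fun f" for f
        proof -
          have "V (\<lambda>r. F (?x i, r)) f - V (\<lambda>r. F (y, r)) f = V (\<lambda>r. F (?x i, r) - F (y, r)) f"
            by (rule V_diff[symmetric]) (intro f continuous_on_section F)+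
          also have "\<bar>\<dots>\<bar> \<le> \<omega> * V1 f"
            by (rule abs_V_le[OF f _ cl]) (intro continuous_intros continuous_on_section F)
          finally show ?thesis .
        qed
        have "?D y i \<le> (\<Sum>y\<in>Y. ?D y i)" using Y(2) y by (intro member_le_sum) auto
        moreover have "radial_fun (\<lambda>s. l * ?\<kappa> i s)" "radial_fun (\<lambda>s. l0 * ?\<kappa> i s)"
          by (intro radial_fun_mult radial_fun_const ll ID(2) i)+
        note diff[OF this(1)] diff[OF this(2)]
        ultimately show ?thesis unfolding distrib_left by linarith
      qed
      have Dy: "(\<Sum>i\<in>?I. ?D y i) \<le> 4 * \<epsilon>1" if "y \<in> Y" for y
        using dy(2)[OF that, unfolded Q_def, rule_format, OF P ll(1)] ll(3) d(3)[OF that] by simp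
      have "\<bar>riemann_seq l F j - riemann_seq l0 F j\<bar> \<le> (\<Sum>i\<in>?I. ?D (?x i) i)"
        unfolding riemann_seq_def riemann_sum_def sum_subtractf[symmetric] by (rule sum_abs)
      also have "\<dots> \<le> (\<Sum>i\<in>?I. (\<Sum>y\<in>Y. ?D y i) + \<omega> * (V1 (\<lambda>s. l * ?\<kappa> i s) + V1 (\<lambda>s. l0 * ?\<kappa> i s)))"
        by (rule sum_mono) (rule each)
      also have "\<dots> = (\<Sum>y\<in>Y. \<Sum>i\<in>?I. ?D y i) + \<omega> * ((\<Sum>i\<in>?I. V1 (\<lambda>s. l * ?\<kappa> i s)) + (\<Sum>i\<in>?I. V1 (\<lambda>s. l0 * ?\<kappa> i s)))"
        by (simp add: sum.distrib sum_distrib_left sum.swap[of _ Y] distrib_left)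
      also have "\<dots> \<le> (\<Sum>y\<in>Y. 4 * \<epsilon>1) + \<omega> * (C + C)"
        using ll \<omega> Dy by (intro add_mono sum_mono mult_left_mono sum_V1_le[OF seq_disjoint _ _ C(2)]) auto
      also have "\<dots> = real (card Y) * (4 * \<epsilon>1) + 2 * (\<omega> * C)" by simp
      also have "real (card Y) * (4 * \<epsilon>1) \<le> \<epsilon> / 4" using \<epsilon> by (simp add: \<epsilon>1_def field_simps)
      also have "2 * (\<omega> * C) \<le> \<epsilon> / 4" using \<epsilon> C by (simp add: \<omega>_def field_simps)
      finally show ?thesis by simp
    qed
    have "\<bar>M l F - M l0 F\<bar> \<le> \<epsilon> / 2"
    proof (rule tendsto_upperbound)
      show "(\<lambda>j. \<bar>riemann_seq l F j - riemann_seq l0 F j\<bar>) \<longlonglongrightarrow> \<bar>M l F - M l0 F\<bar>"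
        by (intro tendsto_intros riemann_seq_tendsto ll F)
      show "eventually (\<lambda>j. \<bar>riemann_seq l F j - riemann_seq l0 F j\<bar> \<le> \<epsilon> / 2) sequentially"
        using eventually_seq_partition[OF zero_less_one e(1), of \<Lambda>] by eventually_elim (rule est)
    qed simp
    then show "dist (M l F) (M l0 F) < \<epsilon>" using \<epsilon> by (simp add: dist_real_def)
  qed
qed

end

section \<open>Limits of measures on the interval\<close>

text \<open>Inner regularity is taken from the image of the measure on the whole complete separable
  space and brought back; compact subsets of a subset of \<open>T\<close> are the same in both
  spaces.\<close>

lemma finite_borel_measure_radon:
  fixes T :: "'a::{second_countable_topology, complete_space} set"
  assumes T: "T \<in> sets borel" and M: "sets M = sets (restrict_space borel T)" "finite_measure M"
  shows "M \<in> radon_measures T"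
  unfolding radon_measures_def
proof (intro CollectI conjI M ballI)
  fix A assume "A \<in> sets M"
  then have A: "A \<subseteq> T" "A \<in> sets borel" using T by (auto simp: M(1) sets_restrict_space)
  interpret finite_measure M by fact
  have sp: "space M = T" using sets_eq_imp_space_eq[OF M(1)] by (simp add: space_restrict_space)
  have idm: "(\<lambda>x. x) \<in> measurable M borel"
    using measurable_restrict_space1[of "\<lambda>x. x" borel borel T] by (simp cong: measurable_cong_sets add: M(1))
  let ?N = "distr M borel (\<lambda>x. x)"
  have em: "emeasure ?N B = emeasure M B" if "B \<subseteq> T" "B \<in> sets borel" for B
    using that idm by (subst emeasure_distr) (auto simp: sp Int_absorb2)
  have "emeasure ?N (space ?N) \<noteq> \<infinity>" using idm by (subst emeasure_distr) auto
  then have "emeasure ?N A = (SUP K \<in> {K. K \<subseteq> A \<and> compact K}. emeasure ?N K)"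
    using A by (intro inner_regular) auto
  also have "\<dots> = (SUP K \<in> {K. K \<subseteq> A \<and> compact K}. emeasure M K)"
    using A by (intro SUP_cong refl em) (auto intro: borel_compact)
  finally show "emeasure M A = (SUP K \<in> {K. K \<subseteq> A \<and> compact K}. emeasure M K)" using em[OF A] by simp
qed

section \<open>Finite sums of measures on the line\<close>

definition sum_measures :: "'i set \<Rightarrow> ('i \<Rightarrow> real measure) \<Rightarrow> real measure" where
  "sum_measures I \<mu> = measure_of UNIV (sets borel) (\<lambda>A. \<Sum>i\<in>I. emeasure (\<mu> i) A)"

lemma sets_sum_measures [simp, measurable_cong]: "sets (sum_measures I \<mu>) = sets borel"
  unfolding sum_measures_def using sets.sigma_sets_eq[of borel] by simp

lemma space_sum_measures [simp]: "space (sum_measures I \<mu>) = UNIV"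
  unfolding sum_measures_def by (simp add: space_measure_of_conv)

lemma emeasure_sum_measures:
  assumes \<mu>: "\<And>i. i \<in> I \<Longrightarrow> sets (\<mu> i) = sets borel" and A: "A \<in> sets borel"
  shows "emeasure (sum_measures I \<mu>) A = (\<Sum>i\<in>I. emeasure (\<mu> i) A)"
  unfolding sum_measures_def
proof (rule emeasure_measure_of_sigma[OF _ _ _ A])
  show "sigma_algebra UNIV (sets (borel :: real measure))"
    using sets.sigma_algebra_axioms[of "borel :: real measure"] by simp
  show "countably_additive (sets borel) (\<lambda>A. \<Sum>i\<in>I. emeasure (\<mu> i) A)"
  proof (rule countably_additiveI)
    fix A :: "nat \<Rightarrow> real set" assume A: "range A \<subseteq> sets borel" "disjoint_family A"
    have "(\<Sum>n. \<Sum>i\<in>I. emeasure (\<mu> i) (A n)) = (\<Sum>i\<in>I. \<Sum>n. emeasure (\<mu> i) (A n))"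
      by (rule suminf_sum) simp
    also have "\<dots> = (\<Sum>i\<in>I. emeasure (\<mu> i) (\<Union>n. A n))"
      by (intro sum.cong refl suminf_emeasure) (use \<mu> A in auto)
    finally show "(\<Sum>n. \<Sum>i\<in>I. emeasure (\<mu> i) (A n)) = (\<Sum>i\<in>I. emeasure (\<mu> i) (\<Union>n. A n))" .
  qed
qed (simp add: positive_def)

lemma nn_integral_sum_measures:
  assumes \<mu>: "\<And>i. i \<in> I \<Longrightarrow> sets (\<mu> i) = sets borel" and f: "f \<in> borel_measurable borel"
  shows "(\<integral>\<^sup>+x. f x \<partial>sum_measures I \<mu>) = (\<Sum>i\<in>I. \<integral>\<^sup>+x. f x \<partial>\<mu> i)"
proof -
  have m: "g \<in> borel_measurable (\<mu> i)" if "g \<in> borel_measurable borel" "i \<in> I" for g :: "real \<Rightarrow> ennreal" and i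
    using that \<mu> by (simp cong: measurable_cong_sets)
  have ms: "g \<in> borel_measurable (sum_measures I \<mu>)" if "g \<in> borel_measurable borel" for g :: "real \<Rightarrow> ennreal"
    using that by (simp cong: measurable_cong_sets)
  show ?thesis
    using f
  proof (induction f rule: borel_measurable_induct)
    case (cong f g)
    then have "f = g" by auto
    then show ?case using cong by simp
  next
    case (set A)
    then show ?case using \<mu> by (simp add: emeasure_sum_measures)
  next
    case (mult u c)
    then show ?case by (simp add: nn_integral_cmult m ms sum_distrib_left)
  next
    case (add u v)
    then show ?case by (simp add: nn_integral_add m ms sum.distrib)
  next
    case (seq U)
    have *: "(\<integral>\<^sup>+x. (SUP n. U n) x \<partial>N) = (SUP n. \<integral>\<^sup>+x. U n x \<partial>N)"
      if "\<And>n. U n \<in> borel_measurable N" for N :: "real measure"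
    proof -
      have "(\<integral>\<^sup>+x. (SUP n. U n) x \<partial>N) = (\<integral>\<^sup>+x. (SUP n. U n x) \<partial>N)" by (simp add: image_comp)
      also have "\<dots> = (SUP n. \<integral>\<^sup>+x. U n x \<partial>N)"
        by (rule nn_integral_monotone_convergence_SUP[OF \<open>incseq U\<close>]) (rule that)
      finally show ?thesis .
    qed
    have inc: "incseq (\<lambda>n. \<integral>\<^sup>+x. U n x \<partial>N)" for N
      using \<open>incseq U\<close> by (auto simp: incseq_def le_fun_def intro!: nn_integral_mono)
    have "(\<integral>\<^sup>+x. (SUP n. U n) x \<partial>sum_measures I \<mu>) = (SUP n. \<integral>\<^sup>+x. U n x \<partial>sum_measures I \<mu>)"
      by (rule *) (rule ms[OF seq.hyps(1)])
    also have "\<dots> = (SUP n. \<Sum>i\<in>I. \<integral>\<^sup>+x. U n x \<partial>\<mu> i)" by (simp only: seq.IH)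
    also have "\<dots> = (\<Sum>i\<in>I. SUP n. \<integral>\<^sup>+x. U n x \<partial>\<mu> i)" by (rule ennreal_SUP_sum[OF inc])
    also have "\<dots> = (\<Sum>i\<in>I. \<integral>\<^sup>+x. (SUP n. U n) x \<partial>\<mu> i)"
      by (intro sum.cong refl *[symmetric] m[OF seq.hyps(1)])
    finally show ?case .
  qed
qed

lemma integral_sum_measures:
  fixes f :: "real \<Rightarrow> real"
  assumes \<mu>: "\<And>i. i \<in> I \<Longrightarrow> sets (\<mu> i) = sets borel" "\<And>i. i \<in> I \<Longrightarrow> finite_measure (\<mu> i)" and I: "finite I"
    and f: "f \<in> borel_measurable borel" "\<And>x. \<bar>f x\<bar> \<le> B"
  shows "(\<integral>x. f x \<partial>sum_measures I \<mu>) = (\<Sum>i\<in>I. \<integral>x. f x \<partial>\<mu> i)" "finite_measure (sum_measures I \<mu>)"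
proof -
  have em: "emeasure (sum_measures I \<mu>) UNIV = (\<Sum>i\<in>I. emeasure (\<mu> i) UNIV)" by (rule emeasure_sum_measures[OF \<mu>(1)]) auto
  have "emeasure (\<mu> i) UNIV \<noteq> \<infinity>" if "i \<in> I" for i
    using finite_measure.emeasure_finite[OF \<mu>(2)[OF that]] by simp
  then have "emeasure (sum_measures I \<mu>) UNIV \<noteq> \<infinity>" unfolding em using I by auto
  then show fin: "finite_measure (sum_measures I \<mu>)" by (intro finite_measureI) simp
  have ms: "g \<in> borel_measurable (sum_measures I \<mu>)" if "g \<in> borel_measurable borel" for g :: "real \<Rightarrow> real"
    using that by (simp cong: measurable_cong_sets)
  have m: "g \<in> borel_measurable (\<mu> i)" if "g \<in> borel_measurable borel" "i \<in> I" for g :: "real \<Rightarrow> real" and i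
    using that \<mu>(1) by (simp cong: measurable_cong_sets)
  have pos: "(\<integral>x. g x \<partial>sum_measures I \<mu>) = (\<Sum>i\<in>I. \<integral>x. g x \<partial>\<mu> i)"
    if g: "g \<in> borel_measurable borel" "\<And>x. 0 \<le> g x" "\<And>x. g x \<le> D" for g :: "real \<Rightarrow> real" and D
  proof -
    have int: "integrable (\<mu> i) g" if "i \<in> I" for i
      using finite_measure.integrable_const_bound[OF \<mu>(2)[OF that] _ m[OF g(1) that], of D] g by simp
    have "(\<integral>x. g x \<partial>sum_measures I \<mu>) = enn2real (\<integral>\<^sup>+x. ennreal (g x) \<partial>sum_measures I \<mu>)"
      by (rule integral_eq_nn_integral[OF ms[OF g(1)]]) (use g in auto)
    also have "(\<integral>\<^sup>+x. ennreal (g x) \<partial>sum_measures I \<mu>) = (\<Sum>i\<in>I. \<integral>\<^sup>+x. ennreal (g x) \<partial>\<mu> i)"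
      by (rule nn_integral_sum_measures[OF \<mu>(1)]) (use g in auto)
    also have "\<dots> = (\<Sum>i\<in>I. ennreal (\<integral>x. g x \<partial>\<mu> i))"
      by (intro sum.cong refl nn_integral_eq_integral int) (use g in auto)
    also have "\<dots> = ennreal (\<Sum>i\<in>I. \<integral>x. g x \<partial>\<mu> i)"
      by (intro sum_ennreal Bochner_Integration.integral_nonneg g)
    finally show ?thesis by (simp add: sum_nonneg Bochner_Integration.integral_nonneg g)
  qed
  have B: "0 \<le> B" using f(2)[of 0] by simp
  have split: "(\<integral>x. f x \<partial>N) = (\<integral>x. f x + B \<partial>N) - (\<integral>x. B \<partial>N)" if "finite_measure N" "f \<in> borel_measurable N" for N :: "real measure"
  proof -
    interpret finite_measure N by fact
    have "integrable N f" by (rule integrable_const_bound[where B=B]) (use f that in auto)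
    then show ?thesis by simp
  qed
  have fB: "0 \<le> f x + B" "f x + B \<le> 2 * B" for x using f(2)[of x] by auto
  have "(\<integral>x. f x \<partial>sum_measures I \<mu>) = (\<Sum>i\<in>I. \<integral>x. f x + B \<partial>\<mu> i) - (\<Sum>i\<in>I. \<integral>x. B \<partial>\<mu> i)"
    unfolding split[OF fin ms[OF f(1)]]
    using pos[of "\<lambda>x. f x + B" "2 * B"] pos[of "\<lambda>_. B" B] f(1) fB B by simp
  also have "\<dots> = (\<Sum>i\<in>I. \<integral>x. f x \<partial>\<mu> i)"
    unfolding sum_subtractf[symmetric] by (intro sum.cong refl split[symmetric] \<mu>(2) m[OF f(1)])
  finally show "(\<integral>x. f x \<partial>sum_measures I \<mu>) = (\<Sum>i\<in>I. \<integral>x. f x \<partial>\<mu> i)" .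
qed

lemma hat_partition_of_unity:
  fixes u :: real
  assumes "0 \<le> u" "u \<le> real K"
  shows "(\<Sum>k\<le>K. max 0 (1 - \<bar>u - real k\<bar>)) = 1"
  using assms
proof (induction K)
  case (Suc K)
  show ?case
  proof (cases "u \<le> real K")
    case True
    then show ?thesis using Suc by simp
  next
    case False
    have "(\<Sum>k\<le>K. max 0 (1 - \<bar>u - real k\<bar>)) = (\<Sum>k\<in>{K}. max 0 (1 - \<bar>u - real k\<bar>))"
    proof (intro sum.mono_neutral_right ballI)
      fix k assume k: "k \<in> {..K} - {K}"
      then have "real k + 1 \<le> real K" by auto
      then show "max 0 (1 - \<bar>u - real k\<bar>) = 0" using False by simp
    qed auto
    then show ?thesis using False Suc.prems by simp
  qed
qed simp

lemma Rbar_cmult: "Rbar (\<lambda>r. c * g r) s \<alpha> = c * Rbar g s \<alpha>"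
  by (simp add: Rbar_def set_lebesgue_integral_def mult.left_commute[of _ c])

section \<open>Functions of the inner product, the kernel measures and the representation\<close>

context equivariant_valuation
begin

text \<open>Lets a function on [-1,1] be composed with the inner product on all of the space, as the
  limit functional expects continuous functions there; on pairs of unit vectors it changes
  nothing.\<close>

definition unit_clamp :: "real \<Rightarrow> real" where
  "unit_clamp t = max (- 1) (min 1 t)"

lemma unit_clamp_mem [simp]: "unit_clamp t \<in> {-1..1}" by (simp add: unit_clamp_def)

lemma unit_clamp_eq: "t \<in> {-1..1} \<Longrightarrow> unit_clamp t = t" by (simp add: unit_clamp_def)

lemma continuous_on_unit_clamp: "continuous_on A unit_clamp"
  unfolding unit_clamp_def by (intro continuous_intros)

lemma inner_usphere: "x \<in> usphere \<times> usphere \<Longrightarrow> fst x \<bullet> snd x \<in> {-1..1}" for x :: "'a \<times> 'a"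
  using Cauchy_Schwarz_ineq2[of "fst x" "snd x"] by (auto simp: mem_Times_iff abs_le_iff)

lemma continuous_on_zonal:
  assumes "continuous_on {-1..1} (\<xi> :: real \<Rightarrow> real)"
  shows "continuous_on UNIV (\<lambda>x :: 'a \<times> 'a. \<xi> (unit_clamp (fst x \<bullet> snd x)))"
proof (rule continuous_on_compose2[OF assms])
  show "continuous_on UNIV (\<lambda>x :: 'a \<times> 'a. unit_clamp (fst x \<bullet> snd x))"
    by (rule continuous_on_compose2[OF continuous_on_unit_clamp[of UNIV]]) (auto intro!: continuous_intros)
qed (use unit_clamp_mem in blast)

lemma M_cong:
  assumes l: "0 \<le> l" and F: "continuous_on UNIV F" "continuous_on UNIV G"
    and eq: "\<And>z. z \<in> usphere \<times> usphere \<Longrightarrow> F z = G z"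
  shows "M l F = M l G"
proof -
  obtain C where C: "\<And>f. radial_fun f \<Longrightarrow> (\<And>s. s \<in> usphere \<Longrightarrow> f s \<le> l) \<Longrightarrow> V1 f \<le> C"
    using V1_bounded[OF l] by metis
  show ?thesis using M_lip[OF l order_refl F C, of 0] eq by simp
qed

lemma M_zero: "M 0 F = 0"
proof -
  have "riemann_seq 0 F = (\<lambda>_. 0)" by (simp add: riemann_seq_def riemann_sum_def fun_eq_iff)
  then show ?thesis by (simp add: M_def)
qed

lemma abs_M_le:
  assumes l: "0 \<le> l" and F: "continuous_on UNIV F" and B: "\<And>z. z \<in> usphere \<times> usphere \<Longrightarrow> \<bar>F z\<bar> \<le> B"
  shows "\<bar>M l F\<bar> \<le> B * M l (\<lambda>_. 1)"
proof (rule tendsto_le)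
  show "(\<lambda>j. \<bar>riemann_seq l F j\<bar>) \<longlonglongrightarrow> \<bar>M l F\<bar>" by (intro tendsto_intros riemann_seq_tendsto l F)
  show "(\<lambda>j. B * riemann_seq l (\<lambda>_. 1) j) \<longlonglongrightarrow> B * M l (\<lambda>_. 1)"
    by (intro tendsto_intros riemann_seq_tendsto l continuous_intros)
  have "\<bar>riemann_seq l F j\<bar> \<le> B * riemann_seq l (\<lambda>_. 1) j" for j
  proof -
    have "\<bar>V (\<lambda>r. F (seq_points j i, r)) (\<lambda>s. l * seq_bumps j i s)\<bar> \<le> B * V1 (\<lambda>s. l * seq_bumps j i s)"
      if i: "i \<in> seq_cells j" for i
    proof (rule abs_V_le)
      show "radial_fun (\<lambda>s. l * seq_bumps j i s)"
        by (intro radial_fun_mult radial_fun_const l disjoint_family_funD(2)[OF seq_disjoint] i)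
      show "\<bar>F (seq_points j i, s)\<bar> \<le> B" if "s \<in> usphere" for s
        using seq_points_usphere[OF i] that by (intro B) auto
    qed (rule continuous_on_section[OF F])
    then show ?thesis
      unfolding riemann_seq_def riemann_sum_def sum_distrib_left
      by (intro order_trans[OF sum_abs] sum_mono) auto
  qed
  then show "eventually (\<lambda>j. \<bar>riemann_seq l F j\<bar> \<le> B * riemann_seq l (\<lambda>_. 1) j) sequentially" by simp
qed simp

text \<open>The image of the j-th Riemann sum under the inner product: for bounded continuous \<xi>,
  integration against it gives the Riemann sum of \<xi> of the clamped inner product.\<close>

definition zonal_measure :: "real \<Rightarrow> nat \<Rightarrow> real measure" where
  "zonal_measure l j = sum_measures (seq_cells j)
     (\<lambda>i. distr (Z (body (\<lambda>s. l * seq_bumps j i s))) borel (\<lambda>r. unit_clamp (seq_points j i \<bullet> r)))"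

lemma zonal_measure:
  assumes l: "0 \<le> l"
  shows "finite_measure (zonal_measure l j)"
    and "A \<in> sets borel \<Longrightarrow> {-1..1} \<subseteq> A \<Longrightarrow> emeasure (zonal_measure l j) A = emeasure (zonal_measure l j) UNIV"
    and "continuous_on UNIV \<xi> \<Longrightarrow> (\<And>t. \<bar>\<xi> t\<bar> \<le> B) \<Longrightarrow>
      (\<integral>t. \<xi> t \<partial>zonal_measure l j) = riemann_seq l (\<lambda>x. \<xi> (unit_clamp (fst x \<bullet> snd x))) j"
proof -
  let ?Z = "\<lambda>i. Z (body (\<lambda>s. l * seq_bumps j i s))"
  let ?c = "\<lambda>i r. unit_clamp (seq_points j i \<bullet> r)"
  have rf: "radial_fun (\<lambda>s. l * seq_bumps j i s)" if "i \<in> seq_cells j" for i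
    by (intro radial_fun_mult radial_fun_const l disjoint_family_funD(2)[OF seq_disjoint] that)
  have cm: "?c i \<in> measurable (?Z i) borel" if "i \<in> seq_cells j" for i
  proof (rule borel_measurable_radon[OF Z_body(1)[OF rf[OF that]]])
    show "continuous_on usphere (?c i)"
      by (rule continuous_on_compose2[OF continuous_on_unit_clamp[of UNIV]]) (auto intro!: continuous_intros)
  qed
  have fin: "finite_measure (distr (?Z i) borel (?c i))" if "i \<in> seq_cells j" for i
    by (rule finite_measure.finite_measure_distr[OF Z_body(2)[OF rf[OF that]] cm[OF that]])
  note I = disjoint_family_funD(1)[OF seq_disjoint[of j]]
  show "finite_measure (zonal_measure l j)"
    unfolding zonal_measure_def
    by (rule integral_sum_measures(2)[of _ _ "\<lambda>_. 0" 0]) (use fin I in auto)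
  show "emeasure (zonal_measure l j) A = emeasure (zonal_measure l j) UNIV" if A: "A \<in> sets borel" "{-1..1} \<subseteq> A"
  proof -
    have "emeasure (distr (?Z i) borel (?c i)) A = emeasure (distr (?Z i) borel (?c i)) UNIV" if "i \<in> seq_cells j" for i
    proof -
      have "?c i -` A = UNIV" using A(2) unit_clamp_mem by blast
      then show ?thesis using A(1) cm[OF that] by (simp add: emeasure_distr)
    qed
    then show ?thesis unfolding zonal_measure_def using A(1) by (simp add: emeasure_sum_measures)
  qed
  show "(\<integral>t. \<xi> t \<partial>zonal_measure l j) = riemann_seq l (\<lambda>x. \<xi> (unit_clamp (fst x \<bullet> snd x))) j"
    if \<xi>: "continuous_on UNIV \<xi>" "\<And>t. \<bar>\<xi> t\<bar> \<le> B"
  proof -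
    have \<xi>m: "\<xi> \<in> borel_measurable borel" by (rule borel_measurable_continuous_onI[OF \<xi>(1)])
    have "(\<integral>t. \<xi> t \<partial>zonal_measure l j) = (\<Sum>i\<in>seq_cells j. \<integral>t. \<xi> t \<partial>distr (?Z i) borel (?c i))"
      unfolding zonal_measure_def by (rule integral_sum_measures(1)[OF _ fin I \<xi>m \<xi>(2)]) auto
    also have "\<dots> = riemann_seq l (\<lambda>x. \<xi> (unit_clamp (fst x \<bullet> snd x))) j"
      unfolding riemann_seq_def riemann_sum_def V_def
      by (intro sum.cong refl) (simp add: integral_distr[OF cm \<xi>m])
    finally show ?thesis .
  qed
qed

text \<open>The kernel at height \<open>l\<close> is a weak limit (Helly) of the normalized images of the Riemann sums
  under \<open>(s, r) \<mapsto> s \<bullet> r\<close>.\<close>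

lemma kernel_measure_exists:
  assumes l: "0 \<le> l"
  shows "\<exists>t\<in>radon_measures {-1..1}. \<forall>\<xi>. continuous_on {-1..1} \<xi> \<longrightarrow>
    (\<integral>\<alpha>. \<xi> \<alpha> \<partial>t) = M l (\<lambda>x. \<xi> (unit_clamp (fst x \<bullet> snd x))) / sphere_area TYPE('a)"
proof -
  let ?A = "sphere_area TYPE('a)"
  let ?X = "\<lambda>(\<xi> :: real \<Rightarrow> real) (x :: 'a \<times> 'a). \<xi> (unit_clamp (fst x \<bullet> snd x))"
  define m where "m j = riemann_seq l (\<lambda>_. 1) j" for j
  define c where "c = M l (\<lambda>_. 1)"
  have one: "continuous_on UNIV (\<lambda>_ :: 'a \<times> 'a. 1 :: real)" by (intro continuous_intros)
  have mc: "m \<longlonglongrightarrow> c" unfolding m_def[abs_def] c_def by (rule riemann_seq_tendsto[OF l one])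
  have mpos: "0 \<le> m j" for j unfolding m_def riemann_seq_def riemann_sum_def by (intro sum_nonneg V1_nonneg)
  have c0: "0 \<le> c" by (rule LIMSEQ_le_const[OF mc]) (use mpos in auto)
  show ?thesis
  proof (cases "c = 0")
    \<comment> \<open>If the masses tend to 0 they cannot be normalized, but then
      \<open>abs_M_le\<close> makes the limit functional vanish altogether.\<close>
    case True
    have "M l (?X \<xi>) = 0" if \<xi>: "continuous_on {-1..1} \<xi>" for \<xi>
    proof -
      obtain B where B: "\<And>z. z \<in> usphere \<times> usphere \<Longrightarrow> \<bar>?X \<xi> z\<bar> \<le> B"
        using continuous_usphere_bounded[OF continuous_on_zonal[OF \<xi>]] by metis
      show ?thesis using abs_M_le[OF l continuous_on_zonal[OF \<xi>] B] True by (simp add: c_def)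
    qed
    moreover have "zero_measure {-1..1} \<in> radon_measures {-1..1::real}"
      by (rule finite_borel_measure_radon) (auto intro!: finite_measureI)
    ultimately show ?thesis by (intro bexI[of _ "zero_measure {-1..1}"]) (auto simp: integral_null_measure)
  next
    case False
    then have cpos: "0 < c" using c0 by simp
    \<comment> \<open>The masses are positive from some index on; the sequence is shifted there so
      that all its members can be normalized.\<close>
    obtain J where J: "\<And>j. J \<le> j \<Longrightarrow> 0 < m j"
      using order_tendstoD(1)[OF mc cpos] unfolding eventually_sequentially by blast
    define N where "N j = zonal_measure l (j + J)" for j
    have Nm: "measure (N j) UNIV = m (j + J)" for j
      using zonal_measure(3)[OF l, of "\<lambda>_. 1" 1 "j + J"] by (simp add: N_def m_def zonal_measure_def)
    have Nfin: "finite_measure (N j)" for j unfolding N_def by (rule zonal_measure(1)[OF l])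
    have Ns: "sets (N j) = sets borel" "space (N j) = UNIV" for j by (simp_all add: N_def zonal_measure_def)
    have NU: "emeasure (N j) UNIV \<noteq> 0" "emeasure (N j) UNIV \<noteq> \<infinity>" for j
      using J[of "j + J"] Nm[of j] finite_measure.emeasure_finite[OF Nfin, of j UNIV] by (auto simp: measure_def)
    define \<mu> where "\<mu> j = uniform_measure (N j) UNIV" for j
    have dist: "real_distribution (\<mu> j)" for j
      unfolding real_distribution_def real_distribution_axioms_def \<mu>_def
      using prob_space_uniform_measure[OF NU] by (simp add: Ns)
    have conc: "measure (\<mu> j) A = 1" if "A \<in> sets borel" "{-1..1} \<subseteq> A" for j A
    proof -
      have "emeasure (N j) A = emeasure (N j) UNIV" unfolding N_def by (rule zonal_measure(2)[OF l that])
      then have "emeasure (\<mu> j) A = emeasure (N j) UNIV / emeasure (N j) UNIV"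
        unfolding \<mu>_def using that by (subst emeasure_uniform_measure) (auto simp: Ns)
      then have "emeasure (\<mu> j) A = 1" using NU[of j] by (simp add: less_top)
      then show ?thesis by (simp add: measure_def)
    qed
    have int\<mu>: "(\<integral>t. \<xi> t \<partial>\<mu> j) = riemann_seq l (?X \<xi>) (j + J) / m (j + J)"
      if \<xi>: "continuous_on UNIV \<xi>" "\<And>t. \<bar>\<xi> t\<bar> \<le> B" for \<xi> B j
    proof -
      have "\<xi> \<in> borel_measurable (N j)"
        using borel_measurable_continuous_onI[OF \<xi>(1)] by (simp cong: measurable_cong_sets add: Ns)
      from integral_uniform_measure[OF NU this] have "(\<integral>t. \<xi> t \<partial>\<mu> j) = (LINT t:UNIV|N j. \<xi> t) / measure (N j) UNIV"
        unfolding \<mu>_def .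
      also have "(LINT t:UNIV|N j. \<xi> t) = (\<integral>t. \<xi> t \<partial>N j)" by (simp add: set_lebesgue_integral_def)
      also have "\<dots> = riemann_seq l (?X \<xi>) (j + J)" unfolding N_def by (rule zonal_measure(3)[OF l \<xi>])
      finally show ?thesis by (simp add: Nm)
    qed
    \<comment> \<open>All these laws live on [-1,1]. The half-open interval in the definition of
      tightness must have its left end below -1.\<close>
    have "tight \<mu>"
      unfolding tight_def
    proof (intro conjI allI impI dist)
      fix e :: real assume "0 < e"
      moreover have "measure (\<mu> n) {-2<..1} = 1" for n by (rule conc) auto
      ultimately have "-2 < (1::real) \<and> (\<forall>n. 1 - e < measure (\<mu> n) {-2<..1})" by simp
      then show "\<exists>a b. a < b \<and> (\<forall>n. 1 - e < measure (\<mu> n) {a<..b})" by blast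
    qed
    from tight_imp_convergent_subsubsequence[OF this strict_mono_id]
    obtain r D where r: "strict_mono (r :: nat \<Rightarrow> nat)" and D: "real_distribution D" and wc: "weak_conv_m (\<mu> \<circ> id \<circ> r) D"
      by blast
    interpret D: real_distribution D by (rule D)
    have Dint: "(\<integral>t. \<xi> t \<partial>D) = M l (?X \<xi>) / c" if \<xi>: "continuous_on UNIV \<xi>" "\<And>t. \<bar>\<xi> t\<bar> \<le> B" for \<xi> B
    proof (rule LIMSEQ_unique)
      have "(\<lambda>n. \<integral>t. \<xi> t \<partial>((\<mu> \<circ> id \<circ> r) n)) \<longlonglongrightarrow> (\<integral>t. \<xi> t \<partial>D)"
        by (rule weak_conv_imp_integral_bdd_continuous_conv[OF _ D wc, where B=B])
          (use \<xi> dist in \<open>auto simp: continuous_on_eq_continuous_at\<close>)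
      then show "(\<lambda>n. riemann_seq l (?X \<xi>) (r n + J) / m (r n + J)) \<longlonglongrightarrow> (\<integral>t. \<xi> t \<partial>D)"
        by (simp add: int\<mu>[OF \<xi>] o_def)
      have rJ: "filterlim (\<lambda>n. r n + J) sequentially sequentially"
        using filterlim_subseq[OF r] by (intro filterlim_compose[OF filterlim_add_const_nat_at_top])
      have "(\<lambda>j. riemann_seq l (?X \<xi>) j / m j) \<longlonglongrightarrow> M l (?X \<xi>) / c"
        using cpos by (intro tendsto_divide riemann_seq_tendsto l mc continuous_on_zonal continuous_on_subset[OF \<xi>(1)]) auto
      from filterlim_compose[OF this rJ] show "(\<lambda>n. riemann_seq l (?X \<xi>) (r n + J) / m (r n + J)) \<longlonglongrightarrow> M l (?X \<xi>) / c" .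
    qed
    have AE1: "AE t in D. t \<in> {-1..1}"
    proof -
      \<comment> \<open>Vanishes exactly on [-1,1], hence on all clamped inner products, so its
        integral against the weak limit is 0 and the limit is concentrated on the interval.\<close>
      define \<zeta> where "\<zeta> t = min 1 (max 0 (\<bar>t\<bar> - 1))" for t :: real
      have \<zeta>: "continuous_on UNIV \<zeta>" "\<And>t. \<bar>\<zeta> t\<bar> \<le> 1" "\<And>t. 0 \<le> \<zeta> t"
        by (auto simp: \<zeta>_def intro!: continuous_intros)
      have "?X \<zeta> = (\<lambda>_. 0)" by (auto simp: \<zeta>_def unit_clamp_def fun_eq_iff)
      then have "\<bar>M l (?X \<zeta>)\<bar> \<le> 0" using abs_M_le[OF l, of "\<lambda>_. 0" 0] by simp
      then have "(\<integral>t. \<zeta> t \<partial>D) = 0" by (simp add: Dint[OF \<zeta>(1,2)])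
      moreover have "integrable D \<zeta>"
        by (rule D.integrable_const_bound[where B=1])
          (use \<zeta> borel_measurable_continuous_onI[OF \<zeta>(1)] in \<open>auto cong: measurable_cong_sets\<close>)
      ultimately have "AE t in D. \<zeta> t = 0" using \<zeta>(3) by (subst (asm) integral_nonneg_eq_0_iff_AE) auto
      then show ?thesis by eventually_elim (auto simp: \<zeta>_def min_def max_def split: if_splits)
    qed
    \<comment> \<open>The factor restores the mass \<open>c\<close> lost by normalization and
      divides by the area of the sphere, which the representation multiplies back.\<close>
    define t where "t = density (restrict_space D {-1..1}) (\<lambda>_. ennreal (c / ?A))"
    have st: "sets t = sets (restrict_space borel {-1..1})"
      unfolding t_def by (simp add: sets_restrict_space_cong[of D borel])
    have cA: "0 < c / ?A" using cpos sphere_area_pos[where 'a='a] by simp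
    interpret R: finite_measure "restrict_space D {-1..1}"
      by (rule finite_measure_restrict_space) (auto intro: D.finite_measure_axioms)
    have "t \<in> radon_measures {-1..1}"
    proof (rule finite_borel_measure_radon[OF _ st])
      show "finite_measure t"
      proof (rule finite_measureI)
        have "emeasure t (space (restrict_space D {-1..1}))
            = ennreal (c / ?A) * emeasure (restrict_space D {-1..1}) (space (restrict_space D {-1..1}))"
          unfolding t_def by (rule emeasure_density_const[OF sets.top])
        also have "\<dots> \<noteq> \<infinity>" using R.emeasure_finite by (auto simp: ennreal_mult_eq_top_iff)
        finally show "emeasure t (space t) \<noteq> \<infinity>" by (simp add: t_def)
      qed
    qed simp
    moreover have "(\<integral>\<alpha>. \<xi> \<alpha> \<partial>t) = M l (?X \<xi>) / ?A" if \<xi>: "continuous_on {-1..1} \<xi>" for \<xi>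
    proof -
      have \<xi>c: "continuous_on UNIV (\<lambda>t. \<xi> (unit_clamp t))"
        by (rule continuous_on_compose2[OF \<xi> continuous_on_unit_clamp]) (use unit_clamp_mem in blast)
      obtain B where "\<And>t. t \<in> {-1..1} \<Longrightarrow> \<bar>\<xi> t\<bar> \<le> B" using continuous_on_compact_abs_bound[OF compact_Icc \<xi>] by metis
      then have \<xi>B: "\<bar>\<xi> (unit_clamp t)\<bar> \<le> B" for t using unit_clamp_mem by blast
      have \<xi>m: "\<xi> \<in> borel_measurable (restrict_space D {-1..1})"
        by (rule borel_measurable_radon[OF _ \<xi>]) (simp add: sets_restrict_space_cong[of D borel])
      have \<xi>cm: "(\<lambda>t. \<xi> (unit_clamp t)) \<in> borel_measurable D"
        using borel_measurable_continuous_onI[OF \<xi>c] by (simp cong: measurable_cong_sets)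
      have "(\<integral>\<alpha>. \<xi> \<alpha> \<partial>t) = (\<integral>\<alpha>. (c / ?A) *\<^sub>R \<xi> \<alpha> \<partial>restrict_space D {-1..1})"
        unfolding t_def by (rule integral_density) (use \<xi>m cA in auto)
      also have "\<dots> = (c / ?A) * (\<integral>\<alpha>. \<xi> \<alpha> \<partial>restrict_space D {-1..1})" by simp
      also have "(\<integral>\<alpha>. \<xi> \<alpha> \<partial>restrict_space D {-1..1}) = (\<integral>\<alpha>. \<xi> (unit_clamp \<alpha>) \<partial>restrict_space D {-1..1})"
        by (rule Bochner_Integration.integral_cong) (auto simp: space_restrict_space unit_clamp_eq)
      also have "\<dots> = (\<integral>\<alpha>. indicator {-1..1} \<alpha> *\<^sub>R \<xi> (unit_clamp \<alpha>) \<partial>D)"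
        by (rule integral_restrict_space) auto
      also have "\<dots> = (\<integral>\<alpha>. \<xi> (unit_clamp \<alpha>) \<partial>D)"
      proof (rule integral_cong_AE)
        show "AE \<alpha> in D. indicator {-1..1} \<alpha> *\<^sub>R \<xi> (unit_clamp \<alpha>) = \<xi> (unit_clamp \<alpha>)"
          using AE1 by eventually_elim auto
      qed (use \<xi>cm in \<open>auto intro!: borel_measurable_scaleR borel_measurable_indicator\<close>)
      also have "\<dots> = M l (?X (\<lambda>t. \<xi> (unit_clamp t))) / c" by (rule Dint[OF \<xi>c \<xi>B])
      also have "?X (\<lambda>t. \<xi> (unit_clamp t)) = ?X \<xi>" by (simp add: unit_clamp_eq[OF unit_clamp_mem])
      finally show ?thesis using cpos by simp
    qed
    ultimately show ?thesis by blast
  qed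
qed

text \<open>Height 0 is set apart because the theorem asks for an equality of measures there, not
  only of integrals.\<close>

definition kernel :: "real \<Rightarrow> real measure" where
  "kernel l = (if l = 0 then zero_measure {-1..1} else SOME t. t \<in> radon_measures {-1..1} \<and>
    (\<forall>\<xi>. continuous_on {-1..1} \<xi> \<longrightarrow>
      (\<integral>\<alpha>. \<xi> \<alpha> \<partial>t) = M l (\<lambda>x. \<xi> (unit_clamp (fst x \<bullet> snd x))) / sphere_area TYPE('a)))"

lemma kernel:
  assumes l: "0 \<le> l"
  shows "kernel l \<in> radon_measures {-1..1}"
    and "continuous_on {-1..1} \<xi> \<Longrightarrow>
      (\<integral>\<alpha>. \<xi> \<alpha> \<partial>kernel l) = M l (\<lambda>x. \<xi> (unit_clamp (fst x \<bullet> snd x))) / sphere_area TYPE('a)"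
proof -
  have "kernel l \<in> radon_measures {-1..1} \<and> (\<forall>\<xi>. continuous_on {-1..1} \<xi> \<longrightarrow>
      (\<integral>\<alpha>. \<xi> \<alpha> \<partial>kernel l) = M l (\<lambda>x. \<xi> (unit_clamp (fst x \<bullet> snd x))) / sphere_area TYPE('a))"
  proof (cases "l = 0")
    case True
    have "zero_measure {-1..1} \<in> radon_measures {-1..1::real}"
      by (rule finite_borel_measure_radon) (auto intro!: finite_measureI)
    then show ?thesis using True by (simp add: kernel_def M_zero integral_null_measure)
  next
    case False
    then show ?thesis
      using someI_ex[OF kernel_measure_exists[OF l, unfolded Bex_def]] by (simp add: kernel_def)
  qed
  then show "kernel l \<in> radon_measures {-1..1}"
    "continuous_on {-1..1} \<xi> \<Longrightarrow>
      (\<integral>\<alpha>. \<xi> \<alpha> \<partial>kernel l) = M l (\<lambda>x. \<xi> (unit_clamp (fst x \<bullet> snd x))) / sphere_area TYPE('a)"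
    by blast+
qed

lemma weak_star_continuous_kernel: "weak_star_continuous_param kernel"
  unfolding weak_star_continuous_param_def
proof (intro allI impI)
  fix \<xi> :: "real \<Rightarrow> real" assume \<xi>: "continuous_on {-1..1} \<xi>"
  have "continuous_on {0..} (\<lambda>l. M l (\<lambda>x. \<xi> (unit_clamp (fst x \<bullet> snd x))) / sphere_area TYPE('a))"
    using sphere_area_pos[where 'a='a]
    by (intro continuous_intros continuous_on_M continuous_on_zonal \<xi>) auto
  then show "continuous_on {0..} (\<lambda>l. \<integral>\<alpha>. \<xi> \<alpha> \<partial>kernel l)"
    by (rule continuous_on_eq) (simp add: kernel(2)[OF _ \<xi>])
qed

lemma kernel_radon: "kernel \<in> {0..} \<rightarrow> radon_measures {-1..1}"
  using kernel(1) by auto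

lemma continuous_on_Rbar_kernel:
  fixes g :: "'a \<Rightarrow> real"
  assumes "continuous_on usphere g"
  shows "continuous_on (usphere \<times> {0..}) (\<lambda>(s, l). \<integral>\<alpha>. Rbar g s \<alpha> \<partial>kernel l)"
  by (rule continuous_on_kernel[OF continuous_on_Rbar'[OF dim assms] _ kernel_radon weak_star_continuous_kernel]) simp

text \<open>By \<open>M_average\<close> only the frame average of the integrand matters, and this is
  a function of the inner product, hence integrated by the kernel measure. At \<alpha> the frame
  average is the spherical mean of \<open>h s * Rbar g s \<alpha>\<close>, and Fubini exchanges the
  two integrals.\<close>

lemma M_tensor:
  assumes l: "0 \<le> l" and h: "continuous_on UNIV h" and g: "continuous_on UNIV g"
  shows "M l (\<lambda>x. h (fst x) * g (snd x)) = sphere_area TYPE('a) * sphere_average (\<lambda>s. h s * (\<integral>\<alpha>. Rbar g s \<alpha> \<partial>kernel l))"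
proof -
  let ?F = "\<lambda>x :: 'a \<times> 'a. h (fst x) * g (snd x)"
  let ?A = "sphere_area TYPE('a)"
  obtain b :: 'a where "b \<in> Basis" using SOME_Basis by blast
  then have b: "b \<in> usphere" by simp
  have hc: "continuous_on A (\<lambda>z. h (f z))" if "continuous_on A f" for A :: "'b::topological_space set" and f
    using continuous_on_compose2[OF h that] by simp
  have gc: "continuous_on A (\<lambda>z. g (f z))" if "continuous_on A f" for A :: "'b::topological_space set" and f
    using continuous_on_compose2[OF g that] by simp
  have F: "continuous_on UNIV ?F" by (intro continuous_intros hc gc)
  have Fc: "continuous_on A (\<lambda>z. ?F (f z))" if "continuous_on A f" for A :: "'b::topological_space set" and f
    using continuous_on_compose2[OF F that] by simp
  note fl = prob_space_frame_law[OF dim b] sets_frame_law compact_frames AE_frame_law[OF dim b]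
  have avc: "continuous_on UNIV (frame_average b ?F)"
    unfolding frame_average_def[abs_def]
    by (rule continuous_on_integral_parameter[OF _ fl]) (unfold case_prod_beta, intro Fc continuous_intros)
  have avc': "continuous_on UNIV (\<lambda>x :: 'a \<times> 'a. frame_average b ?F (fst x \<bullet> snd x))"
    by (rule continuous_on_compose2[OF avc]) (auto intro!: continuous_intros)
  have avc1: "continuous_on {-1..1} (frame_average b ?F)" by (rule continuous_on_subset[OF avc]) simp
  have "M l ?F = M l (\<lambda>x. frame_average b ?F (fst x \<bullet> snd x))" by (rule M_average[OF l F b])
  also have "\<dots> = M l (\<lambda>x. frame_average b ?F (unit_clamp (fst x \<bullet> snd x)))"
    by (rule M_cong[OF l avc' continuous_on_zonal[OF avc1]]) (simp add: unit_clamp_eq[OF inner_usphere])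
  also have "\<dots> = ?A * (\<integral>\<alpha>. frame_average b ?F \<alpha> \<partial>kernel l)"
    using sphere_area_pos[where 'a='a] by (simp add: kernel(2)[OF l avc1])
  also have "(\<integral>\<alpha>. frame_average b ?F \<alpha> \<partial>kernel l) = sphere_average (\<lambda>s. h s * (\<integral>\<alpha>. Rbar g s \<alpha> \<partial>kernel l))"
  proof -
    interpret S: prob_space "sphere_prob :: 'a measure" by (rule prob_space_sphere_prob)
    note kD = radon_measuresD[OF kernel(1)[OF l]]
    interpret T: finite_measure "kernel l" by (rule kD(2))
    interpret P: pair_sigma_finite "sphere_prob :: 'a measure" "kernel l" ..
    \<comment> \<open>The product is jointly continuous on the sphere times [-1,1] only; cutting it
      off there makes it Borel on the product space, as Fubini requires.\<close>
    define k where "k p = indicator (usphere \<times> {-1..1}) p * (h (fst p) * Rbar g (fst p) (snd p))" for p :: "'a \<times> real"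
    have kc: "continuous_on (usphere \<times> {-1..1}) (\<lambda>p. h (fst p) * Rbar g (fst p) (snd p))"
      using continuous_on_Rbar[OF dim g] by (intro continuous_intros hc) (simp add: case_prod_beta)
    have "closed (usphere \<times> {-1..1} :: ('a \<times> real) set)" by (intro closed_Times) auto
    then have "(\<lambda>p. indicator (usphere \<times> {-1..1}) p *\<^sub>R (h (fst p) * Rbar g (fst p) (snd p))) \<in> borel_measurable borel"
      by (intro borel_measurable_continuous_on_indicator kc) auto
    then have km: "k \<in> borel_measurable (borel \<Otimes>\<^sub>M borel)" unfolding borel_prod k_def[abs_def] by simp
    have idm: "(\<lambda>x. x) \<in> measurable (kernel l) borel"
      using measurable_restrict_space1[of "\<lambda>x. x" borel borel "{-1..1}"] by (simp cong: measurable_cong_sets add: kD(1))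
    have "(\<lambda>p. (fst p, snd p)) \<in> measurable (sphere_prob \<Otimes>\<^sub>M kernel l) (borel \<Otimes>\<^sub>M borel)"
      using measurable_compose[OF measurable_snd idm] by (intro measurable_Pair) (auto cong: measurable_cong_sets)
    from measurable_compose[OF this km] have km': "k \<in> borel_measurable (sphere_prob \<Otimes>\<^sub>M kernel l)" by simp
    obtain B where B: "0 \<le> B" "\<And>p. p \<in> usphere \<times> {-1..1} \<Longrightarrow> \<bar>h (fst p) * Rbar g (fst p) (snd p)\<bar> \<le> B"
      using continuous_on_compact_abs_bound[OF compact_Times[OF compact_sphere compact_Icc] kc] by metis
    have kB: "\<bar>k p\<bar> \<le> B" for p using B by (auto simp: k_def indicator_def)
    have int: "integrable (sphere_prob \<Otimes>\<^sub>M kernel l) (\<lambda>(s, \<alpha>). k (s, \<alpha>))"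
      by (rule finite_measure.integrable_const_bound[OF finite_measure_pair_measure[OF T.finite_measure_axioms S.finite_measure_axioms], where B=B]) (use kB km' in auto)
    have ave: "frame_average b ?F \<alpha> = (\<integral>s. k (s, \<alpha>) \<partial>sphere_prob)" if "\<alpha> \<in> {-1..1}" for \<alpha>
      unfolding frame_average_eq(1)[OF dim b that F]
      by (intro Bochner_Integration.integral_cong) (use that in \<open>auto simp: k_def indicator_def Rbar_cmult\<close>)
    have "(\<integral>\<alpha>. frame_average b ?F \<alpha> \<partial>kernel l) = (\<integral>\<alpha>. (\<integral>s. k (s, \<alpha>) \<partial>sphere_prob) \<partial>kernel l)"
      by (intro Bochner_Integration.integral_cong refl ave) (simp add: kD(3))
    also have "\<dots> = (\<integral>s. (\<integral>\<alpha>. k (s, \<alpha>) \<partial>kernel l) \<partial>sphere_prob)" by (rule P.Fubini_integral[OF int])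
    also have "\<dots> = sphere_average (\<lambda>s. h s * (\<integral>\<alpha>. Rbar g s \<alpha> \<partial>kernel l))"
      unfolding sphere_average_def
    proof (intro Bochner_Integration.integral_cong refl)
      fix s :: 'a
      have "(\<integral>\<alpha>. k (s, \<alpha>) \<partial>kernel l) = (\<integral>\<alpha>. (indicator usphere s * h s) * Rbar g s \<alpha> \<partial>kernel l)"
        by (intro Bochner_Integration.integral_cong refl) (auto simp: k_def kD(3) indicator_def)
      also have "\<dots> = indicator usphere s * h s * (\<integral>\<alpha>. Rbar g s \<alpha> \<partial>kernel l)" by (rule integral_mult_right_zero)
      finally show "(\<integral>\<alpha>. k (s, \<alpha>) \<partial>kernel l) = indicator usphere s * (h s * (\<integral>\<alpha>. Rbar g s \<alpha> \<partial>kernel l))" by simp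
    qed
    finally show ?thesis .
  qed
  finally show ?thesis .
qed

text \<open>Both sides are compared with the sum over k of the limit functionals at height
  k\<delta>, applied to hat_k(f(s)) g(r). By \<open>M_tensor\<close> this sum is the spherical mean
  of a piecewise linear interpolation of the inner integral in the height. In terms of Riemann sums,
  it is an average over heights k\<delta> close to the value of \<open>f\<close> at the sample point
  of each cell.\<close>

theorem V_representation:
  assumes f: "radial_fun f" and g: "continuous_on usphere g"
  shows "V g f = sphere_area TYPE('a) * sphere_average (\<lambda>s. \<integral>\<alpha>. Rbar g s \<alpha> \<partial>kernel (f s))"
proof -
  let ?A = "sphere_area TYPE('a)"
  define G where "G s l = (\<integral>\<alpha>. Rbar g s \<alpha> \<partial>kernel l)" for s l
  obtain f' :: "'a \<Rightarrow> real" where f': "continuous_on UNIV f'" "\<And>s. s \<in> usphere \<Longrightarrow> f' s = f s"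
    using continuous_on_usphere_extension[OF radial_fun_continuous[OF f]] by metis
  obtain g' :: "'a \<Rightarrow> real" where g': "continuous_on UNIV g'" "\<And>s. s \<in> usphere \<Longrightarrow> g' s = g s"
    using continuous_on_usphere_extension[OF g] by metis
  obtain B where B: "0 \<le> B" "\<And>s. s \<in> usphere \<Longrightarrow> \<bar>g s\<bar> \<le> B"
    using continuous_on_compact_abs_bound[OF compact_sphere g] by metis
  obtain L where L: "0 \<le> L" "\<And>s. s \<in> usphere \<Longrightarrow> \<bar>f s\<bar> \<le> L"
    using continuous_on_compact_abs_bound[OF compact_sphere radial_fun_continuous[OF f]] by metis
  have Gc: "continuous_on (usphere \<times> {0..}) (\<lambda>(s, l). G s l)"
    unfolding G_def by (rule continuous_on_Rbar_kernel[OF g])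
  have Gl: "continuous_on usphere (\<lambda>s. G s (h s))" if "radial_fun h" for h
  proof -
    have "continuous_on usphere (\<lambda>s. (\<lambda>(s, l). G s l) (s, h s))"
      by (rule continuous_on_compose2[OF Gc])
        (use that in \<open>auto simp: radial_fun_def intro!: continuous_on_Pair continuous_on_id\<close>)
    then show ?thesis by simp
  qed
  have "\<bar>V g f - ?A * sphere_average (\<lambda>s. G s (f s))\<bar> \<le> 5 * \<epsilon> + ?A * \<epsilon>" if \<epsilon>: "0 < \<epsilon>" for \<epsilon>
  proof -
    obtain d0 where d0: "0 < d0" "\<And>h. radial_fun h \<Longrightarrow> (\<And>s. s \<in> usphere \<Longrightarrow> \<bar>h s - f s\<bar> \<le> d0) \<Longrightarrow> \<bar>V g h - V g f\<bar> < \<epsilon>"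
      using V_continuous[OF f g \<epsilon>] by metis
    define d where "d = min d0 1"
    have d: "0 < d" "d \<le> 1" using d0 by (auto simp: d_def)
    define \<Lambda> where "\<Lambda> = L + 1"
    have \<Lambda>: "0 \<le> \<Lambda>" "\<And>s. s \<in> usphere \<Longrightarrow> f s + d \<le> \<Lambda>" using L d by (auto simp: \<Lambda>_def abs_le_iff add_mono)
    have near: "\<bar>V g k - V g f\<bar> \<le> \<epsilon>" if "radial_fun k" "\<And>s. s \<in> usphere \<Longrightarrow> \<bar>k s - f s\<bar> \<le> d" for k
      using d0(2)[OF that(1)] that(2) by (simp add: d_def less_imp_le)
    have "uniformly_continuous_on (usphere \<times> {0..\<Lambda>}) (\<lambda>(s, l). G s l)"
      by (intro compact_uniformly_continuous continuous_on_subset[OF Gc] compact_Times) auto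
    then obtain \<delta>0 where \<delta>0: "0 < \<delta>0" "\<And>x y. x \<in> usphere \<times> {0..\<Lambda>} \<Longrightarrow> y \<in> usphere \<times> {0..\<Lambda>} \<Longrightarrow> dist y x < \<delta>0 \<Longrightarrow>
        dist ((\<lambda>(s, l). G s l) y) ((\<lambda>(s, l). G s l) x) < \<epsilon>"
      using \<epsilon> unfolding uniformly_continuous_on_def by metis
    \<comment> \<open>Half of \<open>d\<close> is spent on the spacing of the heights, the other
      half on the oscillation of \<open>f\<close> within a cell; \<delta>0 is the modulus of
      continuity of \<open>G\<close>.\<close>
    define \<delta> where "\<delta> = min (d / 2) \<delta>0"
    have \<delta>: "0 < \<delta>" "\<delta> \<le> d / 2" "\<delta> \<le> \<delta>0" using d \<delta>0 by (auto simp: \<delta>_def)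
    \<comment> \<open>The nodes 0, \<delta>, ..., K\<delta> reach beyond the upper bound
      \<open>L\<close> of \<open>f\<close>, so the hats sum to 1 at all values of
      \<open>f\<close>.\<close>
    define K where "K = nat \<lceil>L / \<delta>\<rceil>"
    define hat where "hat k t = max 0 (1 - \<bar>t / \<delta> - real k\<bar>)" for k :: nat and t
    have hat0: "0 \<le> hat k t" for k t by (simp add: hat_def)
    have hat_near: "\<bar>real k * \<delta> - t\<bar> < \<delta>" if "hat k t \<noteq> 0" for k t
    proof -
      have "\<bar>t / \<delta> - real k\<bar> < 1" using that by (auto simp: hat_def max_def split: if_splits)
      then have "\<bar>t / \<delta> - real k\<bar> * \<delta> < 1 * \<delta>" using \<delta>(1) by (intro mult_strict_right_mono)
      moreover have "\<bar>t / \<delta> - real k\<bar> * \<delta> = \<bar>t - real k * \<delta>\<bar>"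
        using \<delta>(1) abs_mult[of "t / \<delta> - real k" \<delta>] by (simp add: left_diff_distrib)
      ultimately show ?thesis by (simp add: abs_minus_commute)
    qed
    have hat_sum: "(\<Sum>k\<le>K. hat k (f s)) = 1" if s: "s \<in> usphere" for s
      unfolding hat_def
    proof (rule hat_partition_of_unity)
      show "0 \<le> f s / \<delta>" using radial_fun_nonneg[OF f s] \<delta>(1) by simp
      have "f s / \<delta> \<le> L / \<delta>" using L(2)[OF s] \<delta>(1) by (intro divide_right_mono) auto
      also have "\<dots> \<le> real K" unfolding K_def by linarith
      finally show "f s / \<delta> \<le> real K" .
    qed
    have hatc: "continuous_on A (\<lambda>z. hat k (u z))" if "continuous_on A u" for A :: "'b::topological_space set" and u k
      unfolding hat_def using \<delta>(1) by (intro continuous_intros that) auto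
    have kd0: "0 \<le> real k * \<delta>" for k using \<delta>(1) by simp
    let ?F = "\<lambda>k (x :: 'a \<times> 'a). hat k (f' (fst x)) * g' (snd x)"
    have f'c: "continuous_on A (\<lambda>z. f' (u z))" if "continuous_on A u" for A :: "'b::topological_space set" and u
      using continuous_on_compose2[OF f'(1) that] by simp
    have g'c: "continuous_on A (\<lambda>z. g' (u z))" if "continuous_on A u" for A :: "'b::topological_space set" and u
      using continuous_on_compose2[OF g'(1) that] by simp
    have Fc: "continuous_on UNIV (?F k)" for k by (intro continuous_intros hatc f'c g'c)
    have MF: "M (real k * \<delta>) (?F k) = ?A * sphere_average (\<lambda>s. hat k (f s) * G s (real k * \<delta>))" for k
    proof -
      have "M (real k * \<delta>) (?F k) = ?A * sphere_average (\<lambda>s. hat k (f' s) * (\<integral>\<alpha>. Rbar g' s \<alpha> \<partial>kernel (real k * \<delta>)))"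
        by (rule M_tensor[OF kd0 _ g'(1)]) (intro hatc f'c continuous_intros)
      also have "sphere_average (\<lambda>s. hat k (f' s) * (\<integral>\<alpha>. Rbar g' s \<alpha> \<partial>kernel (real k * \<delta>))) = sphere_average (\<lambda>s. hat k (f s) * G s (real k * \<delta>))"
      proof (rule sphere_average_cong)
        fix s :: 'a assume s: "s \<in> usphere"
        have "Rbar g' s = Rbar g s" using Rbar_cong[OF g'(2) s] by (intro ext) simp
        then show "hat k (f' s) * (\<integral>\<alpha>. Rbar g' s \<alpha> \<partial>kernel (real k * \<delta>)) = hat k (f s) * G s (real k * \<delta>)"
          by (simp only: G_def f'(2)[OF s])
      qed
      finally show ?thesis .
    qed
    have fc: "continuous_on usphere f" by (rule radial_fun_continuous[OF f])
    have hG: "continuous_on usphere (\<lambda>s. hat k (f s) * G s (real k * \<delta>))" for k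
      by (intro continuous_intros hatc fc Gl[OF radial_fun_const[OF kd0]])
    have 1: "\<bar>(\<Sum>k\<le>K. M (real k * \<delta>) (?F k)) - ?A * sphere_average (\<lambda>s. G s (f s))\<bar> \<le> ?A * \<epsilon>"
    proof -
      have "(\<Sum>k\<le>K. M (real k * \<delta>) (?F k)) - ?A * sphere_average (\<lambda>s. G s (f s))
          = ?A * sphere_average (\<lambda>s. (\<Sum>k\<le>K. hat k (f s) * G s (real k * \<delta>)) - G s (f s))"
        by (simp add: MF sum_distrib_left[symmetric] sphere_average_sum[OF hG] sphere_average_diff continuous_on_sum hG Gl[OF f] right_diff_distrib)
      moreover have "\<bar>sphere_average (\<lambda>s. (\<Sum>k\<le>K. hat k (f s) * G s (real k * \<delta>)) - G s (f s))\<bar> \<le> \<epsilon>"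
      proof (rule abs_sphere_average_le)
        show "continuous_on usphere (\<lambda>s. (\<Sum>k\<le>K. hat k (f s) * G s (real k * \<delta>)) - G s (f s))"
          by (intro continuous_on_diff continuous_on_sum hG Gl[OF f])
        fix s :: 'a assume s: "s \<in> usphere"
        have each: "\<bar>hat k (f s) * (G s (real k * \<delta>) - G s (f s))\<bar> \<le> hat k (f s) * \<epsilon>" for k
        proof (cases "hat k (f s) = 0")
          case False
          note n = hat_near[OF False]
          have "real k * \<delta> \<le> \<Lambda>" "f s \<le> \<Lambda>" "0 \<le> f s"
            using n \<Lambda>(2)[OF s] \<delta>(1,2) d radial_fun_nonneg[OF f s] by (auto simp: abs_less_iff)
          then have "\<bar>G s (real k * \<delta>) - G s (f s)\<bar> \<le> \<epsilon>"
            using \<delta>0(2)[of "(s, f s)" "(s, real k * \<delta>)"] s n \<delta> kd0[of k] by (auto simp: dist_Pair_Pair dist_real_def)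
          then show ?thesis using hat0[of k "f s"] by (simp add: abs_mult mult_left_mono)
        qed simp
        have "(\<Sum>k\<le>K. hat k (f s) * G s (real k * \<delta>)) - G s (f s) = (\<Sum>k\<le>K. hat k (f s) * (G s (real k * \<delta>) - G s (f s)))"
          using hat_sum[OF s] by (simp add: right_diff_distrib sum_subtractf sum_distrib_right[symmetric])
        also have "\<bar>\<dots>\<bar> \<le> (\<Sum>k\<le>K. hat k (f s) * \<epsilon>)" by (rule order_trans[OF sum_abs]) (rule sum_mono, rule each)
        also have "\<dots> = \<epsilon>" using hat_sum[OF s] by (simp add: sum_distrib_right[symmetric])
        finally show "\<bar>(\<Sum>k\<le>K. hat k (f s) * G s (real k * \<delta>)) - G s (f s)\<bar> \<le> \<epsilon>" .
      qed (use \<epsilon> in simp)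
      ultimately show ?thesis
        using sphere_area_pos[where 'a='a] by (simp add: abs_mult mult_left_mono)
    qed
    define e where "e = \<epsilon> / (4 * (B + 1))"
    have e: "0 < e" "4 * B * e \<le> \<epsilon>" using \<epsilon> B by (auto simp: e_def field_simps)
    have "uniformly_continuous_on usphere f"
      by (rule compact_uniformly_continuous[OF radial_fun_continuous[OF f] compact_sphere])
    moreover have "0 < d / 2" using d by simp
    ultimately obtain \<delta>1 where \<delta>1: "0 < \<delta>1" "\<And>s t. s \<in> usphere \<Longrightarrow> t \<in> usphere \<Longrightarrow> dist t s < \<delta>1 \<Longrightarrow> dist (f t) (f s) < d / 2"
      unfolding uniformly_continuous_on_def by metis
    \<comment> \<open>The three estimates below add up to 3 \<epsilon> + 6 B e, which is at most 5
      \<epsilon> by the choice of \<open>e\<close>.\<close>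
    have est: "\<bar>V g f - (\<Sum>k\<le>K. riemann_seq (real k * \<delta>) (?F k) j)\<bar> \<le> 5 * \<epsilon>"
      if P: "thin_partition \<Lambda> \<delta>1 e (seq_cells j) (seq_bumps j) (seq_points j) (seq_seam j)" for j
    proof -
      let ?I = "seq_cells j" let ?\<kappa> = "seq_bumps j" let ?x = "seq_points j"
      note ID = disjoint_family_funD[OF seq_disjoint[of j]]
      define D where "D i k = \<bar>V g (\<lambda>s. real k * \<delta> * ?\<kappa> i s) - V g (\<lambda>s. f s * ?\<kappa> i s)\<bar>" for i and k :: nat
      \<comment> \<open>Several hats can be nonzero at one sample point, whereas
        \<open>V_total_variation\<close> allows one competitor per cell. Among the heights with
        nonzero weight the worst is chosen; as the weights sum to 1, the weighted average of the
        differences is bounded by the difference at that height.\<close>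
      have "\<exists>k\<le>K. hat k (f (?x i)) \<noteq> 0 \<and> (\<forall>k'\<le>K. hat k' (f (?x i)) \<noteq> 0 \<longrightarrow> D i k' \<le> D i k)" if i: "i \<in> ?I" for i
      proof -
        let ?K = "{k. k \<le> K \<and> hat k (f (?x i)) \<noteq> 0}"
        have "finite ?K" by (rule finite_subset[of _ "{..K}"]) auto
        moreover have "?K \<noteq> {}"
        proof
          assume "?K = {}"
          then have "(\<Sum>k\<le>K. hat k (f (?x i))) = 0" by (intro sum.neutral) auto
          then show False using hat_sum[OF seq_points_usphere[OF i]] by simp
        qed
        ultimately have "Max (D i ` ?K) \<in> D i ` ?K" by (intro Max_in) auto
        then obtain k where "k \<in> ?K" "Max (D i ` ?K) = D i k" by blast
        moreover have "D i k' \<le> Max (D i ` ?K)" if "k' \<in> ?K" for k' using \<open>finite ?K\<close> that by (intro Max_ge) auto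
        ultimately show ?thesis by auto
      qed
      then obtain ks where ks: "\<And>i. i \<in> ?I \<Longrightarrow> hat (ks i) (f (?x i)) \<noteq> 0"
        "\<And>i k. i \<in> ?I \<Longrightarrow> k \<le> K \<Longrightarrow> hat k (f (?x i)) \<noteq> 0 \<Longrightarrow> D i k \<le> D i (ks i)" by metis
      have a: "\<bar>(\<Sum>i\<in>?I. V g (\<lambda>s. f s * ?\<kappa> i s)) - V g f\<bar> \<le> \<epsilon> + 2 * B * e"
        by (rule V_variation[OF f g B(2,1) near \<Lambda>(2,1) _ P]) (use d f in auto)
      have b: "(\<Sum>i\<in>?I. D i (ks i)) \<le> 2 * \<epsilon> + 4 * B * e"
        unfolding D_def
      proof (rule V_total_variation[OF f g B(2,1) near \<Lambda>(2,1) _ P])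
        fix i s assume i: "i \<in> ?I" and s: "s \<in> usphere" and nz: "?\<kappa> i s \<noteq> 0"
        have "dist s (?x i) < \<delta>1" by (rule thin_partitionD(6)[OF P i s nz])
        then have "\<bar>f s - f (?x i)\<bar> < d / 2"
          using \<delta>1(2)[OF seq_points_usphere[OF i] s] by (simp add: dist_real_def)
        then show "\<bar>real (ks i) * \<delta> - f s\<bar> \<le> d"
          using hat_near[OF ks(1)[OF i]] \<delta>(2) by linarith
      qed (use d radial_fun_const[OF kd0] in auto)
      have rs: "(\<Sum>k\<le>K. riemann_seq (real k * \<delta>) (?F k) j) = (\<Sum>i\<in>?I. \<Sum>k\<le>K. hat k (f (?x i)) * V g (\<lambda>s. real k * \<delta> * ?\<kappa> i s))"
        unfolding riemann_seq_def riemann_sum_def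
      proof (subst sum.swap, intro sum.cong refl)
        fix i k assume i: "i \<in> ?I"
        have rf: "radial_fun (\<lambda>s. real k * \<delta> * ?\<kappa> i s)" by (intro radial_fun_mult[OF radial_fun_const[OF kd0]] ID(2) i)
        have "V (\<lambda>r. ?F k (?x i, r)) (\<lambda>s. real k * \<delta> * ?\<kappa> i s) = hat k (f (?x i)) * V g' (\<lambda>s. real k * \<delta> * ?\<kappa> i s)"
          using f'(2)[OF seq_points_usphere[OF i]] by (simp add: V_cmult)
        then show "V (\<lambda>r. ?F k (?x i, r)) (\<lambda>s. real k * \<delta> * ?\<kappa> i s) = hat k (f (?x i)) * V g (\<lambda>s. real k * \<delta> * ?\<kappa> i s)"
          using V_cong_test[OF rf g'(2)] by simp
      qed
      have vs: "(\<Sum>i\<in>?I. V g (\<lambda>s. f s * ?\<kappa> i s)) = (\<Sum>i\<in>?I. \<Sum>k\<le>K. hat k (f (?x i)) * V g (\<lambda>s. f s * ?\<kappa> i s))"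
        by (intro sum.cong refl) (simp add: sum_distrib_right[symmetric] hat_sum[OF seq_points_usphere])
      have "\<bar>(\<Sum>k\<le>K. riemann_seq (real k * \<delta>) (?F k) j) - (\<Sum>i\<in>?I. V g (\<lambda>s. f s * ?\<kappa> i s))\<bar>
          = \<bar>\<Sum>i\<in>?I. \<Sum>k\<le>K. hat k (f (?x i)) * (V g (\<lambda>s. real k * \<delta> * ?\<kappa> i s) - V g (\<lambda>s. f s * ?\<kappa> i s))\<bar>"
        unfolding rs vs by (simp add: sum_subtractf right_diff_distrib)
      also have "\<dots> \<le> (\<Sum>i\<in>?I. \<Sum>k\<le>K. hat k (f (?x i)) * D i (ks i))"
      proof (rule order_trans[OF sum_abs], rule sum_mono, rule order_trans[OF sum_abs], rule sum_mono)
        fix i k assume i: "i \<in> ?I" and k: "k \<in> {..K}"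
        have "hat k (f (?x i)) * D i k \<le> hat k (f (?x i)) * D i (ks i)"
          using ks(2)[OF i, of k] k hat0[of k "f (?x i)"] by (cases "hat k (f (?x i)) = 0") (auto intro: mult_left_mono)
        then show "\<bar>hat k (f (?x i)) * (V g (\<lambda>s. real k * \<delta> * ?\<kappa> i s) - V g (\<lambda>s. f s * ?\<kappa> i s))\<bar> \<le> hat k (f (?x i)) * D i (ks i)"
          using hat0[of k "f (?x i)"] by (simp add: abs_mult D_def)
      qed
      also have "\<dots> = (\<Sum>i\<in>?I. D i (ks i))"
        by (intro sum.cong refl) (simp add: sum_distrib_right[symmetric] hat_sum[OF seq_points_usphere])
      finally show ?thesis using a b e(2) by linarith
    qed
    have 2: "\<bar>V g f - (\<Sum>k\<le>K. M (real k * \<delta>) (?F k))\<bar> \<le> 5 * \<epsilon>"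
    proof (rule tendsto_upperbound)
      show "(\<lambda>j. \<bar>V g f - (\<Sum>k\<le>K. riemann_seq (real k * \<delta>) (?F k) j)\<bar>) \<longlonglongrightarrow> \<bar>V g f - (\<Sum>k\<le>K. M (real k * \<delta>) (?F k))\<bar>"
        by (intro tendsto_intros riemann_seq_tendsto kd0 Fc)
      show "eventually (\<lambda>j. \<bar>V g f - (\<Sum>k\<le>K. riemann_seq (real k * \<delta>) (?F k) j)\<bar> \<le> 5 * \<epsilon>) sequentially"
        using eventually_seq_partition[OF \<delta>1(1) e(1), of \<Lambda>] by eventually_elim (rule est)
    qed simp
    show ?thesis using 1 2 by linarith
  qed
  note main = this
  have "\<bar>V g f - ?A * sphere_average (\<lambda>s. G s (f s))\<bar> \<le> 0 + \<epsilon>" if \<epsilon>: "0 < \<epsilon>" for \<epsilon>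
  proof -
    have "0 < \<epsilon> / (5 + ?A)" using \<epsilon> sphere_area_pos[where 'a='a] by simp
    from main[OF this] have "\<bar>V g f - ?A * sphere_average (\<lambda>s. G s (f s))\<bar> \<le> (5 + ?A) * (\<epsilon> / (5 + ?A))"
      by (simp only: distrib_right)
    also have "\<dots> = \<epsilon>" using sphere_area_pos[where 'a='a] by simp
    finally show ?thesis by simp
  qed
  then have "\<bar>V g f - ?A * sphere_average (\<lambda>s. G s (f s))\<bar> \<le> 0" by (rule field_le_epsilon)
  then show ?thesis by (simp add: G_def)
qed

end

theorem theorem1p2:
  fixes Z :: "(real ^ 'n) set \<Rightarrow> (real ^ 'n) measure"
  assumes "CARD('n) \<ge> 2"
    and "Z \<in> star_bodies \<rightarrow> radon_measures usphere"
  shows "(weak_star_continuous Z \<and> rotation_equivariant Z \<and> valuation Z \<and>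
            Z {0} = zero_measure usphere) \<longleftrightarrow>
         (\<exists>\<tau> :: real \<Rightarrow> real measure.
            \<tau> \<in> {0..} \<rightarrow> radon_measures {-1..1} \<and>
            weak_star_continuous_param \<tau> \<and>
            \<tau> 0 = zero_measure {-1..1} \<and>
            (\<forall>L\<in>star_bodies. \<forall>g :: real ^ 'n \<Rightarrow> real. continuous_on usphere g \<longrightarrow>
               (\<integral>x. g x \<partial>Z L) =
               (LINT s : usphere | hausdorff (CARD('n) - 1).
                  (\<integral>\<alpha>. Rbar g s \<alpha> \<partial>\<tau> (radial L s)))))"
    (is "?val \<longleftrightarrow> ?rep")
proof
  assume val: ?val
  have dim: "DIM(real ^ 'n) = CARD('n)" by simp
  interpret equivariant_valuation Z
    by unfold_locales (use assms val dim in auto)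
  have "(\<integral>x. g x \<partial>Z L) = (LINT s : usphere | hausdorff (CARD('n) - 1). (\<integral>\<alpha>. Rbar g s \<alpha> \<partial>kernel (radial L s)))"
    if L: "L \<in> star_bodies" and g: "continuous_on usphere g" for L :: "(real ^ 'n) set" and g :: "real ^ 'n \<Rightarrow> real"
  proof -
    have rf: "radial_fun (radial L)" by (rule star_bodies_radial_fun[OF L])
    \<comment> \<open>Continuity of the inner integral allows the integral over the sphere to be
      read as the area times the normalized average.\<close>
    have "continuous_on usphere (\<lambda>s. (\<lambda>(s, l). \<integral>\<alpha>. Rbar g s \<alpha> \<partial>kernel l) (s, radial L s))"
      by (rule continuous_on_compose2[OF continuous_on_Rbar_kernel[OF g]])
        (use rf in \<open>auto simp: radial_fun_def intro!: continuous_on_Pair continuous_on_id\<close>)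
    then have c: "continuous_on usphere (\<lambda>s. \<integral>\<alpha>. Rbar g s \<alpha> \<partial>kernel (radial L s))" by simp
    have "(\<integral>x. g x \<partial>Z L) = V g (radial L)" unfolding V_def using body_radial[OF L] by simp
    then show ?thesis using V_representation[OF rf g] set_integral_usphere[OF c] by (simp add: dim)
  qed
  then show ?rep
    using kernel_radon weak_star_continuous_kernel by (intro exI[of _ kernel]) (auto simp: kernel_def)
next
  assume ?rep
  then obtain \<tau> :: "real \<Rightarrow> real measure" where \<tau>: "\<tau> \<in> {0..} \<rightarrow> radon_measures {-1..1}" "weak_star_continuous_param \<tau>"
    "\<tau> 0 = zero_measure {-1..1}"
    "\<And>L g. L \<in> star_bodies \<Longrightarrow> continuous_on usphere (g :: real ^ 'n \<Rightarrow> real) \<Longrightarrow> (\<integral>x. g x \<partial>Z L) =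
       (LINT s : usphere | hausdorff (DIM(real ^ 'n) - 1). (\<integral>\<alpha>. Rbar g s \<alpha> \<partial>\<tau> (radial L s)))"
    by auto
  have "2 \<le> DIM(real ^ 'n)" using assms(1) by simp
  from kernel_imp_valuation[OF this assms(2) \<tau>] show ?val by blast
qed

end
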